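(* The probability distribution $\rho_{\mathcal{R}_{A\to B}}$ of transition trajectories from $A$ to $B$ is given by $$\rho_{\mathcal{R}_{A\to B}}(x)=\rho(x)\,q(x)\,\overleftarrow{q}(x),\qquad x\in\mathbb{R}^d.$$ That is, for every Borel set $C\subset\mathbb{R}^d$, almost surely, $$\lim_{T\to\infty}\frac1T\int_0^T\mathbf 1_C(X_t)\,\mathbf 1_{\mathcal{R}_{A\to B}}(t)\,\mathrm{d}t=\int_C\rho(x)\,q(x)\,\overleftarrow{q}(x)\,\mathrm{d}x .$$
   Context: Setting. On a filtered probability space satisfying the usual conditions, $X$ is the càdlàg solution in $\mathbb{R}^d$ of $$\mathrm{d}X_t=b(X_{t-})\,\mathrm{d}t+\sigma(X_{t-})\,\mathrm{d}B_t+\int_{|r|<1}F(X_{t-},r)\,\widetilde N(\mathrm{d}r,\mathrm{d}t),\qquad X_0=x_0\in A,$$ with $B_\cdot$ a $d$-dimensional Brownian motion, $N$ an independent Poisson random measure with intensity $\nu(\mathrm{d}r)\,\mathrm{d}t$, $\widetilde N$ its compensated version, $\nu$ a Lévy measure, and $b,\sigma,F$ measurable. $\Sigma=\sigma\sigma^\top$. Generator: $$\mathcal{L}f(x)=b(x)\cdot\nabla f(x)+\tfrac12\sum_{i,j}\Sigma_{ij}(x)\partial_{ij}f(x)+\int_{|r|<1}\big[f(x+F(x,r))-f(x)-F(x,r)\cdot\nabla f(x)\big]\nu(\mathrm{d}r).$$ Standing assumption 1. $b,\sigma,F$ are such that the Markov process $X$ is ergodic and has a unique invariant probability density $\rho>0$;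 for $\theta\in[0,1]$ the map $\mathcal{T}_{F,\theta,r}:x\mapsto x+\theta F(x,r)$ is invertible, and, with $|\mathcal{J}_{F,\theta,r}|$ the Jacobian determinant of its inverse, $\rho$ satisfies $$-\nabla\cdot\Big[\Big(b-\int_{|r|<1}F(\cdot,r)\nu(\mathrm{d}r)\Big)\rho\Big]+\tfrac12\sum_{i,j}\partial_{ij}(\Sigma_{ij}\rho)-\nabla\cdot\int_{|r|<1}\int_0^1F(\mathcal{T}^{-1}_{F,\theta,r}(x),r)\,\rho(\mathcal{T}^{-1}_{F,\theta,r}(x))\,|\mathcal{J}_{F,\theta,r}(x)|\,\mathrm{d}\theta\,\nu(\mathrm{d}r)=0 .$$ Standing assumption 2. $A,B\subset\mathbb{R}^d$ are disjoint open sets with smooth boundary, and $|x-y|>1$ for all $x\in A$, $y\in B$. Committors. $\Theta=\mathbb{R}^d\setminus(\bar A\cup\bar B)$. Forward committor: $q(x)=\mathbb{P}(\tau_B^+(t)<\tau_A^+(t)\mid X_t=x)$, where $\tau^+_C(t)=\inf\{t'\ge t:X_{t'}\in\bar C\}$; it satisfies $\mathcal{L}q=0$ on $\Theta$, $q=0$ on $\bar A$, $q=1$ on $\bar B$. Backward committor: with $\overleftarrow{\mathcal{L}}$ the adjoint of $\mathcal{L}$ in $L^2(\mathbb{R}^d,\rho(x)\mathrm{d}x)$ (the generator of the stationary time-reversed process $t\mapsto X_{(T-t)-}$), $\overleftarrow q$ is the unique solution of $\overleftarrow{\mathcal{L}}\overleftarrow q=0$ on $\Theta$, $\overleftarrow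 q=1$ on $\bar A$, $\overleftarrow q=0$ on $\bar B$; equivalently, for the stationary process, $\overleftarrow q(x)=\mathbb{P}(\tau_B^-(t)<\tau_A^-(t)\mid X_t=x)$ with $\tau^-_C(t)=\sup\{t'\le t:X_{t'}\in\bar C\}$. Transition times. For a trajectory started in $A$, the times $\tau^-_{A,n}\le\tau^+_{B,n}\le\tau^-_{B,n}\le\tau^+_{A,n}\le\tau^-_{A,n+1}$ ($n\ge1$) are the increasing enumeration of the times such that: $\lim_{t\uparrow\tau^-_{A,n}}X_t\in\bar A$, $X_{\tau^+_{B,n}}\in\bar B$ and $X_s\notin A\cup B$ for all $s\in(\tau^-_{A,n},\tau^+_{B,n})$; likewise with $A,B$ exchanged for $\tau^-_{B,n},\tau^+_{A,n}$. Set $\mathcal{R}_{A\to B}=\bigcup_n(\tau^-_{A,n},\tau^+_{B,n})$. Distribution of transition trajectories. $\rho_{\mathcal{R}_{A\to B}}$ is the (unnormalized) density of the long-time occupation measure $C\mapsto\lim_{T\to\infty}\frac1T\int_0^T\mathbf 1_C(X_t)\mathbf 1_{\mathcal{R}_{A\to B}}(t)\,\mathrm{d}t$; equivalently $\rho_{\mathcal{R}_{A\to B}}(x)\,\mathrm{d}x=\mathbb{P}^{\mathrm s}(X_t\in\mathrm{d}x,\ t\in\mathcal{R}_{A\to B})$ for the stationary process. *)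

theory Defs
  imports "HOL-Probability.Probability"
begin

section \<open>Calculus on Euclidean space\<close>

definition partial :: "'n \<Rightarrow> (real^'n \<Rightarrow> real) \<Rightarrow> real^'n \<Rightarrow> real" where
  "partial i f x = frechet_derivative f (at x) (axis i 1)"

definition grad :: "(real^'n \<Rightarrow> real) \<Rightarrow> real^'n \<Rightarrow> real^'n" where
  "grad f x = (\<chi> i. partial i f x)"

(* For open U only. *)
primrec Ck_on :: "nat \<Rightarrow> (real^'n) set \<Rightarrow> (real^'n \<Rightarrow> real) \<Rightarrow> bool" where
  "Ck_on 0 U f \<longleftrightarrow> continuous_on U f"
| "Ck_on (Suc k) U f \<longleftrightarrow> f differentiable_on U \<and> (\<forall>i. Ck_on k U (partial i f))"

definition smooth_on :: "(real^'n) set \<Rightarrow> (real^'n \<Rightarrow> real) \<Rightarrow> bool" where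
  "smooth_on U f \<longleftrightarrow> (\<forall>k. Ck_on k U f)"

definition test_function :: "(real^'n) set \<Rightarrow> (real^'n \<Rightarrow> real) \<Rightarrow> bool" where
  "test_function U \<phi> \<longleftrightarrow> smooth_on UNIV \<phi> \<and>
     compact (closure {x. \<phi> x \<noteq> 0}) \<and> closure {x. \<phi> x \<noteq> 0} \<subseteq> U"

definition smooth_boundary :: "(real^'n) set \<Rightarrow> bool" where
  "smooth_boundary A \<longleftrightarrow> (\<forall>p\<in>frontier A. \<exists>U g. open U \<and> p \<in> U \<and> smooth_on U g \<and>
     (\<forall>x\<in>U. grad g x \<noteq> 0) \<and> A \<inter> U = {x\<in>U. g x < 0} \<and> frontier A \<inter> U = {x\<in>U. g x = 0})"

section \<open>Path space and transition kernels\<close>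

definition cadlag_on :: "real set \<Rightarrow> (real \<Rightarrow> 'a::topological_space) \<Rightarrow> bool" where
  "cadlag_on I w \<longleftrightarrow> (\<forall>t\<in>I. (w \<longlongrightarrow> w t) (at t within I \<inter> {t<..}) \<and>
     (\<exists>l. (w \<longlongrightarrow> l) (at t within I \<inter> {..<t})))"

definition left_lim :: "(real \<Rightarrow> 'w \<Rightarrow> 'a::t2_space) \<Rightarrow> real \<Rightarrow> 'w \<Rightarrow> 'a" where
  "left_lim X t \<omega> = Lim (at_left t) (\<lambda>s. X s \<omega>)"

definition cadlag_space :: "(real \<Rightarrow> real^'n) measure" where
  "cadlag_space = restrict_space (Pi\<^sub>M {0..} (\<lambda>_. borel)) {w. cadlag_on {0..} w}"

definition path_from :: "(real \<Rightarrow> 'w \<Rightarrow> real^'n) \<Rightarrow> real \<Rightarrow> 'w \<Rightarrow> real \<Rightarrow> real^'n" where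
  "path_from X t \<omega> = restrict (\<lambda>s. X (t + s) \<omega>) {0..}"

type_synonym 'n path_kernel = "real^'n \<Rightarrow> (real \<Rightarrow> real^'n) measure"

(* P x is the law, on path space, of the Markov process started at x. *)
definition path_kernel :: "('n::finite) path_kernel \<Rightarrow> bool" where
  "path_kernel P \<longleftrightarrow> P \<in> borel \<rightarrow>\<^sub>M prob_algebra cadlag_space"

definition markov_process ::
    "real set \<Rightarrow> 'w measure \<Rightarrow> (real \<Rightarrow> 'w measure) \<Rightarrow> (real \<Rightarrow> 'w \<Rightarrow> real^'n) \<Rightarrow> ('n::finite) path_kernel \<Rightarrow> bool" where
  "markov_process I M Fil X P \<longleftrightarrow> (\<forall>t\<in>I. X t \<in> borel_measurable (Fil t)) \<and>
     (\<forall>t\<in>I. \<forall>E\<in>sets cadlag_space. AE \<omega> in M.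
        real_cond_exp M (Fil t) (indicator {\<omega>\<in>space M. path_from X t \<omega> \<in> E}) \<omega> = measure (P (X t \<omega>)) E)"

definition invariant_density :: "('n::finite) path_kernel \<Rightarrow> (real^'n \<Rightarrow> real) \<Rightarrow> bool" where
  "invariant_density P g \<longleftrightarrow> g \<in> borel_measurable borel \<and> (\<forall>x. 0 \<le> g x) \<and>
     prob_space (density lborel g) \<and>
     (\<forall>t\<ge>0. \<forall>D\<in>sets borel.
        (\<integral>\<^sup>+x. emeasure (P x) {w\<in>space cadlag_space. w t \<in> D} \<partial>(density lborel g))
          = emeasure (density lborel g) D)"

definition unique_invariant_density :: "('n::finite) path_kernel \<Rightarrow> (real^'n \<Rightarrow> real) \<Rightarrow> bool" where
  "unique_invariant_density P \<rho> \<longleftrightarrow> invariant_density P \<rho> \<and>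
     (\<forall>g. invariant_density P g \<longrightarrow> (AE x in lborel. g x = \<rho> x))"

definition ergodic_process :: "'w measure \<Rightarrow> (real \<Rightarrow> 'w \<Rightarrow> real^'n) \<Rightarrow> (real^'n \<Rightarrow> real) \<Rightarrow> bool" where
  "ergodic_process M X \<rho> \<longleftrightarrow> (\<forall>f. f \<in> borel_measurable borel \<longrightarrow> bounded (range f) \<longrightarrow>
     (AE \<omega> in M. ((\<lambda>T. (LINT t:{0..T}|lborel. f (X t \<omega>)) / T)
        \<longlongrightarrow> (LINT x|lborel. (f x * \<rho> x :: real))) at_top))"

section \<open>Driving noise\<close>

definition usual_conditions :: "'w measure \<Rightarrow> (real \<Rightarrow> 'w measure) \<Rightarrow> bool" where
  "usual_conditions M Fil \<longleftrightarrow> prob_space M \<and> complete_measure M \<and> filtration (space M) Fil \<and>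
     (\<forall>t. sets (Fil t) \<subseteq> sets M) \<and> null_sets M \<subseteq> sets (Fil 0) \<and>
     (\<forall>t\<ge>0. sets (Fil t) = (\<Inter>u\<in>{t<..}. sets (Fil u)))"

definition levy_measure :: "(real^'m) measure \<Rightarrow> bool" where
  "levy_measure \<nu> \<longleftrightarrow> sets \<nu> = sets borel \<and> emeasure \<nu> {0} = 0 \<and>
     (\<integral>\<^sup>+r. ennreal (min 1 ((norm r)\<^sup>2)) \<partial>\<nu>) < \<infinity>"

definition small_marks :: "(real^'m) measure \<Rightarrow> (real^'m) measure" where
  "small_marks \<nu> = restrict_space \<nu> {r. norm r < 1}"

definition generated_sets :: "'w measure \<Rightarrow> 'i set \<Rightarrow> ('i \<Rightarrow> 'w \<Rightarrow> 'b::topological_space) \<Rightarrow> 'w set set" where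
  "generated_sets M I Z =
     sigma_sets (space M) {Z i -` D \<inter> space M | i D. i \<in> I \<and> D \<in> sets borel}"

definition brownian_motion ::
    "'w measure \<Rightarrow> (real \<Rightarrow> 'w measure) \<Rightarrow> (real \<Rightarrow> 'w \<Rightarrow> real^'n) \<Rightarrow> bool" where
  "brownian_motion M Fil W \<longleftrightarrow>
     (\<forall>t\<ge>0. W t \<in> borel_measurable (Fil t)) \<and>
     (\<forall>\<omega>\<in>space M. continuous_on {0..} (\<lambda>t. W t \<omega>)) \<and>
     (AE \<omega> in M. W 0 \<omega> = 0) \<and>
     (\<forall>s t. 0 \<le> s \<and> s < t \<longrightarrow>
        distr M borel (\<lambda>\<omega>. W t \<omega> - W s \<omega>)
          = density lborel (\<lambda>x. ennreal (\<Prod>i\<in>UNIV. normal_density 0 (sqrt (t - s)) (x $ i))) \<and>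
        prob_space.indep_set M (sets (Fil s))
          (sets (vimage_algebra (space M) (\<lambda>\<omega>. W t \<omega> - W s \<omega>) borel)))"

definition poisson_random_measure ::
    "'w measure \<Rightarrow> (real \<Rightarrow> 'w measure) \<Rightarrow> (real^'m) measure \<Rightarrow> ('w \<Rightarrow> ((real^'m) \<times> real) measure) \<Rightarrow> bool" where
  "poisson_random_measure M Fil \<nu> N \<longleftrightarrow>
     (\<forall>\<omega>\<in>space M. sets (N \<omega>) = sets borel) \<and>
     (\<forall>E\<in>sets borel. E \<subseteq> UNIV \<times> {0<..} \<longrightarrow> (\<lambda>\<omega>. emeasure (N \<omega>) E) \<in> borel_measurable M) \<and>
     (\<forall>E\<in>sets borel. E \<subseteq> UNIV \<times> {0<..} \<and> emeasure (\<nu> \<Otimes>\<^sub>M lborel) E < \<infinity> \<longrightarrow>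
        (\<forall>k::nat. measure M {\<omega>\<in>space M. emeasure (N \<omega>) E = of_nat k}
           = exp (- measure (\<nu> \<Otimes>\<^sub>M lborel) E) * measure (\<nu> \<Otimes>\<^sub>M lborel) E ^ k / fact k)) \<and>
     (\<forall>n::nat. \<forall>E. (\<forall>i<n. E i \<in> sets borel \<and> E i \<subseteq> UNIV \<times> {0<..}) \<and> disjoint_family_on E {..<n} \<longrightarrow>
        prob_space.indep_vars M (\<lambda>_. borel) (\<lambda>i \<omega>. emeasure (N \<omega>) (E i)) {..<n}) \<and>
     (\<forall>t\<ge>0. \<forall>E\<in>sets borel. E \<subseteq> UNIV \<times> {0<..t} \<longrightarrow>
        (\<lambda>\<omega>. emeasure (N \<omega>) E) \<in> borel_measurable (Fil t)) \<and>
     (\<forall>t\<ge>0. prob_space.indep_set M (sets (Fil t))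
        (generated_sets M {E\<in>sets borel. E \<subseteq> UNIV \<times> {t<..}} (\<lambda>E \<omega>. emeasure (N \<omega>) E)))"

definition driving_noise ::
    "'w measure \<Rightarrow> (real \<Rightarrow> 'w measure) \<Rightarrow> (real \<Rightarrow> 'w \<Rightarrow> real^'n) \<Rightarrow> (real^'m) measure \<Rightarrow>
     ('w \<Rightarrow> ((real^'m) \<times> real) measure) \<Rightarrow> bool" where
  "driving_noise M Fil W \<nu> N \<longleftrightarrow> usual_conditions M Fil \<and> levy_measure \<nu> \<and>
     brownian_motion M Fil W \<and> poisson_random_measure M Fil \<nu> N \<and>
     prob_space.indep_set M (generated_sets M {0..} W)
       (generated_sets M {E\<in>sets borel. E \<subseteq> UNIV \<times> {0<..}} (\<lambda>E \<omega>. emeasure (N \<omega>) E))"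

section \<open>Stochastic integrals\<close>

definition null_in_prob :: "'w measure \<Rightarrow> (nat \<Rightarrow> 'w \<Rightarrow> ennreal) \<Rightarrow> bool" where
  "null_in_prob M Z \<longleftrightarrow> (\<forall>n. Z n \<in> borel_measurable M) \<and>
     (\<forall>e>0. (\<lambda>n. measure M {\<omega>\<in>space M. Z n \<omega> > ennreal e}) \<longlonglongrightarrow> 0)"

definition adapted_cadlag :: "'w measure \<Rightarrow> (real \<Rightarrow> 'w measure) \<Rightarrow> (real \<Rightarrow> 'w \<Rightarrow> real^'n) \<Rightarrow> bool" where
  "adapted_cadlag M Fil X \<longleftrightarrow> (\<forall>t\<ge>0. X t \<in> borel_measurable (Fil t)) \<and>
     (\<forall>\<omega>\<in>space M. cadlag_on {0..} (\<lambda>t. X t \<omega>))"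

definition ucp_limit ::
    "'w measure \<Rightarrow> (nat \<Rightarrow> real \<Rightarrow> 'w \<Rightarrow> real^'n) \<Rightarrow> (real \<Rightarrow> 'w \<Rightarrow> real^'n) \<Rightarrow> bool" where
  "ucp_limit M Z Y \<longleftrightarrow>
     (\<forall>T>0. null_in_prob M (\<lambda>n \<omega>. SUP t\<in>{0..T}. ennreal (norm (Z n t \<omega> - Y t \<omega>))))"

(* The entry (s, u, xi) stands for the integrand xi on the time interval ]s, u]. *)
type_synonym ('w, 'n) ito_simple = "(real \<times> real \<times> ('w \<Rightarrow> real^'n^'n)) list"

definition ito_simple :: "(real \<Rightarrow> 'w measure) \<Rightarrow> ('w, 'n::finite) ito_simple \<Rightarrow> bool" where
  "ito_simple Fil h \<longleftrightarrow> (\<forall>(s, u, \<xi>)\<in>set h. 0 \<le> s \<and> s \<le> u \<and> \<xi> \<in> borel_measurable (Fil s) \<and> bounded (range \<xi>))"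

definition ito_simple_val :: "('w, 'n::finite) ito_simple \<Rightarrow> real \<Rightarrow> 'w \<Rightarrow> real^'n^'n" where
  "ito_simple_val h t \<omega> = (\<Sum>(s, u, \<xi>)\<leftarrow>h. indicator {s<..u} t *\<^sub>R \<xi> \<omega>)"

definition ito_simple_integral ::
    "(real \<Rightarrow> 'w \<Rightarrow> real^'n) \<Rightarrow> ('w, 'n::finite) ito_simple \<Rightarrow> real \<Rightarrow> 'w \<Rightarrow> real^'n" where
  "ito_simple_integral W h t \<omega> = (\<Sum>(s, u, \<xi>)\<leftarrow>h. \<xi> \<omega> *v (W (min u t) \<omega> - W (min s t) \<omega>))"

(* Stochastic integrals are limits, uniformly on compacts in probability, of integrals of simple
   integrands that converge in the L^2 seminorm on ]0, T], in probability, for every T. *)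
definition has_ito_integral ::
    "'w measure \<Rightarrow> (real \<Rightarrow> 'w measure) \<Rightarrow> (real \<Rightarrow> 'w \<Rightarrow> real^'n) \<Rightarrow>
     (real \<Rightarrow> 'w \<Rightarrow> real^'n^'n) \<Rightarrow> (real \<Rightarrow> 'w \<Rightarrow> real^'n) \<Rightarrow> bool" where
  "has_ito_integral M Fil W H Y \<longleftrightarrow> adapted_cadlag M Fil Y \<and>
     (\<exists>h. (\<forall>n. ito_simple Fil (h n)) \<and>
        (\<forall>T>0. null_in_prob M (\<lambda>n \<omega>.
           \<integral>\<^sup>+t\<in>{0<..T}. ennreal ((norm (ito_simple_val (h n) t \<omega> - H t \<omega>))\<^sup>2) \<partial>lborel)) \<and>
        ucp_limit M (\<lambda>n. ito_simple_integral W (h n)) Y)"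

(* The entry (s, u, E, xi) stands for the integrand xi on ]s, u] x E. *)
type_synonym ('w, 'm, 'n) jump_simple = "(real \<times> real \<times> (real^'m) set \<times> ('w \<Rightarrow> real^'n)) list"

definition jump_simple ::
    "(real \<Rightarrow> 'w measure) \<Rightarrow> (real^'m) measure \<Rightarrow> ('w, 'm::finite, 'n::finite) jump_simple \<Rightarrow> bool" where
  "jump_simple Fil \<nu> h \<longleftrightarrow> (\<forall>(s, u, E, \<xi>)\<in>set h. 0 \<le> s \<and> s \<le> u \<and>
     E \<in> sets borel \<and> E \<subseteq> {r. norm r < 1} \<and> emeasure \<nu> E < \<infinity> \<and>
     \<xi> \<in> borel_measurable (Fil s) \<and> bounded (range \<xi>))"

definition jump_simple_val ::
    "('w, 'm::finite, 'n::finite) jump_simple \<Rightarrow> real \<Rightarrow> real^'m \<Rightarrow> 'w \<Rightarrow> real^'n" where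
  "jump_simple_val h t r \<omega> = (\<Sum>(s, u, E, \<xi>)\<leftarrow>h. (indicator {s<..u} t * indicator E r) *\<^sub>R \<xi> \<omega>)"

definition jump_simple_integral ::
    "(real^'m) measure \<Rightarrow> ('w \<Rightarrow> ((real^'m) \<times> real) measure) \<Rightarrow>
     ('w, 'm::finite, 'n::finite) jump_simple \<Rightarrow> real \<Rightarrow> 'w \<Rightarrow> real^'n" where
  "jump_simple_integral \<nu> N h t \<omega> = (\<Sum>(s, u, E, \<xi>)\<leftarrow>h.
     (measure (N \<omega>) (E \<times> {min s t<..min u t}) - measure \<nu> E * (min u t - min s t)) *\<^sub>R \<xi> \<omega>)"

definition has_compensated_integral ::
    "'w measure \<Rightarrow> (real \<Rightarrow> 'w measure) \<Rightarrow> (real^'m) measure \<Rightarrow> ('w \<Rightarrow> ((real^'m) \<times> real) measure) \<Rightarrow>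
     (real \<Rightarrow> real^'m \<Rightarrow> 'w \<Rightarrow> real^'n) \<Rightarrow> (real \<Rightarrow> 'w \<Rightarrow> real^'n) \<Rightarrow> bool" where
  "has_compensated_integral M Fil \<nu> N H Y \<longleftrightarrow> adapted_cadlag M Fil Y \<and>
     (\<exists>h. (\<forall>n. jump_simple Fil \<nu> (h n)) \<and>
        (\<forall>T>0. null_in_prob M (\<lambda>n \<omega>.
           \<integral>\<^sup>+t\<in>{0<..T}. (\<integral>\<^sup>+r. ennreal ((norm (jump_simple_val (h n) t r \<omega> - H t r \<omega>))\<^sup>2) \<partial>small_marks \<nu>) \<partial>lborel)) \<and>
        ucp_limit M (\<lambda>n. jump_simple_integral \<nu> N (h n)) Y)"

section \<open>The jump diffusion\<close>

definition sde_solution ::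
    "'w measure \<Rightarrow> (real \<Rightarrow> 'w measure) \<Rightarrow> (real \<Rightarrow> 'w \<Rightarrow> real^'n) \<Rightarrow> (real^'m) measure \<Rightarrow>
     ('w \<Rightarrow> ((real^'m) \<times> real) measure) \<Rightarrow> (real^'n \<Rightarrow> real^'n) \<Rightarrow> (real^'n \<Rightarrow> real^'n^'n) \<Rightarrow>
     (real^'n \<Rightarrow> real^'m \<Rightarrow> real^'n) \<Rightarrow> real^'n \<Rightarrow> (real \<Rightarrow> 'w \<Rightarrow> real^'n) \<Rightarrow> bool" where
  "sde_solution M Fil W \<nu> N b \<sigma> F x X \<longleftrightarrow> adapted_cadlag M Fil X \<and>
     (AE \<omega> in M. \<forall>t\<ge>0. set_integrable lborel {0<..t} (\<lambda>s. b (left_lim X s \<omega>))) \<and>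
     (\<exists>Y Z. has_ito_integral M Fil W (\<lambda>s \<omega>. \<sigma> (left_lim X s \<omega>)) Y \<and>
        has_compensated_integral M Fil \<nu> N (\<lambda>s r \<omega>. F (left_lim X s \<omega>) r) Z \<and>
        (AE \<omega> in M. \<forall>t\<ge>0. X t \<omega> =
           x + (LINT s:{0<..t}|lborel. b (left_lim X s \<omega>)) + Y t \<omega> + Z t \<omega>))"

(* P is the Markov family of the equation: P x is the common law of its solutions from x. *)
definition sde_markov_family ::
    "'w measure \<Rightarrow> (real \<Rightarrow> 'w measure) \<Rightarrow> (real \<Rightarrow> 'w \<Rightarrow> real^'n) \<Rightarrow> (real^'m) measure \<Rightarrow>
     ('w \<Rightarrow> ((real^'m) \<times> real) measure) \<Rightarrow> (real^'n \<Rightarrow> real^'n) \<Rightarrow> (real^'n \<Rightarrow> real^'n^'n) \<Rightarrow>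
     (real^'n \<Rightarrow> real^'m \<Rightarrow> real^'n) \<Rightarrow> ('n::finite) path_kernel \<Rightarrow> bool" where
  "sde_markov_family M Fil W \<nu> N b \<sigma> F P \<longleftrightarrow> path_kernel P \<and>
     (\<forall>x. \<exists>X. sde_solution M Fil W \<nu> N b \<sigma> F x X) \<and>
     (\<forall>x X. sde_solution M Fil W \<nu> N b \<sigma> F x X \<longrightarrow> markov_process {0..} M Fil X P)"

definition second_order :: "(real^'n \<Rightarrow> real^'n^'n) \<Rightarrow> (real^'n \<Rightarrow> real) \<Rightarrow> real^'n \<Rightarrow> real" where
  "second_order \<sigma> f x = (1/2) *
     (\<Sum>i\<in>UNIV. \<Sum>j\<in>UNIV. (\<sigma> x ** transpose (\<sigma> x)) $ i $ j * partial i (partial j f) x)"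

definition jump_increment ::
    "(real^'n \<Rightarrow> real^'m \<Rightarrow> real^'n) \<Rightarrow> (real^'n \<Rightarrow> real) \<Rightarrow> real^'n \<Rightarrow> real^'m \<Rightarrow> real" where
  "jump_increment F f x r = f (x + F x r) - f x - F x r \<bullet> grad f x"

definition generator ::
    "(real^'n \<Rightarrow> real^'n) \<Rightarrow> (real^'n \<Rightarrow> real^'n^'n) \<Rightarrow> (real^'n \<Rightarrow> real^'m \<Rightarrow> real^'n) \<Rightarrow>
     (real^'m) measure \<Rightarrow> (real^'n \<Rightarrow> real) \<Rightarrow> real^'n \<Rightarrow> real" where
  "generator b \<sigma> F \<nu> f x = b x \<bullet> grad f x + second_order \<sigma> f x
     + (LINT r|small_marks \<nu>. jump_increment F f x r)"

(* h is the image of g under the adjoint of the generator in L^2(rho dx), locally on U,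
   i.e. tested against smooth functions with compact support in U. *)
definition adjoint_generator_on ::
    "(real^'n) set \<Rightarrow> (real^'n \<Rightarrow> real^'n) \<Rightarrow> (real^'n \<Rightarrow> real^'n^'n) \<Rightarrow>
     (real^'n \<Rightarrow> real^'m \<Rightarrow> real^'n) \<Rightarrow> (real^'m) measure \<Rightarrow> (real^'n \<Rightarrow> real) \<Rightarrow>
     (real^'n \<Rightarrow> real) \<Rightarrow> (real^'n \<Rightarrow> real) \<Rightarrow> bool" where
  "adjoint_generator_on U b \<sigma> F \<nu> \<rho> g h \<longleftrightarrow> (\<forall>\<phi>. test_function U \<phi> \<longrightarrow>
     (AE x in lebesgue. integrable (small_marks \<nu>) (jump_increment F \<phi> x)) \<and>
     integrable lebesgue (\<lambda>x. generator b \<sigma> F \<nu> \<phi> x * g x * \<rho> x) \<and>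
     integrable lebesgue (\<lambda>x. \<phi> x * h x * \<rho> x) \<and>
     (LINT x|lebesgue. generator b \<sigma> F \<nu> \<phi> x * g x * \<rho> x) = (LINT x|lebesgue. \<phi> x * h x * \<rho> x))"

definition jump_map :: "(real^'n \<Rightarrow> real^'m \<Rightarrow> real^'n) \<Rightarrow> real \<Rightarrow> real^'m \<Rightarrow> real^'n \<Rightarrow> real^'n" where
  "jump_map F \<theta> r x = x + \<theta> *\<^sub>R F x r"

definition invertible_jump_maps :: "(real^'n \<Rightarrow> real^'m \<Rightarrow> real^'n) \<Rightarrow> bool" where
  "invertible_jump_maps F \<longleftrightarrow> (\<forall>\<theta>\<in>{0..1}. \<forall>r. norm r < 1 \<longrightarrow>
     bij (jump_map F \<theta> r) \<and> inv (jump_map F \<theta> r) differentiable_on UNIV)"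

definition inv_jacobian :: "(real^'n \<Rightarrow> real^'m \<Rightarrow> real^'n) \<Rightarrow> real \<Rightarrow> real^'m \<Rightarrow> real^'n \<Rightarrow> real" where
  "inv_jacobian F \<theta> r x = \<bar>det (matrix (frechet_derivative (inv (jump_map F \<theta> r)) (at x)))\<bar>"

definition jump_flux_density ::
    "(real^'n \<Rightarrow> real^'m \<Rightarrow> real^'n) \<Rightarrow> (real^'n \<Rightarrow> real) \<Rightarrow> real^'m \<Rightarrow> real^'n \<Rightarrow> real \<Rightarrow> real^'n" where
  "jump_flux_density F \<rho> r x \<theta> =
     (\<rho> (inv (jump_map F \<theta> r) x) * inv_jacobian F \<theta> r x) *\<^sub>R F (inv (jump_map F \<theta> r) x) r"

(* Net jump flux for the mark r: the theta-integral of the transported flux minus the compensator. *)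
definition jump_flux ::
    "(real^'n \<Rightarrow> real^'m \<Rightarrow> real^'n) \<Rightarrow> (real^'n \<Rightarrow> real) \<Rightarrow> real^'m \<Rightarrow> real^'n \<Rightarrow> real^'n" where
  "jump_flux F \<rho> r x = (LINT \<theta>:{0..1}|lborel. jump_flux_density F \<rho> r x \<theta>) - \<rho> x *\<^sub>R F x r"

(* The stationary Fokker-Planck equation in the sense of distributions: the coefficients are
   merely measurable.  The compensator, part of the drift b - \<integral> F d\<nu> in the strong form, is grouped
   with the jump term, since the two \<nu>-integrals need only converge jointly. *)
definition stationary_fokker_planck ::
    "(real^'n \<Rightarrow> real^'n) \<Rightarrow> (real^'n \<Rightarrow> real^'n^'n) \<Rightarrow> (real^'n \<Rightarrow> real^'m \<Rightarrow> real^'n) \<Rightarrow>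
     (real^'m) measure \<Rightarrow> (real^'n \<Rightarrow> real) \<Rightarrow> bool" where
  "stationary_fokker_planck b \<sigma> F \<nu> \<rho> \<longleftrightarrow> (\<forall>\<phi>. test_function UNIV \<phi> \<longrightarrow>
     integrable lebesgue (\<lambda>x. (b x \<bullet> grad \<phi> x + second_order \<sigma> \<phi> x) * \<rho> x) \<and>
     (AE r in small_marks \<nu>.
        (AE x in lebesgue. set_integrable lborel {0..1} (jump_flux_density F \<rho> r x)) \<and>
        integrable lebesgue (\<lambda>x. grad \<phi> x \<bullet> jump_flux F \<rho> r x)) \<and>
     integrable (small_marks \<nu>) (\<lambda>r. LINT x|lebesgue. grad \<phi> x \<bullet> jump_flux F \<rho> r x) \<and>
     (LINT x|lebesgue. (b x \<bullet> grad \<phi> x + second_order \<sigma> \<phi> x) * \<rho> x)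
       + (LINT r|small_marks \<nu>. LINT x|lebesgue. grad \<phi> x \<bullet> jump_flux F \<rho> r x) = 0)"

section \<open>Committors\<close>

(* Infinite values: a set never hit again has hitting time \<infinity>, a set never hit before -\<infinity>. *)
definition next_hit :: "(real \<Rightarrow> real^'n) \<Rightarrow> (real^'n) set \<Rightarrow> real \<Rightarrow> ereal" where
  "next_hit w C t = Inf (ereal ` {s. t \<le> s \<and> w s \<in> closure C})"

definition last_hit :: "(real \<Rightarrow> real^'n) \<Rightarrow> (real^'n) set \<Rightarrow> real \<Rightarrow> ereal" where
  "last_hit w C t = Sup (ereal ` {s. s \<le> t \<and> w s \<in> closure C})"

(* By homogeneity the law of the future of the process given X_t = x is P x for every t.
   The event is an analytic-set event, hence only measurable for the completed law, and q is
   then only universally measurable. *)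
definition forward_committor ::
    "('n::finite) path_kernel \<Rightarrow> (real^'n) set \<Rightarrow> (real^'n) set \<Rightarrow> (real^'n \<Rightarrow> real) \<Rightarrow> bool" where
  "forward_committor P A B q \<longleftrightarrow> q \<in> borel_measurable lebesgue \<and>
     (\<forall>x. {w\<in>space cadlag_space. next_hit w B 0 < next_hit w A 0} \<in> sets (completion (P x)) \<and>
        q x = measure (completion (P x)) {w\<in>space cadlag_space. next_hit w B 0 < next_hit w A 0})"

(* The two-sided stationary version of the process; the Markov property together with the
   constant one-dimensional marginals makes all its finite-dimensional laws shift invariant. *)
definition stationary_version ::
    "'s measure \<Rightarrow> (real \<Rightarrow> 's \<Rightarrow> real^'n) \<Rightarrow> ('n::finite) path_kernel \<Rightarrow> (real^'n \<Rightarrow> real) \<Rightarrow> bool" where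
  "stationary_version S Y P \<rho> \<longleftrightarrow> prob_space S \<and> complete_measure S \<and>
     (\<forall>t. Y t \<in> borel_measurable S) \<and> (\<forall>\<omega>\<in>space S. cadlag_on UNIV (\<lambda>t. Y t \<omega>)) \<and>
     (\<forall>t. distr S borel (Y t) = density lborel \<rho>) \<and>
     markov_process UNIV S (\<lambda>t. sigma (space S) (generated_sets S {..t} Y)) Y P"

(* The Dirichlet problem for the adjoint, on the complement of both closures, together with its
   probabilistic representation; the latter determines q up to a Lebesgue null set, so no class in
   which the Dirichlet problem is uniquely solvable has to be fixed. *)
definition backward_committor ::
    "(real^'n \<Rightarrow> real^'n) \<Rightarrow> (real^'n \<Rightarrow> real^'n^'n) \<Rightarrow> (real^'n \<Rightarrow> real^'m \<Rightarrow> real^'n) \<Rightarrow>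
     (real^'m) measure \<Rightarrow> (real^'n \<Rightarrow> real) \<Rightarrow> 's measure \<Rightarrow> (real \<Rightarrow> 's \<Rightarrow> real^'n) \<Rightarrow>
     (real^'n) set \<Rightarrow> (real^'n) set \<Rightarrow> (real^'n \<Rightarrow> real) \<Rightarrow> bool" where
  "backward_committor b \<sigma> F \<nu> \<rho> S Y A B q \<longleftrightarrow> q \<in> borel_measurable lebesgue \<and>
     adjoint_generator_on (- (closure A \<union> closure B)) b \<sigma> F \<nu> \<rho> q (\<lambda>_. 0) \<and>
     (\<forall>x\<in>closure A. q x = 1) \<and> (\<forall>x\<in>closure B. q x = 0) \<and>
     (\<forall>t. let E = {\<omega>\<in>space S. last_hit (\<lambda>s. Y s \<omega>) B t < last_hit (\<lambda>s. Y s \<omega>) A t} in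
        E \<in> sets S \<and>
        (AE \<omega> in S. real_cond_exp S (vimage_algebra (space S) (Y t) borel) (indicator E) \<omega> = q (Y t \<omega>)))"

section \<open>Transitions\<close>

definition crossings ::
    "(real \<Rightarrow> real^'n) \<Rightarrow> (real^'n) set \<Rightarrow> (real^'n) set \<Rightarrow> (real \<times> real) set" where
  "crossings w C D = {(s, u). 0 < s \<and> s \<le> u \<and> (\<exists>l\<in>closure C. (w \<longlongrightarrow> l) (at_left s)) \<and>
     w u \<in> closure D \<and> (\<forall>v\<in>{s<..<u}. w v \<notin> C \<union> D)}"

(* The four sequences enumerate all crossings in both directions, in alternating order.  Since
   paths may not enter A or B but may touch their boundaries strictly inside a crossing interval,
   the existence of such an enumeration is a genuine condition on the path.
   The index starts at 0 instead of 1. *)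
definition transition_times ::
    "(real \<Rightarrow> real^'n) \<Rightarrow> (real^'n) set \<Rightarrow> (real^'n) set \<Rightarrow>
     (nat \<Rightarrow> real) \<Rightarrow> (nat \<Rightarrow> real) \<Rightarrow> (nat \<Rightarrow> real) \<Rightarrow> (nat \<Rightarrow> real) \<Rightarrow> bool" where
  "transition_times w A B \<tau>Am \<tau>Bp \<tau>Bm \<tau>Ap \<longleftrightarrow>
     (\<forall>n. \<tau>Am n \<le> \<tau>Bp n \<and> \<tau>Bp n \<le> \<tau>Bm n \<and> \<tau>Bm n \<le> \<tau>Ap n \<and> \<tau>Ap n \<le> \<tau>Am (Suc n)) \<and>
     range (\<lambda>n. (\<tau>Am n, \<tau>Bp n)) = crossings w A B \<and>
     range (\<lambda>n. (\<tau>Bm n, \<tau>Ap n)) = crossings w B A"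

definition reactive_times :: "(nat \<Rightarrow> real) \<Rightarrow> (nat \<Rightarrow> real) \<Rightarrow> real set" where
  "reactive_times \<tau>Am \<tau>Bp = (\<Union>n. {\<tau>Am n<..<\<tau>Bp n})"

definition occupation_density ::
    "'w measure \<Rightarrow> (real \<Rightarrow> 'w \<Rightarrow> real^'n) \<Rightarrow> ('w \<Rightarrow> real set) \<Rightarrow> (real^'n \<Rightarrow> real) \<Rightarrow> bool" where
  "occupation_density M X R g \<longleftrightarrow> integrable lebesgue g \<and> (\<forall>C\<in>sets borel. AE \<omega> in M.
     ((\<lambda>T. (LINT t:{0..T}|lborel. indicator C (X t \<omega>) * indicator (R \<omega>) t) / T)
        \<longlongrightarrow> (LINT x:C|lebesgue. g x)) at_top)"

end

theory Submission
  imports Defs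
begin

text \<open>
Call a jump bad if it starts or lands on one of the boundaries of \<open>A\<close> and \<open>B\<close>. On a path without
bad jumps, \<open>t\<close> lies in a reactive interval iff the last hit before \<open>t\<close> is in the closure of \<open>A\<close> and the
next hit after \<open>t\<close> is in the closure of \<open>B\<close>; this event is approximated by events that only depend on the
window \<open>[t - h, t + h]\<close>. Functionals of windows at large distance are, given the Markov property, conditionally
centred, so a second-moment law of large numbers together with ergodicity shows that their time
averages along \<open>X\<close> converge to expectations under the stationary law on path space. Letting \<open>h\<close> tend to infinity
and using the Markov property at the current time, the stationary probability factorises into the
density \<open>\<rho>\<close>, the forward committor and the backward committor.

Bad jumps are null under the stationary law: by the compensation formula for the Poisson random measure,
the expected number of bad jumps is an integral over the states before the jump, whose law has
density \<open>\<rho>\<close>; the boundaries are Lebesgue null, and so are their preimages under \<open>x \<mapsto> x + F x r\<close>, because the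
inverse of this map is differentiable.
\<close>

section \<open>Paths with left limits\<close>

text \<open>Ergodicity is available only for functions of the single state \<open>X t\<close>, along
  the path started at \<open>x0\<close>, while membership in a reactive interval involves past and
  future of \<open>t\<close>. This is what forces a separate law of large numbers for path events.

  The definition of \<open>crossings\<close> uses a left limit at the start, a value at the end and
  avoids only the open sets in between, whereas the committors count hits of the closures by values.
  The two descriptions can disagree through jumps from or onto a boundary, and the word "bad" refers
  to this.

  Reactive intervals have no bound on their length. A window decides about its centre only if it
  contains a visit to \<open>A\<close> on either side; recurrence makes the failure of this
  improbable for large \<open>h\<close>.

  The stochastic integrals are given only as limits in probability of simple integrals, so their
  jumps are not directly visible. They are recovered along an almost surely convergent subsequence,
  by selecting a mark outside a null set of \<open>N\<close>. Predictable sets enter because they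
  are the random sets for which null under the compensator implies null under
  \<open>N\<close>.\<close>

definition rcll :: "real \<Rightarrow> (real \<Rightarrow> 'a::topological_space) \<Rightarrow> bool" where
  "rcll a w \<longleftrightarrow> (\<forall>s\<ge>a. (w \<longlongrightarrow> w s) (at_right s)) \<and> (\<forall>s>a. \<exists>l. (w \<longlongrightarrow> l) (at_left s))"

definition nbhd :: "real \<Rightarrow> 'a::metric_space set \<Rightarrow> 'a set" where
  "nbhd e A = {x. \<exists>y\<in>A. dist x y < e}"

text \<open>For cadlag paths this says that a value or a left limit in the interval lies in the
  closure of \<open>A\<close> (\<open>approachesI\<close>, \<open>approachesI_left\<close>,
  \<open>approachesD\<close>). Countably many conditions with open neighbourhoods keep it
  measurable.\<close>

definition approaches :: "'a::metric_space set \<Rightarrow> (real \<Rightarrow> 'a) \<Rightarrow> real \<Rightarrow> real \<Rightarrow> bool" where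
  "approaches A w a b \<longleftrightarrow> (\<forall>n::nat. \<exists>s\<in>{a..b}. w s \<in> nbhd (1 / Suc n) A)"

text \<open>\<open>K\<close> will be the union of the two boundaries. Only interior times are
  tested, so the condition makes sense for paths that begin at the left end of the interval.\<close>

definition no_bad_jump :: "'a::topological_space set \<Rightarrow> (real \<Rightarrow> 'a) \<Rightarrow> real \<Rightarrow> real \<Rightarrow> bool" where
  "no_bad_jump K w a b \<longleftrightarrow>
     (\<forall>v l. a < v \<and> v < b \<and> (w \<longlongrightarrow> l) (at_left v) \<and> l \<noteq> w v \<longrightarrow> l \<notin> K \<and> w v \<notin> K)"

text \<open>Of the two sets, \<open>A\<close> is the one seen last before \<open>t\<close>: some
  look-back sees \<open>A\<close> but not \<open>B\<close>. A rational look-back makes this a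
  countable union, and the bound \<open>h\<close> confines it to a window.\<close>

definition came_from :: "'a::metric_space set \<Rightarrow> 'a set \<Rightarrow> (real \<Rightarrow> 'a) \<Rightarrow> real \<Rightarrow> real \<Rightarrow> bool" where
  "came_from A B w t h \<longleftrightarrow>
     (\<exists>\<alpha>\<in>\<rat>. 0 < \<alpha> \<and> \<alpha> < h \<and> approaches A w (t - \<alpha>) t \<and> \<not> approaches B w (t - \<alpha>) t)"

definition heads_to :: "'a::metric_space set \<Rightarrow> 'a set \<Rightarrow> (real \<Rightarrow> 'a) \<Rightarrow> real \<Rightarrow> real \<Rightarrow> bool" where
  "heads_to B A w t h \<longleftrightarrow>
     (\<exists>\<alpha>\<in>\<rat>. 0 < \<alpha> \<and> \<alpha> < h \<and> approaches B w t (t + \<alpha>) \<and> \<not> approaches A w t (t + \<alpha>))"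

lemma open_nbhd [simp]: "open (nbhd e A)"
proof -
  have "nbhd e A = (\<Union>y\<in>A. ball y e)" by (auto simp: nbhd_def dist_commute)
  then show ?thesis by auto
qed

lemma nbhd_closure: "0 < e \<Longrightarrow> closure A \<subseteq> nbhd e A"
  by (force simp: nbhd_def closure_approachable dist_commute)

lemma rcll_mono: "rcll a w \<Longrightarrow> a \<le> b \<Longrightarrow> rcll b w"
  by (auto simp: rcll_def)

lemma rcll_right: "rcll a w \<Longrightarrow> a \<le> s \<Longrightarrow> (w \<longlongrightarrow> w s) (at_right s)"
  by (auto simp: rcll_def)

lemma rcll_left: "rcll a w \<Longrightarrow> a < s \<Longrightarrow> \<exists>l. (w \<longlongrightarrow> l) (at_left s)"
  by (auto simp: rcll_def)

lemma cadlag_on_rcll_0: "cadlag_on {0..} w \<Longrightarrow> rcll 0 w"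
proof -
  assume c: "cadlag_on {0..} w"
  have "(w \<longlongrightarrow> w s) (at_right s)" if "s \<ge> 0" for s
  proof -
    have e: "{0..} \<inter> {s<..} = {s<..}" using that by auto
    show ?thesis using bspec[OF c[unfolded cadlag_on_def], of s] that unfolding e by auto
  qed
  moreover have "\<exists>l. (w \<longlongrightarrow> l) (at_left s)" if "s > 0" for s
  proof -
    have "s \<in> {0..}" using that by simp
    then obtain l where l: "(w \<longlongrightarrow> l) (at s within {0..} \<inter> {..<s})"
      using c unfolding cadlag_on_def by blast
    have "at s within {0..} \<inter> {..<s} = at s within {..<s}"
      by (rule at_within_nhd[of _ "{0<..}"]) (use that in auto)
    with l show ?thesis by metis
  qed
  ultimately show ?thesis by (auto simp: rcll_def)
qed

lemma cadlag_on_UNIV_rcll: "cadlag_on UNIV w \<Longrightarrow> rcll a w"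
  by (simp add: rcll_def cadlag_on_def)

lemma rcll_cadlag_on: "rcll 0 w \<Longrightarrow> cadlag_on {0..} w"
  unfolding cadlag_on_def
proof (intro ballI conjI)
  fix t :: real assume r: "rcll 0 w" and t: "t \<in> {0..}"
  have "{0..} \<inter> {t<..} = {t<..}" using t by auto
  then show "(w \<longlongrightarrow> w t) (at t within {0..} \<inter> {t<..})" using rcll_right[OF r] t by auto
  show "\<exists>l. (w \<longlongrightarrow> l) (at t within {0..} \<inter> {..<t})"
  proof (cases "t = 0")
    case True
    then have "{0..} \<inter> {..<t} = {}" by auto
    then show ?thesis by simp
  next
    case False
    then have "t > 0" using t by auto
    from rcll_left[OF r this] obtain l where "(w \<longlongrightarrow> l) (at_left t)" by auto
    then have "(w \<longlongrightarrow> l) (at t within {0..} \<inter> {..<t})" by (rule tendsto_within_subset) auto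
    then show ?thesis by blast
  qed
qed

lemma rcll_shift: "rcll (t + a) w \<Longrightarrow> rcll a (\<lambda>s. w (t + s))"
proof -
  assume r: "rcll (t + a) w"
  have "filterlim (\<lambda>s. t + s) (at_right (t + s)) (at_right s)" for s
    by (intro filterlim_at_withinI) (auto intro!: tendsto_intros eventually_at_right_less simp: eventually_at_filter)
  moreover have "filterlim (\<lambda>s. t + s) (at_left (t + s)) (at_left s)" for s
    by (intro filterlim_at_withinI) (auto intro!: tendsto_intros simp: eventually_at_filter)
  ultimately have f: "filterlim (\<lambda>s. t + s) (at_right (t + s)) (at_right s)"
    "filterlim (\<lambda>s. t + s) (at_left (t + s)) (at_left s)" for s by auto
  show ?thesis unfolding rcll_def
  proof (intro conjI allI impI)
    fix s assume "a \<le> s"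
    then show "((\<lambda>s. w (t + s)) \<longlongrightarrow> w (t + s)) (at_right s)"
      using filterlim_compose[OF rcll_right[OF r] f(1)] by simp
  next
    fix s assume "a < s"
    then obtain l where "(w \<longlongrightarrow> l) (at_left (t + s))" using rcll_left[OF r, of "t + s"] by auto
    then show "\<exists>l. ((\<lambda>s. w (t + s)) \<longlongrightarrow> l) (at_left s)"
      using filterlim_compose[OF _ f(2)] by blast
  qed
qed

lemma rcll_cong:
  assumes "\<And>s. s \<ge> a \<Longrightarrow> w s = w' s" "rcll a w"
  shows "rcll a w'"
proof -
  have "(w' \<longlongrightarrow> w' s) (at_right s)" if "s \<ge> a" for s
  proof -
    have "\<forall>\<^sub>F x in at_right s. w x = w' x"
      using assms(1) that by (auto simp: eventually_at_filter intro!: always_eventually)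
    then show ?thesis using rcll_right[OF assms(2) that] assms(1)[OF that] Lim_transform_eventually by fastforce
  qed
  moreover have "\<exists>l. (w' \<longlongrightarrow> l) (at_left s)" if "s > a" for s
  proof -
    from rcll_left[OF assms(2) that] obtain l where l: "(w \<longlongrightarrow> l) (at_left s)" by auto
    have "\<forall>\<^sub>F x in at_left s. w x = w' x"
      using eventually_at_left_real[OF that] by (rule eventually_mono) (use assms(1) in auto)
    then show ?thesis using l Lim_transform_eventually by blast
  qed
  ultimately show ?thesis by (auto simp: rcll_def)
qed

text \<open>Compactness for paths that are not continuous. The accumulating times can be thinned out
  to lie on one side of their limit \<open>s\<close>, and the side decides whether the values
  converge to \<open>w s\<close> or to the left limit.\<close>

lemma rcll_seq:
  fixes w :: "real \<Rightarrow> 'a::metric_space"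
  assumes "rcll a w" and x: "\<And>n::nat. x n \<in> {a..b}"
  shows "\<exists>r s. strict_mono r \<and> s \<in> {a..b} \<and> (x \<circ> r) \<longlonglongrightarrow> s \<and>
    ((\<forall>n. s \<le> x (r n)) \<and> (\<lambda>n. w (x (r n))) \<longlonglongrightarrow> w s \<or>
     a < s \<and> (\<forall>n. x (r n) < s) \<and> (\<exists>l. (w \<longlongrightarrow> l) (at_left s) \<and> (\<lambda>n. w (x (r n))) \<longlonglongrightarrow> l))"
proof -
  obtain s r where s: "s \<in> {a..b}" and r: "strict_mono r" "(x \<circ> r) \<longlonglongrightarrow> s"
    using compact_Icc[of a b] x unfolding compact_def by blast
  show ?thesis
  proof (cases "\<exists>\<^sub>\<infinity>n. s \<le> x (r n)")
    case True
    then have inf: "infinite {n. s \<le> x (r n)}" by (simp add: INFM_iff_infinite)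
    define r' where "r' = r \<circ> enumerate {n. s \<le> x (r n)}"
    have r'm: "strict_mono r'" unfolding r'_def
      using r(1) strict_mono_enumerate[OF inf] by (simp add: strict_mono_o)
    have xr': "(x \<circ> r') \<longlonglongrightarrow> s" unfolding r'_def
      using LIMSEQ_subseq_LIMSEQ[OF r(2) strict_mono_enumerate[OF inf]] by (simp add: o_assoc)
    have ge: "s \<le> x (r' n)" for n using enumerate_in_set[OF inf, of n] by (simp add: r'_def)
    have "(w \<longlongrightarrow> w s) (at s within {s..})"
      using rcll_right[OF assms(1)] s by (auto simp: at_within_Ici_at_right)
    then have c: "continuous (at s within {s..}) w" by (simp add: continuous_within)
    have "(\<lambda>n. w ((x \<circ> r') n)) \<longlonglongrightarrow> w s"
      using c xr' ge unfolding continuous_within_sequentially by (auto simp: o_def)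
    then show ?thesis using r'm s xr' ge by (intro exI[of _ r'] exI[of _ s]) (simp add: o_def)
  next
    case False
    then have "\<forall>\<^sub>\<infinity>n. x (r n) < s" by (simp add: not_INFM not_le)
    then obtain m where m: "\<And>n. n \<ge> m \<Longrightarrow> x (r n) < s" by (auto simp: MOST_nat_le)
    define r' where "r' = (\<lambda>n. r (n + m))"
    have r'm: "strict_mono r'" using r(1) by (simp add: r'_def strict_mono_def)
    have xr': "(x \<circ> r') \<longlonglongrightarrow> s" using LIMSEQ_ignore_initial_segment[OF r(2), of m] by (simp add: r'_def o_def)
    have lt: "x (r' n) < s" for n using m by (simp add: r'_def)
    have "a < s" using lt[of 0] x[of "r' 0"] by auto
    then obtain l where l: "(w \<longlongrightarrow> l) (at_left s)" using rcll_left[OF assms(1)] by blast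
    have "filterlim (x \<circ> r') (at_left s) sequentially"
      using xr' lt by (intro filterlim_at_withinI) (auto simp: less_imp_neq)
    then have "(\<lambda>n. w ((x \<circ> r') n)) \<longlonglongrightarrow> l" using l filterlim_compose by blast
    then show ?thesis using r'm s xr' lt \<open>a < s\<close> l by (intro exI[of _ r'] exI[of _ s]) (auto simp: o_def)
  qed
qed

lemma approaches_mono: "approaches A w a b \<Longrightarrow> a' \<le> a \<Longrightarrow> b \<le> b' \<Longrightarrow> approaches A w a' b'"
  unfolding approaches_def by (meson atLeastAtMost_iff order_trans)

lemma approachesI:
  assumes "s \<in> {a..b}" "w s \<in> closure A"
  shows "approaches A w a b"
proof -
  have "w s \<in> nbhd (1 / Suc n) A" for n
    using nbhd_closure[of "1 / Suc n" A] assms(2) by (auto simp del: of_nat_Suc)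
  then show ?thesis using assms(1) unfolding approaches_def by blast
qed

lemma approachesI_left:
  assumes "s \<in> {a<..b}" "(w \<longlongrightarrow> l) (at_left s)" "l \<in> closure A"
  shows "approaches A w a b"
  unfolding approaches_def
proof
  fix n :: nat
  have "l \<in> nbhd (1 / Suc n) A" using nbhd_closure[of "1 / Suc n" A] assms(3) by (auto simp del: of_nat_Suc)
  then have "\<forall>\<^sub>F v in at_left s. w v \<in> nbhd (1 / Suc n) A"
    using assms(2) topological_tendstoD open_nbhd by blast
  moreover have "\<forall>\<^sub>F v in at_left s. v \<in> {a<..<s}" using assms(1) eventually_at_left_real by auto
  ultimately have "\<forall>\<^sub>F v in at_left s. w v \<in> nbhd (1 / Suc n) A \<and> v \<in> {a<..<s}" by eventually_elim auto
  then obtain v where "w v \<in> nbhd (1 / Suc n) A" "v \<in> {a<..<s}"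
    by (metis (no_types, lifting) eventually_happens trivial_limit_at_left_real)
  then show "\<exists>s\<in>{a..b}. w s \<in> nbhd (1 / Suc n) A" using assms(1) by (intro bexI[of _ v]) auto
qed

text \<open>Times with values in shrinking neighbourhoods of \<open>A\<close> accumulate, and by
  \<open>rcll_seq\<close> the values converge to a value or a left limit, which must then lie in the
  closure.\<close>

lemma approachesD:
  fixes w :: "real \<Rightarrow> 'a::metric_space"
  assumes "rcll a w" "approaches A w a b"
  shows "(\<exists>s\<in>{a..b}. w s \<in> closure A) \<or> (\<exists>s\<in>{a<..b}. \<exists>l\<in>closure A. (w \<longlongrightarrow> l) (at_left s))"
proof -
  obtain x where x: "\<And>n. x n \<in> {a..b}" "\<And>n. w (x n) \<in> nbhd (1 / Suc n) A"
    using assms(2) unfolding approaches_def by metis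
  then obtain y where y: "\<And>n. y n \<in> A" "\<And>n. dist (w (x n)) (y n) < 1 / Suc n"
    unfolding nbhd_def by (simp del: of_nat_Suc) metis
  obtain r s where r: "strict_mono r" "s \<in> {a..b}" "(x \<circ> r) \<longlonglongrightarrow> s"
    "(\<forall>n. s \<le> x (r n)) \<and> (\<lambda>n. w (x (r n))) \<longlonglongrightarrow> w s \<or>
     a < s \<and> (\<forall>n. x (r n) < s) \<and> (\<exists>l. (w \<longlongrightarrow> l) (at_left s) \<and> (\<lambda>n. w (x (r n))) \<longlonglongrightarrow> l)"
    using rcll_seq[OF assms(1), of x b] x(1) by blast
  have *: "l \<in> closure A" if l: "(\<lambda>n. w (x (r n))) \<longlonglongrightarrow> l" for l
  proof -
    have "(\<lambda>n. 1 / real (Suc n)) \<longlonglongrightarrow> 0" by (rule lim_1_over_n[THEN LIMSEQ_Suc])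
    then have "(\<lambda>n. 1 / real (Suc (r n))) \<longlonglongrightarrow> 0" using r(1) by (rule LIMSEQ_subseq_LIMSEQ[unfolded o_def])
    then have "(\<lambda>n. dist (w (x (r n))) (y (r n))) \<longlonglongrightarrow> 0"
      by (rule Lim_null_comparison[rotated])
        (use y(2) in \<open>auto intro!: always_eventually less_imp_le simp del: of_nat_Suc\<close>)
    from tendsto_add[OF this tendsto_dist_iff[THEN iffD1, OF l]]
    have "(\<lambda>n. dist (w (x (r n))) (y (r n)) + dist (w (x (r n))) l) \<longlonglongrightarrow> 0" by simp
    moreover have "\<forall>n. norm (dist (y (r n)) l) \<le> dist (w (x (r n))) (y (r n)) + dist (w (x (r n))) l"
      by (simp add: dist_triangle3)
    ultimately have "(\<lambda>n. dist (y (r n)) l) \<longlonglongrightarrow> 0"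
      by (rule Lim_null_comparison[rotated, OF _ always_eventually])
    then have "(\<lambda>n. y (r n)) \<longlonglongrightarrow> l" by (rule tendsto_dist_iff[THEN iffD2])
    then show ?thesis unfolding closure_sequential by (intro exI[of _ "\<lambda>n. y (r n)"]) (simp add: y(1))
  qed
  from r(4) show ?thesis
  proof
    assume "(\<forall>n. s \<le> x (r n)) \<and> (\<lambda>n. w (x (r n))) \<longlonglongrightarrow> w s"
    then have "w s \<in> closure A" using * by blast
    then show ?thesis using r(2) by blast
  next
    assume "a < s \<and> (\<forall>n. x (r n) < s) \<and> (\<exists>l. (w \<longlongrightarrow> l) (at_left s) \<and> (\<lambda>n. w (x (r n))) \<longlonglongrightarrow> l)"
    then obtain l where "(w \<longlongrightarrow> l) (at_left s)" "l \<in> closure A" "a < s" using * by blast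
    then show ?thesis using r(2) by auto
  qed
qed

section \<open>Paths without bad jumps: left limits against values\<close>

lemma no_bad_jump_mono: "no_bad_jump K w a b \<Longrightarrow> a \<le> a' \<Longrightarrow> b' \<le> b \<Longrightarrow> no_bad_jump K w a' b'"
  unfolding no_bad_jump_def by (meson le_less_trans less_le_trans)

lemma no_bad_jump_subset: "no_bad_jump K w a b \<Longrightarrow> K' \<subseteq> K \<Longrightarrow> no_bad_jump K' w a b"
  by (auto simp: no_bad_jump_def)

text \<open>Without jumps from or onto the boundary, a left limit in the closure is either a value in the
  closure or is approached through the open set itself.\<close>

lemma left_limit_closure:
  assumes "open A" "no_bad_jump (frontier A) w a b" "a < v" "v < b" "(w \<longlongrightarrow> l) (at_left v)" "l \<in> closure A"
    and "w v \<notin> closure A" "c < v"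
  shows "\<exists>s. c < s \<and> s < v \<and> w s \<in> A"
proof -
  have "l \<noteq> w v" using assms by auto
  then have "l \<notin> frontier A" using assms unfolding no_bad_jump_def by blast
  then have "l \<in> A" using assms by (auto simp: frontier_def interior_open)
  then have "\<forall>\<^sub>F s in at_left v. w s \<in> A" using assms topological_tendstoD by blast
  moreover have "\<forall>\<^sub>F s in at_left v. s \<in> {c<..<v}" using assms eventually_at_left_real by auto
  ultimately have "\<forall>\<^sub>F s in at_left v. w s \<in> A \<and> s \<in> {c<..<v}" by eventually_elim auto
  then show ?thesis by (metis (no_types, lifting) eventually_happens trivial_limit_at_left_real greaterThanLessThan_iff)
qed

lemma right_open:
  assumes "rcll a w" "open A" "a \<le> v" "w v \<in> A" "v < c"
  shows "\<exists>s. v < s \<and> s < c \<and> w s \<in> A"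
proof -
  have "\<forall>\<^sub>F s in at_right v. w s \<in> A" using rcll_right[OF assms(1,3)] assms topological_tendstoD by blast
  moreover have "\<forall>\<^sub>F s in at_right v. s \<in> {v<..<c}" using assms eventually_at_right_real by auto
  ultimately have "\<forall>\<^sub>F s in at_right v. w s \<in> A \<and> s \<in> {v<..<c}" by eventually_elim auto
  then show ?thesis by (metis (no_types, lifting) eventually_happens trivial_limit_at_right_real greaterThanLessThan_iff)
qed

lemma left_limit_closure_value:
  assumes "open A" "no_bad_jump (frontier A) w a b" "a < v" "v < b" "(w \<longlongrightarrow> l) (at_left v)" "l \<in> closure A"
    "c < v"
  shows "\<exists>s. c < s \<and> s \<le> v \<and> w s \<in> closure A"
  using left_limit_closure[OF assms(1-6) _ assms(7)] assms(7) closure_subset by (metis less_imp_le order_refl subsetD)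

text \<open>A left limit in the closure is either matched by the value at the same time or, lying in
  the open set itself, by earlier values. The condition \<open>b < b'\<close> covers a jump at
  \<open>b\<close>.\<close>

lemma approaches_value:
  assumes "open A" "rcll a w" "no_bad_jump (frontier A) w a' b'" "a' \<le> a" "b < b'" "approaches A w a b"
  shows "\<exists>s\<in>{a..b}. w s \<in> closure A"
  using approachesD[OF assms(2,6)]
proof
  assume "\<exists>s\<in>{a<..b}. \<exists>l\<in>closure A. (w \<longlongrightarrow> l) (at_left s)"
  then obtain v l where "v \<in> {a<..b}" "l \<in> closure A" "(w \<longlongrightarrow> l) (at_left v)" by auto
  with left_limit_closure_value[OF assms(1,3), of v l a] assms show ?thesis by force
qed

text \<open>Once \<open>A\<close> is visited at \<open>s\<close> within the window, a look-back just
  beyond \<open>s\<close> suffices: it still sees \<open>A\<close>, and it sees no more of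
  \<open>B\<close> than a longer one.\<close>

lemma came_from_truncate:
  assumes "\<exists>s. t - h < s \<and> s < t \<and> w s \<in> A"
  shows "came_from A B w t h \<longleftrightarrow> (\<exists>n::nat. came_from A B w t n)"
proof
  assume "came_from A B w t h"
  then obtain \<alpha> where \<alpha>: "\<alpha> \<in> \<rat>" "0 < \<alpha>" "approaches A w (t - \<alpha>) t" "\<not> approaches B w (t - \<alpha>) t"
    by (auto simp: came_from_def)
  obtain n :: nat where "\<alpha> < n" using reals_Archimedean2 by blast
  with \<alpha> show "\<exists>n::nat. came_from A B w t n" by (auto simp: came_from_def)
next
  assume "\<exists>n::nat. came_from A B w t n"
  then obtain \<alpha> where \<alpha>: "\<alpha> \<in> \<rat>" "0 < \<alpha>" "approaches A w (t - \<alpha>) t" "\<not> approaches B w (t - \<alpha>) t"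
    by (auto simp: came_from_def)
  obtain s where s: "t - h < s" "s < t" "w s \<in> A" using assms by auto
  show "came_from A B w t h"
  proof (cases "\<alpha> < h")
    case True
    then show ?thesis using \<alpha> by (auto simp: came_from_def)
  next
    case False
    obtain \<beta> where \<beta>: "\<beta> \<in> \<rat>" "t - s < \<beta>" "\<beta> < h" using Rats_dense_in_real[of "t - s" h] s by auto
    have "approaches A w (t - \<beta>) t" using s \<beta> closure_subset by (intro approachesI[of s]) auto
    moreover have "\<not> approaches B w (t - \<beta>) t"
      using approaches_mono[of B w "t - \<beta>" t "t - \<alpha>" t] \<alpha> \<beta> False by auto
    ultimately show ?thesis using \<beta> s by (auto simp: came_from_def intro!: bexI[of _ \<beta>])
  qed
qed

text \<open>Not the mirror image of the backward case: a look-ahead has to avoid \<open>A\<close>,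
  so a visit to \<open>A\<close> before \<open>t + h\<close> forces every admissible \<alpha> to be
  below \<open>h\<close>.\<close>

lemma heads_to_truncate:
  assumes "\<exists>s. t < s \<and> s < t + h \<and> w s \<in> A"
  shows "heads_to B A w t h \<longleftrightarrow> (\<exists>n::nat. heads_to B A w t n)"
proof
  assume "heads_to B A w t h"
  then obtain \<alpha> where \<alpha>: "\<alpha> \<in> \<rat>" "0 < \<alpha>" "approaches B w t (t + \<alpha>)" "\<not> approaches A w t (t + \<alpha>)"
    by (auto simp: heads_to_def)
  obtain n :: nat where "\<alpha> < n" using reals_Archimedean2 by blast
  with \<alpha> show "\<exists>n::nat. heads_to B A w t n" by (auto simp: heads_to_def)
next
  assume "\<exists>n::nat. heads_to B A w t n"
  then obtain \<alpha> where \<alpha>: "\<alpha> \<in> \<rat>" "0 < \<alpha>" "approaches B w t (t + \<alpha>)" "\<not> approaches A w t (t + \<alpha>)"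
    by (auto simp: heads_to_def)
  obtain s where s: "t < s" "s < t + h" "w s \<in> A" using assms by auto
  have "\<alpha> < h"
    using approachesI[of s t "t + \<alpha>" w A] \<alpha>(4) s closure_subset[of A] by force
  then show "heads_to B A w t h" using \<alpha> by (auto simp: heads_to_def)
qed

text \<open>Without bad jumps, approaching a closure amounts to hitting it, so look-backs of any
  length recover the comparison of suprema. The delicate point is the strict inequality when
  \<open>A\<close> is met only at the very start of the look-back.\<close>

lemma came_from_iff_last_hit:
  fixes w :: "real \<Rightarrow> real^'n"
  assumes "open A" "open B" "\<And>a. rcll a w"
    and A: "\<And>a b. no_bad_jump (frontier A) w a b" and B: "\<And>a b. no_bad_jump (frontier B) w a b"
    and disj: "closure A \<inter> closure B = {}"
  shows "(\<exists>n::nat. came_from A B w t n) \<longleftrightarrow> last_hit w B t < last_hit w A t"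
proof
  assume "\<exists>n::nat. came_from A B w t n"
  then obtain \<alpha> where \<alpha>: "0 < \<alpha>" "approaches A w (t - \<alpha>) t" "\<not> approaches B w (t - \<alpha>) t"
    by (auto simp: came_from_def)
  let ?a = "t - \<alpha>"
  have Bout: "w s \<notin> closure B" if "s \<in> {?a..t}" for s using approachesI[OF that] \<alpha> by blast
  have le: "last_hit w B t \<le> ereal ?a"
    unfolding last_hit_def
  proof (rule SUP_least)
    fix s assume "s \<in> {s. s \<le> t \<and> w s \<in> closure B}"
    then show "ereal s \<le> ereal ?a" using Bout[of s] by force
  qed
  obtain v where v: "v \<in> {?a..t}" "w v \<in> closure A"
    using approaches_value[OF assms(1) assms(3) A[of "?a - 1" "t + 1"] _ _ \<alpha>(2)] by auto
  have ge: "ereal v \<le> last_hit w A t" unfolding last_hit_def using v by (intro SUP_upper) auto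
  show "last_hit w B t < last_hit w A t"
  proof (cases "v = ?a")
    case False
    then have "ereal ?a < ereal v" using v by auto
    with le ge show ?thesis by (meson le_less_trans less_le_trans)
  next
    \<comment> \<open>Hits of \<open>B\<close> could still accumulate at \<open>v\<close> from the
      left. If \<open>w v\<close> is in the open set, right continuity supplies a later visit to
      \<open>A\<close>; if it is on the boundary, there is no jump at \<open>v\<close>, and the path
      stays off the closure of \<open>B\<close> shortly before \<open>v\<close>.\<close>
    case veq: True
    show ?thesis
    proof (cases "w v \<in> A")
      case True
      then obtain s where "v < s" "s < t" "w s \<in> A" using right_open[OF assms(3) assms(1), of v v t] veq \<alpha> by auto
      then have "ereal s \<le> last_hit w A t" unfolding last_hit_def using closure_subset by (intro SUP_upper) auto
      moreover have "ereal ?a < ereal s" using \<open>v < s\<close> veq by simp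
      ultimately show ?thesis using le by (meson le_less_trans less_le_trans)
    next
      case False
      then have fr: "w v \<in> frontier A" using v assms(1) by (simp add: frontier_def interior_open)
      obtain l where l: "(w \<longlongrightarrow> l) (at_left v)" using rcll_left[OF assms(3), of "v - 1" v] by auto
      have "l = w v" using A[of "v - 1" "v + 1"] l fr unfolding no_bad_jump_def by force
      then have "l \<in> - closure B" using v disj by auto
      then have "\<forall>\<^sub>F s in at_left v. w s \<in> - closure B" using l topological_tendstoD open_Compl closed_closure by blast
      then obtain c where c: "c < v" "\<And>s. c < s \<Longrightarrow> s < v \<Longrightarrow> w s \<notin> closure B"
        by (auto simp: eventually_at_left[of "v - 1" v])
      have "last_hit w B t \<le> ereal c"
        unfolding last_hit_def
      proof (rule SUP_least)
        fix s assume s: "s \<in> {s. s \<le> t \<and> w s \<in> closure B}"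
        then have "\<not> (c < s \<and> s < v)" "\<not> v \<le> s" using c Bout[of s] veq by auto
        then show "ereal s \<le> ereal c" by auto
      qed
      also have "ereal c < ereal v" using c by simp
      finally show ?thesis using ge by (rule less_le_trans)
    qed
  qed
next
  assume lt: "last_hit w B t < last_hit w A t"
  obtain v where v: "v \<le> t" "w v \<in> closure A" "last_hit w B t < ereal v"
    using lt unfolding last_hit_def[of w A] by (auto simp: less_SUP_iff)
  \<comment> \<open>\<open>last_hit\<close> may be infinite, so a real number in between is chosen;
    it leaves room for a rational look-back that reaches \<open>v\<close> but no hit of
    \<open>B\<close>.\<close>
  obtain r :: real where r: "last_hit w B t < ereal r" "ereal r < ereal v" using v(3) ereal_dense2 by blast
  obtain \<alpha> where \<alpha>: "\<alpha> \<in> \<rat>" "t - v < \<alpha>" "\<alpha> < t - r" using Rats_dense_in_real[of "t - v" "t - r"] r by auto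
  have "approaches A w (t - \<alpha>) t" using v \<alpha> by (intro approachesI[of v]) auto
  moreover have "\<not> approaches B w (t - \<alpha>) t"
  proof
    assume "approaches B w (t - \<alpha>) t"
    then obtain s where s: "s \<in> {t - \<alpha>..t}" "w s \<in> closure B"
      using approaches_value[OF assms(2) assms(3) B[of "t - \<alpha>" "t + 1"], of "t - \<alpha>" t] by auto
    then have "ereal s \<le> last_hit w B t" unfolding last_hit_def by (intro SUP_upper) auto
    then have "ereal s < ereal r" using r(1) by (rule le_less_trans)
    then show False using s \<alpha> by auto
  qed
  moreover obtain n :: nat where "\<alpha> < n" using reals_Archimedean2 by blast
  ultimately show "\<exists>n::nat. came_from A B w t n" using \<alpha> v unfolding came_from_def by (intro exI[of _ n] bexI[of _ \<alpha>]) auto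
qed

text \<open>Here strictness comes from right continuity: the path stays outside the closure of
  \<open>A\<close> for some time after the end of the look-ahead, which settles the end point
  without a case distinction.\<close>

lemma heads_to_iff_next_hit:
  fixes w :: "real \<Rightarrow> real^'n"
  assumes "open A" "open B" "rcll t w"
    and A: "\<And>b. no_bad_jump (frontier A) w t b" and B: "\<And>b. no_bad_jump (frontier B) w t b"
  shows "(\<exists>n::nat. heads_to B A w t n) \<longleftrightarrow> next_hit w B t < next_hit w A t"
proof
  assume "\<exists>n::nat. heads_to B A w t n"
  then obtain \<alpha> where \<alpha>: "0 < \<alpha>" "approaches B w t (t + \<alpha>)" "\<not> approaches A w t (t + \<alpha>)"
    by (auto simp: heads_to_def)
  let ?a = "t + \<alpha>"
  obtain v where v: "v \<in> {t..?a}" "w v \<in> closure B"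
    using approaches_value[OF assms(2) assms(3) B[of "?a + 1"] _ _ \<alpha>(2)] by auto
  have "next_hit w B t \<le> ereal v" unfolding next_hit_def using v by (intro INF_lower) auto
  also have "ereal v \<le> ereal ?a" using v by simp
  finally have le: "next_hit w B t \<le> ereal ?a" .
  have Aout: "w s \<in> - closure A" if "s \<in> {t..?a}" for s using approachesI[OF that] \<alpha> by blast
  have "\<forall>\<^sub>F s in at_right ?a. w s \<in> - closure A"
    using rcll_right[OF assms(3)] Aout[of ?a] \<alpha> topological_tendstoD[of w "w ?a" "at_right ?a" "- closure A"] by auto
  then obtain c where c: "?a < c" "\<And>s. ?a < s \<Longrightarrow> s < c \<Longrightarrow> w s \<in> - closure A"
    by (auto simp: eventually_at_right[of ?a "?a + 1"])
  have "ereal c \<le> next_hit w A t"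
    unfolding next_hit_def
  proof (rule INF_greatest)
    fix s assume s: "s \<in> {s. t \<le> s \<and> w s \<in> closure A}"
    then have "\<not> (?a < s \<and> s < c)" "\<not> s \<le> ?a" using c Aout[of s] by auto
    then show "ereal c \<le> ereal s" by auto
  qed
  moreover have "ereal ?a < ereal c" using c by simp
  ultimately show "next_hit w B t < next_hit w A t" using le by (meson le_less_trans less_le_trans)
next
  assume lt: "next_hit w B t < next_hit w A t"
  obtain v where v: "t \<le> v" "w v \<in> closure B" "ereal v < next_hit w A t"
    using lt unfolding next_hit_def[of w B] by (auto simp: INF_less_iff)
  obtain r :: real where r: "ereal v < ereal r" "ereal r < next_hit w A t" using v(3) ereal_dense2 by blast
  obtain \<alpha> where \<alpha>: "\<alpha> \<in> \<rat>" "v - t < \<alpha>" "\<alpha> < r - t" using Rats_dense_in_real[of "v - t" "r - t"] r by auto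
  have "approaches B w t (t + \<alpha>)" using v \<alpha> by (intro approachesI[of v]) auto
  moreover have "\<not> approaches A w t (t + \<alpha>)"
  proof
    assume "approaches A w t (t + \<alpha>)"
    then obtain s where s: "s \<in> {t..t + \<alpha>}" "w s \<in> closure A"
      using approaches_value[OF assms(1) assms(3) A[of "t + \<alpha> + 1"], of "t + \<alpha>"] by auto
    then have "next_hit w A t \<le> ereal s" unfolding next_hit_def by (intro INF_lower) auto
    with r(2) have "ereal r < ereal s" by (rule less_le_trans)
    then show False using s \<alpha> by auto
  qed
  moreover obtain n :: nat where "\<alpha> < n" using reals_Archimedean2 by blast
  ultimately show "\<exists>n::nat. heads_to B A w t n" using \<alpha> v unfolding heads_to_def by (intro exI[of _ n] bexI[of _ \<alpha>]) auto
qed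

text \<open>Between two crossings from \<open>A\<close> to \<open>B\<close> the enumeration places a
  crossing back. If the two touched, this crossing back would be squeezed to a single time, at which
  the left limit lies in both closures.\<close>

lemma crossings_separated:
  assumes "transition_times w A B \<tau>Am \<tau>Bp \<tau>Bm \<tau>Ap" "closure A \<inter> closure B = {}"
    and "(s, u) \<in> crossings w A B" "(s', u') \<in> crossings w A B" "(s, u) \<noteq> (s', u')"
  shows "u < s' \<or> u' < s"
proof -
  have ord: "\<tau>Am n \<le> \<tau>Bp n" "\<tau>Bp n \<le> \<tau>Bm n" "\<tau>Bm n \<le> \<tau>Ap n" "\<tau>Ap n \<le> \<tau>Am (Suc n)"
    and AB: "range (\<lambda>n. (\<tau>Am n, \<tau>Bp n)) = crossings w A B"
    and BA: "range (\<lambda>n. (\<tau>Bm n, \<tau>Ap n)) = crossings w B A" for n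
    using assms(1) by (auto simp: transition_times_def)
  have mono: "\<tau>Am n \<le> \<tau>Am m" if "n \<le> m" for n m
    using that by (rule lift_Suc_mono_le[rotated]) (meson ord order_trans)
  have *: "\<tau>Bp n < \<tau>Am m" if "n < m" for n m
  proof (rule ccontr)
    assume "\<not> \<tau>Bp n < \<tau>Am m"
    then have eq: "\<tau>Bm n = \<tau>Am m"
      using ord(2-4)[of n] mono[of "Suc n" m] that by auto
    have "(\<tau>Bm n, \<tau>Ap n) \<in> crossings w B A" "(\<tau>Am m, \<tau>Bp m) \<in> crossings w A B" using AB BA by auto
    then obtain l l' where "l \<in> closure B" "(w \<longlongrightarrow> l) (at_left (\<tau>Am m))"
      "l' \<in> closure A" "(w \<longlongrightarrow> l') (at_left (\<tau>Am m))"
      unfolding crossings_def eq by blast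
    moreover from this have "l = l'" using tendsto_unique trivial_limit_at_left_real by blast
    ultimately show False using assms(2) by auto
  qed
  obtain n m where "(s, u) = (\<tau>Am n, \<tau>Bp n)" "(s', u') = (\<tau>Am m, \<tau>Bp m)" using assms(3,4) AB by fastforce
  then show ?thesis using *[of n m] *[of m n] assms(5) by (cases n m rule: linorder_cases) auto
qed

lemma reactive_times_iff:
  assumes "transition_times w A B \<tau>Am \<tau>Bp \<tau>Bm \<tau>Ap"
  shows "t \<in> reactive_times \<tau>Am \<tau>Bp \<longleftrightarrow> (\<exists>s u. (s, u) \<in> crossings w A B \<and> s < t \<and> t < u)"
proof -
  have "range (\<lambda>n. (\<tau>Am n, \<tau>Bp n)) = crossings w A B" using assms by (simp add: transition_times_def)
  then show ?thesis unfolding reactive_times_def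
    by (smt (verit) UN_iff greaterThanLessThan_iff image_iff prod.inject rangeI)
qed

text \<open>Separation of crossings does half of the work: a value in the closure of
  \<open>B\<close> before \<open>u\<close>, or a left limit in the closure of \<open>A\<close> after
  \<open>s\<close>, would produce a second crossing that overlaps \<open>(s, u)\<close>. The absence
  of bad jumps excludes the two remaining kinds of contact.\<close>

lemma reactive_imp_came_from_heads_to:
  fixes w :: "real \<Rightarrow> real^'n"
  assumes AB: "open A" "open B" "closure A \<inter> closure B = {}" and w: "rcll 0 w"
    and tt: "transition_times w A B \<tau>Am \<tau>Bp \<tau>Bm \<tau>Ap"
    and h: "h \<le> t"
    and A: "no_bad_jump (frontier A) w (t - h) (t + h)" and B: "no_bad_jump (frontier B) w (t - h) (t + h)"
    and v0: "t - h < v0" "v0 < t" "w v0 \<in> A" and v1: "t < v1" "v1 < t + h" "w v1 \<in> A"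
    and su: "(s, u) \<in> crossings w A B" "s < t" "t < u"
  shows "came_from A B w t h \<and> heads_to B A w t h"
proof -
  have s0: "0 < s" and wu: "w u \<in> closure B" and out: "\<And>v. s < v \<Longrightarrow> v < u \<Longrightarrow> w v \<notin> A \<and> w v \<notin> B"
    using su by (auto simp: crossings_def)
  obtain l where l: "l \<in> closure A" "(w \<longlongrightarrow> l) (at_left s)" using su by (auto simp: crossings_def)
  have sep: "u < s' \<or> u' < s" if "(s', u') \<in> crossings w A B" "(s, u) \<noteq> (s', u')" for s' u'
    using crossings_separated[OF tt AB(3) su(1) that] .
  have noBval: "w v \<notin> closure B" if "s \<le> v" "v < u" for v
  proof
    assume "w v \<in> closure B"
    then have "(s, v) \<in> crossings w A B" using that s0 l out by (auto simp: crossings_def)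
    from sep[OF this] that su show False by auto
  qed
  have noAlim: "l' \<notin> closure A" if "s < v" "v \<le> u" "(w \<longlongrightarrow> l') (at_left v)" for v l'
  proof
    assume "l' \<in> closure A"
    then have "(v, u) \<in> crossings w A B" using that s0 wu out by (auto simp: crossings_def)
    from sep[OF this] that su show False by auto
  qed
  have "\<not> (s < v0)" "\<not> (v1 < u)" "v1 \<noteq> u" "v0 \<noteq> s"
  proof -
    show "\<not> (s < v0)" "\<not> (v1 < u)" using out[of v0] out[of v1] v0 v1 su by auto
    show "v1 \<noteq> u" using wu v1 closure_subset[of A] AB(3) by auto
    show "v0 \<noteq> s"
    proof
      assume "v0 = s"
      then obtain v where "s < v" "v < t" "w v \<in> A" using right_open[OF w AB(1), of s t] s0 v0 su by auto
      then show False using out[of v] su by auto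
    qed
  qed
  \<comment> \<open>The visits to \<open>A\<close> at \<open>v0\<close> and \<open>v1\<close> cannot
    fall inside the crossing, so they enclose it. This fits a crossing of unknown length into the
    window.\<close>
  then have win: "t - h < s" "u < t + h" using v0 v1 by auto
  have noAval: "w v \<notin> closure A" if "s < v" "v < u" for v
  proof
    assume "w v \<in> closure A"
    then have fr: "w v \<in> frontier A" using out[OF that] AB(1) by (simp add: frontier_def interior_open)
    have "0 < v" using s0 that by simp
    then obtain l' where l': "(w \<longlongrightarrow> l') (at_left v)" using rcll_left[OF w, of v] by blast
    have "t - h < v" "v < t + h" using that win by auto
    then have "l' = w v" using A l' fr unfolding no_bad_jump_def by blast
    then show False using noAlim[OF _ _ l'] that \<open>w v \<in> closure A\<close> by auto
  qed
  have noBlim: "l' \<notin> closure B" if v: "s < v" "v < u" and l': "(w \<longlongrightarrow> l') (at_left v)" for v l'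
  proof
    assume "l' \<in> closure B"
    from left_limit_closure[OF AB(2) B _ _ l' this noBval \<open>s < v\<close>] v win
    show False using out by force
  qed
  have fut: "came_from A B w t h"
  proof -
    have "l \<in> - closure B" using l AB(3) by auto
    then have "\<forall>\<^sub>F x in at_left s. w x \<in> - closure B" using l topological_tendstoD open_Compl closed_closure by blast
    then obtain c where c: "c < s" "\<And>x. c < x \<Longrightarrow> x < s \<Longrightarrow> w x \<notin> closure B"
      by (auto simp: eventually_at_left[of "s - 1" s])
    \<comment> \<open>The look-back reaches behind \<open>s\<close>, where the left limit is in the
      closure of \<open>A\<close>, but it stays in the window, after \<open>c\<close> where the path
      is off \<open>B\<close>, and at positive times where the path is cadlag.\<close>
    obtain \<alpha> where \<alpha>: "\<alpha> \<in> \<rat>" "t - s < \<alpha>" "\<alpha> < min h (t - max c 0)"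
      using Rats_dense_in_real[of "t - s" "min h (t - max c 0)"] win c s0 by auto
    have "approaches A w (t - \<alpha>) t" using l \<alpha> su by (intro approachesI_left[of s _ _ _ l]) auto
    moreover have "\<not> approaches B w (t - \<alpha>) t"
    proof
      have a0: "0 \<le> t - \<alpha>" using \<alpha> by auto
      assume "approaches B w (t - \<alpha>) t"
      then consider x where "x \<in> {t - \<alpha>..t}" "w x \<in> closure B"
        | x l' where "x \<in> {t - \<alpha><..t}" "l' \<in> closure B" "(w \<longlongrightarrow> l') (at_left x)"
        using approachesD[OF rcll_mono[OF w a0]] by blast
      then show False
      proof cases
        case 1
        then show False using c(2)[of x] noBval[of x] \<alpha> su by (cases "x < s") auto
      next
        case 2
        consider "x < s" | "x = s" | "s < x" by linarith
        then show False
        proof cases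
          case 1
          from left_limit_closure_value[OF AB(2) B _ _ 2(3,2), of "t - \<alpha>"] 2(1) \<alpha> su
          obtain y where "t - \<alpha> < y" "y \<le> x" "w y \<in> closure B" by auto
          then show False using c(2)[of y] 1 \<alpha> by auto
        next
          case eq: 2
          then have "l = l'" using 2 l tendsto_unique trivial_limit_at_left_real by blast
          then show False using l 2 AB(3) by auto
        next
          case 3
          then show False using noBlim[of x l'] 2 su by auto
        qed
      qed
    qed
    ultimately show ?thesis using \<alpha> su unfolding came_from_def by (intro bexI[of _ \<alpha>]) auto
  qed
  have "heads_to B A w t h"
  proof -
    have "\<forall>\<^sub>F x in at_right u. w x \<in> - closure A"
      using rcll_right[OF w, of u] wu AB(3) s0 su topological_tendstoD[of w "w u" "at_right u" "- closure A"] by auto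
    then obtain c where c: "c > u" "\<And>x. u < x \<Longrightarrow> x < c \<Longrightarrow> w x \<notin> closure A"
      by (auto simp: eventually_at_right[of u "u + 1"])
    \<comment> \<open>The look-ahead passes \<open>u\<close> but ends before \<open>c\<close>, up to
      which the path avoids the closure of \<open>A\<close> after \<open>u\<close>.\<close>
    obtain \<alpha> where \<alpha>: "\<alpha> \<in> \<rat>" "u - t < \<alpha>" "\<alpha> < min h (c - t)"
      using Rats_dense_in_real[of "u - t" "min h (c - t)"] win c by auto
    have "approaches B w t (t + \<alpha>)" using wu \<alpha> su by (intro approachesI[of u]) auto
    moreover have "\<not> approaches A w t (t + \<alpha>)"
    proof
      have t0: "0 \<le> t" using su s0 by auto
      assume "approaches A w t (t + \<alpha>)"
      then consider x where "x \<in> {t..t + \<alpha>}" "w x \<in> closure A"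
        | x l' where "x \<in> {t<..t + \<alpha>}" "l' \<in> closure A" "(w \<longlongrightarrow> l') (at_left x)"
        using approachesD[OF rcll_mono[OF w t0]] by blast
      then show False
      proof cases
        case 1
        then show False using c(2)[of x] noAval[of x] \<alpha> su wu AB(3) by (cases x u rule: linorder_cases) auto
      next
        case 2
        show False
        proof (cases "x \<le> u")
          case True
          then show False using noAlim[of x l'] 2 su by auto
        next
          case False
          from left_limit_closure_value[OF AB(1) A _ _ 2(3,2), of u] 2(1) \<alpha> su False
          obtain y where "u < y" "y \<le> x" "w y \<in> closure A" by auto
          then show False using c(2)[of y] 2 \<alpha> by auto
        qed
      qed
    qed
    ultimately show ?thesis using \<alpha> su unfolding heads_to_def by (intro bexI[of _ \<alpha>]) auto
  qed
  with fut show ?thesis by blast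
qed

text \<open>The last exit is the supremum of the times \<open>v\<close> for which \<open>A\<close>
  is approached between \<open>v\<close> and \<open>t\<close>. Its left limit is in the closure of
  \<open>A\<close>, as \<open>crossings\<close> demands: otherwise only the value at
  \<open>s\<close> is, and since it cannot be in the open set it sits on the boundary after a
  jump.\<close>

lemma came_from_last_exit:
  fixes w :: "real \<Rightarrow> real^'n"
  assumes AB: "open A" and w: "rcll 0 w" and h: "0 \<le> a'" and A: "no_bad_jump (frontier A) w a' b'" "t < b'"
    and cont: "(w \<longlongrightarrow> w t) (at_left t)" and wt: "w t \<notin> closure A"
    and a: "a' < a" "a < t" "approaches A w a t"
  shows "\<exists>s. a \<le> s \<and> s < t \<and> (\<exists>l\<in>closure A. (w \<longlongrightarrow> l) (at_left s)) \<and> (\<forall>v. s < v \<and> v \<le> t \<longrightarrow> w v \<notin> A)"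
proof -
  define H where "H = {v \<in> {a..t}. approaches A w v t}"
  define s where "s = Sup H"
  have aH: "a \<in> H" using a by (auto simp: H_def)
  have bdd: "bdd_above H" unfolding H_def by (intro bdd_aboveI[of _ t]) auto
  have le: "v \<le> s" if "v \<in> H" for v unfolding s_def using that bdd by (rule cSup_upper)
  have "s \<le> t" unfolding s_def using aH by (intro cSup_least) (auto simp: H_def)
  have val: "\<exists>x\<in>{v..t}. w x \<in> closure A \<and> x \<le> s" if "v \<in> H" for v
  proof -
    have "\<exists>x\<in>{v..t}. w x \<in> closure A"
      using that a h by (intro approaches_value[OF AB rcll_mono[OF w] A(1)]) (use A(2) in \<open>auto simp: H_def\<close>)
    then obtain x where x: "x \<in> {v..t}" "w x \<in> closure A" by blast
    then have "x \<in> H" using approachesI[of x x t w A] that by (auto simp: H_def)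
    then show ?thesis using x le by blast
  qed
  have below: "v \<in> H" if v: "a \<le> v" "v < s" for v
  proof -
    obtain y where "y \<in> H" "v < y" using less_cSup_iff[of H v] aH bdd v unfolding s_def by auto
    then show ?thesis using v approaches_mono[of A w y t v t] by (auto simp: H_def)
  qed
  have near: "\<exists>x. c < x \<and> x \<le> s \<and> w x \<in> closure A" if "c < s" for c
  proof (cases "a < s")
    case True
    then have "max a ((c + s) / 2) \<in> H" using that by (intro below) auto
    from val[OF this] obtain x where "max a ((c + s) / 2) \<le> x" "w x \<in> closure A" "x \<le> s" by auto
    then show ?thesis using that by (intro exI[of _ x]) auto
  next
    case False
    then have "s = a" using le[OF aH] by simp
    then show ?thesis using val[OF aH] that by auto
  qed
  \<comment> \<open>Left continuity at \<open>t\<close>, with \<open>w t\<close> outside the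
    closure, keeps the path off \<open>A\<close> shortly before \<open>t\<close>.\<close>
  have "s \<noteq> t"
  proof
    assume "s = t"
    have "\<forall>\<^sub>F x in at_left t. w x \<in> - closure A"
      using cont wt topological_tendstoD[of w "w t" "at_left t" "- closure A"] by auto
    then obtain c where c: "c < t" "\<And>x. c < x \<Longrightarrow> x < t \<Longrightarrow> w x \<notin> closure A"
      by (auto simp: eventually_at_left[of "t - 1" t])
    then show False using near[of c] \<open>s = t\<close> wt by (metis order_le_less)
  qed
  then have "s < t" using \<open>s \<le> t\<close> by simp
  have "a \<le> s" using le[OF aH] .
  have after: "w v \<notin> A" if "s < v" "v \<le> t" for v
  proof
    assume "w v \<in> A"
    then have "v \<in> H" using that \<open>a \<le> s\<close> approachesI[of v v t w A] closure_subset by (auto simp: H_def)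
    then show False using le that by fastforce
  qed
  obtain l where l: "(w \<longlongrightarrow> l) (at_left s)" using rcll_left[OF w, of s] \<open>a \<le> s\<close> a h by auto
  have "l \<in> closure A"
  proof (rule ccontr)
    assume nl: "l \<notin> closure A"
    then have "\<forall>\<^sub>F x in at_left s. w x \<in> - closure A" using l topological_tendstoD[of w l "at_left s" "- closure A"] by auto
    then obtain c where c: "c < s" "\<And>x. c < x \<Longrightarrow> x < s \<Longrightarrow> w x \<notin> closure A"
      by (auto simp: eventually_at_left[of "s - 1" s])
    then have ws: "w s \<in> closure A" using near[of c] by (metis order_le_less)
    have "w s \<notin> A"
      using right_open[OF w AB, of s t] after \<open>s < t\<close> \<open>a \<le> s\<close> a h
      by (meson less_imp_le order.trans order_le_less_trans)
    then have "w s \<in> frontier A" using ws AB by (simp add: frontier_def interior_open)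
    moreover have "l \<noteq> w s" using nl ws by auto
    moreover have "a' < s" "s < b'" using \<open>s < t\<close> \<open>a \<le> s\<close> a A(2) by auto
    ultimately show False using A(1) l unfolding no_bad_jump_def by blast
  qed
  then show ?thesis using l after \<open>s < t\<close> \<open>a \<le> s\<close> by blast
qed

text \<open>The first entrance is an infimum of end points. Right continuity makes it a value in the
  closure of \<open>B\<close>, which is what \<open>crossings\<close> asks of its end.\<close>

lemma heads_to_first_entrance:
  fixes w :: "real \<Rightarrow> real^'n"
  assumes AB: "open B" and w: "rcll t w" and B: "no_bad_jump (frontier B) w t b'" "b < b'"
    and wt: "w t \<notin> closure B" and b: "t < b" "approaches B w t b"
  shows "\<exists>u. t < u \<and> u \<le> b \<and> w u \<in> closure B \<and> (\<forall>v. t \<le> v \<and> v < u \<longrightarrow> w v \<notin> B)"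
proof -
  define H where "H = {v \<in> {t..b}. approaches B w t v}"
  define u where "u = Inf H"
  have bH: "b \<in> H" using b by (auto simp: H_def)
  have bdd: "bdd_below H" unfolding H_def by (intro bdd_belowI[of _ t]) auto
  have le: "u \<le> v" if "v \<in> H" for v unfolding u_def using that bdd by (rule cInf_lower)
  have "t \<le> u" unfolding u_def using bH by (intro cInf_greatest) (auto simp: H_def)
  have val: "\<exists>x\<in>{t..v}. w x \<in> closure B \<and> u \<le> x" if "v \<in> H" for v
  proof -
    have "\<exists>x\<in>{t..v}. w x \<in> closure B"
      using that by (intro approaches_value[OF AB w B(1)]) (use B(2) in \<open>auto simp: H_def\<close>)
    then obtain x where x: "x \<in> {t..v}" "w x \<in> closure B" by blast
    then have "x \<in> H" using approachesI[of x t x w B] that by (auto simp: H_def)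
    then show ?thesis using x le by blast
  qed
  have above: "v \<in> H" if v: "v \<le> b" "u < v" for v
  proof -
    obtain y where "y \<in> H" "y < v" using cInf_less_iff[of H v] bH bdd v unfolding u_def by auto
    then show ?thesis using v approaches_mono[of B w t y t v] by (auto simp: H_def)
  qed
  have near: "\<exists>x. x < c \<and> u \<le> x \<and> w x \<in> closure B" if "u < c" for c
  proof (cases "u < b")
    case True
    then have "min b ((c + u) / 2) \<in> H" using that by (intro above) auto
    from val[OF this] obtain x where "x \<le> min b ((c + u) / 2)" "w x \<in> closure B" "u \<le> x" by auto
    then show ?thesis using that by (intro exI[of _ x]) auto
  next
    case False
    then have "u = b" using le[OF bH] by simp
    then show ?thesis using val[OF bH] that by auto
  qed
  have wu: "w u \<in> closure B"
  proof (rule ccontr)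
    assume n: "w u \<notin> closure B"
    have "\<forall>\<^sub>F x in at_right u. w x \<in> - closure B"
      using rcll_right[OF w \<open>t \<le> u\<close>] n topological_tendstoD[of w "w u" "at_right u" "- closure B"] by auto
    then obtain c where c: "u < c" "\<And>x. u < x \<Longrightarrow> x < c \<Longrightarrow> w x \<notin> closure B"
      by (auto simp: eventually_at_right[of u "u + 1"])
    then show False using near[of c] n by (metis order_le_less)
  qed
  then have "t < u" using wt \<open>t \<le> u\<close> by (metis order_le_less)
  moreover have "w v \<notin> B" if "t \<le> v" "v < u" for v
  proof
    assume "w v \<in> B"
    then have "v \<in> H" using that le[OF bH] approachesI[of v t v w B] closure_subset by (auto simp: H_def)
    then show False using le that by fastforce
  qed
  ultimately show ?thesis using wu le[OF bH] by blast
qed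

text \<open>The reactive interval runs from the last exit from \<open>A\<close> before
  \<open>t\<close> to the first entrance into \<open>B\<close> after \<open>t\<close>. What
  look-back and look-ahead must not approach is what keeps \<open>B\<close> off the first piece and
  \<open>A\<close> off the second.\<close>

lemma came_from_heads_to_imp_reactive:
  fixes w :: "real \<Rightarrow> real^'n"
  assumes AB: "open A" "open B" and w: "rcll 0 w"
    and h: "h \<le> t"
    and A: "no_bad_jump (frontier A) w (t - h) (t + h)" and B: "no_bad_jump (frontier B) w (t - h) (t + h)"
    and cont: "(w \<longlongrightarrow> w t) (at_left t)"
    and "came_from A B w t h" "heads_to B A w t h"
  shows "\<exists>s u. (s, u) \<in> crossings w A B \<and> s < t \<and> t < u"
proof -
  obtain \<alpha> where \<alpha>: "0 < \<alpha>" "\<alpha> < h" "approaches A w (t - \<alpha>) t" "\<not> approaches B w (t - \<alpha>) t"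
    using assms by (auto simp: came_from_def)
  obtain \<beta> where \<beta>: "0 < \<beta>" "\<beta> < h" "approaches B w t (t + \<beta>)" "\<not> approaches A w t (t + \<beta>)"
    using assms by (auto simp: heads_to_def)
  have noB: "w v \<notin> closure B" if "v \<in> {t - \<alpha>..t}" for v using approachesI[OF that] \<alpha> by blast
  have noA: "w v \<notin> closure A" if "v \<in> {t..t + \<beta>}" for v using approachesI[OF that] \<beta> by blast
  obtain s where s: "t - \<alpha> \<le> s" "s < t" "\<exists>l\<in>closure A. (w \<longlongrightarrow> l) (at_left s)"
    "\<And>v. s < v \<Longrightarrow> v \<le> t \<Longrightarrow> w v \<notin> A"
    using came_from_last_exit[OF AB(1) w _ A _ cont noA[of t] _ _ \<alpha>(3)] \<alpha> \<beta> h by auto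
  obtain u where u: "t < u" "u \<le> t + \<beta>" "w u \<in> closure B" "\<And>v. t \<le> v \<Longrightarrow> v < u \<Longrightarrow> w v \<notin> B"
    using heads_to_first_entrance[OF AB(2) rcll_mono[OF w, of t] no_bad_jump_mono[OF B, of t "t + h"] _ noB[of t] _ \<beta>(3)]
      \<alpha> \<beta> h by auto
  have "w v \<notin> A \<and> w v \<notin> B" if v: "s < v" "v < u" for v
  proof (cases "v \<le> t")
    case True
    then show ?thesis using s(4)[of v] noB[of v] v s(1) closure_subset[of B] by auto
  next
    case False
    then show ?thesis using u(4)[of v] noA[of v] v u(2) closure_subset[of A] by auto
  qed
  then have "(s, u) \<in> crossings w A B" using s u \<alpha> h by (auto simp: crossings_def)
  then show ?thesis using s u by blast
qed

text \<open>The deterministic core: under these conditions, membership in a random set that is read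
  off the whole trajectory becomes a condition on the path between \<open>t - h\<close> and
  \<open>t + h\<close>.\<close>

lemma reactive_times_window:
  fixes w :: "real \<Rightarrow> real^'n"
  assumes "open A" "open B" "closure A \<inter> closure B = {}" "rcll 0 w"
    and tt: "transition_times w A B \<tau>Am \<tau>Bp \<tau>Bm \<tau>Ap"
    and "h \<le> t" and bad: "no_bad_jump (frontier A \<union> frontier B) w (t - h) (t + h)"
    and "(w \<longlongrightarrow> w t) (at_left t)"
    and "\<exists>s. t - h < s \<and> s < t \<and> w s \<in> A" "\<exists>s. t < s \<and> s < t + h \<and> w s \<in> A"
  shows "t \<in> reactive_times \<tau>Am \<tau>Bp \<longleftrightarrow> came_from A B w t h \<and> heads_to B A w t h"
  unfolding reactive_times_iff[OF tt]
  using reactive_imp_came_from_heads_to[OF assms(1-6)]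
    came_from_heads_to_imp_reactive[OF assms(1,2,4,6) _ _ assms(8)] assms(9,10)
    no_bad_jump_subset[OF bad, of "frontier A"] no_bad_jump_subset[OF bad, of "frontier B"]
  by blast

section \<open>Measurability of path events\<close>

text \<open>By right continuity an open set is visited at a rational time if it is visited at all.
  The \<sigma>-algebra is only asked to see times from \<open>lo\<close> to \<open>hi\<close>, so
  that the same lemma serves path space, the past of \<open>Y\<close> and, for shifted paths, the
  members of the filtration.\<close>

lemma sets_visits:
  fixes Z :: "real \<Rightarrow> 'w \<Rightarrow> 'a::metric_space"
  assumes Z: "\<And>s. lo \<le> s \<Longrightarrow> s \<le> hi \<Longrightarrow> Z s \<in> borel_measurable N"
    and rc: "\<And>\<omega>. \<omega> \<in> space N \<Longrightarrow> rcll lo (\<lambda>s. Z s \<omega>)"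
    and O: "open O'" and ab: "lo \<le> a" "b \<le> hi"
  shows "{\<omega>\<in>space N. \<exists>s. a < s \<and> s < b \<and> Z s \<omega> \<in> O'} \<in> sets N"
proof -
  have "{\<omega>\<in>space N. \<exists>s. a < s \<and> s < b \<and> Z s \<omega> \<in> O'} = (\<Union>s\<in>\<rat> \<inter> {a<..<b}. Z s -` O' \<inter> space N)"
  proof (intro equalityI subsetI)
    fix \<omega> assume "\<omega> \<in> {\<omega>\<in>space N. \<exists>s. a < s \<and> s < b \<and> Z s \<omega> \<in> O'}"
    then obtain s where s: "\<omega> \<in> space N" "a < s" "s < b" "Z s \<omega> \<in> O'" by auto
    have "\<forall>\<^sub>F x in at_right s. Z x \<omega> \<in> O'"
      using rcll_right[OF rc[OF s(1)], of s] ab s O topological_tendstoD[of "\<lambda>s. Z s \<omega>" "Z s \<omega>" "at_right s" O'] by auto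
    then obtain c where c: "s < c" "\<And>x. s < x \<Longrightarrow> x < c \<Longrightarrow> Z x \<omega> \<in> O'"
      by (auto simp: eventually_at_right[of s "s + 1"])
    obtain x where "x \<in> \<rat>" "s < x" "x < min b c" using Rats_dense_in_real[of s "min b c"] c s by auto
    then show "\<omega> \<in> (\<Union>s\<in>\<rat> \<inter> {a<..<b}. Z s -` O' \<inter> space N)" using c s by (intro UN_I[of x]) auto
  qed auto
  also have "\<dots> \<in> sets N"
  proof (rule sets.countable_UN'')
    show "countable (\<rat> \<inter> {a<..<b})" using countable_rat by auto
    show "Z s -` O' \<inter> space N \<in> sets N" if "s \<in> \<rat> \<inter> {a<..<b}" for s
      using that Z[of s] O ab by (auto intro!: measurable_sets)
  qed
  finally show ?thesis .
qed

lemma sets_approaches: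
  fixes Z :: "real \<Rightarrow> 'w \<Rightarrow> 'a::metric_space"
  assumes Z: "\<And>s. lo \<le> s \<Longrightarrow> s \<le> hi \<Longrightarrow> Z s \<in> borel_measurable N"
    and rc: "\<And>\<omega>. \<omega> \<in> space N \<Longrightarrow> rcll lo (\<lambda>s. Z s \<omega>)"
    and ab: "lo \<le> a" "a \<le> b" "b \<le> hi"
  shows "{\<omega>\<in>space N. approaches A (\<lambda>s. Z s \<omega>) a b} \<in> sets N"
proof -
  have eq: "{\<omega>\<in>space N. approaches A (\<lambda>s. Z s \<omega>) a b} =
     (\<Inter>n::nat. {\<omega>\<in>space N. \<exists>s. a < s \<and> s < b \<and> Z s \<omega> \<in> nbhd (1 / Suc n) A}
        \<union> (Z a -` nbhd (1 / Suc n) A \<inter> space N) \<union> (Z b -` nbhd (1 / Suc n) A \<inter> space N))"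
  proof -
    have "(\<exists>s\<in>{a..b}. Q s) \<longleftrightarrow> (\<exists>s. a < s \<and> s < b \<and> Q s) \<or> Q a \<or> Q b" for Q :: "real \<Rightarrow> bool"
      using ab by (metis atLeastAtMost_iff less_eq_real_def)
    then show ?thesis unfolding approaches_def by auto
  qed
  have *: "{\<omega>\<in>space N. \<exists>s. a < s \<and> s < b \<and> Z s \<omega> \<in> nbhd (1 / Suc n) A}
        \<union> (Z a -` nbhd (1 / Suc n) A \<inter> space N) \<union> (Z b -` nbhd (1 / Suc n) A \<inter> space N) \<in> sets N" for n
    by (intro sets.Un sets_visits[OF Z rc] measurable_sets[OF Z]) (use ab in auto)
  show ?thesis unfolding eq using * by (intro sets.countable_INT) auto
qed

lemma sets_came_from:
  fixes Z :: "real \<Rightarrow> 'w \<Rightarrow> 'a::metric_space"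
  assumes Z: "\<And>s. lo \<le> s \<Longrightarrow> s \<le> hi \<Longrightarrow> Z s \<in> borel_measurable N"
    and rc: "\<And>\<omega>. \<omega> \<in> space N \<Longrightarrow> rcll lo (\<lambda>s. Z s \<omega>)"
    and ab: "lo \<le> t - h" "t \<le> hi"
  shows "{\<omega>\<in>space N. came_from A B (\<lambda>s. Z s \<omega>) t h} \<in> sets N"
proof -
  have "{\<omega>\<in>space N. came_from A B (\<lambda>s. Z s \<omega>) t h} = (\<Union>\<alpha>\<in>\<rat> \<inter> {0<..<h}.
     {\<omega>\<in>space N. approaches A (\<lambda>s. Z s \<omega>) (t - \<alpha>) t} - {\<omega>\<in>space N. approaches B (\<lambda>s. Z s \<omega>) (t - \<alpha>) t})"
    by (auto simp: came_from_def)
  also have "\<dots> \<in> sets N"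
  proof (rule sets.countable_UN'')
    show "countable (\<rat> \<inter> {0<..<h})" using countable_rat by auto
  next
    have "{\<omega>\<in>space N. approaches C (\<lambda>s. Z s \<omega>) (t - \<alpha>) t} \<in> sets N" if "\<alpha> \<in> \<rat> \<inter> {0<..<h}" for \<alpha> C
      using that ab by (intro sets_approaches[OF Z rc]) auto
    then show "{\<omega>\<in>space N. approaches A (\<lambda>s. Z s \<omega>) (t - \<alpha>) t} - {\<omega>\<in>space N. approaches B (\<lambda>s. Z s \<omega>) (t - \<alpha>) t} \<in> sets N"
      if "\<alpha> \<in> \<rat> \<inter> {0<..<h}" for \<alpha> using that by blast
  qed
  finally show ?thesis .
qed

lemma sets_heads_to:
  fixes Z :: "real \<Rightarrow> 'w \<Rightarrow> 'a::metric_space"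
  assumes Z: "\<And>s. lo \<le> s \<Longrightarrow> s \<le> hi \<Longrightarrow> Z s \<in> borel_measurable N"
    and rc: "\<And>\<omega>. \<omega> \<in> space N \<Longrightarrow> rcll lo (\<lambda>s. Z s \<omega>)"
    and ab: "lo \<le> t" "t + h \<le> hi"
  shows "{\<omega>\<in>space N. heads_to B A (\<lambda>s. Z s \<omega>) t h} \<in> sets N"
proof -
  have "{\<omega>\<in>space N. heads_to B A (\<lambda>s. Z s \<omega>) t h} = (\<Union>\<alpha>\<in>\<rat> \<inter> {0<..<h}.
     {\<omega>\<in>space N. approaches B (\<lambda>s. Z s \<omega>) t (t + \<alpha>)} - {\<omega>\<in>space N. approaches A (\<lambda>s. Z s \<omega>) t (t + \<alpha>)})"
    by (auto simp: heads_to_def)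
  also have "\<dots> \<in> sets N"
  proof (rule sets.countable_UN'')
    show "countable (\<rat> \<inter> {0<..<h})" using countable_rat by auto
  next
    have "{\<omega>\<in>space N. approaches C (\<lambda>s. Z s \<omega>) t (t + \<alpha>)} \<in> sets N" if "\<alpha> \<in> \<rat> \<inter> {0<..<h}" for \<alpha> C
      using that ab by (intro sets_approaches[OF Z rc]) auto
    then show "{\<omega>\<in>space N. approaches B (\<lambda>s. Z s \<omega>) t (t + \<alpha>)} - {\<omega>\<in>space N. approaches A (\<lambda>s. Z s \<omega>) t (t + \<alpha>)} \<in> sets N"
      if "\<alpha> \<in> \<rat> \<inter> {0<..<h}" for \<alpha> using that by blast
  qed
  finally show ?thesis .
qed

text \<open>A jump seen at finite resolution: \<open>k\<close> bounds the size of the jump from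
  below and stays fixed, while \<open>n\<close> is the precision in time and in the distance to
  \<open>K\<close> and will tend to infinity.\<close>

definition near_bad_jump :: "'a::metric_space set \<Rightarrow> (real \<Rightarrow> 'a) \<Rightarrow> nat \<Rightarrow> nat \<Rightarrow> real \<Rightarrow> real \<Rightarrow> bool" where
  "near_bad_jump K w k n p q \<longleftrightarrow> q - p < 1 / Suc n \<and> dist (w p) (w q) > 1 / Suc k \<and>
     (w p \<in> nbhd (1 / Suc n) K \<or> w q \<in> nbhd (1 / Suc n) K)"

text \<open>Bad jumps are detected along rational times, which makes them a measurable event.\<close>

lemma bad_jump_iff:
  fixes w :: "real \<Rightarrow> 'a::metric_space"
  assumes w: "rcll a w" and K: "closed K"
  shows "\<not> no_bad_jump K w a b \<longleftrightarrow> (\<exists>k::nat. \<forall>n::nat. \<exists>p\<in>\<rat> \<inter> {a + 1 / Suc k<..<b - 1 / Suc k}.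
    \<exists>q\<in>\<rat> \<inter> {p<..<b - 1 / Suc k}. near_bad_jump K w k n p q)" (is "_ \<longleftrightarrow> ?R")
proof
  assume "\<not> no_bad_jump K w a b"
  then obtain v l where v: "a < v" "v < b" "(w \<longlongrightarrow> l) (at_left v)" "l \<noteq> w v" and lK: "l \<in> K \<or> w v \<in> K"
    by (auto simp: no_bad_jump_def)
  \<comment> \<open>One third of the jump size, because errors of at most \<open>1 / Suc k\<close>
    at \<open>p\<close> and at \<open>q\<close> are subtracted from the distance. The other two
    terms keep both times at least \<open>1 / Suc k\<close> inside the interval.\<close>
  define \<delta> where "\<delta> = min (v - a) (min (b - v) (dist l (w v) / 3))"
  have "\<delta> > 0" using v by (auto simp: \<delta>_def)
  then obtain k :: nat where k: "1 / Suc k < \<delta>" using nat_approx_posE by blast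
  have dl: "dist l (w v) > 3 * (1 / Suc k)" using k unfolding \<delta>_def by auto
  show ?R
  proof (intro exI[of _ k] allI)
    fix n :: nat
    define e where "e = min (1 / Suc n) (1 / Suc k)"
    have e: "e > 0" "e \<le> 1 / Suc n" "e \<le> 1 / Suc k" by (auto simp: e_def)
    have "\<forall>\<^sub>F x in at_left v. dist (w x) l < e" using v(3) e(1) by (rule tendstoD)
    then obtain c where c: "c < v" "\<And>x. c < x \<Longrightarrow> x < v \<Longrightarrow> dist (w x) l < e"
      by (auto simp: eventually_at_left[of "v - 1" v])
    have "\<forall>\<^sub>F x in at_right v. dist (w x) (w v) < e" using rcll_right[OF w] v e(1) by (intro tendstoD) auto
    then obtain d where d: "v < d" "\<And>x. v < x \<Longrightarrow> x < d \<Longrightarrow> dist (w x) (w v) < e"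
      by (auto simp: eventually_at_right[of v "v + 1"])
    have lt: "a + 1 / Suc k < v" "v < b - 1 / Suc k" using k by (auto simp: \<delta>_def)
    have e2: "v - e / 2 < v" "v < v + e / 2" using e by auto
    have "max c (max (a + 1 / Suc k) (v - e / 2)) < v" using c(1) lt e2 by simp
    then obtain p where p: "p \<in> \<rat>" "max c (max (a + 1 / Suc k) (v - e / 2)) < p" "p < v"
      using Rats_dense_in_real by blast
    have "v < min d (min (b - 1 / Suc k) (v + e / 2))" using d(1) lt e2 by simp
    then obtain q where q: "q \<in> \<rat>" "v < q" "q < min d (min (b - 1 / Suc k) (v + e / 2))"
      using Rats_dense_in_real by blast
    have dp: "dist (w p) l < e" using c(2)[of p] p by auto
    have dq: "dist (w q) (w v) < e" using d(2)[of q] q by auto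
    have "dist l (w v) \<le> dist (w p) l + dist (w p) (w q) + dist (w q) (w v)"
      by (metis (no_types, opaque_lifting) add.commute add_mono_thms_linordered_semiring(2) dist_commute dist_triangle dual_order.trans)
    then have "dist (w p) (w q) > 1 / Suc k" using dl dp dq e by argo
    moreover have "w p \<in> nbhd (1 / Suc n) K \<or> w q \<in> nbhd (1 / Suc n) K"
    proof -
      have "dist (w p) l < 1 / Suc n" "dist (w q) (w v) < 1 / Suc n" using dp dq e by argo+
      then show ?thesis using lK dist_commute unfolding nbhd_def by (metis (mono_tags, lifting) mem_Collect_eq)
    qed
    moreover have "q - p < 1 / Suc n" using p q e by argo
    ultimately have "near_bad_jump K w k n p q" unfolding near_bad_jump_def by blast
    then show "\<exists>p\<in>\<rat> \<inter> {a + 1 / Suc k<..<b - 1 / Suc k}. \<exists>q\<in>\<rat> \<inter> {p<..<b - 1 / Suc k}. near_bad_jump K w k n p q"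
      using p q lt by (intro bexI[of _ p] bexI[of _ q]) auto
  qed
next
  assume ?R
  then obtain k :: nat and p q :: "nat \<Rightarrow> real"
    where pq: "\<And>n. a + 1 / Suc k < p n" "\<And>n. p n < q n" "\<And>n. q n < b - 1 / Suc k"
      and nb: "\<And>n. near_bad_jump K w k n (p n) (q n)"
    by (simp only: Bex_def Int_iff greaterThanLessThan_iff) metis
  have pI: "p n \<in> {a + 1 / Suc k..b - 1 / Suc k}" "q n \<in> {a + 1 / Suc k..b - 1 / Suc k}" for n
    using pq[of n] by auto
  have w': "rcll (a + 1 / Suc k) w" using w by (rule rcll_mono) simp
  \<comment> \<open>Three extractions in a row: the times \<open>p\<close> converge, then
    \<open>q\<close> from one side, then \<open>p\<close> from one side. The two limits coincide
    because the gaps tend to 0, and the margin \<open>1 / Suc k\<close> keeps the common limit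
    strictly inside the interval.\<close>
  obtain r1 v where r1: "strict_mono r1" "v \<in> {a + 1 / Suc k..b - 1 / Suc k}" "(p \<circ> r1) \<longlonglongrightarrow> v"
    using rcll_seq[OF w', of p] pI(1) by blast
  have inv0: "(\<lambda>n. 1 / real (Suc n)) \<longlonglongrightarrow> 0" by (rule lim_1_over_n[THEN LIMSEQ_Suc])
  obtain r2 v2 where r2: "strict_mono r2" "v2 \<in> {a + 1 / Suc k..b - 1 / Suc k}" "((q \<circ> r1) \<circ> r2) \<longlonglongrightarrow> v2"
    and c2: "(\<forall>n. v2 \<le> (q \<circ> r1) (r2 n)) \<and> (\<lambda>n. w ((q \<circ> r1) (r2 n))) \<longlonglongrightarrow> w v2 \<or>
     a + 1 / Suc k < v2 \<and> (\<forall>n. (q \<circ> r1) (r2 n) < v2) \<and> (\<exists>l. (w \<longlongrightarrow> l) (at_left v2) \<and> (\<lambda>n. w ((q \<circ> r1) (r2 n))) \<longlonglongrightarrow> l)"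
    using rcll_seq[OF w', of "q \<circ> r1"] pI(2) unfolding comp_apply by blast
  obtain r3 v3 where r3: "strict_mono r3" "((p \<circ> r1 \<circ> r2) \<circ> r3) \<longlonglongrightarrow> v3"
    and c3: "(\<forall>n. v3 \<le> (p \<circ> r1 \<circ> r2) (r3 n)) \<and> (\<lambda>n. w ((p \<circ> r1 \<circ> r2) (r3 n))) \<longlonglongrightarrow> w v3 \<or>
     a + 1 / Suc k < v3 \<and> (\<forall>n. (p \<circ> r1 \<circ> r2) (r3 n) < v3) \<and> (\<exists>l. (w \<longlongrightarrow> l) (at_left v3) \<and> (\<lambda>n. w ((p \<circ> r1 \<circ> r2) (r3 n))) \<longlonglongrightarrow> l)"
    using rcll_seq[OF w', of "p \<circ> r1 \<circ> r2"] pI(1) unfolding comp_apply by blast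
  define r where "r = r1 \<circ> r2 \<circ> r3"
  have r: "strict_mono r" unfolding r_def using r1(1) r2(1) r3(1) by (simp add: strict_mono_o)
  have inv: "(\<lambda>n. 1 / real (Suc (r n))) \<longlonglongrightarrow> 0" using inv0 r by (rule LIMSEQ_subseq_LIMSEQ[unfolded o_def])
  have pv: "(\<lambda>n. p (r n)) \<longlonglongrightarrow> v"
    using LIMSEQ_subseq_LIMSEQ[OF LIMSEQ_subseq_LIMSEQ[OF r1(3) r2(1)] r3(1)] by (simp add: r_def o_def)
  have v3: "v3 = v" using pv r3(2) LIMSEQ_unique by (fastforce simp: r_def o_def)
  have qv2: "(\<lambda>n. q (r n)) \<longlonglongrightarrow> v2"
    using LIMSEQ_subseq_LIMSEQ[OF r2(3) r3(1)] by (simp add: r_def o_def)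
  have "(\<lambda>n. q (r n) - p (r n)) \<longlonglongrightarrow> 0"
  proof (rule Lim_null_comparison[OF always_eventually inv], rule allI)
    fix n show "norm (q (r n) - p (r n)) \<le> 1 / real (Suc (r n))"
      using nb[of "r n"] pq(2)[of "r n"] by (auto simp: near_bad_jump_def)
  qed
  then have "v2 - v = 0" using tendsto_diff[OF qv2 pv] LIMSEQ_unique by blast
  then have v2: "v2 = v" by simp
  have far: "\<not> (\<exists>l. (\<lambda>n. w (p (r n))) \<longlonglongrightarrow> l \<and> (\<lambda>n. w (q (r n))) \<longlonglongrightarrow> l)"
  proof
    assume "\<exists>l. (\<lambda>n. w (p (r n))) \<longlonglongrightarrow> l \<and> (\<lambda>n. w (q (r n))) \<longlonglongrightarrow> l"
    then obtain l where "(\<lambda>n. w (p (r n))) \<longlonglongrightarrow> l" "(\<lambda>n. w (q (r n))) \<longlonglongrightarrow> l" by blast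
    then have "(\<lambda>n. dist (w (p (r n))) (w (q (r n)))) \<longlonglongrightarrow> dist l l" by (rule tendsto_dist)
    then have "\<forall>\<^sub>F n in sequentially. dist (w (p (r n))) (w (q (r n))) < 1 / Suc k"
      by (intro order_tendstoD(2)) auto
    then show False using nb unfolding near_bad_jump_def by (auto simp: eventually_sequentially not_less dest: less_imp_le) (meson less_asym order_refl)
  qed
  have avb: "a < v" "v < b" 
  proof -
    have "0 < 1 / real (Suc k)" "a + 1 / real (Suc k) \<le> v" "v \<le> b - 1 / real (Suc k)" using r1(2) by auto
    then show "a < v" "v < b" by linarith+
  qed
  have qlim: "(\<lambda>n. w (q (r n))) \<longlonglongrightarrow> l" if "(\<lambda>n. w ((q \<circ> r1) (r2 n))) \<longlonglongrightarrow> l" for l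
    using LIMSEQ_subseq_LIMSEQ[OF that r3(1)] by (simp add: r_def o_def)
  obtain l0 where l0: "(w \<longlongrightarrow> l0) (at_left v)" using rcll_left[OF w avb(1)] by blast
  have p: "(\<forall>n. v \<le> p (r n)) \<and> (\<lambda>n. w (p (r n))) \<longlonglongrightarrow> w v \<or> (\<forall>n. p (r n) < v) \<and> (\<lambda>n. w (p (r n))) \<longlonglongrightarrow> l0"
    using c3 l0 tendsto_unique[OF trivial_limit_at_left_real, of w _ v] unfolding v3 r_def comp_apply by blast
  have q: "(\<forall>n. v \<le> q (r n)) \<and> (\<lambda>n. w (q (r n))) \<longlonglongrightarrow> w v \<or> (\<forall>n. q (r n) < v) \<and> (\<lambda>n. w (q (r n))) \<longlonglongrightarrow> l0"
    using c2 qlim l0 tendsto_unique[OF trivial_limit_at_left_real, of w _ v] unfolding v2 r_def comp_apply by blast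
  \<comment> \<open>The two sequences cannot come from the same side, as their values would then
    have the same limit. The inequality leaves only \<open>p\<close> from the left and
    \<open>q\<close> from the right.\<close>
  have "p (r 0) < q (r 0)" using pq(2) by blast
  then have pl: "(\<lambda>n. w (p (r n))) \<longlonglongrightarrow> l0" and ql: "(\<lambda>n. w (q (r n))) \<longlonglongrightarrow> w v"
    using p q far by (metis not_less order.trans less_imp_le)+
  have ne: "l0 \<noteq> w v" using far pl ql by auto
  have "l0 \<in> K \<or> w v \<in> K"
  proof (rule ccontr)
    assume "\<not> (l0 \<in> K \<or> w v \<in> K)"
    then obtain e1 e2 where e: "e1 > 0" "\<And>x. dist x l0 < e1 \<Longrightarrow> x \<notin> K" "e2 > 0" "\<And>x. dist x (w v) < e2 \<Longrightarrow> x \<notin> K"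
      using K unfolding closed_def open_dist by (metis ComplD ComplI)
    define e where "e = min e1 e2 / 2"
    have e0: "e > 0" using e by (simp add: e_def)
    have "\<forall>\<^sub>F n in sequentially. dist (w (p (r n))) l0 < e \<and> dist (w (q (r n))) (w v) < e \<and> 1 / Suc (r n) < e"
      using tendstoD[OF pl e0] tendstoD[OF ql e0] order_tendstoD(2)[OF inv e0] by eventually_elim auto
    then obtain n where n: "dist (w (p (r n))) l0 < e" "dist (w (q (r n))) (w v) < e" "1 / Suc (r n) < e"
      by (auto simp: eventually_sequentially)
    from nb[of "r n"] consider "w (p (r n)) \<in> nbhd (1 / Suc (r n)) K" | "w (q (r n)) \<in> nbhd (1 / Suc (r n)) K"
      by (auto simp: near_bad_jump_def)
    then show False
    proof cases
      case 1
      then obtain y where "y \<in> K" "dist (w (p (r n))) y < e" using n(3) unfolding nbhd_def by fastforce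
      moreover have "dist y l0 \<le> dist (w (p (r n))) y + dist (w (p (r n))) l0" by (rule dist_triangle3)
      ultimately show False using e(2)[of y] n(1) by (auto simp: e_def)
    next
      case 2
      then obtain y where "y \<in> K" "dist (w (q (r n))) y < e" using n(3) unfolding nbhd_def by fastforce
      moreover have "dist y (w v) \<le> dist (w (q (r n))) y + dist (w (q (r n))) (w v)" by (rule dist_triangle3)
      ultimately show False using e(4)[of y] n(2) by (auto simp: e_def)
    qed
  qed
  then show "\<not> no_bad_jump K w a b" using ne avb l0 unfolding no_bad_jump_def by blast
qed

lemma sets_no_bad_jump:
  fixes Z :: "real \<Rightarrow> 'w \<Rightarrow> 'a::{metric_space, second_countable_topology}"
  assumes Z: "\<And>s. lo \<le> s \<Longrightarrow> s \<le> hi \<Longrightarrow> Z s \<in> borel_measurable N"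
    and rc: "\<And>\<omega>. \<omega> \<in> space N \<Longrightarrow> rcll lo (\<lambda>s. Z s \<omega>)"
    and K: "closed K" and ab: "lo \<le> a" "b \<le> hi"
  shows "{\<omega>\<in>space N. no_bad_jump K (\<lambda>s. Z s \<omega>) a b} \<in> sets N"
proof -
  have *: "{\<omega>\<in>space N. near_bad_jump K (\<lambda>s. Z s \<omega>) k n p q} \<in> sets N"
    if p: "p \<in> \<rat> \<inter> {a + 1 / Suc k<..<b - 1 / Suc k}" and q: "q \<in> \<rat> \<inter> {p<..<b - 1 / Suc k}" for k n p q
  proof -
    have k: "0 < 1 / real (Suc k)" by simp
    have "lo \<le> p" "p \<le> hi" "lo \<le> q" "q \<le> hi" 
      using p q ab k unfolding Int_iff greaterThanLessThan_iff by linarith+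
    then have [measurable]: "Z p \<in> borel_measurable N" "Z q \<in> borel_measurable N" using Z by auto
    have [measurable]: "nbhd (1 / Suc n) K \<in> sets borel" by (simp add: borel_open)
    show ?thesis unfolding near_bad_jump_def by measurable
  qed
  have "{\<omega>\<in>space N. \<not> no_bad_jump K (\<lambda>s. Z s \<omega>) a b} =
    (\<Union>k::nat. \<Inter>n::nat. \<Union>p\<in>\<rat> \<inter> {a + 1 / Suc k<..<b - 1 / Suc k}. \<Union>q\<in>\<rat> \<inter> {p<..<b - 1 / Suc k}.
       {\<omega>\<in>space N. near_bad_jump K (\<lambda>s. Z s \<omega>) k n p q})"
    (is "?L = ?R")
  proof -
    have "\<not> no_bad_jump K (\<lambda>s. Z s \<omega>) a b \<longleftrightarrow> (\<exists>k::nat. \<forall>n::nat. \<exists>p\<in>\<rat> \<inter> {a + 1 / Suc k<..<b - 1 / Suc k}.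
      \<exists>q\<in>\<rat> \<inter> {p<..<b - 1 / Suc k}. near_bad_jump K (\<lambda>s. Z s \<omega>) k n p q)" if "\<omega> \<in> space N" for \<omega>
      by (rule bad_jump_iff[OF rcll_mono[OF rc[OF that] ab(1)] K])
    then show ?thesis by (simp only: set_eq_iff mem_Collect_eq UN_iff INT_iff) blast
  qed
  also have "\<dots> \<in> sets N"
  proof (intro sets.countable_UN image_subsetI sets.countable_INT)
    fix k n :: nat
    show "(\<Union>p\<in>\<rat> \<inter> {a + 1 / Suc k<..<b - 1 / Suc k}. \<Union>q\<in>\<rat> \<inter> {p<..<b - 1 / Suc k}.
       {\<omega>\<in>space N. near_bad_jump K (\<lambda>s. Z s \<omega>) k n p q}) \<in> sets N"
      using * by (intro sets.countable_UN'' countable_Int1 countable_rat) blast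
  qed simp
  finally have "space N - {\<omega>\<in>space N. \<not> no_bad_jump K (\<lambda>s. Z s \<omega>) a b} \<in> sets N" by blast
  also have "space N - {\<omega>\<in>space N. \<not> no_bad_jump K (\<lambda>s. Z s \<omega>) a b} = {\<omega>\<in>space N. no_bad_jump K (\<lambda>s. Z s \<omega>) a b}"
    by auto
  finally show ?thesis .
qed

text \<open>The left limit exists, so it can be identified along a single sequence of times, chosen
  strictly between \<open>a\<close> and \<open>t\<close>. This makes left continuity at a fixed time
  a countable condition.\<close>

lemma left_continuous_iff_seq:
  fixes w :: "real \<Rightarrow> 'a::t2_space"
  assumes "rcll a w" "a < t"
  shows "(w \<longlongrightarrow> w t) (at_left t) \<longleftrightarrow> (\<lambda>n::nat. w (t - (t - a) / (n + 2))) \<longlonglongrightarrow> w t"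
proof -
  obtain l where l: "(w \<longlongrightarrow> l) (at_left t)" using rcll_left[OF assms] by blast
  have "(\<lambda>n::nat. t - (t - a) / real (n + 2)) \<longlonglongrightarrow> t - 0"
    by (intro tendsto_diff tendsto_const LIMSEQ_ignore_initial_segment[OF lim_const_over_n])
  then have "(\<lambda>n::nat. t - (t - a) / (n + 2)) \<longlonglongrightarrow> t" by (simp add: add.commute)
  then have "filterlim (\<lambda>n::nat. t - (t - a) / (n + 2)) (at_left t) sequentially"
    using assms by (intro filterlim_at_withinI) auto
  then have "(\<lambda>n::nat. w (t - (t - a) / (n + 2))) \<longlonglongrightarrow> l" using l filterlim_compose by fastforce
  then have "(\<lambda>n::nat. w (t - (t - a) / (n + 2))) \<longlonglongrightarrow> w t \<longleftrightarrow> l = w t" by (metis LIMSEQ_unique)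
  moreover have "(w \<longlongrightarrow> w t) (at_left t) \<longleftrightarrow> l = w t"
    using l tendsto_unique[OF trivial_limit_at_left_real l] by metis
  ultimately show ?thesis by simp
qed

lemma LIMSEQ_inverse_iff:
  "(f \<longlonglongrightarrow> l) \<longleftrightarrow> (\<forall>k::nat. \<exists>m. \<forall>n\<ge>m. dist (f n) l < 1 / Suc k)" for l :: "'a::metric_space"
proof
  assume "f \<longlonglongrightarrow> l"
  then show "\<forall>k::nat. \<exists>m. \<forall>n\<ge>m. dist (f n) l < 1 / Suc k"
    unfolding lim_sequentially by (auto simp del: of_nat_Suc)
next
  assume *: "\<forall>k::nat. \<exists>m. \<forall>n\<ge>m. dist (f n) l < 1 / Suc k"
  show "f \<longlonglongrightarrow> l" unfolding lim_sequentially
  proof (intro allI impI)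
    fix e :: real assume "e > 0"
    then obtain k where "1 / Suc k < e" using nat_approx_posE by blast
    with * show "\<exists>m. \<forall>n\<ge>m. dist (f n) l < e" by (meson less_trans)
  qed
qed

lemma sets_left_continuous:
  fixes Z :: "real \<Rightarrow> 'w \<Rightarrow> 'a::{metric_space, second_countable_topology}"
  assumes Z: "\<And>s. lo \<le> s \<Longrightarrow> s \<le> hi \<Longrightarrow> Z s \<in> borel_measurable N"
    and rc: "\<And>\<omega>. \<omega> \<in> space N \<Longrightarrow> rcll lo (\<lambda>s. Z s \<omega>)"
    and t: "lo < t" "t \<le> hi"
  shows "{\<omega>\<in>space N. ((\<lambda>s. Z s \<omega>) \<longlongrightarrow> Z t \<omega>) (at_left t)} \<in> sets N"
proof -
  have [measurable]: "Z (t - (t - lo) / (real n + 2)) \<in> borel_measurable N" "Z t \<in> borel_measurable N" for n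
  proof -
    have "0 \<le> (t - lo) / (real n + 2)" "(t - lo) / (real n + 2) \<le> (t - lo) / 1"
      using t by (auto intro!: divide_left_mono simp del: div_by_1)
    then have "lo \<le> t - (t - lo) / (real n + 2)" "t - (t - lo) / (real n + 2) \<le> hi" using t by (simp_all, linarith)
    then show "Z (t - (t - lo) / (real n + 2)) \<in> borel_measurable N" by (rule Z)
    show "Z t \<in> borel_measurable N" using t by (intro Z) auto
  qed
  have "{\<omega>\<in>space N. ((\<lambda>s. Z s \<omega>) \<longlongrightarrow> Z t \<omega>) (at_left t)} =
    {\<omega>\<in>space N. \<forall>k::nat. \<exists>m. \<forall>n\<ge>m. dist (Z (t - (t - lo) / (real n + 2)) \<omega>) (Z t \<omega>) < 1 / Suc k}"
    using left_continuous_iff_seq[OF rc t(1)] by (simp only: LIMSEQ_inverse_iff) blast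
  also have "\<dots> \<in> sets N" by measurable
  finally show ?thesis .
qed

text \<open>Time is approximated strictly from the right by grid points \<open>g n t\<close>, so
  that each approximation uses only countably many of the \<open>Z t\<close>.\<close>

lemma measurable_pair_right_continuous:
  fixes Z :: "real \<Rightarrow> 'w \<Rightarrow> 'a::metric_space"
  assumes Z: "\<And>t. Z t \<in> borel_measurable N"
    and rc: "\<And>t \<omega>. \<omega> \<in> space N \<Longrightarrow> ((\<lambda>s. Z s \<omega>) \<longlongrightarrow> Z t \<omega>) (at_right t)"
  shows "(\<lambda>(t, \<omega>). Z t \<omega>) \<in> borel_measurable (borel \<Otimes>\<^sub>M N)"
proof -
  define g where "g n t = (real_of_int \<lfloor>real (Suc n) * t\<rfloor> + 1) / real (Suc n)" for n t
  have g: "t < g n t" "g n t \<le> t + 1 / Suc n" for n t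
    unfolding g_def by (simp_all add: field_simps del: of_nat_Suc) linarith+
  have m: "(\<lambda>x. Z (g n (fst x)) (snd x)) \<in> borel_measurable (borel \<Otimes>\<^sub>M N)" for n
  proof -
    have "(\<lambda>x. (\<lambda>i x. Z ((real_of_int i + 1) / real (Suc n)) (snd x)) \<lfloor>real (Suc n) * fst x\<rfloor> x) \<in> borel_measurable (borel \<Otimes>\<^sub>M N)"
      by (rule measurable_compose_countable) (auto intro: measurable_compose[OF measurable_snd Z])
    then show ?thesis by (simp add: g_def)
  qed
  have "(\<lambda>x. Z (fst x) (snd x)) \<in> borel_measurable (borel \<Otimes>\<^sub>M N)"
  proof (rule borel_measurable_LIMSEQ_metric[OF m])
    fix x :: "real \<times> 'w" assume "x \<in> space (borel \<Otimes>\<^sub>M N)"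
    then have x: "snd x \<in> space N" by (auto simp: space_pair_measure)
    let ?t = "fst x :: real"
    have "(\<lambda>n. g n ?t) \<longlonglongrightarrow> ?t"
    proof (rule tendsto_sandwich[of "\<lambda>_. ?t" _ _ "\<lambda>n. ?t + 1 / real (Suc n)"])
      show "(\<lambda>n. ?t + 1 / real (Suc n)) \<longlonglongrightarrow> ?t"
        using tendsto_add[OF tendsto_const lim_1_over_n[THEN LIMSEQ_Suc], of ?t] by simp
    qed (use g in \<open>auto intro!: always_eventually less_imp_le simp del: of_nat_Suc\<close>)
    then have "filterlim (\<lambda>n. g n ?t) (at_right ?t) sequentially"
      using g(1) by (intro filterlim_at_withinI) (auto simp: less_imp_neq[symmetric])
    then show "(\<lambda>n. Z (g n ?t) (snd x)) \<longlonglongrightarrow> Z ?t (snd x)"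
      using rc[OF x] filterlim_compose by fastforce
  qed
  then show ?thesis by (simp add: case_prod_beta')
qed

section \<open>A law of large numbers in continuous time\<close>

lemma integral_near_diagonal:
  fixes T L s :: real
  assumes "0 \<le> L"
  shows "(LINT t:{0..T}|lborel. indicator {s - L<..<s + L} t :: real) \<le> 2 * L"
proof -
  have "(LINT t:{0..T}|lborel. indicator {s - L<..<s + L} t :: real) = measure lborel ({0..T} \<inter> {s - L<..<s + L})"
    unfolding set_lebesgue_integral_def by (simp flip: indicator_inter_arith)
  also have "\<dots> \<le> measure lborel {s - L<..<s + L}"
    by (intro measure_mono_fmeasurable) (use assms in \<open>auto simp: fmeasurable_def\<close>)
  also have "\<dots> = 2 * L" using assms by simp
  finally show ?thesis .
qed

lemma set_integrable_bounded:
  fixes f :: "real \<Rightarrow> real"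
  assumes "f \<in> borel_measurable lborel" "\<And>x. \<bar>f x\<bar> \<le> B"
  shows "set_integrable lborel {a..b} f"
  unfolding set_integrable_def
proof (rule Bochner_Integration.integrable_bound)
  show "integrable lborel (\<lambda>x. indicator {a..b} x *\<^sub>R B)"
    by (auto intro!: integrable_scaleR_left simp: emeasure_lborel_Icc_eq)
  have "0 \<le> B" using assms(2)[of 0] by linarith
  then show "AE x in lborel. norm (indicator {a..b} x *\<^sub>R f x) \<le> norm (indicator {a..b} x *\<^sub>R B)"
    using assms(2) by (auto split: split_indicator)
qed (use assms(1) in measurable)

lemma set_integral_abs_le:
  fixes f :: "real \<Rightarrow> real"
  assumes "f \<in> borel_measurable lborel" "\<And>x. \<bar>f x\<bar> \<le> 1" "a \<le> b"
  shows "\<bar>LINT t:{a..b}|lborel. f t\<bar> \<le> b - a"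
proof -
  have "\<bar>LINT t:{a..b}|lborel. f t\<bar> \<le> (LINT t:{a..b}|lborel. \<bar>f t\<bar>)"
    using integral_abs_bound[of lborel "\<lambda>t. indicator {a..b} t *\<^sub>R f t"]
    unfolding set_lebesgue_integral_def by (simp add: abs_mult)
  also have "\<dots> \<le> (LINT t:{a..b}|lborel. 1)"
    using assms by (intro set_integral_mono set_integrable_bounded[of _ 1]) auto
  also have "\<dots> = b - a" using assms(3) by (simp add: set_lebesgue_integral_def)
  finally show ?thesis .
qed

lemma set_integral_split:
  fixes f :: "real \<Rightarrow> real"
  assumes "f \<in> borel_measurable lborel" "\<And>x. \<bar>f x\<bar> \<le> 1" "a \<le> b" "b \<le> c"
  shows "(LINT t:{a..c}|lborel. f t) = (LINT t:{a..b}|lborel. f t) + (LINT t:{b..c}|lborel. f t)"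
proof -
  have "(LINT t:{a..b} \<union> {b..c}|lborel. f t) = (LINT t:{a..b}|lborel. f t) + (LINT t:{b..c}|lborel. f t)"
  proof (rule set_integral_Un_AE)
    show "AE x in lborel. \<not> (x \<in> {a..b} \<and> x \<in> {b..c})"
      using AE_lborel_singleton[of b] by eventually_elim auto
  qed (use assms in \<open>auto intro: set_integrable_bounded[of _ 1]\<close>)
  moreover have "{a..b} \<union> {b..c} = {a..c}" using assms by auto
  ultimately show ?thesis by simp
qed

lemma (in prob_space) abs_expectation_le:
  fixes f :: "'a \<Rightarrow> real"
  assumes "f \<in> borel_measurable M" "\<And>x. x \<in> space M \<Longrightarrow> \<bar>f x\<bar> \<le> B"
  shows "\<bar>expectation f\<bar> \<le> B"
proof -
  have int: "integrable M f" using assms by (intro integrable_const_bound[of _ B] AE_I2) auto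
  have "\<bar>expectation f\<bar> \<le> (\<integral>x. \<bar>f x\<bar> \<partial>M)" by (rule integral_abs_bound)
  also have "\<dots> \<le> (\<integral>x. B \<partial>M)" using int assms by (intro integral_mono) auto
  finally show ?thesis by (simp add: prob_space)
qed

text \<open>The second moment is a double integral of \<open>D s * D t\<close> over a square of side
  \<open>T\<close>. Its mean vanishes outside the band of pairs at distance less than
  \<open>L\<close>, whose area is at most \<open>2 * L * T\<close>, and is at most 1 inside.\<close>

lemma second_moment_of_average:
  fixes D :: "real \<Rightarrow> 'w \<Rightarrow> real"
  assumes "prob_space M" and D: "(\<lambda>(t, \<omega>). D t \<omega>) \<in> borel_measurable (lborel \<Otimes>\<^sub>M M)"
    and bound: "\<And>t \<omega>. \<bar>D t \<omega>\<bar> \<le> 1"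
    and L: "0 \<le> L" and corr: "\<And>s t. 0 \<le> s \<Longrightarrow> s + L \<le> t \<Longrightarrow> (\<integral>\<omega>. D s \<omega> * D t \<omega> \<partial>M) = 0"
    and T: "0 \<le> T"
  shows "(\<integral>\<omega>. (LINT t:{0..T}|lborel. D t \<omega>)\<^sup>2 \<partial>M) \<le> 2 * L * T"
proof -
  interpret prob_space M by fact
  define I where "I = restrict_space lborel {0..T}"
  have I: "set_lebesgue_integral lborel {0..T} f = (\<integral>t. f t \<partial>I)" for f :: "real \<Rightarrow> real"
    unfolding I_def by (subst integral_restrict_space) (auto simp: set_lebesgue_integral_def)
  interpret I: finite_measure I
    unfolding I_def by (rule finite_measureI) (auto simp: emeasure_restrict_space space_restrict_space emeasure_lborel_Icc_eq)
  have sI: "space I = {0..T}" by (simp add: I_def space_restrict_space)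
  interpret IM: pair_sigma_finite I M ..
  interpret MI: pair_sigma_finite M I ..
  interpret IMf: finite_measure "I \<Otimes>\<^sub>M M" by (rule finite_measure_pair_measure) unfold_locales
  have DI [measurable]: "(\<lambda>x. D (fst x) (snd x)) \<in> borel_measurable (I \<Otimes>\<^sub>M M)"
  proof -
    have "(\<lambda>x. x) \<in> I \<rightarrow>\<^sub>M lborel" unfolding I_def by (rule measurable_restrict_space1) simp
    then have "(\<lambda>x. (fst x, snd x)) \<in> I \<Otimes>\<^sub>M M \<rightarrow>\<^sub>M lborel \<Otimes>\<^sub>M M" by measurable
    from measurable_compose[OF this D] show ?thesis by simp
  qed
  have D1 [measurable]: "D t \<in> borel_measurable M" for t
    using measurable_compose[OF measurable_Pair1' D, of t] by simp
  have D2 [measurable]: "(\<lambda>t. D t \<omega>) \<in> borel_measurable lborel" if "\<omega> \<in> space M" for \<omega>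
    using measurable_compose[OF measurable_Pair2' D, of \<omega>] that by simp
  have D2I [measurable]: "(\<lambda>t. D t \<omega>) \<in> borel_measurable I" if "\<omega> \<in> space M" for \<omega>
    using D2[OF that] unfolding I_def by (rule measurable_restrict_space1)
  define H where "H \<omega> = (\<integral>t. D t \<omega> \<partial>I)" for \<omega>
  have [measurable]: "H \<in> borel_measurable M"
    unfolding H_def by (rule I.borel_measurable_lebesgue_integral) (use measurable_compose[OF measurable_pair_swap' DI] in \<open>simp add: case_prod_beta'\<close>)
  have Hb: "\<bar>H \<omega>\<bar> \<le> T" if "\<omega> \<in> space M" for \<omega>
    using set_integral_abs_le[OF D2[OF that] bound T] by (simp add: H_def I)
  have Hsq: "(H \<omega>)\<^sup>2 = (\<integral>s. D s \<omega> * H \<omega> \<partial>I)" for \<omega>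
    by (simp add: power2_eq_square H_def)
  have "(\<integral>\<omega>. (H \<omega>)\<^sup>2 \<partial>M) = (\<integral>\<omega>. (\<integral>s. D s \<omega> * H \<omega> \<partial>I) \<partial>M)" by (simp only: Hsq)
  also have "\<dots> = (\<integral>s. (\<integral>\<omega>. D s \<omega> * H \<omega> \<partial>M) \<partial>I)"
  proof (rule IM.Fubini_integral)
    show "integrable (I \<Otimes>\<^sub>M M) (\<lambda>(s, \<omega>). D s \<omega> * H \<omega>)"
    proof (rule IMf.integrable_const_bound[of _ T])
      show "AE x in I \<Otimes>\<^sub>M M. norm (case x of (s, \<omega>) \<Rightarrow> D s \<omega> * H \<omega>) \<le> T"
      proof (rule AE_I2)
        fix x assume "x \<in> space (I \<Otimes>\<^sub>M M)"
        then have "snd x \<in> space M" by (auto simp: space_pair_measure)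
        then show "norm (case x of (s, \<omega>) \<Rightarrow> D s \<omega> * H \<omega>) \<le> T"
          using mult_mono[OF bound[of "fst x" "snd x"] Hb[of "snd x"]] T
          by (auto simp: abs_mult case_prod_beta')
      qed
    qed (simp add: case_prod_beta')
  qed
  also have "\<dots> \<le> (\<integral>s. 2 * L \<partial>I)"
  proof (rule integral_mono)
    show "integrable I (\<lambda>s. \<integral>\<omega>. D s \<omega> * H \<omega> \<partial>M)"
    proof (rule I.integrable_const_bound[of _ T])
      show "AE s in I. norm (\<integral>\<omega>. D s \<omega> * H \<omega> \<partial>M) \<le> T"
      proof (rule AE_I2)
        fix s
        have "\<bar>\<integral>\<omega>. D s \<omega> * H \<omega> \<partial>M\<bar> \<le> T"
        proof (rule abs_expectation_le)
          show "\<bar>D s \<omega> * H \<omega>\<bar> \<le> T" if "\<omega> \<in> space M" for \<omega>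
            using mult_mono[OF bound[of s \<omega>] Hb[OF that]] T by (auto simp: abs_mult)
        qed measurable
        then show "norm (\<integral>\<omega>. D s \<omega> * H \<omega> \<partial>M) \<le> T" by simp
      qed
      show "(\<lambda>s. \<integral>\<omega>. D s \<omega> * H \<omega> \<partial>M) \<in> borel_measurable I" by measurable
    qed
    show "(\<integral>\<omega>. D s \<omega> * H \<omega> \<partial>M) \<le> 2 * L" if s: "s \<in> space I" for s
    proof -
      have cb: "\<bar>\<integral>\<omega>. D s \<omega> * D t \<omega> \<partial>M\<bar> \<le> indicator {s - L<..<s + L} t" if t: "0 \<le> t" for t
      proof (cases "t \<in> {s - L<..<s + L}")
        case True
        have "\<bar>\<integral>\<omega>. D s \<omega> * D t \<omega> \<partial>M\<bar> \<le> 1"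
        proof (rule abs_expectation_le)
          show "\<bar>D s \<omega> * D t \<omega>\<bar> \<le> 1" for \<omega>
            using mult_mono[OF bound[of s \<omega>] bound[of t \<omega>]] by (auto simp: abs_mult)
        qed measurable
        then show ?thesis using True by simp
      next
        case False
        then consider "t + L \<le> s" | "s + L \<le> t" by force
        then have "(\<integral>\<omega>. D s \<omega> * D t \<omega> \<partial>M) = 0"
          using corr[of t s] corr[of s t] t s by cases (auto simp: sI mult.commute)
        then show ?thesis by simp
      qed
      have "(\<integral>\<omega>. D s \<omega> * H \<omega> \<partial>M) = (\<integral>\<omega>. (\<integral>t. D s \<omega> * D t \<omega> \<partial>I) \<partial>M)"
        by (simp add: H_def)
      also have "\<dots> = (\<integral>t. (\<integral>\<omega>. D s \<omega> * D t \<omega> \<partial>M) \<partial>I)"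
      proof (rule IM.Fubini_integral)
        show "integrable (I \<Otimes>\<^sub>M M) (\<lambda>(t, \<omega>). D s \<omega> * D t \<omega>)"
        proof (rule IMf.integrable_const_bound[of _ 1])
          show "AE x in I \<Otimes>\<^sub>M M. norm (case x of (t, \<omega>) \<Rightarrow> D s \<omega> * D t \<omega>) \<le> 1"
            using mult_mono[OF bound[of s] bound] by (auto simp: abs_mult case_prod_beta')
        qed (simp add: case_prod_beta')
      qed
      also have "\<dots> \<le> (\<integral>t. indicator {s - L<..<s + L} t \<partial>I)"
      proof (rule integral_mono)
        show "integrable I (\<lambda>t. \<integral>\<omega>. D s \<omega> * D t \<omega> \<partial>M)"
        proof (rule I.integrable_const_bound[of _ 1])
          show "AE t in I. norm (\<integral>\<omega>. D s \<omega> * D t \<omega> \<partial>M) \<le> 1"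
            using order_trans[OF cb indicator_le_1] by (intro AE_I2) (auto simp: sI)
        qed measurable
        show "integrable I (indicat_real {s - L<..<s + L})"
          unfolding I_def by (rule I.integrable_const_bound[of _ 1, unfolded I_def]) (auto intro!: measurable_restrict_space1)
        show "(\<integral>\<omega>. D s \<omega> * D t \<omega> \<partial>M) \<le> indicator {s - L<..<s + L} t" if "t \<in> space I" for t
          using cb[of t] that by (auto simp: sI)
      qed
      also have "\<dots> \<le> 2 * L" using integral_near_diagonal[OF L, of T s] by (simp add: I)
      finally show ?thesis .
    qed
  qed auto
  also have "\<dots> = 2 * L * T"
  proof -
    have "measure I (space I) = T"
      using T by (simp add: sI measure_def) (simp add: I_def emeasure_restrict_space)
    then show ?thesis by simp
  qed
  finally show ?thesis by (simp add: I H_def)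
qed

text \<open>Along the times \<open>(n + 1)^2\<close> the second moments of the averages are bounded
  by a multiple of \<open>1 / (n + 1)^2\<close>, so their sum is almost surely finite. Between
  neighbouring squares the integral of a function bounded by 1 changes by an amount of order
  \<open>sqrt T\<close>, which is negligible against \<open>T\<close>.\<close>

lemma weakly_correlated_average_tendsto_0:
  fixes D :: "real \<Rightarrow> 'w \<Rightarrow> real"
  assumes "prob_space M" and D: "(\<lambda>(t, \<omega>). D t \<omega>) \<in> borel_measurable (lborel \<Otimes>\<^sub>M M)"
    and bound: "\<And>t \<omega>. \<bar>D t \<omega>\<bar> \<le> 1"
    and L: "0 \<le> L" and corr: "\<And>s t. 0 \<le> s \<Longrightarrow> s + L \<le> t \<Longrightarrow> (\<integral>\<omega>. D s \<omega> * D t \<omega> \<partial>M) = 0"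
  shows "AE \<omega> in M. ((\<lambda>T. (LINT t:{0..T}|lborel. D t \<omega>) / T) \<longlongrightarrow> 0) at_top"
proof -
  interpret prob_space M by fact
  interpret lM: pair_sigma_finite lborel M ..
  have D2: "(\<lambda>t. D t \<omega>) \<in> borel_measurable lborel" if "\<omega> \<in> space M" for \<omega>
    using measurable_compose[OF measurable_Pair2' D, of \<omega>] that by simp
  define H where "H T \<omega> = (LINT t:{0..T}|lborel. D t \<omega>)" for T \<omega>
  have Hm [measurable]: "H T \<in> borel_measurable M" for T
  proof -
    have "(\<lambda>(\<omega>, t). indicator {0..T} t *\<^sub>R D t \<omega>) \<in> borel_measurable (M \<Otimes>\<^sub>M lborel)"
      using measurable_compose[OF measurable_pair_swap' D] by (simp add: case_prod_beta')
    from lborel.borel_measurable_lebesgue_integral[OF this] show ?thesis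
      unfolding H_def set_lebesgue_integral_def by simp
  qed
  have Hb: "\<bar>H T \<omega>\<bar> \<le> T" if "\<omega> \<in> space M" "0 \<le> T" for T \<omega>
    using set_integral_abs_le[OF D2[OF that(1)] bound that(2)] by (simp add: H_def)
  define Q where "Q n \<omega> = (H (real (Suc n)^2) \<omega> / (real (Suc n)^2))\<^sup>2" for n \<omega>
  have [measurable]: "Q n \<in> borel_measurable M" for n unfolding Q_def by measurable
  have EQ: "(\<integral>\<^sup>+\<omega>. ennreal (Q n \<omega>) \<partial>M) \<le> ennreal (2 * L * (1 / real (Suc n)^2))" for n
  proof -
    let ?T = "real (Suc n)^2"
    have T0: "?T > 0" by (simp del: of_nat_Suc)
    have "integrable M (\<lambda>\<omega>. (H ?T \<omega>)\<^sup>2)"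
    proof (rule integrable_const_bound[of _ "?T\<^sup>2"], rule AE_I2)
      fix \<omega> assume "\<omega> \<in> space M"
      from power_mono[OF Hb[OF this, of ?T], of 2] show "norm ((H ?T \<omega>)\<^sup>2) \<le> ?T\<^sup>2" by simp
    qed measurable
    then have int: "integrable M (Q n)" unfolding Q_def power_divide by (rule integrable_divide)
    have "(\<integral>\<omega>. Q n \<omega> \<partial>M) = (\<integral>\<omega>. (H ?T \<omega>)\<^sup>2 \<partial>M) / ?T\<^sup>2" unfolding Q_def power_divide by simp
    also have "\<dots> \<le> (2 * L * ?T) / ?T\<^sup>2"
      using second_moment_of_average[OF assms, of ?T] by (intro divide_right_mono) (auto simp: H_def)
    also have "\<dots> = 2 * L * (1 / ?T)" using T0 by (simp add: power2_eq_square)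
    finally have "(\<integral>\<omega>. Q n \<omega> \<partial>M) \<le> 2 * L * (1 / ?T)" .
    moreover have "(\<integral>\<^sup>+\<omega>. ennreal (Q n \<omega>) \<partial>M) = ennreal (\<integral>\<omega>. Q n \<omega> \<partial>M)"
      using int by (rule nn_integral_eq_integral) (simp add: Q_def)
    ultimately show ?thesis using ennreal_leI by presburger
  qed
  have "(\<integral>\<^sup>+\<omega>. (\<Sum>n. ennreal (Q n \<omega>)) \<partial>M) = (\<Sum>n. \<integral>\<^sup>+\<omega>. ennreal (Q n \<omega>) \<partial>M)"
    by (rule nn_integral_suminf) measurable
  also have "\<dots> \<le> (\<Sum>n. ennreal (2 * L * (1 / real (Suc n)^2)))" by (intro suminf_le EQ) auto
  also have "\<dots> = ennreal (\<Sum>n. 2 * L * (1 / real (Suc n)^2))"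
  proof (rule suminf_ennreal2)
    have "summable (\<lambda>n. 1 / real (Suc n)^2)"
      using inverse_power_summable[of 2, where 'a = real] summable_Suc_iff[of "\<lambda>n. 1 / real n ^ 2"]
      by (simp add: field_simps)
    then show "summable (\<lambda>n. 2 * L * (1 / real (Suc n)^2))" by (rule summable_mult)
  qed (use L in auto)
  also have "\<dots> < \<infinity>" by simp
  finally have "(\<integral>\<^sup>+\<omega>. (\<Sum>n. ennreal (Q n \<omega>)) \<partial>M) \<noteq> \<infinity>" by simp
  then have "AE \<omega> in M. (\<Sum>n. ennreal (Q n \<omega>)) \<noteq> \<infinity>" by (rule nn_integral_PInf_AE[rotated]) measurable
  moreover have "((\<lambda>T. H T \<omega> / T) \<longlongrightarrow> 0) at_top" if \<omega>: "\<omega> \<in> space M" and fin: "(\<Sum>n. ennreal (Q n \<omega>)) \<noteq> \<infinity>" for \<omega>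
  proof -
    have "summable (\<lambda>n. Q n \<omega>)"
      using fin by (intro summable_suminf_not_top) (auto simp: Q_def)
    then have "(\<lambda>n. Q n \<omega>) \<longlonglongrightarrow> 0" by (rule summable_LIMSEQ_zero)
    then have "(\<lambda>n. sqrt (Q n \<omega>)) \<longlonglongrightarrow> sqrt 0" by (rule tendsto_real_sqrt)
    then have q: "(\<lambda>n. \<bar>H (real (Suc n)^2) \<omega> / (real (Suc n)^2)\<bar>) \<longlonglongrightarrow> 0" by (simp add: Q_def)
    \<comment> \<open>Shifted by 1 because \<open>Q n\<close> belongs to \<open>Suc n\<close>: for
      \<open>T \<ge> 1\<close>, \<open>Suc (k T)\<close> is the integer part of
      \<open>sqrt T\<close>.\<close>
    define k where "k T = nat \<lfloor>sqrt T\<rfloor> - 1" for T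
    have "filterlim (\<lambda>T. sqrt T) at_top at_top" by (rule sqrt_at_top)
    then have "filterlim (\<lambda>T. nat \<lfloor>sqrt T\<rfloor>) sequentially at_top"
      using filterlim_compose[OF filterlim_nat_sequentially filterlim_compose[OF filterlim_floor_sequentially]] by blast
    then have "filterlim k sequentially at_top"
      unfolding k_def by (rule filterlim_compose[OF filterlim_minus_const_nat_at_top])
    then have q': "((\<lambda>T. \<bar>H (real (Suc (k T))^2) \<omega> / (real (Suc (k T))^2)\<bar>) \<longlongrightarrow> 0) at_top"
      by (rule filterlim_compose[OF q])
    have lim: "((\<lambda>T. \<bar>H (real (Suc (k T))^2) \<omega> / (real (Suc (k T))^2)\<bar> + (2 / sqrt T + 1 / T)) \<longlongrightarrow> 0 + (0 + 0)) at_top"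
      by (intro tendsto_add q' real_tendsto_divide_at_top[OF tendsto_const] sqrt_at_top filterlim_ident)
    have le: "norm (H T \<omega> / T) \<le> \<bar>H (real (Suc (k T))^2) \<omega> / (real (Suc (k T))^2)\<bar> + (2 / sqrt T + 1 / T)" if T: "T \<ge> 1" for T
    proof -
      define n where "n = real (Suc (k T))"
      have s1: "1 \<le> sqrt T" using T by simp
      then have nf: "n = real_of_int \<lfloor>sqrt T\<rfloor>" unfolding n_def k_def
        by (smt (verit, best) Suc_pred' floor_mono floor_one nat_int_comparison(2) of_int_floor_le of_nat_nat int_nat_eq of_nat_0 of_nat_less_iff of_int_of_nat_eq zero_less_nat_eq)
      have n: "n \<le> sqrt T" "sqrt T < n + 1" "1 \<le> n" using nf s1 by (auto simp: le_floor_iff)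
      have n2: "n\<^sup>2 \<le> T" using n T power_mono[of n "sqrt T" 2] by simp
      have "(sqrt T)\<^sup>2 \<le> (n + 1)\<^sup>2" using n s1 by (intro power_mono) auto
      then have T2: "T - n\<^sup>2 \<le> 2 * sqrt T + 1" using n T by (simp add: power2_eq_square algebra_simps)
      have "H T \<omega> = H (n\<^sup>2) \<omega> + (LINT t:{n\<^sup>2..T}|lborel. D t \<omega>)"
        unfolding H_def using n2 by (intro set_integral_split D2 \<omega> bound) auto
      then have "\<bar>H T \<omega>\<bar> \<le> \<bar>H (n\<^sup>2) \<omega>\<bar> + (2 * sqrt T + 1)"
        using set_integral_abs_le[OF D2[OF \<omega>] bound n2] T2 by linarith
      then have "\<bar>H T \<omega>\<bar> / T \<le> \<bar>H (n\<^sup>2) \<omega>\<bar> / T + (2 * sqrt T + 1) / T"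
        using T by (simp add: divide_right_mono flip: add_divide_distrib)
      also have "\<bar>H (n\<^sup>2) \<omega>\<bar> / T \<le> \<bar>H (n\<^sup>2) \<omega>\<bar> / n\<^sup>2"
        using n2 n T by (intro divide_left_mono mult_pos_pos) auto
      also have "(2 * sqrt T + 1) / T = 2 / sqrt T + 1 / T"
      proof -
        have "2 * sqrt T / T = 2 / sqrt T" using T by (simp add: frac_eq_eq)
        then show ?thesis by (simp add: add_divide_distrib)
      qed
      finally show ?thesis using T by (simp add: n_def)
    qed
    show ?thesis
      by (rule Lim_null_comparison[OF _ lim[simplified]])
        (use le in \<open>auto simp: eventually_at_top_linorder intro!: exI[of _ 1]\<close>)
  qed
  ultimately show ?thesis unfolding H_def[symmetric] by (auto intro: AE_mp)
qed

section \<open>Ergodic averages of path functionals\<close>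

lemma space_cadlag_space: "space cadlag_space = {w \<in> extensional {0..}. cadlag_on {0..} w}"
  by (auto simp: cadlag_space_def space_restrict_space space_PiM PiE_def)

lemma rcll_cadlag_space: "w \<in> space cadlag_space \<Longrightarrow> rcll 0 w"
  by (auto simp: space_cadlag_space cadlag_on_rcll_0)

lemma measurable_coordinate_cadlag: "0 \<le> s \<Longrightarrow> (\<lambda>w. w s) \<in> borel_measurable cadlag_space"
  unfolding cadlag_space_def by (intro measurable_restrict_space1 measurable_component_singleton) auto

lemma measurable_cadlag_spaceI:
  assumes "\<And>x. x \<in> space N \<Longrightarrow> f x \<in> space cadlag_space"
    and "\<And>s. 0 \<le> s \<Longrightarrow> (\<lambda>x. f x s) \<in> borel_measurable N"
  shows "f \<in> N \<rightarrow>\<^sub>M cadlag_space"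
  unfolding cadlag_space_def
proof (rule measurable_restrict_space2)
  show "f \<in> space N \<rightarrow> {w. cadlag_on {0..} w}" using assms(1) by (auto simp: space_cadlag_space)
  have "(\<lambda>x. \<lambda>s\<in>{0..}. f x s) \<in> N \<rightarrow>\<^sub>M Pi\<^sub>M {0..} (\<lambda>_. borel)"
    using assms(2) by (intro measurable_restrict) auto
  moreover have "(\<lambda>s\<in>{0..}. f x s) = f x" if "x \<in> space N" for x
    using assms(1)[OF that] by (auto simp: space_cadlag_space extensional_restrict)
  ultimately show "f \<in> N \<rightarrow>\<^sub>M Pi\<^sub>M {0..} (\<lambda>_. borel)" by (simp cong: measurable_cong)
qed

lemma path_from_apply: "0 \<le> s \<Longrightarrow> path_from X t \<omega> s = X (t + s) \<omega>"
  by (simp add: path_from_def)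

lemma rcll_path_from: "rcll t (\<lambda>s. X s \<omega>) \<Longrightarrow> rcll 0 (path_from X t \<omega>)"
  using rcll_shift[of t 0 "\<lambda>s. X s \<omega>"] by (auto simp: path_from_apply intro: rcll_cong[rotated])

lemma path_from_in_cadlag_space: "rcll t (\<lambda>s. X s \<omega>) \<Longrightarrow> path_from X t \<omega> \<in> space cadlag_space"
  using rcll_path_from[of t X \<omega>] by (simp add: space_cadlag_space rcll_cadlag_on) (simp add: path_from_def)

lemma measurable_path_from:
  assumes "\<And>\<omega>. \<omega> \<in> space N \<Longrightarrow> rcll t (\<lambda>s. X s \<omega>)" "\<And>s. t \<le> s \<Longrightarrow> X s \<in> borel_measurable N"
  shows "path_from X t \<in> N \<rightarrow>\<^sub>M cadlag_space"
proof (rule measurable_cadlag_spaceI)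
  show "path_from X t \<omega> \<in> space cadlag_space" if "\<omega> \<in> space N" for \<omega>
    using assms(1)[OF that] by (rule path_from_in_cadlag_space)
qed (use assms(2) in \<open>simp add: path_from_apply\<close>)

text \<open>Evaluating at \<open>max 0 t\<close> turns a process on \<open>{0..}\<close> into one on
  the whole line, where right continuity gives joint measurability.\<close>

lemma measurable_pair_path_from:
  fixes X :: "real \<Rightarrow> 'w \<Rightarrow> real^'n"
  assumes rc: "\<And>\<omega>. \<omega> \<in> space N \<Longrightarrow> rcll 0 (\<lambda>s. X s \<omega>)" and X: "\<And>s. 0 \<le> s \<Longrightarrow> X s \<in> borel_measurable N"
  shows "(\<lambda>(t, \<omega>). path_from X (max 0 t) \<omega>) \<in> borel \<Otimes>\<^sub>M N \<rightarrow>\<^sub>M cadlag_space"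
proof (rule measurable_cadlag_spaceI)
  fix x :: "real \<times> 'w" assume "x \<in> space (borel \<Otimes>\<^sub>M N)"
  then have "snd x \<in> space N" by (auto simp: space_pair_measure)
  then show "(case x of (t, \<omega>) \<Rightarrow> path_from X (max 0 t) \<omega>) \<in> space cadlag_space"
    using rcll_mono[OF rc, of "snd x" "max 0 (fst x)"] by (auto simp: case_prod_beta' intro!: path_from_in_cadlag_space)
next
  fix s :: real assume s: "0 \<le> s"
  have "(\<lambda>(t, \<omega>). (\<lambda>t. X (max 0 t + s)) t \<omega>) \<in> borel_measurable (borel \<Otimes>\<^sub>M N)"
  proof (rule measurable_pair_right_continuous)
    show "X (max 0 t + s) \<in> borel_measurable N" for t using X s by auto
    fix t \<omega> assume "\<omega> \<in> space N"
    then have r: "rcll s (\<lambda>u. X u \<omega>)" using rc s rcll_mono by blast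
    show "((\<lambda>u. X (max 0 u + s) \<omega>) \<longlongrightarrow> X (max 0 t + s) \<omega>) (at_right t)"
    proof (cases "t < 0")
      case True
      have "\<forall>\<^sub>F u in at_right t. u \<in> {t<..<0}" using eventually_at_right_real[OF True] .
      then have "\<forall>\<^sub>F u in at_right t. X (max 0 t + s) \<omega> = X (max 0 u + s) \<omega>"
        by (rule eventually_mono) (use True in auto)
      then show ?thesis by (rule Lim_transform_eventually[OF tendsto_const])
    next
      case False
      then have "rcll (s + t) (\<lambda>u. X u \<omega>)" using r rcll_mono[of s _ "s + t"] by auto
      then have "((\<lambda>u. X (s + u) \<omega>) \<longlongrightarrow> X (s + t) \<omega>) (at_right t)"
        using rcll_right[OF rcll_shift, of s t] by blast
      moreover have "\<forall>\<^sub>F u in at_right t. X (s + u) \<omega> = X (max 0 u + s) \<omega>"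
        using False by (auto simp: eventually_at_filter add.commute intro!: always_eventually)
      ultimately show ?thesis using False Lim_transform_eventually by (fastforce simp: add.commute)
    qed
  qed
  moreover have "(case x of (t, \<omega>) \<Rightarrow> path_from X (max 0 t) \<omega>) s = (case x of (t, \<omega>) \<Rightarrow> X (max 0 t + s) \<omega>)" for x
    using s by (simp add: case_prod_beta' path_from_apply)
  ultimately show "(\<lambda>x. (case x of (t, \<omega>) \<Rightarrow> path_from X (max 0 t) \<omega>) s) \<in> borel_measurable (borel \<Otimes>\<^sub>M N)"
    by simp
qed

section \<open>Path kernels and the Markov property\<close>

lemma path_kernel_measurable: "path_kernel P \<Longrightarrow> P \<in> borel \<rightarrow>\<^sub>M subprob_algebra cadlag_space"
  unfolding path_kernel_def by (rule measurable_prob_algebraD)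

lemma path_kernel_in_prob_algebra: "path_kernel P \<Longrightarrow> P x \<in> space (prob_algebra cadlag_space)"
  unfolding path_kernel_def by (rule measurable_space) auto

lemma path_kernel_prob_space: "path_kernel P \<Longrightarrow> prob_space (P x)"
  by (drule path_kernel_in_prob_algebra[of _ x]) (simp add: space_prob_algebra)

lemma path_kernel_sets: "path_kernel P \<Longrightarrow> sets (P x) = sets cadlag_space"
  by (drule path_kernel_in_prob_algebra[of _ x]) (simp add: space_prob_algebra)

lemma path_kernel_space: "path_kernel P \<Longrightarrow> space (P x) = space cadlag_space"
  by (rule sets_eq_imp_space_eq) (rule path_kernel_sets)

lemma path_kernel_measure_measurable:
  "path_kernel P \<Longrightarrow> E \<in> sets cadlag_space \<Longrightarrow> (\<lambda>x. measure (P x) E) \<in> borel_measurable borel"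
  using measurable_compose[OF path_kernel_measurable measurable_emeasure_subprob_algebra]
  unfolding measure_def by (intro borel_measurable_enn2real)

lemma path_kernel_measure_le_1: "path_kernel P \<Longrightarrow> measure (P x) E \<le> 1"
  using prob_space.prob_le_1[OF path_kernel_prob_space] .

lemma markov_expectation:
  assumes "markov_process I M Fil X P" "t \<in> I" "prob_space M" "subalgebra M (Fil t)" and P: "path_kernel P"
    and G: "G \<in> borel_measurable (Fil t)" "\<And>\<omega>. \<omega> \<in> space M \<Longrightarrow> \<bar>G \<omega>\<bar> \<le> 1"
    and E: "E \<in> sets cadlag_space" "{\<omega>\<in>space M. path_from X t \<omega> \<in> E} \<in> sets M"
  shows "(\<integral>\<omega>. G \<omega> * indicator E (path_from X t \<omega>) \<partial>M) = (\<integral>\<omega>. G \<omega> * measure (P (X t \<omega>)) E \<partial>M)"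
proof -
  interpret prob_space M by fact
  interpret finite_measure_subalgebra M "Fil t" by unfold_locales (rule assms(4))
  let ?E = "{\<omega>\<in>space M. path_from X t \<omega> \<in> E}"
  have G': "G \<in> borel_measurable M" using G(1) assms(4) by (rule measurable_from_subalg[rotated])
  have X: "X t \<in> borel_measurable (Fil t)" using assms(1,2) by (auto simp: markov_process_def)
  have X': "X t \<in> borel_measurable M" using X assms(4) by (rule measurable_from_subalg[rotated])
  have int: "integrable M (\<lambda>\<omega>. G \<omega> * indicator ?E \<omega>)"
    using G G' E(2) by (intro integrable_const_bound[of _ 1] AE_I2) (auto simp: indicator_def)
  have "(\<integral>\<omega>. G \<omega> * indicator E (path_from X t \<omega>) \<partial>M) = (\<integral>\<omega>. G \<omega> * indicator ?E \<omega> \<partial>M)"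
    by (intro Bochner_Integration.integral_cong) (auto simp: indicator_def)
  also have "\<dots> = (\<integral>\<omega>. G \<omega> * real_cond_exp M (Fil t) (indicator ?E) \<omega> \<partial>M)"
    by (rule real_cond_exp_intg(2)[symmetric, OF int G(1)]) (use E(2) in measurable)
  also have "\<dots> = (\<integral>\<omega>. G \<omega> * measure (P (X t \<omega>)) E \<partial>M)"
  proof (rule integral_cong_AE)
    show "(\<lambda>\<omega>. G \<omega> * measure (P (X t \<omega>)) E) \<in> borel_measurable M"
      using G' measurable_compose[OF X' path_kernel_measure_measurable[OF P E(1)]] by measurable
    show "AE \<omega> in M. G \<omega> * real_cond_exp M (Fil t) (indicator ?E) \<omega> = G \<omega> * measure (P (X t \<omega>)) E"
    proof -
      have "AE \<omega> in M. real_cond_exp M (Fil t) (indicator ?E) \<omega> = measure (P (X t \<omega>)) E"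
        using assms(1,2) E(1) unfolding markov_process_def by blast
      then show ?thesis by eventually_elim simp
    qed
  qed (use G' in measurable)
  finally show ?thesis .
qed

lemma path_average_tendsto:
  fixes X :: "real \<Rightarrow> 'w \<Rightarrow> real^'n"
  assumes M: "prob_space M" and filt: "filtration (space M) Fil" "\<And>t. sets (Fil t) \<subseteq> sets M"
    and X: "adapted_cadlag M Fil X" and P: "path_kernel P" and markov: "markov_process {0..} M Fil X P"
    and erg: "ergodic_process M X \<rho>" and E: "E \<in> sets cadlag_space" and L: "0 \<le> L"
    and window: "\<And>t. 0 \<le> t \<Longrightarrow> {\<omega>\<in>space M. path_from X t \<omega> \<in> E} \<in> sets (Fil (t + L))"
  shows "AE \<omega> in M. ((\<lambda>T. (LINT t:{0..T}|lborel. indicator E (path_from X t \<omega>)) / T)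
     \<longlongrightarrow> (LINT x|lborel. measure (P x) E * \<rho> x)) at_top"
proof -
  interpret prob_space M by fact
  have sub: "subalgebra M (Fil t)" for t using filt by (auto simp: subalgebra_def filtration_def)
  have Fmono: "sets (Fil s) \<subseteq> sets (Fil t)" if "s \<le> t" for s t using filt that by (auto simp: filtration_def)
  have subF: "subalgebra (Fil t) (Fil s)" if "s \<le> t" for s t
    using filt Fmono[OF that] by (auto simp: subalgebra_def filtration_def)
  have XF: "X t \<in> borel_measurable (Fil t)" if "0 \<le> t" for t using X that by (auto simp: adapted_cadlag_def)
  have XM: "X t \<in> borel_measurable M" if "0 \<le> t" for t using XF[OF that] sub by (rule measurable_from_subalg[rotated])
  have rc: "rcll 0 (\<lambda>t. X t \<omega>)" if "\<omega> \<in> space M" for \<omega>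
    using X that by (auto simp: adapted_cadlag_def cadlag_on_rcll_0)
  define g where "g x = measure (P x) E" for x
  have g [measurable]: "g \<in> borel_measurable borel" unfolding g_def by (rule path_kernel_measure_measurable[OF P E])
  have g01: "0 \<le> g x" "g x \<le> 1" for x unfolding g_def using path_kernel_measure_le_1[OF P] by auto
  \<comment> \<open>What is subtracted is a bounded function of the state alone, so its time average
    is covered by ergodicity.\<close>
  define D where "D t \<omega> = indicator E (path_from X (max 0 t) \<omega>) - g (X (max 0 t) \<omega>)" for t \<omega>
  note pf [measurable] = measurable_pair_path_from[of M X, OF rc XM]
  have Xpair: "(\<lambda>(t, \<omega>). X (max 0 t) \<omega>) \<in> borel_measurable (borel \<Otimes>\<^sub>M M)"
  proof -
    have "(\<lambda>x. (case x of (t, \<omega>) \<Rightarrow> path_from X (max 0 t) \<omega>) 0) \<in> borel_measurable (borel \<Otimes>\<^sub>M M)"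
      by (rule measurable_compose[OF pf measurable_coordinate_cadlag[of 0]]) simp_all
    then show ?thesis by (simp add: path_from_apply case_prod_beta')
  qed
  have D: "(\<lambda>(t, \<omega>). D t \<omega>) \<in> borel_measurable (lborel \<Otimes>\<^sub>M M)"
  proof -
    have "(\<lambda>x. indicator E (case x of (t, \<omega>) \<Rightarrow> path_from X (max 0 t) \<omega>) - g (case x of (t, \<omega>) \<Rightarrow> X (max 0 t) \<omega>))
      \<in> borel_measurable (borel \<Otimes>\<^sub>M M)"
      by (intro borel_measurable_diff measurable_compose[OF pf] measurable_compose[OF Xpair g]) (use E in measurable)
    then have "(\<lambda>x. indicator E (case x of (t, \<omega>) \<Rightarrow> path_from X (max 0 t) \<omega>) - g (case x of (t, \<omega>) \<Rightarrow> X (max 0 t) \<omega>))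
      \<in> borel_measurable (lborel \<Otimes>\<^sub>M M)"
      by (subst measurable_cong_sets[OF sets_pair_measure_cong[OF sets_lborel refl] refl])
    then show ?thesis by (simp add: D_def case_prod_beta')
  qed
  have bound: "\<bar>D t \<omega>\<bar> \<le> 1" for t \<omega>
    unfolding D_def using g01[of "X (max 0 t) \<omega>"] indicator_pos_le[of E "path_from X (max 0 t) \<omega>", where 'a = real]
      indicator_le_1[of E "path_from X (max 0 t) \<omega>", where 'a = real] by linarith
  have avg0: "AE \<omega> in M. ((\<lambda>T. (LINT t:{0..T}|lborel. D t \<omega>) / T) \<longlongrightarrow> 0) at_top"
  proof (rule weakly_correlated_average_tendsto_0[OF M D bound L])
    fix s t :: real assume st: "0 \<le> s" "s + L \<le> t"
    then have t: "0 \<le> t" "s \<le> t" using L by auto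
    \<comment> \<open>The window that starts at \<open>s\<close> is over by time \<open>t\<close>,
      so \<open>D s\<close> may serve as a weight in the Markov property at
      \<open>t\<close>.\<close>
    have Ds: "D s \<in> borel_measurable (Fil t)"
    proof -
      have "{\<omega>\<in>space M. path_from X s \<omega> \<in> E} \<in> sets (Fil t)" using window[OF st(1)] Fmono[OF st(2)] by blast
      then have "indicat_real {\<omega>\<in>space M. path_from X s \<omega> \<in> E} \<in> borel_measurable (Fil t)" by measurable
      moreover have "(\<lambda>\<omega>. g (X s \<omega>)) \<in> borel_measurable (Fil t)"
        using measurable_compose[OF measurable_from_subalg[OF subF[OF t(2)] XF[OF st(1)]] g] .
      ultimately have "(\<lambda>\<omega>. indicat_real {\<omega>\<in>space M. path_from X s \<omega> \<in> E} \<omega> - g (X s \<omega>)) \<in> borel_measurable (Fil t)"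
        by measurable
      moreover have "space (Fil t) = space M" using filt by (auto simp: filtration_def)
      ultimately show ?thesis using st(1) by (subst measurable_cong) (auto simp: D_def indicator_def)
    qed
    have DsM [measurable]: "D s \<in> borel_measurable M" using Ds sub by (rule measurable_from_subalg[rotated])
    have Et: "{\<omega>\<in>space M. path_from X t \<omega> \<in> E} \<in> sets M" using window[OF t(1)] filt(2) by blast
    have gX [measurable]: "(\<lambda>\<omega>. g (X t \<omega>)) \<in> borel_measurable M" using measurable_compose[OF XM[OF t(1)] g] .
    have "(\<integral>\<omega>. D s \<omega> * D t \<omega> \<partial>M)
      = (\<integral>\<omega>. D s \<omega> * indicator E (path_from X t \<omega>) - D s \<omega> * g (X t \<omega>) \<partial>M)"
      using t by (simp add: D_def algebra_simps)
    also have "\<dots> = (\<integral>\<omega>. D s \<omega> * indicator E (path_from X t \<omega>) \<partial>M) - (\<integral>\<omega>. D s \<omega> * g (X t \<omega>) \<partial>M)"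
    proof (rule Bochner_Integration.integral_diff)
      have "(\<lambda>\<omega>. indicat_real {\<omega>\<in>space M. path_from X t \<omega> \<in> E} \<omega>) \<in> borel_measurable M" using Et by measurable
      then have "(\<lambda>\<omega>. indicat_real E (path_from X t \<omega>)) \<in> borel_measurable M"
        by (rule measurable_cong[THEN iffD1, rotated]) (auto simp: indicator_def)
      then show "integrable M (\<lambda>\<omega>. D s \<omega> * indicator E (path_from X t \<omega>))"
        using bound by (intro integrable_const_bound[of _ 1] AE_I2) (auto simp: indicator_def)
      show "integrable M (\<lambda>\<omega>. D s \<omega> * g (X t \<omega>))"
        using mult_mono[OF bound[of s] g01(2)] g01(1) by (intro integrable_const_bound[of _ 1] AE_I2) (auto simp: abs_mult)
    qed
    also have "\<dots> = 0"
      using markov_expectation[OF markov _ M sub P Ds bound E Et] t by (simp add: g_def)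
    finally show "(\<integral>\<omega>. D s \<omega> * D t \<omega> \<partial>M) = 0" .
  qed
  have "bounded (range g)" unfolding bounded_iff using g01 by (intro exI[of _ 1]) auto
  then have avg1: "AE \<omega> in M. ((\<lambda>T. (LINT t:{0..T}|lborel. g (X t \<omega>)) / T) \<longlongrightarrow> (LINT x|lborel. g x * \<rho> x)) at_top"
    using erg g unfolding ergodic_process_def by blast
  from avg0 avg1 AE_space show ?thesis
  proof eventually_elim
    case (elim \<omega>)
    have eq: "(LINT t:{0..T}|lborel. indicator E (path_from X t \<omega>)) / T =
      (LINT t:{0..T}|lborel. D t \<omega>) / T + (LINT t:{0..T}|lborel. g (X t \<omega>)) / T" for T
    proof -
      have 1: "set_integrable lborel {0..T} (\<lambda>t. D t \<omega>)"
        using measurable_compose[OF measurable_Pair2' D] elim(3) bound by (intro set_integrable_bounded[of _ 1]) auto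
      have "(\<lambda>t. X (max 0 t) \<omega>) \<in> borel_measurable borel"
        using measurable_compose[OF measurable_Pair2' Xpair] elim(3) by auto
      then have 2: "set_integrable lborel {0..T} (\<lambda>t. g (X (max 0 t) \<omega>))"
        using g01 by (intro set_integrable_bounded[of _ 1]) auto
      have "(LINT t:{0..T}|lborel. indicator E (path_from X t \<omega>)) = (LINT t:{0..T}|lborel. D t \<omega> + g (X (max 0 t) \<omega>))"
        by (intro set_lebesgue_integral_cong) (auto simp: D_def)
      also have "\<dots> = (LINT t:{0..T}|lborel. D t \<omega>) + (LINT t:{0..T}|lborel. g (X (max 0 t) \<omega>))"
        using 1 2 by (rule set_integral_add)
      also have "(LINT t:{0..T}|lborel. g (X (max 0 t) \<omega>)) = (LINT t:{0..T}|lborel. g (X t \<omega>))"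
        by (intro set_lebesgue_integral_cong) auto
      finally show ?thesis by (simp add: add_divide_distrib)
    qed
    show ?case unfolding eq using tendsto_add[OF elim(1,2)] by (simp add: g_def)
  qed
qed

section \<open>The stationary law on path space\<close>

definition stationary_law :: "('n::finite) path_kernel \<Rightarrow> (real^'n \<Rightarrow> real) \<Rightarrow> (real \<Rightarrow> real^'n) measure" where
  "stationary_law P \<rho> = density lborel \<rho> \<bind> P"

lemma path_kernel_measurable_density:
  "path_kernel P \<Longrightarrow> P \<in> density lborel f \<rightarrow>\<^sub>M subprob_algebra cadlag_space"
  using path_kernel_measurable by (simp cong: measurable_cong_sets)

lemma sets_stationary_law: "path_kernel P \<Longrightarrow> sets (stationary_law P \<rho>) = sets cadlag_space"
  unfolding stationary_law_def by (rule sets_bind) (auto simp: path_kernel_sets)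

lemma space_stationary_law: "path_kernel P \<Longrightarrow> space (stationary_law P \<rho>) = space cadlag_space"
  by (rule sets_eq_imp_space_eq) (rule sets_stationary_law)

lemma emeasure_stationary_law:
  assumes "path_kernel P" "invariant_density P \<rho>" "E \<in> sets cadlag_space"
  shows "emeasure (stationary_law P \<rho>) E = (\<integral>\<^sup>+x. emeasure (P x) E \<partial>density lborel \<rho>)"
  unfolding stationary_law_def
  by (rule emeasure_bind[OF _ path_kernel_measurable_density[OF assms(1)] assms(3)]) simp

lemma prob_space_stationary_law:
  assumes "path_kernel P" "invariant_density P \<rho>"
  shows "prob_space (stationary_law P \<rho>)"
proof (rule prob_spaceI)
  interpret D: prob_space "density lborel \<rho>" using assms(2) by (simp add: invariant_density_def)
  have "emeasure (P x) (space cadlag_space) = 1" for x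
    using prob_space.emeasure_space_1[OF path_kernel_prob_space[OF assms(1)], of x] path_kernel_space[OF assms(1)] by simp
  then show "emeasure (stationary_law P \<rho>) (space (stationary_law P \<rho>)) = 1"
    using emeasure_stationary_law[OF assms, of "space cadlag_space"] D.emeasure_space_1
    by (simp add: space_stationary_law[OF assms(1)])
qed

lemma invariant_density_measurable: "invariant_density P \<rho> \<Longrightarrow> \<rho> \<in> borel_measurable borel"
  by (simp add: invariant_density_def)

lemma integral_invariant_density:
  fixes f :: "real^'n \<Rightarrow> real"
  assumes "invariant_density P \<rho>" "f \<in> borel_measurable borel"
  shows "(\<integral>x. f x \<partial>density lborel \<rho>) = (LINT x|lborel. f x * \<rho> x)"
  using assms by (subst integral_density) (auto simp: invariant_density_def mult.commute)

lemma measure_stationary_law: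
  assumes "path_kernel P" "invariant_density P \<rho>" "E \<in> sets cadlag_space"
  shows "measure (stationary_law P \<rho>) E = (LINT x|lborel. measure (P x) E * \<rho> x)"
proof -
  interpret D: prob_space "density lborel \<rho>" using assms(2) by (simp add: invariant_density_def)
  have m: "(\<lambda>x. measure (P x) E) \<in> borel_measurable borel"
    by (rule path_kernel_measure_measurable[OF assms(1,3)])
  have "emeasure (stationary_law P \<rho>) E = (\<integral>\<^sup>+x. ennreal (measure (P x) E) \<partial>density lborel \<rho>)"
    unfolding emeasure_stationary_law[OF assms]
    by (intro nn_integral_cong finite_measure.emeasure_eq_measure prob_space.finite_measure path_kernel_prob_space[OF assms(1)])
  also have "\<dots> = ennreal (\<integral>x. measure (P x) E \<partial>density lborel \<rho>)"
    using m path_kernel_measure_le_1[OF assms(1)]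
    by (intro nn_integral_eq_integral D.integrable_const_bound[of _ 1] AE_I2) (auto cong: measurable_cong_sets)
  finally have "measure (stationary_law P \<rho>) E = (\<integral>x. measure (P x) E \<partial>density lborel \<rho>)"
    by (simp add: measure_def[of "stationary_law P \<rho>"])
  then show ?thesis using integral_invariant_density[OF assms(2) m] by simp
qed

text \<open>Since \<rho> is positive, null sets of starting points are the same for \<rho> and for
  Lebesgue measure. Statements under the stationary law thus reduce to statements under
  \<open>P x\<close> for almost every \<open>x\<close>, and back.\<close>

lemma AE_stationary_law:
  assumes P: "path_kernel P" and inv: "invariant_density P \<rho>" and pos: "\<And>x. \<rho> x > 0"
    and E: "{w\<in>space cadlag_space. Q w} \<in> sets cadlag_space"
  shows "(AE w in stationary_law P \<rho>. Q w) \<longleftrightarrow> (AE x in lborel. AE w in P x. Q w)"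
proof -
  have "(AE w in stationary_law P \<rho>. Q w) \<longleftrightarrow> (AE x in density lborel \<rho>. AE w in P x. Q w)"
    unfolding stationary_law_def
    by (rule AE_bind[OF path_kernel_measurable_density[OF P]]) (use E in \<open>simp add: pred_def\<close>)
  also have "\<dots> \<longleftrightarrow> (AE x in lborel. AE w in P x. Q w)"
    using invariant_density_measurable[OF inv] pos by (subst AE_density) auto
  finally show ?thesis .
qed

lemma emeasure_coordinate_stationary_law:
  assumes P: "path_kernel P" and inv: "invariant_density P \<rho>" and t: "0 \<le> t" and D: "D \<in> sets borel"
  shows "emeasure (stationary_law P \<rho>) {w\<in>space cadlag_space. w t \<in> D} = emeasure (density lborel \<rho>) D"
proof -
  have "{w\<in>space cadlag_space. w t \<in> D} = (\<lambda>w. w t) -` D \<inter> space cadlag_space" by auto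
  then have "{w\<in>space cadlag_space. w t \<in> D} \<in> sets cadlag_space"
    using measurable_sets[OF measurable_coordinate_cadlag[OF t] D] by simp
  then show ?thesis using emeasure_stationary_law[OF P inv] inv t D by (simp add: invariant_density_def)
qed

lemma sets_never_visits:
  assumes "open A"
  shows "{w\<in>space cadlag_space. \<not> (\<exists>s>0. w s \<in> A)} \<in> sets (cadlag_space :: (real \<Rightarrow> real^'n) measure)"
proof -
  have "{w\<in>space (cadlag_space :: (real \<Rightarrow> real^'n) measure). \<not> (\<exists>s>0. w s \<in> A)} =
    (\<Inter>n::nat. space cadlag_space - {w\<in>space cadlag_space. \<exists>s. 0 < s \<and> s < real n \<and> w s \<in> A})"
  proof -
    have "(\<exists>s>0. w s \<in> A) \<longleftrightarrow> (\<exists>n::nat. \<exists>s. 0 < s \<and> s < real n \<and> w s \<in> A)" for w :: "real \<Rightarrow> real^'n"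
      using reals_Archimedean2 by blast
    then show ?thesis by auto
  qed
  also have "\<dots> \<in> sets cadlag_space"
    by (intro sets.countable_INT image_subsetI sets.Diff sets.top
        sets_visits[where lo = 0, OF measurable_coordinate_cadlag rcll_cadlag_space _ order_refl order_refl]) (use assms in auto)
  finally show ?thesis .
qed

text \<open>Positive recurrence: \<open>X\<close> spends a positive fraction of time in \<open>A\<close>, so the probability \<open>g\<close> of never
  returning to \<open>A\<close> vanishes along \<open>X\<close>, and ergodicity turns this into a statement on the stationary law.\<close>

lemma stationary_law_never_visits:
  fixes X :: "real \<Rightarrow> 'w \<Rightarrow> real^'n"
  assumes M: "prob_space M" and filt: "filtration (space M) Fil" "\<And>t. sets (Fil t) \<subseteq> sets M"
    and X: "adapted_cadlag M Fil X" and P: "path_kernel P" and markov: "markov_process {0..} M Fil X P"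
    and erg: "ergodic_process M X \<rho>" and inv: "invariant_density P \<rho>" and pos: "\<And>x. \<rho> x > 0"
    and A: "open A" "A \<noteq> {}"
  shows "measure (stationary_law P \<rho>) {w\<in>space cadlag_space. \<not> (\<exists>s>0. w s \<in> A)} = 0"
proof -
  interpret prob_space M by fact
  interpret lM: pair_sigma_finite lborel M ..
  let ?E = "{w\<in>space cadlag_space. \<not> (\<exists>s>0. w s \<in> A)}"
  have E: "?E \<in> sets cadlag_space" by (rule sets_never_visits[OF A(1)])
  define g where "g x = measure (P x) ?E" for x
  have g [measurable]: "g \<in> borel_measurable borel" unfolding g_def by (rule path_kernel_measure_measurable[OF P E])
  have g01: "0 \<le> g x" "g x \<le> 1" for x unfolding g_def using path_kernel_measure_le_1[OF P] by auto
  have sub: "subalgebra M (Fil t)" for t using filt by (auto simp: subalgebra_def filtration_def)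
  have XM: "X t \<in> borel_measurable M" if "0 \<le> t" for t
    using X that sub[of t] unfolding adapted_cadlag_def by (auto intro: measurable_from_subalg)
  have rc: "rcll 0 (\<lambda>t. X t \<omega>)" if "\<omega> \<in> space M" for \<omega>
    using X that by (auto simp: adapted_cadlag_def cadlag_on_rcll_0)
  have rcm: "rcll t (\<lambda>t. X t \<omega>)" if "\<omega> \<in> space M" "0 \<le> t" for \<omega> t using rcll_mono[OF rc[OF that(1)] that(2)] .
  have [measurable]: "A \<in> sets borel" using A by auto
  define c where "c = (LINT x|lborel. indicator A x * \<rho> x)"
  \<comment> \<open>A nonempty open set has positive Lebesgue measure, and \<rho> is
    positive.\<close>
  have "c > 0"
  proof -
    interpret D: prob_space "density lborel \<rho>" using inv by (simp add: invariant_density_def)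
    have "\<not> (AE x in lborel. x \<notin> A)"
    proof
      assume "AE x in lborel. x \<notin> A"
      then have "negligible A"
        using AE_iff_null_sets[of A lborel] A by (simp add: negligible_iff_null_sets null_sets_completionI)
      then show False using A open_not_negligible by blast
    qed
    then have "\<not> (AE x in density lborel \<rho>. x \<notin> A)"
      using invariant_density_measurable[OF inv] pos by (subst AE_density) auto
    then have "measure (density lborel \<rho>) A \<noteq> 0"
      using D.prob_eq_0[of A] by auto
    moreover have "measure (density lborel \<rho>) A = c"
      using integral_invariant_density[OF inv, of "indicator A"] by (simp add: c_def)
    ultimately show ?thesis using measure_nonneg[of "density lborel \<rho>" A] by linarith
  qed
  have "bounded (range (indicat_real A))" "indicat_real A \<in> borel_measurable borel"
    unfolding bounded_iff by (auto simp: indicator_def intro!: exI[of _ 1] A(1))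
  then have "AE \<omega> in M. ((\<lambda>T. (LINT t:{0..T}|lborel. indicat_real A (X t \<omega>)) / T) \<longlongrightarrow> c) at_top"
    using erg unfolding ergodic_process_def c_def by blast
  \<comment> \<open>If \<open>A\<close> were not visited after \<open>t\<close>, the time spent in
    it would be at most \<open>t\<close>, and its average would tend to 0 instead of
    \<open>c\<close>.\<close>
  then have ret: "AE \<omega> in M. \<forall>t\<ge>0. \<exists>s>t. X s \<omega> \<in> A"
  proof eventually_elim
    case (elim \<omega>)
    show ?case
    proof (intro allI impI, rule ccontr)
      fix t :: real assume t: "0 \<le> t" and no: "\<not> (\<exists>s>t. X s \<omega> \<in> A)"
      have "((\<lambda>T. (LINT t:{0..T}|lborel. indicat_real A (X t \<omega>)) / T) \<longlongrightarrow> 0) at_top"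
      proof (rule Lim_null_comparison)
        show "\<forall>\<^sub>F T in at_top. norm ((LINT t:{0..T}|lborel. indicat_real A (X t \<omega>)) / T) \<le> t / T"
          using eventually_gt_at_top[of t]
        proof eventually_elim
          case (elim T)
          have "(LINT s|lborel. indicator {0..T} s *\<^sub>R indicat_real A (X s \<omega>)) \<le> (LINT s|lborel. indicat_real {0..t} s)"
          proof (rule integral_mono')
            show "indicator {0..T} s *\<^sub>R indicat_real A (X s \<omega>) \<le> indicat_real {0..t} s" for s
              using no t by (cases "s \<le> t") (auto simp: indicator_def)
          qed (simp_all add: emeasure_lborel_Icc_eq integrable_indicator_iff)
          then have "(LINT s:{0..T}|lborel. indicat_real A (X s \<omega>)) \<le> t"
            using t by (simp add: set_lebesgue_integral_def)
          moreover have "0 \<le> (LINT s:{0..T}|lborel. indicat_real A (X s \<omega>))"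
            unfolding set_lebesgue_integral_def by (intro Bochner_Integration.integral_nonneg) simp
          ultimately show ?case using elim t by (simp add: divide_right_mono)
        qed
        show "((\<lambda>T. t / T) \<longlongrightarrow> 0) at_top"
          by (intro real_tendsto_divide_at_top[OF tendsto_const] filterlim_ident)
      qed
      with elim have "c = 0" using tendsto_unique trivial_limit_at_top_linorder by blast
      then show False using \<open>c > 0\<close> by simp
    qed
  qed
  \<comment> \<open>By the Markov property the mean of \<open>g\<close> at the current state is the
    probability of no visit to \<open>A\<close> later on, which is 0; a nonnegative function of mean
    0 vanishes almost surely.\<close>
  have "AE \<omega> in M. g (X (max 0 t) \<omega>) = 0" for t
  proof -
    let ?t = "max 0 t"
    have pE: "AE \<omega> in M. indicat_real ?E (path_from X ?t \<omega>) = 0"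
      using ret
    proof eventually_elim
      case (elim \<omega>)
      then obtain s where "s > ?t" "X s \<omega> \<in> A" by (meson max.cobounded1)
      then have "path_from X ?t \<omega> (s - ?t) \<in> A" by (subst path_from_apply) auto
      then show ?case using \<open>s > ?t\<close> by (auto simp: indicator_def intro!: exI[of _ "s - ?t"])
    qed
    have pm: "path_from X ?t \<in> M \<rightarrow>\<^sub>M cadlag_space" using rcm XM by (intro measurable_path_from) auto
    have "(\<integral>\<omega>. 1 * g (X ?t \<omega>) \<partial>M) = (\<integral>\<omega>. 1 * indicat_real ?E (path_from X ?t \<omega>) \<partial>M)"
      unfolding g_def
    proof (rule markov_expectation[OF markov _ M sub P _ _ E, symmetric])
      show "{\<omega> \<in> space M. path_from X ?t \<omega> \<in> ?E} \<in> sets M"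
        using measurable_sets[OF pm E] by (simp add: vimage_def Int_def conj_commute)
    qed auto
    also have "\<dots> = (\<integral>\<omega>. 0 \<partial>M)"
    proof (rule integral_cong_AE)
      show "(\<lambda>\<omega>. 1 * indicat_real ?E (path_from X ?t \<omega>)) \<in> borel_measurable M"
        using measurable_compose[OF pm borel_measurable_indicator[OF E]] by simp
    qed (use pE in auto)
    finally have z: "(\<integral>\<omega>. g (X ?t \<omega>) \<partial>M) = 0" by simp
    have [measurable]: "(\<lambda>\<omega>. g (X ?t \<omega>)) \<in> borel_measurable M" using measurable_compose[OF XM g, of ?t] by simp
    have "integrable M (\<lambda>\<omega>. g (X ?t \<omega>))" using g01 by (intro integrable_const_bound[of _ 1] AE_I2) auto
    then show ?thesis using z g01 by (subst (asm) integral_nonneg_eq_0_iff_AE) auto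
  qed
  then have "AE t in lborel. AE \<omega> in M. g (X (max 0 t) \<omega>) = 0" by simp
  then have "AE \<omega> in M. AE t in lborel. g (X (max 0 t) \<omega>) = 0"
  proof (rule lM.AE_commute[THEN iffD1, rotated])
    have "(\<lambda>x. (case x of (t, \<omega>) \<Rightarrow> path_from X (max 0 t) \<omega>) 0) \<in> borel_measurable (borel \<Otimes>\<^sub>M M)"
      by (rule measurable_compose[OF measurable_pair_path_from[OF rc XM] measurable_coordinate_cadlag[of 0]]) simp_all
    then have [measurable]: "(\<lambda>x. X (max 0 (fst x)) (snd x)) \<in> borel_measurable (lborel \<Otimes>\<^sub>M M)"
      by (simp add: path_from_apply case_prod_beta' measurable_cong_sets[OF sets_pair_measure_cong[OF sets_lborel refl] refl])
    show "{x \<in> space (lborel \<Otimes>\<^sub>M M). g (X (max 0 (fst x)) (snd x)) = 0} \<in> sets (lborel \<Otimes>\<^sub>M M)" by measurable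
  qed
  moreover have "AE \<omega> in M. ((\<lambda>T. (LINT t:{0..T}|lborel. g (X t \<omega>)) / T) \<longlongrightarrow> (LINT x|lborel. g x * \<rho> x)) at_top"
  proof -
    have "bounded (range g)" unfolding bounded_iff using g01 by (intro exI[of _ 1]) auto
    then show ?thesis using erg g unfolding ergodic_process_def by blast
  qed
  ultimately have "AE \<omega> in M. (LINT x|lborel. g x * \<rho> x) = 0"
  proof eventually_elim
    case (elim \<omega>)
    have "(LINT t:{0..T}|lborel. g (X t \<omega>)) = 0" for T
    proof -
      have "AE t in lborel. indicator {0..T} t *\<^sub>R g (X t \<omega>) = 0"
        using elim(1) by eventually_elim (auto simp: indicator_def)
      then show ?thesis unfolding set_lebesgue_integral_def by (rule integral_eq_zero_AE)
    qed
    with elim(2) have "((\<lambda>T::real. 0::real) \<longlongrightarrow> (LINT x|lborel. g x * \<rho> x)) at_top" by simp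
    then show ?case using tendsto_unique[OF trivial_limit_at_top_linorder tendsto_const] by metis
  qed
  then show ?thesis using AE_False prob_space_axioms unfolding measure_stationary_law[OF P inv E] g_def
    by simp
qed

section \<open>Path events under time shifts\<close>

lemma tendsto_at_left_shift:
  fixes w :: "real \<Rightarrow> 'a::topological_space"
  shows "((\<lambda>s. w (t + s)) \<longlongrightarrow> l) (at_left v) \<longleftrightarrow> (w \<longlongrightarrow> l) (at_left (t + v))"
proof -
  have f: "filterlim (\<lambda>s. c + s) (at_left (c + s)) (at_left s)" for c s :: real
    by (intro filterlim_at_withinI) (auto intro!: tendsto_intros simp: eventually_at_filter)
  show ?thesis
    using filterlim_compose[OF _ f[of t v], of w "nhds l"] filterlim_compose[OF _ f[of "- t" "t + v"], of "\<lambda>s. w (t + s)" "nhds l"]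
    by auto
qed

lemma no_bad_jump_shift: "no_bad_jump K (\<lambda>s. w (t + s)) a b \<longleftrightarrow> no_bad_jump K w (t + a) (t + b)"
proof
  assume *: "no_bad_jump K (\<lambda>s. w (t + s)) a b"
  show "no_bad_jump K w (t + a) (t + b)" unfolding no_bad_jump_def
  proof (intro allI impI)
    fix v l assume "t + a < v \<and> v < t + b \<and> (w \<longlongrightarrow> l) (at_left v) \<and> l \<noteq> w v"
    then show "l \<notin> K \<and> w v \<notin> K"
      using *[unfolded no_bad_jump_def tendsto_at_left_shift, rule_format, of "v - t" l] by auto
  qed
next
  assume *: "no_bad_jump K w (t + a) (t + b)"
  show "no_bad_jump K (\<lambda>s. w (t + s)) a b" unfolding no_bad_jump_def tendsto_at_left_shift
    using *[unfolded no_bad_jump_def, rule_format, of "t + v" l for v l] by auto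
qed

lemma no_bad_jump_cong:
  assumes "\<And>s. a \<le> s \<Longrightarrow> w s = w' s"
  shows "no_bad_jump K w a b \<longleftrightarrow> no_bad_jump K w' a b"
proof -
  have "(w \<longlongrightarrow> l) (at_left v) \<longleftrightarrow> (w' \<longlongrightarrow> l) (at_left v)" if "a < v" for v l
    using eventually_at_left_real[OF that] by (intro tendsto_cong, rule eventually_mono) (use assms in auto)
  then show ?thesis using assms unfolding no_bad_jump_def by (metis less_imp_le)
qed

lemma no_bad_jump_path_from: "no_bad_jump K (path_from X t \<omega>) 0 b \<longleftrightarrow> no_bad_jump K (\<lambda>s. X s \<omega>) t (t + b)"
  using no_bad_jump_cong[of 0 "path_from X t \<omega>" "\<lambda>s. X (t + s) \<omega>" K b] no_bad_jump_shift[of K "\<lambda>s. X s \<omega>" t 0 b]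
  by (simp add: path_from_apply)

lemma approaches_shift: "approaches A (\<lambda>s. w (t + s)) a b \<longleftrightarrow> approaches A w (t + a) (t + b)"
proof -
  have "(\<exists>s\<in>{a..b}. Q (t + s)) \<longleftrightarrow> (\<exists>s\<in>{t + a..t + b}. Q s)" for Q
  proof
    assume "\<exists>s\<in>{t + a..t + b}. Q s"
    then obtain s where "s \<in> {t + a..t + b}" "Q s" by blast
    then show "\<exists>s\<in>{a..b}. Q (t + s)" by (intro bexI[of _ "s - t"]) auto
  qed force
  from this[of "\<lambda>s. w s \<in> nbhd (1 / Suc n) A" for n] show ?thesis unfolding approaches_def by blast
qed

lemma approaches_cong: "(\<And>s. a \<le> s \<Longrightarrow> w s = w' s) \<Longrightarrow> approaches A w a b \<longleftrightarrow> approaches A w' a b"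
  unfolding approaches_def by auto

lemma came_from_path_from:
  assumes "h \<le> u"
  shows "came_from A B (path_from X t \<omega>) u h \<longleftrightarrow> came_from A B (\<lambda>s. X s \<omega>) (t + u) h"
proof -
  have "approaches C (path_from X t \<omega>) (u - \<alpha>) u \<longleftrightarrow> approaches C (\<lambda>s. X s \<omega>) (t + u - \<alpha>) (t + u)" if "\<alpha> < h" for C \<alpha>
  proof -
    have "approaches C (path_from X t \<omega>) (u - \<alpha>) u \<longleftrightarrow> approaches C (\<lambda>s. X (t + s) \<omega>) (u - \<alpha>) u"
      using that assms by (intro approaches_cong) (simp add: path_from_apply)
    then show ?thesis using approaches_shift[of C "\<lambda>s. X s \<omega>" t "u - \<alpha>" u] by (simp add: add_diff_eq)
  qed
  then show ?thesis unfolding came_from_def by blast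
qed

lemma heads_to_path_from:
  assumes "0 \<le> u"
  shows "heads_to B A (path_from X t \<omega>) u h \<longleftrightarrow> heads_to B A (\<lambda>s. X s \<omega>) (t + u) h"
proof -
  have "approaches C (path_from X t \<omega>) u (u + \<alpha>) \<longleftrightarrow> approaches C (\<lambda>s. X s \<omega>) (t + u) (t + u + \<alpha>)" for C \<alpha>
  proof -
    have "approaches C (path_from X t \<omega>) u (u + \<alpha>) \<longleftrightarrow> approaches C (\<lambda>s. X (t + s) \<omega>) u (u + \<alpha>)"
      using assms by (intro approaches_cong) (simp add: path_from_apply)
    then show ?thesis using approaches_shift[of C "\<lambda>s. X s \<omega>" t u "u + \<alpha>"] by (simp add: add.assoc)
  qed
  then show ?thesis unfolding heads_to_def by blast
qed

section \<open>The stationary process and the committors\<close>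

lemma subalgebra_past:
  fixes Y :: "real \<Rightarrow> 's \<Rightarrow> 'b::topological_space"
  assumes "\<And>t. Y t \<in> borel_measurable S"
  shows "subalgebra S (sigma (space S) (generated_sets S {..t} Y))"
proof -
  have "generated_sets S {..t} Y \<subseteq> sets S"
    unfolding generated_sets_def
    by (intro sets.sigma_sets_subset) (use assms in \<open>auto intro!: measurable_sets\<close>)
  moreover have "generated_sets S {..t} Y \<subseteq> Pow (space S)"
    using sets.sets_into_space calculation by blast
  ultimately show ?thesis
    by (auto simp: subalgebra_def sets_measure_of intro: sets.sigma_sets_subset[THEN subsetD])
qed

lemma measurable_past:
  fixes Y :: "real \<Rightarrow> 's \<Rightarrow> 'b::topological_space"
  assumes "\<And>t. Y t \<in> borel_measurable S" "s \<le> t"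
  shows "Y s \<in> borel_measurable (sigma (space S) (generated_sets S {..t} Y))"
proof (rule measurableI)
  fix D :: "'b set" assume D: "D \<in> sets borel"
  have sub: "generated_sets S {..t} Y \<subseteq> Pow (space S)"
  proof
    fix E assume "E \<in> generated_sets S {..t} Y"
    then have "E \<subseteq> space S" unfolding generated_sets_def by (rule sigma_sets_into_sp[rotated]) auto
    then show "E \<in> Pow (space S)" by blast
  qed
  have "Y s -` D \<inter> space S \<in> generated_sets S {..t} Y"
    unfolding generated_sets_def using D assms(2) by (intro sigma_sets.Basic) auto
  then show "Y s -` D \<inter> space (sigma (space S) (generated_sets S {..t} Y)) \<in> sets (sigma (space S) (generated_sets S {..t} Y))"
    using sub by (simp add: sets_measure_of)
qed simp

lemma stationary_version_expectation:
  fixes Y :: "real \<Rightarrow> 's \<Rightarrow> real^'n" and f :: "real^'n \<Rightarrow> real"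
  assumes "stationary_version S Y P \<rho>" "invariant_density P \<rho>" "f \<in> borel_measurable borel"
  shows "(\<integral>\<omega>. f (Y t \<omega>) \<partial>S) = (LINT x|lborel. f x * \<rho> x)"
proof -
  have Yt: "Y t \<in> borel_measurable S" and d: "distr S borel (Y t) = density lborel \<rho>"
    using assms(1) by (auto simp: stationary_version_def)
  have "(\<integral>\<omega>. f (Y t \<omega>) \<partial>S) = (\<integral>x. f x \<partial>distr S borel (Y t))"
    using assms(3) Yt by (simp add: integral_distr)
  then show ?thesis unfolding d integral_invariant_density[OF assms(2,3)] .
qed

lemma stationary_version_AE:
  fixes Y :: "real \<Rightarrow> 's \<Rightarrow> real^'n"
  assumes "stationary_version S Y P \<rho>" "invariant_density P \<rho>" "AE x in lborel. Q x"
  shows "AE \<omega> in S. Q (Y t \<omega>)"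
proof -
  have Yt: "Y t \<in> borel_measurable S" and d: "distr S borel (Y t) = density lborel \<rho>"
    using assms(1) by (auto simp: stationary_version_def)
  have "AE x in density lborel \<rho>. Q x"
    using assms(3) invariant_density_measurable[OF assms(2)] by (subst AE_density) auto
  then have "AE x in distr S borel (Y t). Q x" unfolding d .
  then show ?thesis using Yt by (rule AE_distrD[rotated])
qed

text \<open>Negative \<open>t\<close> is the point: a window centred at time 0 of the two-sided
  process becomes the beginning of a path that starts at 0.\<close>

lemma stationary_version_law:
  fixes Y :: "real \<Rightarrow> 's \<Rightarrow> real^'n"
  assumes Y: "stationary_version S Y P \<rho>" and P: "path_kernel P" and inv: "invariant_density P \<rho>"
    and E: "E \<in> sets cadlag_space"
  shows "{\<omega>\<in>space S. path_from Y t \<omega> \<in> E} \<in> sets S"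
    and "measure S {\<omega>\<in>space S. path_from Y t \<omega> \<in> E} = measure (stationary_law P \<rho>) E"
proof -
  interpret prob_space S using Y by (simp add: stationary_version_def)
  have Ym: "Y s \<in> borel_measurable S" for s using Y by (simp add: stationary_version_def)
  have rc: "rcll a (\<lambda>t. Y t \<omega>)" if "\<omega> \<in> space S" for a \<omega>
    using Y that by (auto simp: stationary_version_def cadlag_on_UNIV_rcll)
  have pm: "path_from Y t \<in> S \<rightarrow>\<^sub>M cadlag_space" by (rule measurable_path_from) (use rc Ym in auto)
  show Es: "{\<omega>\<in>space S. path_from Y t \<omega> \<in> E} \<in> sets S"
    using measurable_sets[OF pm E] by (simp add: vimage_def Int_def conj_commute)
  have "measure S {\<omega>\<in>space S. path_from Y t \<omega> \<in> E} = (\<integral>\<omega>. 1 * indicator E (path_from Y t \<omega>) \<partial>S)"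
  proof -
    have "(\<integral>\<omega>. 1 * indicator E (path_from Y t \<omega>) \<partial>S) = (\<integral>\<omega>. indicat_real {\<omega>\<in>space S. path_from Y t \<omega> \<in> E} \<omega> \<partial>S)"
      by (intro Bochner_Integration.integral_cong) (auto simp: indicator_def)
    then show ?thesis using Es by simp
  qed
  also have "\<dots> = (\<integral>\<omega>. 1 * measure (P (Y t \<omega>)) E \<partial>S)"
    by (rule markov_expectation[OF _ _ prob_space_axioms subalgebra_past[OF Ym] P _ _ E Es])
      (use Y in \<open>auto simp: stationary_version_def\<close>)
  also have "\<dots> = measure (stationary_law P \<rho>) E"
    using stationary_version_expectation[OF Y inv path_kernel_measure_measurable[OF P E], of t]
    by (simp add: measure_stationary_law[OF P inv E])
  finally show "measure S {\<omega>\<in>space S. path_from Y t \<omega> \<in> E} = measure (stationary_law P \<rho>) E" .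
qed

lemma sets_eventually_heads_to:
  fixes A B :: "(real^'n) set"
  shows "{w\<in>space cadlag_space. \<exists>n::nat. heads_to B A w 0 n} \<in> sets cadlag_space"
proof -
  have "{w\<in>space cadlag_space. heads_to B A w 0 n} \<in> sets cadlag_space" for n :: nat
    by (rule sets_heads_to[where lo = 0 and hi = n, OF measurable_coordinate_cadlag rcll_cadlag_space]) auto
  then show ?thesis by (intro sets.sets_Collect_countable_Ex)
qed

lemma sets_no_bad_jump_cadlag:
  fixes K :: "(real^'n) set"
  assumes "closed K" "0 \<le> a"
  shows "{w\<in>space cadlag_space. no_bad_jump K w a b} \<in> sets cadlag_space"
  by (rule sets_no_bad_jump[where lo = 0 and hi = b, OF measurable_coordinate_cadlag rcll_cadlag_space]) (use assms in auto)

lemma sets_no_bad_jump_all: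
  fixes K :: "(real^'n) set"
  assumes "closed K"
  shows "{w\<in>space cadlag_space. \<forall>b. no_bad_jump K w 0 b} \<in> sets cadlag_space"
proof -
  have "(\<forall>b. no_bad_jump K w 0 b) \<longleftrightarrow> (\<forall>n::nat. no_bad_jump K w 0 n)" for w :: "real \<Rightarrow> real^'n"
    by (meson less_imp_le no_bad_jump_mono order_refl reals_Archimedean2)
  moreover have "{w\<in>space cadlag_space. \<forall>n::nat. no_bad_jump K w 0 n} \<in> sets cadlag_space"
    by (intro sets.sets_Collect_countable_All sets_no_bad_jump_cadlag assms) simp
  ultimately show ?thesis by simp
qed

text \<open>Elements of path space start at 0, so the whole line is covered by starting the path of
  \<open>Y\<close> at \<open>- real n\<close> for every \<open>n\<close>.\<close>

lemma stationary_version_no_bad_jump: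
  fixes Y :: "real \<Rightarrow> 's \<Rightarrow> real^'n"
  assumes Y: "stationary_version S Y P \<rho>" and P: "path_kernel P" and inv: "invariant_density P \<rho>"
    and K: "closed K" and bad: "AE w in stationary_law P \<rho>. \<forall>b. no_bad_jump K w 0 b"
  shows "AE \<omega> in S. \<forall>a b. no_bad_jump K (\<lambda>s. Y s \<omega>) a b"
proof -
  interpret prob_space S using Y by (simp add: stationary_version_def)
  interpret Q: prob_space "stationary_law P \<rho>" using prob_space_stationary_law[OF P inv] .
  let ?E = "{w\<in>space cadlag_space. \<forall>b. no_bad_jump K w 0 b}"
  have E: "?E \<in> sets cadlag_space" using sets_no_bad_jump_all[OF K] .
  have "measure (stationary_law P \<rho>) ?E = 1"
    using bad E by (subst Q.prob_eq_1) (auto simp: sets_stationary_law[OF P] space_stationary_law[OF P])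
  then have "measure S {\<omega>\<in>space S. path_from Y (- real n) \<omega> \<in> ?E} = 1" for n :: nat
    using stationary_version_law(2)[OF Y P inv E] by simp
  then have "AE \<omega> in S. \<omega> \<in> {\<omega>\<in>space S. path_from Y (- real n) \<omega> \<in> ?E}" for n :: nat
    using stationary_version_law(1)[OF Y P inv E] by (subst (asm) prob_eq_1) auto
  then have "AE \<omega> in S. \<forall>n::nat. \<omega> \<in> {\<omega>\<in>space S. path_from Y (- real n) \<omega> \<in> ?E}"
    by (simp only: AE_all_countable) blast
  then show ?thesis
  proof eventually_elim
    case (elim \<omega>)
    show ?case
    proof (intro allI)
      fix a b
      from reals_Archimedean2[of "- a"] obtain n :: nat where n: "- a < real n" ..
      have "no_bad_jump K (path_from Y (- real n) \<omega>) 0 (b + real n)"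
        using elim[rule_format, of n] by blast
      then have "no_bad_jump K (\<lambda>s. Y s \<omega>) (- real n) (- real n + (b + real n))"
        by (simp only: no_bad_jump_path_from)
      then show "no_bad_jump K (\<lambda>s. Y s \<omega>) a b" by (rule no_bad_jump_mono) (use n in auto)
    qed
  qed
qed

text \<open>The event in the definition of \<open>q\<close> is only known to be measurable for the
  completed law. On paths without bad jumps it coincides with an event of path space described by
  \<open>heads_to\<close>, to which the Markov property applies.\<close>

lemma forward_committor_eq:
  fixes A B :: "(real^'n) set"
  assumes P: "path_kernel P" and inv: "invariant_density P \<rho>" and pos: "\<And>x. \<rho> x > 0"
    and AB: "open A" "open B" and bad: "AE w in stationary_law P \<rho>. \<forall>b. no_bad_jump (frontier A \<union> frontier B) w 0 b"
    and q: "forward_committor P A B q"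
  shows "AE x in lborel. q x = measure (P x) {w\<in>space cadlag_space. \<exists>n::nat. heads_to B A w 0 n}"
proof -
  let ?K = "frontier A \<union> frontier B"
  let ?E = "{w\<in>space cadlag_space. \<exists>n::nat. heads_to B A w 0 n}"
  let ?E' = "{w\<in>space cadlag_space. next_hit w B 0 < next_hit w A 0}"
  have "AE x in lborel. AE w in P x. \<forall>b. no_bad_jump ?K w 0 b"
    using bad AE_stationary_law[OF P inv pos, of "\<lambda>w. \<forall>b. no_bad_jump ?K w 0 b"] sets_no_bad_jump_all[of ?K]
    by (auto simp: closed_Un)
  then show ?thesis
  proof eventually_elim
    case (elim x)
    have E: "?E \<in> sets (P x)" using sets_eventually_heads_to by (simp add: path_kernel_sets[OF P])
    have E': "?E' \<in> sets (completion (P x))" "q x = measure (completion (P x)) ?E'"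
      using q by (auto simp: forward_committor_def)
    have "AE w in P x. w \<in> ?E \<longleftrightarrow> w \<in> ?E'"
      using elim AE_space
    proof eventually_elim
      case (elim w)
      then have w: "w \<in> space cadlag_space" by (simp add: path_kernel_space[OF P])
      have "(\<exists>n::nat. heads_to B A w 0 n) \<longleftrightarrow> next_hit w B 0 < next_hit w A 0"
        by (rule heads_to_iff_next_hit[OF AB rcll_cadlag_space[OF w]])
          (use elim(1) no_bad_jump_subset in blast)+
      then show ?case using w by simp
    qed
    then have "AE w in completion (P x). w \<in> ?E \<longleftrightarrow> w \<in> ?E'" by (rule AE_completion)
    then have "measure (completion (P x)) ?E = measure (completion (P x)) ?E'"
      by (intro measure_eq_AE) (use E E' in \<open>auto intro: sets_completionI_sets\<close>)
    then show ?case using E E' by simp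
  qed
qed

text \<open>The future event is integrated out first, with the past event and \<open>Y 0\<close> as
  weight; this leaves a function of \<open>Y 0\<close> times the past event. Conditioning on
  \<open>Y 0\<close> alone then turns the past event into \<open>qb\<close>. The Borel functions
  \<open>p\<close> and \<open>qb'\<close> stand in for \<open>q\<close> and \<open>qb\<close>, which
  are only Lebesgue measurable.\<close>

lemma committor_formula:
  fixes Y :: "real \<Rightarrow> 's \<Rightarrow> real^'n"
  assumes Y: "stationary_version S Y P \<rho>" and P: "path_kernel P" and inv: "invariant_density P \<rho>"
    and pos: "\<And>x. \<rho> x > 0" and AB: "open A" "open B" "closure A \<inter> closure B = {}"
    and bad: "AE w in stationary_law P \<rho>. \<forall>b. no_bad_jump (frontier A \<union> frontier B) w 0 b"
    and q: "forward_committor P A B q" and qb: "backward_committor b \<sigma> F \<nu> \<rho> S Y A B qb"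
    and C: "C \<in> sets borel"
  shows "set_integrable lebesgue C (\<lambda>x. \<rho> x * q x * qb x)"
    and "measure S {\<omega>\<in>space S. Y 0 \<omega> \<in> C \<and> (\<exists>n::nat. came_from A B (\<lambda>s. Y s \<omega>) 0 n)
        \<and> (\<exists>n::nat. heads_to B A (\<lambda>s. Y s \<omega>) 0 n)} = (LINT x:C|lebesgue. \<rho> x * q x * qb x)"
proof -
  let ?K = "frontier A \<union> frontier B"
  interpret prob_space S using Y by (simp add: stationary_version_def)
  have Ym [measurable]: "Y s \<in> borel_measurable S" for s using Y by (simp add: stationary_version_def)
  have rc: "rcll a (\<lambda>t. Y t \<omega>)" if "\<omega> \<in> space S" for a \<omega>
    using Y that by (auto simp: stationary_version_def cadlag_on_UNIV_rcll)
  have clK: "closed ?K" by (simp add: closed_Un)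
  define F0 where "F0 = sigma (space S) (generated_sets S {..0} Y)"
  have sub: "subalgebra S F0" unfolding F0_def by (rule subalgebra_past[OF Ym])
  have spF: "space F0 = space S" using sub by (simp add: subalgebra_def)
  have past: "Y s \<in> borel_measurable F0" if "s \<le> 0" for s
    unfolding F0_def by (rule measurable_past[OF Ym that])
  define Em where "Em = {\<omega>\<in>space S. \<exists>n::nat. came_from A B (\<lambda>s. Y s \<omega>) 0 n}"
  have EmF: "Em \<in> sets F0"
  proof -
    have "{\<omega>\<in>space F0. came_from A B (\<lambda>s. Y s \<omega>) 0 n} \<in> sets F0" for n :: nat
      by (rule sets_came_from[where lo = "- real n" and hi = 0, OF past rc]) (auto simp: spF)
    then have "{\<omega>\<in>space F0. \<exists>n::nat. came_from A B (\<lambda>s. Y s \<omega>) 0 n} \<in> sets F0"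
      by (intro sets.sets_Collect_countable_Ex)
    then show ?thesis by (simp add: Em_def spF)
  qed
  have Em [measurable]: "Em \<in> sets S" using EmF sub by (auto simp: subalgebra_def)
  define Ep where "Ep = {w\<in>space cadlag_space. \<exists>n::nat. heads_to B A w 0 n}"
  have Ep: "Ep \<in> sets cadlag_space" unfolding Ep_def by (rule sets_eventually_heads_to)
  define p where "p x = measure (P x) Ep" for x
  have p [measurable]: "p \<in> borel_measurable borel" unfolding p_def by (rule path_kernel_measure_measurable[OF P Ep])
  have p01: "0 \<le> p x" "p x \<le> 1" for x unfolding p_def using path_kernel_measure_le_1[OF P] by auto
  have pq: "AE x in lborel. q x = p x"
    using forward_committor_eq[OF P inv pos AB(1,2) bad q] by (simp add: p_def Ep_def)
  obtain qb' where qb' [measurable]: "qb' \<in> borel_measurable lborel" and qbq: "AE x in lborel. qb x = qb' x"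
    using completion_ex_borel_measurable_real[of qb lborel] qb by (auto simp: backward_committor_def)
  define G where "G = vimage_algebra (space S) (Y 0) borel"
  have subG: "subalgebra S G"
    unfolding G_def subalgebra_def by (auto simp: sets_vimage_algebra2 measurable_sets)
  interpret G: finite_measure_subalgebra S G by unfold_locales (rule subG)
  define El where "El = {\<omega>\<in>space S. last_hit (\<lambda>s. Y s \<omega>) B 0 < last_hit (\<lambda>s. Y s \<omega>) A 0}"
  have El [measurable]: "El \<in> sets S"
    and cond: "AE \<omega> in S. real_cond_exp S G (indicator El) \<omega> = qb (Y 0 \<omega>)"
    using qb unfolding backward_committor_def El_def G_def Let_def by auto
  \<comment> \<open>Two versions of the past event: \<open>Em\<close> belongs to the
    \<sigma>-algebra of the past, \<open>El\<close> is the event whose conditional probability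
    defines \<open>qb\<close>.\<close>
  have EmEl: "AE \<omega> in S. \<omega> \<in> Em \<longleftrightarrow> \<omega> \<in> El"
    using stationary_version_no_bad_jump[OF Y P inv clK bad] AE_space
  proof eventually_elim
    case (elim \<omega>)
    have "(\<exists>n::nat. came_from A B (\<lambda>s. Y s \<omega>) 0 n) \<longleftrightarrow> last_hit (\<lambda>s. Y s \<omega>) B 0 < last_hit (\<lambda>s. Y s \<omega>) A 0"
      by (rule came_from_iff_last_hit[OF AB(1,2) rc[OF elim(2)] _ _ AB(3)])
        (use elim(1) no_bad_jump_subset in blast)+
    then show ?case using elim(2) by (simp add: Em_def El_def)
  qed
  define f where "f \<omega> = indicator C (Y 0 \<omega>) * p (Y 0 \<omega>)" for \<omega>
  have Y0G: "Y 0 \<in> borel_measurable G" unfolding G_def by (rule measurable_vimage_algebra1) auto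
  have fG: "f \<in> borel_measurable G"
    unfolding f_def using measurable_compose[OF Y0G p] measurable_compose[OF Y0G borel_measurable_indicator[OF C]]
    by measurable
  have fS [measurable]: "f \<in> borel_measurable S" using fG subG by (rule measurable_from_subalg[rotated])
  have f01: "0 \<le> f \<omega>" "f \<omega> \<le> 1" for \<omega> unfolding f_def using p01 by (auto simp: indicator_def)
  have fint: "integrable S (\<lambda>\<omega>. f \<omega> * indicator El \<omega>)"
    using f01 by (intro integrable_const_bound[of _ 1] AE_I2) (auto simp: indicator_def)
  have c1: "integrable S (\<lambda>\<omega>. f \<omega> * real_cond_exp S G (indicator El) \<omega>)"
    by (rule G.real_cond_exp_intg(1)[OF fint fG]) measurable
  have c2: "(\<integral>\<omega>. f \<omega> * real_cond_exp S G (indicator El) \<omega> \<partial>S) = (\<integral>\<omega>. f \<omega> * indicator El \<omega> \<partial>S)"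
    by (rule G.real_cond_exp_intg(2)[OF fint fG]) measurable
  define k where "k x = indicator C x * p x * qb' x" for x
  have k [measurable]: "k \<in> borel_measurable borel" unfolding k_def using C qb' by measurable
  have fk: "AE \<omega> in S. f \<omega> * real_cond_exp S G (indicator El) \<omega> = k (Y 0 \<omega>)"
    using cond stationary_version_AE[OF Y inv qbq, of 0] by eventually_elim (simp add: f_def k_def)
  have kint: "integrable S (\<lambda>\<omega>. k (Y 0 \<omega>))"
    by (rule integrable_cong_AE_imp[OF c1 measurable_compose[OF Ym k] fk])
  have dY: "distr S borel (Y 0) = density lborel \<rho>" using Y by (auto simp: stationary_version_def)
  have "integrable (distr S borel (Y 0)) k" using kint by (subst integrable_distr_eq) auto
  then have kl: "integrable lborel (\<lambda>x. \<rho> x * k x)"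
    unfolding dY using invariant_density_measurable[OF inv] less_imp_le[OF pos]
    by (subst (asm) integrable_density) auto
  have ae: "AE x in lebesgue. \<rho> x * k x = indicator C x *\<^sub>R (\<rho> x * q x * qb x)"
  proof (rule AE_completion)
    show "AE x in lborel. \<rho> x * k x = indicator C x *\<^sub>R (\<rho> x * q x * qb x)"
      using pq qbq by eventually_elim (simp add: k_def)
  qed
  have rm: "\<rho> \<in> borel_measurable lebesgue" using invariant_density_measurable[OF inv] by (simp add: measurable_completion)
  have gm: "(\<lambda>x. indicator C x *\<^sub>R (\<rho> x * q x * qb x)) \<in> borel_measurable lebesgue"
  proof -
    have q': "q \<in> borel_measurable lebesgue" and qb'': "qb \<in> borel_measurable lebesgue"
      using q qb by (auto simp: forward_committor_def backward_committor_def)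
    have "C \<in> sets lebesgue" using C by (auto intro: sets_completionI_sets)
    then show ?thesis
      by (intro borel_measurable_scaleR borel_measurable_times rm q' qb'' borel_measurable_indicator)
  qed
  have kl': "integrable lebesgue (\<lambda>x. \<rho> x * k x)" using kl by (simp add: integrable_completion)
  show "set_integrable lebesgue C (\<lambda>x. \<rho> x * q x * qb x)"
    unfolding set_integrable_def by (rule integrable_cong_AE_imp[OF kl' gm ae])
  have "{\<omega>\<in>space S. Y 0 \<omega> \<in> C \<and> (\<exists>n::nat. came_from A B (\<lambda>s. Y s \<omega>) 0 n) \<and> (\<exists>n::nat. heads_to B A (\<lambda>s. Y s \<omega>) 0 n)}
    = {\<omega>\<in>space S. Y 0 \<omega> \<in> C \<and> \<omega> \<in> Em \<and> path_from Y 0 \<omega> \<in> Ep}" (is "?L = _")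
    using path_from_in_cadlag_space[OF rc] by (auto simp: Em_def Ep_def heads_to_path_from)
  moreover have "{\<omega>\<in>space S. Y 0 \<omega> \<in> C \<and> \<omega> \<in> Em \<and> path_from Y 0 \<omega> \<in> Ep} \<in> sets S"
  proof -
    have "{\<omega>\<in>space S. path_from Y 0 \<omega> \<in> Ep} \<in> sets S" by (rule stationary_version_law(1)[OF Y P inv Ep])
    then have "(Y 0 -` C \<inter> space S) \<inter> Em \<inter> {\<omega>\<in>space S. path_from Y 0 \<omega> \<in> Ep} \<in> sets S"
      using measurable_sets[OF Ym C] Em by blast
    also have "(Y 0 -` C \<inter> space S) \<inter> Em \<inter> {\<omega>\<in>space S. path_from Y 0 \<omega> \<in> Ep} = {\<omega>\<in>space S. Y 0 \<omega> \<in> C \<and> \<omega> \<in> Em \<and> path_from Y 0 \<omega> \<in> Ep}"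
      by auto
    finally show ?thesis .
  qed
  ultimately have "measure S ?L = (\<integral>\<omega>. indicat_real {\<omega>\<in>space S. Y 0 \<omega> \<in> C \<and> \<omega> \<in> Em \<and> path_from Y 0 \<omega> \<in> Ep} \<omega> \<partial>S)"
    by simp
  also have "\<dots> = (\<integral>\<omega>. (indicator C (Y 0 \<omega>) * indicator Em \<omega>) * indicator Ep (path_from Y 0 \<omega>) \<partial>S)"
    by (intro Bochner_Integration.integral_cong) (auto simp: indicator_def)
  also have "\<dots> = (\<integral>\<omega>. (indicator C (Y 0 \<omega>) * indicator Em \<omega>) * measure (P (Y 0 \<omega>)) Ep \<partial>S)"
  proof (rule markov_expectation[OF _ _ prob_space_axioms _ P _ _ Ep])
    show "markov_process UNIV S (\<lambda>t. sigma (space S) (generated_sets S {..t} Y)) Y P"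
      using Y by (simp add: stationary_version_def)
    show "subalgebra S (sigma (space S) (generated_sets S {..0} Y))" using sub by (simp add: F0_def)
    show "(\<lambda>\<omega>. indicat_real C (Y 0 \<omega>) * indicat_real Em \<omega>) \<in> borel_measurable (sigma (space S) (generated_sets S {..0} Y))"
      using measurable_compose[OF past borel_measurable_indicator[OF C], of 0] borel_measurable_indicator[OF EmF]
      unfolding F0_def by measurable
    show "{\<omega>\<in>space S. path_from Y 0 \<omega> \<in> Ep} \<in> sets S" by (rule stationary_version_law(1)[OF Y P inv Ep])
  qed (auto simp: indicator_def)
  also have "\<dots> = (\<integral>\<omega>. f \<omega> * indicator El \<omega> \<partial>S)"
  proof (rule integral_cong_AE)
    show "AE \<omega> in S. indicat_real C (Y 0 \<omega>) * indicat_real Em \<omega> * measure (P (Y 0 \<omega>)) Ep = f \<omega> * indicat_real El \<omega>"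
      using EmEl by eventually_elim (auto simp: f_def p_def indicator_def)
    have "(\<lambda>\<omega>. indicat_real C (Y 0 \<omega>) * indicat_real Em \<omega> * p (Y 0 \<omega>)) \<in> borel_measurable S"
      using measurable_compose[OF Ym borel_measurable_indicator[OF C], of 0] by measurable
    then show "(\<lambda>\<omega>. indicat_real C (Y 0 \<omega>) * indicat_real Em \<omega> * measure (P (Y 0 \<omega>)) Ep) \<in> borel_measurable S"
      by (simp add: p_def)
  qed measurable
  also have "\<dots> = (\<integral>\<omega>. k (Y 0 \<omega>) \<partial>S)"
    unfolding c2[symmetric] using fk c1 kint by (intro integral_cong_AE) auto
  also have "\<dots> = (LINT x|lborel. k x * \<rho> x)" by (rule stationary_version_expectation[OF Y inv k])
  also have "\<dots> = (LINT x|lebesgue. \<rho> x * k x)"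
    using kl by (subst integral_completion) (auto simp: mult.commute)
  also have "\<dots> = (LINT x:C|lebesgue. \<rho> x * q x * qb x)"
    unfolding set_lebesgue_integral_def using ae gm kl' by (intro integral_cong_AE) auto
  finally show "measure S ?L = (LINT x:C|lebesgue. \<rho> x * q x * qb x)" .
qed

section \<open>Occupation of reactive times\<close>

text \<open>\<psi> and \<delta> describe the window that starts at \<open>t\<close>, \<phi> its
  centre \<open>t + h\<close>. Aligning them loses a piece of length \<open>h\<close> at the
  beginning of the integral of \<phi> and one at the end of that of \<psi>, whence
  \<open>2 * h / T\<close>.\<close>

lemma averages_close:
  fixes \<phi> \<psi> \<delta> :: "real \<Rightarrow> real"
  assumes m: "\<phi> \<in> borel_measurable lborel" "\<psi> \<in> borel_measurable lborel" "\<delta> \<in> borel_measurable lborel"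
    and b: "\<And>t. \<bar>\<phi> t\<bar> \<le> 1" "\<And>t. \<bar>\<psi> t\<bar> \<le> 1" "\<And>t. \<bar>\<delta> t\<bar> \<le> 1"
    and h: "0 \<le> h" and close: "\<And>t. 0 \<le> t \<Longrightarrow> \<bar>\<phi> (t + h) - \<psi> t\<bar> \<le> \<delta> t" and T: "h < T"
  shows "\<bar>(LINT t:{0..T}|lborel. \<phi> t) / T - (LINT t:{0..T}|lborel. \<psi> t) / T\<bar> \<le> 2 * h / T + (LINT t:{0..T}|lborel. \<delta> t) / T"
proof -
  have "(LINT t:{h..T}|lborel. \<phi> t) = (LINT t|lborel. indicator {h..T} (h + 1 * t) *\<^sub>R \<phi> (h + 1 * t))"
    unfolding set_lebesgue_integral_def by (subst lborel_integral_real_affine[of 1 _ h]) auto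
  also have "\<dots> = (LINT t:{0..T-h}|lborel. \<phi> (t + h))"
    unfolding set_lebesgue_integral_def
    by (intro Bochner_Integration.integral_cong) (auto simp: indicator_def add.commute)
  finally have shift: "(LINT t:{h..T}|lborel. \<phi> t) = (LINT t:{0..T-h}|lborel. \<phi> (t + h))" .
  have s\<phi>: "(LINT t:{0..T}|lborel. \<phi> t) = (LINT t:{0..h}|lborel. \<phi> t) + (LINT t:{h..T}|lborel. \<phi> t)"
    using h T by (intro set_integral_split m b) auto
  have s\<psi>: "(LINT t:{0..T}|lborel. \<psi> t) = (LINT t:{0..T-h}|lborel. \<psi> t) + (LINT t:{T-h..T}|lborel. \<psi> t)"
    using h T by (intro set_integral_split m b) auto
  have s\<delta>: "(LINT t:{0..T}|lborel. \<delta> t) = (LINT t:{0..T-h}|lborel. \<delta> t) + (LINT t:{T-h..T}|lborel. \<delta> t)"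
    using h T by (intro set_integral_split m b) auto
  have m': "(\<lambda>t. \<phi> (t + h)) \<in> borel_measurable lborel" using m(1) by measurable
  have i: "set_integrable lborel {0..T-h} (\<lambda>t. \<phi> (t + h))" "set_integrable lborel {0..T-h} \<psi>" "set_integrable lborel {0..T-h} \<delta>"
    by (auto intro!: set_integrable_bounded[of _ 1] m m' b)
  have "\<bar>(LINT t:{0..T-h}|lborel. \<phi> (t + h)) - (LINT t:{0..T-h}|lborel. \<psi> t)\<bar> = \<bar>LINT t:{0..T-h}|lborel. \<phi> (t + h) - \<psi> t\<bar>"
    using i by (subst set_integral_diff) auto
  also have "\<dots> \<le> (LINT t:{0..T-h}|lborel. \<bar>\<phi> (t + h) - \<psi> t\<bar>)"
    using integral_abs_bound[of lborel "\<lambda>t. indicator {0..T-h} t *\<^sub>R (\<phi> (t + h) - \<psi> t)"]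
    unfolding set_lebesgue_integral_def by (simp add: abs_mult)
  also have "\<dots> \<le> (LINT t:{0..T-h}|lborel. \<delta> t)"
    using i close by (intro set_integral_mono set_integrable_abs set_integral_diff) auto
  finally have 1: "\<bar>(LINT t:{0..T-h}|lborel. \<phi> (t + h)) - (LINT t:{0..T-h}|lborel. \<psi> t)\<bar> \<le> (LINT t:{0..T-h}|lborel. \<delta> t)" .
  have 2: "\<bar>LINT t:{0..h}|lborel. \<phi> t\<bar> \<le> h" using set_integral_abs_le[OF m(1) b(1) h] by simp
  have 3: "\<bar>LINT t:{T-h..T}|lborel. \<psi> t\<bar> \<le> h" using set_integral_abs_le[OF m(2) b(2), of "T - h" T] h by simp
  have 4: "0 \<le> (LINT t:{T-h..T}|lborel. \<delta> t)"
  proof -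
    have "0 \<le> \<delta> t" if "0 \<le> t" for t using close[OF that] by linarith
    then show ?thesis unfolding set_lebesgue_integral_def using T h
      by (intro Bochner_Integration.integral_nonneg) (auto simp: indicator_def)
  qed
  have "\<bar>(LINT t:{0..T}|lborel. \<phi> t) - (LINT t:{0..T}|lborel. \<psi> t)\<bar> \<le> 2 * h + (LINT t:{0..T}|lborel. \<delta> t)"
    unfolding s\<phi> s\<psi> s\<delta> shift using 1 2 3 4 by linarith
  then have "\<bar>(LINT t:{0..T}|lborel. \<phi> t) - (LINT t:{0..T}|lborel. \<psi> t)\<bar> / T \<le> (2 * h + (LINT t:{0..T}|lborel. \<delta> t)) / T"
    using T h by (intro divide_right_mono) auto
  moreover have "\<bar>(LINT t:{0..T}|lborel. \<phi> t) / T - (LINT t:{0..T}|lborel. \<psi> t) / T\<bar>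
    = \<bar>(LINT t:{0..T}|lborel. \<phi> t) - (LINT t:{0..T}|lborel. \<psi> t)\<bar> / T"
    using T h by (simp add: abs_divide diff_divide_distrib[symmetric])
  ultimately show ?thesis by (simp only: add_divide_distrib)
qed

lemma (in finite_measure) measure_symmetric_difference_le:
  assumes "E \<in> sets M" "E' \<in> sets M" "D \<in> sets M" "E \<subseteq> E' \<union> D" "E' \<subseteq> E \<union> D"
  shows "\<bar>measure M E - measure M E'\<bar> \<le> measure M D"
proof -
  have "measure M E \<le> measure M (E' \<union> D)" "measure M E' \<le> measure M (E \<union> D)"
    using assms by (auto intro!: finite_measure_mono)
  moreover have "measure M (E' \<union> D) \<le> measure M E' + measure M D" "measure M (E \<union> D) \<le> measure M E + measure M D"
    using assms by (auto intro!: measure_Un_le)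
  ultimately show ?thesis by linarith
qed

text \<open>Elements of path space start at 0, so a window has length \<open>2 * h\<close> and the
  time of interest is its centre \<open>h\<close>.\<close>

definition reactive_window :: "(real^'n) set \<Rightarrow> (real^'n) set \<Rightarrow> (real^'n) set \<Rightarrow> real \<Rightarrow> (real \<Rightarrow> real^'n) \<Rightarrow> bool" where
  "reactive_window C A B h w \<longleftrightarrow> w h \<in> C \<and> came_from A B w h h \<and> heads_to B A w h h"

text \<open>These are the conditions of \<open>reactive_times_window\<close> at the centre,
  expressed for a path that starts at 0.\<close>

definition good_window :: "(real^'n) set \<Rightarrow> (real^'n) set \<Rightarrow> real \<Rightarrow> (real \<Rightarrow> real^'n) \<Rightarrow> bool" where
  "good_window K A h w \<longleftrightarrow> no_bad_jump K w 0 (2 * h) \<and> (w \<longlongrightarrow> w h) (at_left h) \<and>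
     (\<exists>s. 0 < s \<and> s < h \<and> w s \<in> A) \<and> (\<exists>s. h < s \<and> s < 2 * h \<and> w s \<in> A)"

lemma sets_reactive_window:
  assumes Z: "\<And>s. 0 \<le> s \<Longrightarrow> s \<le> 2 * h \<Longrightarrow> Z s \<in> borel_measurable N"
    and rc: "\<And>\<omega>. \<omega> \<in> space N \<Longrightarrow> rcll 0 (\<lambda>s. Z s \<omega>)" and h: "0 < h" and C: "C \<in> sets borel"
  shows "{\<omega>\<in>space N. reactive_window C A B h (\<lambda>s. Z s \<omega>)} \<in> sets N"
proof -
  have "(Z h -` C \<inter> space N) \<inter> {\<omega>\<in>space N. came_from A B (\<lambda>s. Z s \<omega>) h h} \<inter> {\<omega>\<in>space N. heads_to B A (\<lambda>s. Z s \<omega>) h h} \<in> sets N"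
    using h C by (intro sets.Int measurable_sets[OF Z] sets_came_from[OF Z rc] sets_heads_to[OF Z rc]) auto
  also have "(Z h -` C \<inter> space N) \<inter> {\<omega>\<in>space N. came_from A B (\<lambda>s. Z s \<omega>) h h} \<inter> {\<omega>\<in>space N. heads_to B A (\<lambda>s. Z s \<omega>) h h}
    = {\<omega>\<in>space N. reactive_window C A B h (\<lambda>s. Z s \<omega>)}" by (auto simp: reactive_window_def)
  finally show ?thesis .
qed

lemma sets_good_window:
  assumes Z: "\<And>s. 0 \<le> s \<Longrightarrow> s \<le> 2 * h \<Longrightarrow> Z s \<in> borel_measurable N"
    and rc: "\<And>\<omega>. \<omega> \<in> space N \<Longrightarrow> rcll 0 (\<lambda>s. Z s \<omega>)" and h: "0 < h" and K: "closed K" and A: "open A"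
  shows "{\<omega>\<in>space N. good_window K A h (\<lambda>s. Z s \<omega>)} \<in> sets N"
proof -
  have "{\<omega>\<in>space N. no_bad_jump K (\<lambda>s. Z s \<omega>) 0 (2 * h)} \<inter> {\<omega>\<in>space N. ((\<lambda>s. Z s \<omega>) \<longlongrightarrow> Z h \<omega>) (at_left h)}
      \<inter> {\<omega>\<in>space N. \<exists>s. 0 < s \<and> s < h \<and> Z s \<omega> \<in> A} \<inter> {\<omega>\<in>space N. \<exists>s. h < s \<and> s < 2 * h \<and> Z s \<omega> \<in> A} \<in> sets N"
    using h by (intro sets.Int sets_no_bad_jump[OF Z rc K] sets_left_continuous[OF Z rc] sets_visits[OF Z rc A]) auto
  also have "{\<omega>\<in>space N. no_bad_jump K (\<lambda>s. Z s \<omega>) 0 (2 * h)} \<inter> {\<omega>\<in>space N. ((\<lambda>s. Z s \<omega>) \<longlongrightarrow> Z h \<omega>) (at_left h)}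
      \<inter> {\<omega>\<in>space N. \<exists>s. 0 < s \<and> s < h \<and> Z s \<omega> \<in> A} \<inter> {\<omega>\<in>space N. \<exists>s. h < s \<and> s < 2 * h \<and> Z s \<omega> \<in> A}
    = {\<omega>\<in>space N. good_window K A h (\<lambda>s. Z s \<omega>)}" by (auto simp: good_window_def)
  finally show ?thesis .
qed

lemma left_limit_path_from:
  assumes "0 < v"
  shows "(path_from X t \<omega> \<longlongrightarrow> l) (at_left v) \<longleftrightarrow> ((\<lambda>s. X s \<omega>) \<longlongrightarrow> l) (at_left (t + v))"
proof -
  have "(path_from X t \<omega> \<longlongrightarrow> l) (at_left v) \<longleftrightarrow> ((\<lambda>s. X (t + s) \<omega>) \<longlongrightarrow> l) (at_left v)"
    using eventually_at_left_real[OF assms] by (intro tendsto_cong, rule eventually_mono) (auto simp: path_from_apply)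
  then show ?thesis using tendsto_at_left_shift[of "\<lambda>s. X s \<omega>"] by blast
qed

lemma good_window_path_from:
  assumes "0 < h"
  shows "good_window K A h (path_from X t \<omega>) \<longleftrightarrow> no_bad_jump K (\<lambda>s. X s \<omega>) t (t + 2 * h) \<and>
    ((\<lambda>s. X s \<omega>) \<longlongrightarrow> X (t + h) \<omega>) (at_left (t + h)) \<and>
    (\<exists>s. t < s \<and> s < t + h \<and> X s \<omega> \<in> A) \<and> (\<exists>s. t + h < s \<and> s < t + 2 * h \<and> X s \<omega> \<in> A)"
proof -
  have "(\<exists>s. a < s \<and> s < b \<and> path_from X t \<omega> s \<in> A) \<longleftrightarrow> (\<exists>s. t + a < s \<and> s < t + b \<and> X s \<omega> \<in> A)" if "0 \<le> a" for a b
  proof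
    assume "\<exists>s. a < s \<and> s < b \<and> path_from X t \<omega> s \<in> A"
    then obtain s where "a < s" "s < b" "path_from X t \<omega> s \<in> A" by blast
    then show "\<exists>s. t + a < s \<and> s < t + b \<and> X s \<omega> \<in> A" using that by (intro exI[of _ "t + s"]) (auto simp: path_from_apply)
  next
    assume "\<exists>s. t + a < s \<and> s < t + b \<and> X s \<omega> \<in> A"
    then obtain s where "t + a < s" "s < t + b" "X s \<omega> \<in> A" by blast
    then show "\<exists>s. a < s \<and> s < b \<and> path_from X t \<omega> s \<in> A" using that
      by (intro exI[of _ "s - t"]) (auto simp: path_from_apply)
  qed
  from this[of 0 h] this[of h "2 * h"] show ?thesis using assms
    by (simp add: good_window_def no_bad_jump_path_from left_limit_path_from path_from_apply)
qed

lemma reactive_window_path_from: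
  assumes "0 < h"
  shows "reactive_window C A B h (path_from X t \<omega>) \<longleftrightarrow>
    X (t + h) \<omega> \<in> C \<and> came_from A B (\<lambda>s. X s \<omega>) (t + h) h \<and> heads_to B A (\<lambda>s. X s \<omega>) (t + h) h"
  using assms by (simp add: reactive_window_def path_from_apply came_from_path_from heads_to_path_from)

definition reactive_paths :: "(real^'n) set \<Rightarrow> (real^'n) set \<Rightarrow> (real^'n) set \<Rightarrow> real \<Rightarrow> (real \<Rightarrow> real^'n) set" where
  "reactive_paths C A B h = {w\<in>space cadlag_space. reactive_window C A B h w}"

definition bad_paths :: "(real^'n) set \<Rightarrow> (real^'n) set \<Rightarrow> real \<Rightarrow> (real \<Rightarrow> real^'n) set" where
  "bad_paths K A h = {w\<in>space cadlag_space. \<not> good_window K A h w}"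

lemma sets_reactive_paths: "0 < h \<Longrightarrow> C \<in> sets borel \<Longrightarrow> reactive_paths C A B h \<in> sets cadlag_space"
  unfolding reactive_paths_def by (intro sets_reactive_window measurable_coordinate_cadlag rcll_cadlag_space) auto

lemma sets_bad_paths: "0 < h \<Longrightarrow> closed K \<Longrightarrow> open A \<Longrightarrow> bad_paths K A h \<in> sets cadlag_space"
  unfolding bad_paths_def
  by (intro sets.sets_Collect_neg sets_good_window measurable_coordinate_cadlag rcll_cadlag_space) auto

text \<open>The centre of the window is moved to time 0 of \<open>Y\<close>. Off the bad windows the
  truncated events agree with the untruncated ones, whose probability is given by the
  committors.\<close>

lemma reactive_paths_close:
  fixes Y :: "real \<Rightarrow> 's \<Rightarrow> real^'n"
  assumes Y: "stationary_version S Y P \<rho>" and P: "path_kernel P" and inv: "invariant_density P \<rho>"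
    and pos: "\<And>x. \<rho> x > 0" and AB: "open A" "open B" "closure A \<inter> closure B = {}"
    and bad: "AE w in stationary_law P \<rho>. \<forall>b. no_bad_jump (frontier A \<union> frontier B) w 0 b"
    and q: "forward_committor P A B q" and qb: "backward_committor b \<sigma> F \<nu> \<rho> S Y A B qb"
    and C: "C \<in> sets borel" and h: "0 < h"
  shows "\<bar>measure (stationary_law P \<rho>) (reactive_paths C A B h) - (LINT x:C|lebesgue. \<rho> x * q x * qb x)\<bar>
     \<le> measure (stationary_law P \<rho>) (bad_paths (frontier A \<union> frontier B) A h)"
proof -
  let ?K = "frontier A \<union> frontier B"
  interpret prob_space S using Y by (simp add: stationary_version_def)
  have Ym [measurable]: "Y s \<in> borel_measurable S" for s using Y by (simp add: stationary_version_def)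
  have rc: "rcll a (\<lambda>t. Y t \<omega>)" if "\<omega> \<in> space S" for a \<omega>
    using Y that by (auto simp: stationary_version_def cadlag_on_UNIV_rcll)
  have K: "closed ?K" by (simp add: closed_Un)
  note law = stationary_version_law[OF Y P inv, where t = "- h"]
  note R = sets_reactive_paths[OF h C, of A B] and D = sets_bad_paths[OF h K AB(1)]
  let ?E = "{\<omega>\<in>space S. path_from Y (- h) \<omega> \<in> reactive_paths C A B h}"
  let ?E' = "{\<omega>\<in>space S. Y 0 \<omega> \<in> C \<and> (\<exists>n::nat. came_from A B (\<lambda>s. Y s \<omega>) 0 n)
        \<and> (\<exists>n::nat. heads_to B A (\<lambda>s. Y s \<omega>) 0 n)}"
  let ?D = "{\<omega>\<in>space S. path_from Y (- h) \<omega> \<in> bad_paths ?K A h}"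
  have mem: "path_from Y (- h) \<omega> \<in> space cadlag_space" if "\<omega> \<in> space S" for \<omega>
    by (rule path_from_in_cadlag_space) (rule rc[OF that])
  have E': "?E' \<in> sets S"
  proof -
    have 1: "{\<omega>\<in>space S. came_from A B (\<lambda>s. Y s \<omega>) 0 n} \<in> sets S" for n :: nat
      by (rule sets_came_from[where lo = "- real n" and hi = 0, OF Ym rc]) auto
    have 2: "{\<omega>\<in>space S. heads_to B A (\<lambda>s. Y s \<omega>) 0 n} \<in> sets S" for n :: nat
      by (rule sets_heads_to[where lo = 0 and hi = n, OF Ym rc]) auto
    have "{\<omega>\<in>space S. \<exists>n::nat. came_from A B (\<lambda>s. Y s \<omega>) 0 n} \<in> sets S"
      "{\<omega>\<in>space S. \<exists>n::nat. heads_to B A (\<lambda>s. Y s \<omega>) 0 n} \<in> sets S"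
      using 1 2 by (auto intro!: sets.sets_Collect_countable_Ex)
    then have "(Y 0 -` C \<inter> space S) \<inter> {\<omega>\<in>space S. \<exists>n::nat. came_from A B (\<lambda>s. Y s \<omega>) 0 n}
      \<inter> {\<omega>\<in>space S. \<exists>n::nat. heads_to B A (\<lambda>s. Y s \<omega>) 0 n} \<in> sets S"
      using measurable_sets[OF Ym C] by blast
    also have "(Y 0 -` C \<inter> space S) \<inter> {\<omega>\<in>space S. \<exists>n::nat. came_from A B (\<lambda>s. Y s \<omega>) 0 n}
      \<inter> {\<omega>\<in>space S. \<exists>n::nat. heads_to B A (\<lambda>s. Y s \<omega>) 0 n} = ?E'" by auto
    finally show ?thesis .
  qed
  have eq: "\<omega> \<in> ?E \<longleftrightarrow> \<omega> \<in> ?E'" if \<omega>: "\<omega> \<in> space S" "\<omega> \<notin> ?D" for \<omega>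
  proof -
    have g: "good_window ?K A h (path_from Y (- h) \<omega>)" using \<omega> mem by (auto simp: bad_paths_def)
    have "came_from A B (\<lambda>s. Y s \<omega>) 0 h \<longleftrightarrow> (\<exists>n::nat. came_from A B (\<lambda>s. Y s \<omega>) 0 n)"
      by (rule came_from_truncate) (use g h in \<open>auto simp: good_window_path_from\<close>)
    moreover have "heads_to B A (\<lambda>s. Y s \<omega>) 0 h \<longleftrightarrow> (\<exists>n::nat. heads_to B A (\<lambda>s. Y s \<omega>) 0 n)"
      by (rule heads_to_truncate) (use g h in \<open>auto simp: good_window_path_from\<close>)
    ultimately show ?thesis using \<omega> mem[OF \<omega>(1)] h by (simp add: reactive_paths_def reactive_window_path_from)
  qed
  have "\<bar>measure S ?E - measure S ?E'\<bar> \<le> measure S ?D"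
    by (rule measure_symmetric_difference_le[OF law(1)[OF R] E' law(1)[OF D]]) (use eq in blast)+
  then show ?thesis
    unfolding law(2)[OF R] law(2)[OF D] committor_formula(2)[OF Y P inv pos AB bad q qb C] .
qed

text \<open>Bad jumps and a jump at the centre have probability 0, which leaves missing visits to
  \<open>A\<close>. By stationarity both halves of the window fail with the same probability, and in
  the limit only paths that never visit \<open>A\<close> remain.\<close>

lemma measure_bad_paths_tendsto_0:
  fixes Y :: "real \<Rightarrow> 's \<Rightarrow> real^'n"
  assumes Y: "stationary_version S Y P \<rho>" and P: "path_kernel P" and inv: "invariant_density P \<rho>"
    and A: "open A" and K: "closed K"
    and bad: "AE w in stationary_law P \<rho>. \<forall>b. no_bad_jump K w 0 b"
    and cont: "\<And>h. 0 < h \<Longrightarrow> AE w in stationary_law P \<rho>. (w \<longlongrightarrow> w h) (at_left h)"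
    and never: "measure (stationary_law P \<rho>) {w\<in>space cadlag_space. \<not> (\<exists>s>0. w s \<in> A)} = 0"
  shows "(\<lambda>n. measure (stationary_law P \<rho>) (bad_paths K A (real (Suc n)))) \<longlonglongrightarrow> 0"
proof -
  let ?Q = "stationary_law P \<rho>"
  interpret Q: prob_space ?Q using prob_space_stationary_law[OF P inv] .
  define V where "V a b = {w\<in>space (cadlag_space :: (real \<Rightarrow> real^'n) measure). \<not> (\<exists>s. a < s \<and> s < b \<and> w s \<in> A)}" for a b
  have V: "V a b \<in> sets cadlag_space" if "0 \<le> a" for a b
    unfolding V_def
    by (intro sets.sets_Collect_neg sets_visits[where lo = 0 and hi = b, OF measurable_coordinate_cadlag rcll_cadlag_space _ that order_refl]) (use A in auto)
  have VQ: "V a b \<in> sets ?Q" if "0 \<le> a" for a b using V[OF that] by (simp add: sets_stationary_law[OF P])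
  have shift: "measure ?Q (V h (h + h')) = measure ?Q (V 0 h')" if h: "0 \<le> h" for h h'
  proof -
    have rc: "rcll a (\<lambda>t. Y t \<omega>)" if "\<omega> \<in> space S" for a \<omega>
      using Y that by (auto simp: stationary_version_def cadlag_on_UNIV_rcll)
    have "{\<omega>\<in>space S. path_from Y 0 \<omega> \<in> V h (h + h')} = {\<omega>\<in>space S. path_from Y h \<omega> \<in> V 0 h'}"
    proof -
      have "(\<exists>s. h < s \<and> s < h + h' \<and> path_from Y 0 \<omega> s \<in> A) \<longleftrightarrow> (\<exists>s. 0 < s \<and> s < h' \<and> path_from Y h \<omega> s \<in> A)" for \<omega>
      proof
        assume "\<exists>s. h < s \<and> s < h + h' \<and> path_from Y 0 \<omega> s \<in> A"
        then obtain s where "h < s" "s < h + h'" "path_from Y 0 \<omega> s \<in> A" by blast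
        then show "\<exists>s. 0 < s \<and> s < h' \<and> path_from Y h \<omega> s \<in> A"
          using h by (intro exI[of _ "s - h"]) (auto simp: path_from_apply)
      next
        assume "\<exists>s. 0 < s \<and> s < h' \<and> path_from Y h \<omega> s \<in> A"
        then obtain s where "0 < s" "s < h'" "path_from Y h \<omega> s \<in> A" by blast
        then show "\<exists>s. h < s \<and> s < h + h' \<and> path_from Y 0 \<omega> s \<in> A"
          using h by (intro exI[of _ "h + s"]) (auto simp: path_from_apply)
      qed
      moreover have "path_from Y t \<omega> \<in> space cadlag_space" if "\<omega> \<in> space S" for t \<omega>
        by (rule path_from_in_cadlag_space) (rule rc[OF that])
      ultimately show ?thesis unfolding V_def by blast
    qed
    then show ?thesis
      using stationary_version_law(2)[OF Y P inv V[OF h], of 0 "h + h'"] stationary_version_law(2)[OF Y P inv V[of 0], of h h']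
      by simp
  qed
  have le: "measure ?Q (bad_paths K A h) \<le> 2 * measure ?Q (V 0 h)" if h: "0 < h" for h
  proof -
    have "AE w in ?Q. w \<in> bad_paths K A h \<longrightarrow> w \<in> V 0 h \<union> V h (h + h)"
      using bad cont[OF h] by eventually_elim (auto simp: bad_paths_def good_window_def V_def)
    then have "measure ?Q (bad_paths K A h) \<le> measure ?Q (V 0 h \<union> V h (h + h))"
      using h VQ by (intro Q.finite_measure_mono_AE) auto
    also have "\<dots> \<le> measure ?Q (V 0 h) + measure ?Q (V h (h + h))"
      using h VQ by (intro measure_Un_le) auto
    finally show ?thesis using shift[of h h] h by simp
  qed
  have "(\<lambda>n. measure ?Q (V 0 (real (Suc n)))) \<longlonglongrightarrow> measure ?Q (\<Inter>n. V 0 (real (Suc n)))"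
  proof (rule Q.finite_Lim_measure_decseq)
    show "range (\<lambda>n. V 0 (real (Suc n))) \<subseteq> sets ?Q" using VQ by auto
    show "decseq (\<lambda>n. V 0 (real (Suc n)))" unfolding decseq_def V_def by force
  qed
  also have "(\<Inter>n. V 0 (real (Suc n))) = {w\<in>space cadlag_space. \<not> (\<exists>s>0. w s \<in> A)}"
  proof -
    have "\<exists>n. s < real (Suc n)" for s using reals_Archimedean2[of s] by (meson less_trans of_nat_less_iff lessI)
    then show ?thesis unfolding V_def by (auto simp del: of_nat_Suc)
  qed
  finally have "(\<lambda>n. 2 * measure ?Q (V 0 (real (Suc n)))) \<longlonglongrightarrow> 2 * 0"
    unfolding never by (rule tendsto_mult[OF tendsto_const])
  then have *: "(\<lambda>n. 2 * measure ?Q (V 0 (real (Suc n)))) \<longlonglongrightarrow> 0" by simp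
  show ?thesis by (rule Lim_null_comparison[OF always_eventually *]) (use le in auto)
qed

lemma reactive_occupation_limit:
  fixes X :: "real \<Rightarrow> 'w \<Rightarrow> real^'n" and Y :: "real \<Rightarrow> 's \<Rightarrow> real^'n"
  assumes M: "prob_space M" and filt: "filtration (space M) Fil" "\<And>t. sets (Fil t) \<subseteq> sets M"
    and X: "adapted_cadlag M Fil X" and P: "path_kernel P" and markov: "markov_process {0..} M Fil X P"
    and erg: "ergodic_process M X \<rho>" and inv: "invariant_density P \<rho>" and pos: "\<And>x. \<rho> x > 0"
    and Y: "stationary_version S Y P \<rho>" and AB: "open A" "open B" "closure A \<inter> closure B = {}" "A \<noteq> {}"
    and bad: "AE w in stationary_law P \<rho>. \<forall>b. no_bad_jump (frontier A \<union> frontier B) w 0 b"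
    and cont: "\<And>h. 0 < h \<Longrightarrow> AE w in stationary_law P \<rho>. (w \<longlongrightarrow> w h) (at_left h)"
    and q: "forward_committor P A B q" and qb: "backward_committor b \<sigma> F \<nu> \<rho> S Y A B qb"
    and times: "AE \<omega> in M. transition_times (\<lambda>t. X t \<omega>) A B (\<tau>Am \<omega>) (\<tau>Bp \<omega>) (\<tau>Bm \<omega>) (\<tau>Ap \<omega>)"
    and C: "C \<in> sets borel"
  shows "AE \<omega> in M. ((\<lambda>T. (LINT t:{0..T}|lborel. indicator C (X t \<omega>) * indicator (reactive_times (\<tau>Am \<omega>) (\<tau>Bp \<omega>)) t) / T)
     \<longlongrightarrow> (LINT x:C|lebesgue. \<rho> x * q x * qb x)) at_top"
proof -
  interpret prob_space M by fact
  let ?K = "frontier A \<union> frontier B"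
  let ?Q = "stationary_law P \<rho>"
  have K: "closed ?K" by (simp add: closed_Un)
  have XF: "X t \<in> borel_measurable (Fil t)" if "0 \<le> t" for t using X that by (auto simp: adapted_cadlag_def)
  have subF: "subalgebra (Fil t) (Fil s)" if "s \<le> t" for s t
    using filt that by (auto simp: subalgebra_def filtration_def)
  have sub: "subalgebra M (Fil t)" for t using filt by (auto simp: subalgebra_def filtration_def)
  have spF: "space (Fil t) = space M" for t using filt by (auto simp: filtration_def)
  have XM: "X t \<in> borel_measurable M" if "0 \<le> t" for t using XF[OF that] sub by (rule measurable_from_subalg[rotated])
  have rc: "rcll 0 (\<lambda>t. X t \<omega>)" if "\<omega> \<in> space M" for \<omega>
    using X that by (auto simp: adapted_cadlag_def cadlag_on_rcll_0)
  have rcm: "rcll t (\<lambda>t. X t \<omega>)" if "\<omega> \<in> space M" "0 \<le> t" for \<omega> t using rcll_mono[OF rc[OF that(1)] that(2)] .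
  have pfin: "path_from X t \<omega> \<in> space cadlag_space" if "\<omega> \<in> space M" "0 \<le> t" for t \<omega>
    by (rule path_from_in_cadlag_space) (rule rcm[OF that])
  have pfm: "(\<lambda>\<omega>. path_from X t \<omega> s) \<in> borel_measurable (Fil (t + L))" if "0 \<le> t" "0 \<le> s" "s \<le> L" for t s L
    using measurable_from_subalg[OF subF[of "t + s" "t + L"] XF[of "t + s"]] that by (simp add: path_from_apply)
  have avgR: "AE \<omega> in M. ((\<lambda>T. (LINT t:{0..T}|lborel. indicator (reactive_paths C A B h) (path_from X t \<omega>)) / T)
     \<longlongrightarrow> measure ?Q (reactive_paths C A B h)) at_top" if h: "0 < h" for h
    unfolding measure_stationary_law[OF P inv sets_reactive_paths[OF h C]]
  proof (rule path_average_tendsto[OF M filt X P markov erg sets_reactive_paths[OF h C], of "2 * h"])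
    fix t :: real assume t: "0 \<le> t"
    have "{\<omega>\<in>space (Fil (t + 2 * h)). reactive_window C A B h (\<lambda>s. path_from X t \<omega> s)} \<in> sets (Fil (t + 2 * h))"
      using t h C rcm by (intro sets_reactive_window pfm rcll_path_from) (auto simp: spF)
    then show "{\<omega>\<in>space M. path_from X t \<omega> \<in> reactive_paths C A B h} \<in> sets (Fil (t + 2 * h))"
      using pfin[OF _ t] by (simp add: reactive_paths_def spF conj_commute cong: conj_cong)
  qed (use h in auto)
  have avgD: "AE \<omega> in M. ((\<lambda>T. (LINT t:{0..T}|lborel. indicator (bad_paths ?K A h) (path_from X t \<omega>)) / T)
     \<longlongrightarrow> measure ?Q (bad_paths ?K A h)) at_top" if h: "0 < h" for h
    unfolding measure_stationary_law[OF P inv sets_bad_paths[OF h K AB(1)]]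
  proof (rule path_average_tendsto[OF M filt X P markov erg sets_bad_paths[OF h K AB(1)], of "2 * h"])
    fix t :: real assume t: "0 \<le> t"
    have "{\<omega>\<in>space (Fil (t + 2 * h)). \<not> good_window ?K A h (\<lambda>s. path_from X t \<omega> s)} \<in> sets (Fil (t + 2 * h))"
      using t h K AB rcm by (intro sets.sets_Collect_neg sets_good_window pfm rcll_path_from) (auto simp: spF)
    then show "{\<omega>\<in>space M. path_from X t \<omega> \<in> bad_paths ?K A h} \<in> sets (Fil (t + 2 * h))"
      using pfin[OF _ t] by (simp add: bad_paths_def spF conj_commute cong: conj_cong)
  qed (use h in auto)
  \<comment> \<open>Only the widths \<open>Suc n\<close> are used, so that one null set of
    trajectories serves all of them.\<close>
  have "AE \<omega> in M. \<forall>n::nat.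
      ((\<lambda>T. (LINT t:{0..T}|lborel. indicator (reactive_paths C A B (real (Suc n))) (path_from X t \<omega>)) / T)
         \<longlongrightarrow> measure ?Q (reactive_paths C A B (real (Suc n)))) at_top \<and>
      ((\<lambda>T. (LINT t:{0..T}|lborel. indicator (bad_paths ?K A (real (Suc n))) (path_from X t \<omega>)) / T)
         \<longlongrightarrow> measure ?Q (bad_paths ?K A (real (Suc n)))) at_top"
    using avgR avgD by (simp add: AE_all_countable)
  then show ?thesis using times AE_space
  proof eventually_elim
    case (elim \<omega>)
    let ?R = "reactive_times (\<tau>Am \<omega>) (\<tau>Bp \<omega>)"
    let ?I = "LINT x:C|lebesgue. \<rho> x * q x * qb x"
    define \<phi> where "\<phi> t = indicator C (X (max 0 t) \<omega>) * indicat_real ?R t" for t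
    have pair: "(\<lambda>t. path_from X (max 0 t) \<omega>) \<in> borel \<rightarrow>\<^sub>M cadlag_space"
      using measurable_compose[OF measurable_Pair2' measurable_pair_path_from[of M X, OF rc XM]] elim(3) by simp
    have Xt: "(\<lambda>t. X (max 0 t) \<omega>) \<in> borel_measurable borel"
      using measurable_compose[OF pair measurable_coordinate_cadlag[of 0]] by (simp add: path_from_apply)
    have "open ?R" by (auto simp: reactive_times_def)
    then have \<phi>m: "\<phi> \<in> borel_measurable lborel"
      unfolding \<phi>_def using borel_measurable_times[OF measurable_compose[OF Xt borel_measurable_indicator[OF C]]
        borel_measurable_indicator[OF borel_open]] by simp
    have \<phi>eq: "(LINT t:{0..T}|lborel. indicator C (X t \<omega>) * indicator ?R t) = (LINT t:{0..T}|lborel. \<phi> t)" for T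
      by (intro set_lebesgue_integral_cong) (auto simp: \<phi>_def)
    have bound: "\<bar>(LINT t:{0..T}|lborel. \<phi> t) / T - (LINT t:{0..T}|lborel. indicator (reactive_paths C A B h) (path_from X t \<omega>)) / T\<bar>
        \<le> 2 * h / T + (LINT t:{0..T}|lborel. indicator (bad_paths ?K A h) (path_from X t \<omega>)) / T"
      if h: "0 < h" and T: "h < T" for h T
    proof -
      let ?\<psi> = "\<lambda>t. indicat_real (reactive_paths C A B h) (path_from X (max 0 t) \<omega>)"
      let ?\<delta> = "\<lambda>t. indicat_real (bad_paths ?K A h) (path_from X (max 0 t) \<omega>)"
      have "\<bar>(LINT t:{0..T}|lborel. \<phi> t) / T - (LINT t:{0..T}|lborel. ?\<psi> t) / T\<bar> \<le> 2 * h / T + (LINT t:{0..T}|lborel. ?\<delta> t) / T"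
      proof (rule averages_close[OF \<phi>m _ _ _ _ _ less_imp_le[OF h] _ T])
        show "?\<psi> \<in> borel_measurable lborel" "?\<delta> \<in> borel_measurable lborel"
          using measurable_compose[OF pair borel_measurable_indicator[OF sets_reactive_paths[OF h C]]]
            measurable_compose[OF pair borel_measurable_indicator[OF sets_bad_paths[OF h K AB(1)]]] by auto
        fix t :: real assume t: "0 \<le> t"
        show "\<bar>\<phi> (t + h) - ?\<psi> t\<bar> \<le> ?\<delta> t"
        \<comment> \<open>On a good window both indicators agree; on a bad one they differ by at
          most 1, which is the value of \<delta>.\<close>
        proof (cases "good_window ?K A h (path_from X t \<omega>)")
          case False
          then have "?\<delta> t = 1" using pfin[OF elim(3) t] t by (simp add: bad_paths_def)
          then show ?thesis by (auto simp: \<phi>_def indicator_def)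
        next
          case True
          have "t + h \<in> ?R \<longleftrightarrow> came_from A B (\<lambda>s. X s \<omega>) (t + h) h \<and> heads_to B A (\<lambda>s. X s \<omega>) (t + h) h"
            using True t h by (intro reactive_times_window[OF AB(1-3) rc[OF elim(3)] elim(2)])
              (auto simp: good_window_path_from algebra_simps)
          then have "\<phi> (t + h) = ?\<psi> t"
            using t h pfin[OF elim(3) t] by (auto simp: \<phi>_def reactive_paths_def reactive_window_path_from indicator_def)
          then show ?thesis by simp
        qed
      qed (auto simp: \<phi>_def indicator_def)
      moreover have "(LINT t:{0..T}|lborel. ?\<psi> t) = (LINT t:{0..T}|lborel. indicator (reactive_paths C A B h) (path_from X t \<omega>))"
        "(LINT t:{0..T}|lborel. ?\<delta> t) = (LINT t:{0..T}|lborel. indicator (bad_paths ?K A h) (path_from X t \<omega>))"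
        by (auto intro!: set_lebesgue_integral_cong)
      ultimately show ?thesis by simp
    qed
    show ?case unfolding \<phi>eq
    proof (rule tendstoI)
      \<comment> \<open>\<open>h\<close> is fixed before \<open>T\<close>. A small probability of
        bad windows controls two errors: the average of bad windows and the distance of the reactive
        windows to the integral. The term \<open>2 * h / T\<close> and the average of reactive
        windows give two more. Four errors below \<open>e / 5\<close> leave the total below
        \<open>e\<close>.\<close>
      fix e :: real assume e: "0 < e"
      have "\<forall>\<^sub>F n in sequentially. measure ?Q (bad_paths ?K A (real (Suc n))) < e / 5"
        using measure_bad_paths_tendsto_0[OF Y P inv AB(1) K bad cont
            stationary_law_never_visits[OF M filt X P markov erg inv pos AB(1,4)]] e
        by (intro order_tendstoD(2)) auto
      then obtain n where n: "measure ?Q (bad_paths ?K A (real (Suc n))) < e / 5"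
        by (auto simp: eventually_sequentially)
      define h where "h = real (Suc n)"
      have h: "0 < h" by (simp add: h_def)
      have dI: "\<bar>measure ?Q (reactive_paths C A B h) - ?I\<bar> < e / 5"
        using reactive_paths_close[OF Y P inv pos AB(1-3) bad q qb C h] n by (simp add: h_def)
      have lims: "((\<lambda>T. (LINT t:{0..T}|lborel. indicator (reactive_paths C A B h) (path_from X t \<omega>)) / T)
         \<longlongrightarrow> measure ?Q (reactive_paths C A B h)) at_top"
        "((\<lambda>T. (LINT t:{0..T}|lborel. indicator (bad_paths ?K A h) (path_from X t \<omega>)) / T)
         \<longlongrightarrow> measure ?Q (bad_paths ?K A h)) at_top"
        using elim(1) unfolding h_def by blast+
      have "((\<lambda>T. 2 * h / T) \<longlongrightarrow> 0) at_top"
        by (intro real_tendsto_divide_at_top[OF tendsto_const] filterlim_ident)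
      then have "\<forall>\<^sub>F T in at_top. 2 * h / T < e / 5" using e by (intro order_tendstoD(2)) auto
      moreover have "\<forall>\<^sub>F T in at_top. dist ((LINT t:{0..T}|lborel. indicator (reactive_paths C A B h) (path_from X t \<omega>)) / T)
          (measure ?Q (reactive_paths C A B h)) < e / 5"
        using lims(1) e by (intro tendstoD) auto
      moreover have "\<forall>\<^sub>F T in at_top. (LINT t:{0..T}|lborel. indicator (bad_paths ?K A h) (path_from X t \<omega>)) / T < e / 5"
        using lims(2) n by (intro order_tendstoD(2)) (auto simp: h_def)
      ultimately show "\<forall>\<^sub>F T in at_top. dist ((LINT t:{0..T}|lborel. \<phi> t) / T) ?I < e"
        using eventually_gt_at_top[of h]
      proof eventually_elim
        case (elim T)
        then show ?case using bound[OF h elim(4)] dI unfolding dist_real_def by linarith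
      qed
    qed
  qed
qed

section \<open>Poisson random measures and predictable sets\<close>

text \<open>This lets one subsequence serve both convergences in the definition of the compensated
  integral, that of the integrands and that of the integrals.\<close>

lemma null_in_prob_add:
  assumes "prob_space M" "null_in_prob M Z" "null_in_prob M Z'"
  shows "null_in_prob M (\<lambda>n \<omega>. Z n \<omega> + Z' n \<omega>)"
proof -
  interpret prob_space M by fact
  have m [measurable]: "Z n \<in> borel_measurable M" "Z' n \<in> borel_measurable M" for n
    using assms by (auto simp: null_in_prob_def)
  have "(\<lambda>n. prob {\<omega>\<in>space M. Z n \<omega> + Z' n \<omega> > ennreal e}) \<longlonglongrightarrow> 0" if e: "e > 0" for e
  proof (rule Lim_null_comparison[OF always_eventually])
    have "e / 2 > 0" using e by simp
    then have "(\<lambda>n. prob {\<omega>\<in>space M. Z n \<omega> > ennreal (e/2)} + prob {\<omega>\<in>space M. Z' n \<omega> > ennreal (e/2)}) \<longlonglongrightarrow> 0 + 0"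
      using assms(2,3) unfolding null_in_prob_def by (intro tendsto_add) blast+
    then show "(\<lambda>n. prob {\<omega>\<in>space M. Z n \<omega> > ennreal (e/2)} + prob {\<omega>\<in>space M. Z' n \<omega> > ennreal (e/2)}) \<longlonglongrightarrow> 0" by simp
    show "\<forall>n. norm (prob {\<omega>\<in>space M. Z n \<omega> + Z' n \<omega> > ennreal e}) \<le>
        prob {\<omega>\<in>space M. Z n \<omega> > ennreal (e/2)} + prob {\<omega>\<in>space M. Z' n \<omega> > ennreal (e/2)}"
    proof
      fix n
      have ee: "ennreal e = ennreal (e/2) + ennreal (e/2)" using e by (simp flip: ennreal_plus)
      have "prob {\<omega>\<in>space M. Z n \<omega> + Z' n \<omega> > ennreal e} \<le>
          prob ({\<omega>\<in>space M. Z n \<omega> > ennreal (e/2)} \<union> {\<omega>\<in>space M. Z' n \<omega> > ennreal (e/2)})"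
        unfolding ee
      proof (intro finite_measure_mono subsetI)
        fix \<omega> assume \<omega>: "\<omega> \<in> {\<omega>\<in>space M. Z n \<omega> + Z' n \<omega> > ennreal (e/2) + ennreal (e/2)}"
        then have "\<not> (Z n \<omega> \<le> ennreal (e/2) \<and> Z' n \<omega> \<le> ennreal (e/2))"
          using add_mono[of "Z n \<omega>" "ennreal (e/2)" "Z' n \<omega>" "ennreal (e/2)"] by (auto dest: leD)
        then show "\<omega> \<in> {\<omega>\<in>space M. Z n \<omega> > ennreal (e/2)} \<union> {\<omega>\<in>space M. Z' n \<omega> > ennreal (e/2)}"
          using \<omega> by (auto simp: not_le)
      qed measurable
      also have "\<dots> \<le> prob {\<omega>\<in>space M. Z n \<omega> > ennreal (e/2)} + prob {\<omega>\<in>space M. Z' n \<omega> > ennreal (e/2)}"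
        by (intro measure_Un_le) measurable
      finally show "norm (prob {\<omega>\<in>space M. Z n \<omega> + Z' n \<omega> > ennreal e}) \<le>
        prob {\<omega>\<in>space M. Z n \<omega> > ennreal (e/2)} + prob {\<omega>\<in>space M. Z' n \<omega> > ennreal (e/2)}" by simp
    qed
  qed
  then show ?thesis unfolding null_in_prob_def by auto
qed

text \<open>Borel-Cantelli with the rate \<open>(1/2)^n\<close>. The same summable rate later yields
  almost everywhere convergence of the integrands.\<close>

lemma null_in_prob_subseq:
  assumes "prob_space M" "null_in_prob M Z"
  shows "\<exists>r::nat \<Rightarrow> nat. AE \<omega> in M. \<forall>\<^sub>F n in sequentially. Z (r n) \<omega> \<le> ennreal ((1/2)^n)"
proof -
  interpret prob_space M by fact
  have m [measurable]: "Z n \<in> borel_measurable M" for n using assms by (auto simp: null_in_prob_def)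
  have "\<exists>k. prob {\<omega>\<in>space M. Z k \<omega> > ennreal ((1/2)^n)} < (1/2)^n" for n
  proof -
    have "(\<lambda>k. prob {\<omega>\<in>space M. Z k \<omega> > ennreal ((1/2)^n)}) \<longlonglongrightarrow> 0"
      using assms(2) unfolding null_in_prob_def by auto
    then have "\<forall>\<^sub>F k in sequentially. prob {\<omega>\<in>space M. Z k \<omega> > ennreal ((1/2)^n)} < (1/2)^n"
      by (rule order_tendstoD(2)) simp
    then show ?thesis by (auto simp: eventually_sequentially)
  qed
  then obtain r where r: "\<And>n. prob {\<omega>\<in>space M. Z (r n) \<omega> > ennreal ((1/2)^n)} < (1/2)^n" by metis
  define A where "A n = {\<omega>\<in>space M. Z (r n) \<omega> > ennreal ((1/2)^n)}" for n
  have "AE \<omega> in M. \<forall>\<^sub>F n in sequentially. \<omega> \<in> space M - A n"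
  proof (rule borel_cantelli_AE1)
    show "A n \<in> sets M" for n unfolding A_def by measurable
    show "emeasure M (A n) < \<infinity>" for n by (simp add: less_top[symmetric])
    show "summable (\<lambda>n. measure M (A n))"
      by (rule summable_comparison_test'[OF summable_geometric[of "1/2::real"], of 0]) (use r in \<open>auto simp: A_def intro: less_imp_le\<close>)
  qed
  then have "AE \<omega> in M. \<forall>\<^sub>F n in sequentially. Z (r n) \<omega> \<le> ennreal ((1/2)^n)"
  proof eventually_elim
    case (elim \<omega>)
    then show ?case by eventually_elim (auto simp: A_def not_less)
  qed
  then show ?thesis by blast
qed

section \<open>Counts of a Poisson random measure\<close>

lemma poisson_mass_sums: "(\<lambda>k. exp (- l) * l ^ k / fact k) sums (1::real)"
proof -
  have "(\<lambda>k. l ^ k / fact k) sums exp l" using exp_converges[of l] by (simp add: divide_inverse mult.commute)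
  from sums_mult[OF this, of "exp (- l)"] show ?thesis by (simp flip: exp_add)
qed

lemma poisson_mean_sums: "(\<lambda>k. real k * (exp (- l) * l ^ k / fact k)) sums (l::real)"
proof -
  have "(\<lambda>k. real (Suc k) * (exp (- l) * l ^ Suc k / fact (Suc k))) = (\<lambda>k. l * (exp (- l) * l ^ k / fact k))"
    by (rule ext) (simp add: fact_Suc del: of_nat_Suc)
  then have "(\<lambda>k. real (Suc k) * (exp (- l) * l ^ Suc k / fact (Suc k))) sums l"
    using sums_mult[OF poisson_mass_sums, of l l] by simp
  then show ?thesis using sums_Suc_iff[of "\<lambda>k. real k * (exp (- l) * l ^ k / fact k)" l] by simp
qed

locale poisson_noise = prob_space M
  for M :: "'w measure" and Fil :: "real \<Rightarrow> 'w measure" and \<nu> :: "(real^'m) measure"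
    and N :: "'w \<Rightarrow> ((real^'m) \<times> real) measure" +
  assumes filt: "filtration (space M) Fil" and Fil_sub: "\<And>t. sets (Fil t) \<subseteq> sets M"
    and levy: "levy_measure \<nu>" and prm: "poisson_random_measure M Fil \<nu> N"
begin

lemma sets_\<nu> [measurable_cong]: "sets \<nu> = sets borel" using levy by (simp add: levy_measure_def)

lemma sets_N: "\<omega> \<in> space M \<Longrightarrow> sets (N \<omega>) = sets borel"
  using prm by (simp add: poisson_random_measure_def)

lemma N_measurable: "E \<in> sets borel \<Longrightarrow> E \<subseteq> UNIV \<times> {0<..} \<Longrightarrow> (\<lambda>\<omega>. emeasure (N \<omega>) E) \<in> borel_measurable M"
  using prm unfolding poisson_random_measure_def by (elim conjE) blast

lemma N_poisson:
  "E \<in> sets borel \<Longrightarrow> E \<subseteq> UNIV \<times> {0<..} \<Longrightarrow> emeasure (\<nu> \<Otimes>\<^sub>M lborel) E < \<infinity> \<Longrightarrow>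
    prob {\<omega>\<in>space M. emeasure (N \<omega>) E = of_nat k}
      = exp (- measure (\<nu> \<Otimes>\<^sub>M lborel) E) * measure (\<nu> \<Otimes>\<^sub>M lborel) E ^ k / fact k"
  using prm unfolding poisson_random_measure_def by (elim conjE) blast

lemma N_indep: "0 \<le> t \<Longrightarrow> indep_set (sets (Fil t))
    (generated_sets M {E\<in>sets borel. E \<subseteq> UNIV \<times> {t<..}} (\<lambda>E \<omega>. emeasure (N \<omega>) E))"
  using prm unfolding poisson_random_measure_def by (elim conjE) simp

text \<open>\<open>N\<close> is not given as a counting measure; its values are integers because the
  Poisson probabilities over all \<open>k\<close> add up to 1.\<close>

lemma AE_N_integer:
  assumes E: "E \<in> sets borel" "E \<subseteq> UNIV \<times> {0<..}" "emeasure (\<nu> \<Otimes>\<^sub>M lborel) E < \<infinity>"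
  shows "AE \<omega> in M. \<exists>k. emeasure (N \<omega>) E = of_nat k"
proof -
  note [measurable] = N_measurable[OF E(1,2)]
  define A where "A k = {\<omega>\<in>space M. emeasure (N \<omega>) E = of_nat k}" for k
  have Am: "A k \<in> sets M" for k unfolding A_def by measurable
  have "(\<lambda>k. prob (A k)) sums prob (\<Union>k. A k)"
    using Am by (intro finite_measure_UNION) (auto simp: A_def disjoint_family_on_def)
  moreover have "(\<lambda>k. prob (A k)) sums 1"
    using poisson_mass_sums unfolding A_def N_poisson[OF E] .
  ultimately have "prob (\<Union>k. A k) = 1" using sums_unique2 by blast
  then have "AE \<omega> in M. \<omega> \<in> (\<Union>k. A k)" using Am by (subst (asm) prob_eq_1) auto
  then show ?thesis by eventually_elim (auto simp: A_def)
qed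

text \<open>The number of points after time \<open>t\<close> is independent of \<open>G\<close>.
  Summing over the possible numbers reduces the claim to the mean of a Poisson law.\<close>

lemma N_mean:
  assumes E: "E \<in> sets borel" "E \<subseteq> UNIV \<times> {t<..}" "emeasure (\<nu> \<Otimes>\<^sub>M lborel) E < \<infinity>" and t: "0 \<le> t"
    and G: "G \<in> sets (Fil t)"
  shows "(\<integral>\<^sup>+\<omega>. indicator G \<omega> * emeasure (N \<omega>) E \<partial>M) = emeasure M G * emeasure (\<nu> \<Otimes>\<^sub>M lborel) E"
proof -
  have E0: "E \<subseteq> UNIV \<times> {0<..}" using E(2) t by auto
  note [measurable] = N_measurable[OF E(1) E0]
  have [measurable]: "G \<in> sets M" using G Fil_sub by blast
  define A where "A k = {\<omega>\<in>space M. emeasure (N \<omega>) E = of_nat k}" for k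
  have Am [measurable]: "A k \<in> sets M" for k unfolding A_def by measurable
  let ?l = "measure (\<nu> \<Otimes>\<^sub>M lborel) E"
  have GA: "prob (G \<inter> A k) = prob G * (exp (- ?l) * ?l ^ k / fact k)" for k
  proof -
    have "A k = (\<lambda>\<omega>. emeasure (N \<omega>) E) -` {of_nat k} \<inter> space M" by (auto simp: A_def)
    then have "A k \<in> generated_sets M {E\<in>sets borel. E \<subseteq> UNIV \<times> {t<..}} (\<lambda>E \<omega>. emeasure (N \<omega>) E)"
      unfolding generated_sets_def using E by (intro sigma_sets.Basic) (auto intro!: exI[of _ E] exI[of _ "{of_nat k}"])
    from indep_setD[OF N_indep[OF t] G this] show ?thesis
      using N_poisson[OF E(1) E0 E(3), of k] by (simp add: A_def)
  qed
  have "(\<integral>\<^sup>+\<omega>. indicator G \<omega> * emeasure (N \<omega>) E \<partial>M) = (\<integral>\<^sup>+\<omega>. (\<Sum>k. of_nat k * indicator (G \<inter> A k) \<omega>) \<partial>M)"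
  proof (rule nn_integral_cong_AE)
    show "AE \<omega> in M. indicator G \<omega> * emeasure (N \<omega>) E = (\<Sum>k. of_nat k * indicator (G \<inter> A k) \<omega>)"
      using AE_N_integer[OF E(1) E0 E(3)] AE_space
    proof eventually_elim
      case (elim \<omega>)
      then obtain k where k: "emeasure (N \<omega>) E = of_nat k" by blast
      have "(\<Sum>j. of_nat j * indicator (G \<inter> A j) \<omega> :: ennreal) = (\<Sum>j\<in>{k}. of_nat j * indicator (G \<inter> A j) \<omega>)"
        by (rule suminf_finite) (use k in \<open>auto simp: A_def indicator_def\<close>)
      also have "\<dots> = of_nat k * indicator G \<omega>" using k elim(2) by (simp add: A_def indicator_def)
      finally show ?case using k by (simp add: mult.commute)
    qed
  qed
  also have "\<dots> = (\<Sum>k. \<integral>\<^sup>+\<omega>. of_nat k * indicator (G \<inter> A k) \<omega> \<partial>M)"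
    by (rule nn_integral_suminf) measurable
  also have "\<dots> = (\<Sum>k. ennreal (prob G * (real k * (exp (- ?l) * ?l ^ k / fact k))))"
  proof (rule suminf_cong)
    fix k
    have "(\<integral>\<^sup>+\<omega>. of_nat k * indicator (G \<inter> A k) \<omega> \<partial>M) = of_nat k * ennreal (prob (G \<inter> A k))"
      by (subst nn_integral_cmult_indicator) (auto simp: emeasure_eq_measure)
    also have "\<dots> = ennreal (prob G * (real k * (exp (- ?l) * ?l ^ k / fact k)))"
      unfolding GA by (simp add: ennreal_of_nat_eq_real_of_nat mult_ac flip: ennreal_mult)
    finally show "(\<integral>\<^sup>+\<omega>. of_nat k * indicator (G \<inter> A k) \<omega> \<partial>M) = ennreal (prob G * (real k * (exp (- ?l) * ?l ^ k / fact k)))" .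
  qed
  also have "\<dots> = ennreal (prob G * ?l)"
    using sums_mult[OF poisson_mean_sums[of ?l], of "prob G"]
    by (intro suminf_ennreal_eq) auto
  also have "\<dots> = emeasure M G * emeasure (\<nu> \<Otimes>\<^sub>M lborel) E"
    using E(3) by (simp add: emeasure_eq_measure ennreal_mult emeasure_eq_ennreal_measure less_top)
  finally show ?thesis .
qed

lemma emeasure_cell:
  assumes "E \<in> sets borel" "a \<le> b"
  shows "emeasure (\<nu> \<Otimes>\<^sub>M lborel) (E \<times> {a<..b}) = emeasure \<nu> E * ennreal (b - a)"
  using assms by (subst lborel.emeasure_pair_measure_Times) (auto simp: sets_\<nu>)

lemma cell_sets: "E \<in> sets borel \<Longrightarrow> E \<times> {a<..b} \<in> sets (borel :: ((real^'m) \<times> real) measure)"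
  by (simp add: borel_prod[symmetric] pair_measureI)

lemma prob_N_not_0_1:
  assumes E: "E \<in> sets borel" "E \<subseteq> UNIV \<times> {0<..}" "emeasure (\<nu> \<Otimes>\<^sub>M lborel) E < \<infinity>"
  shows "prob {\<omega>\<in>space M. emeasure (N \<omega>) E \<notin> {0, 1}} \<le> (measure (\<nu> \<Otimes>\<^sub>M lborel) E)\<^sup>2"
proof -
  note [measurable] = N_measurable[OF E(1,2)]
  let ?l = "measure (\<nu> \<Otimes>\<^sub>M lborel) E"
  let ?A = "{\<omega>\<in>space M. emeasure (N \<omega>) E = 0}" and ?B = "{\<omega>\<in>space M. emeasure (N \<omega>) E = 1}"
  have "{\<omega>\<in>space M. emeasure (N \<omega>) E \<notin> {0, 1}} = space M - (?A \<union> ?B)" by auto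
  moreover have "prob (space M - (?A \<union> ?B)) = 1 - prob (?A \<union> ?B)" by (rule prob_compl) measurable
  moreover have "prob (?A \<union> ?B) = prob ?A + prob ?B" by (rule finite_measure_Union) (measurable, auto)
  moreover have "prob ?A = exp (- ?l)" "prob ?B = exp (- ?l) * ?l"
    using N_poisson[OF E, of 0] N_poisson[OF E, of 1] by simp_all
  \<comment> \<open>Since \<open>exp (- l)\<close> is at least \<open>1 - l\<close>, its product
    with \<open>1 + l\<close> is at least \<open>1 - l^2\<close>. The bound must be quadratic, to
    beat the number of dyadic cells in the next lemma.\<close>
  moreover have "1 - (exp (- ?l) + exp (- ?l) * ?l) \<le> ?l\<^sup>2"
  proof -
    have "(1 - ?l) * (1 + ?l) \<le> exp (- ?l) * (1 + ?l)"
      using exp_ge_add_one_self[of "- ?l"] by (intro mult_right_mono) auto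
    then show ?thesis by (simp add: algebra_simps power2_eq_square)
  qed
  ultimately show ?thesis by simp
qed

text \<open>Dyadic cells: the event that at level \<open>k\<close> some cell contains at least two points has
  probability \<open>O(2\<^sup>-\<^sup>k)\<close>.\<close>

lemma AE_N_simple:
  assumes E: "E \<in> sets borel" "emeasure \<nu> E < \<infinity>"
  shows "AE \<omega> in M. \<forall>t. 0 < t \<and> t \<le> real T \<longrightarrow> emeasure (N \<omega>) (E \<times> {t}) \<in> {0, 1}"
proof -
  define c where "c k j = E \<times> {real j / 2^k<..real (Suc j) / 2^k}" for k j
  have c: "c k j \<in> sets borel" "c k j \<subseteq> UNIV \<times> {0<..}" for k j
    unfolding c_def by (rule cell_sets[OF E(1)]) (auto intro: le_less_trans[rotated])
  have ec: "emeasure (\<nu> \<Otimes>\<^sub>M lborel) (c k j) = emeasure \<nu> E * ennreal (1 / 2^k)" for k j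
    unfolding c_def by (subst emeasure_cell[OF E(1)]) (auto simp: divide_right_mono simp flip: diff_divide_distrib)
  have fin: "emeasure (\<nu> \<Otimes>\<^sub>M lborel) (c k j) < \<infinity>" for k j
    unfolding ec using E(2) by (simp add: ennreal_mult_less_top)
  have mc: "measure (\<nu> \<Otimes>\<^sub>M lborel) (c k j) = measure \<nu> E / 2^k" for k j
    unfolding measure_def ec by (simp add: enn2real_mult)
  note [measurable] = N_measurable[OF c]
  define B where "B k = (\<Union>j<T * 2^k. {\<omega>\<in>space M. emeasure (N \<omega>) (c k j) \<notin> {0, 1}})" for k
  have Bm: "B k \<in> sets M" for k unfolding B_def by measurable
  have PB: "prob (B k) \<le> (real T * (measure \<nu> E)\<^sup>2) * (1/2)^k" for k
  proof -
    have "prob (B k) \<le> (\<Sum>j<T * 2^k. prob {\<omega>\<in>space M. emeasure (N \<omega>) (c k j) \<notin> {0, 1}})"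
      unfolding B_def by (rule finite_measure_subadditive_finite) (auto, measurable)
    also have "\<dots> \<le> (\<Sum>j<T * 2^k. (measure \<nu> E / 2^k)\<^sup>2)"
      using prob_N_not_0_1[OF c fin] unfolding mc by (rule sum_mono)
    also have "\<dots> = (real T * (measure \<nu> E)\<^sup>2) * (1/2)^k"
      by (simp add: power_divide field_simps power2_eq_square power_one_over)
    finally show ?thesis .
  qed
  have "prob (\<Inter>k. B k) = 0"
  proof -
    have "prob (\<Inter>k. B k) \<le> (real T * (measure \<nu> E)\<^sup>2) * (1/2)^n" for n
      using PB[of n] finite_measure_mono[of "\<Inter>k. B k" "B n"] Bm by force
    moreover have "(\<lambda>n. (real T * (measure \<nu> E)\<^sup>2) * (1/2)^n) \<longlonglongrightarrow> 0"
      by (intro tendsto_mult_right_zero LIMSEQ_power_zero) simp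
    ultimately have "prob (\<Inter>k. B k) \<le> 0" by (intro LIMSEQ_le_const) auto
    then show ?thesis using measure_nonneg[of M "\<Inter>k. B k"] by linarith
  qed
  then have "AE \<omega> in M. \<omega> \<notin> (\<Inter>k. B k)"
    using Bm by (subst (asm) prob_eq_0) auto
  moreover have "AE \<omega> in M. \<forall>k j. \<exists>n. emeasure (N \<omega>) (c k j) = of_nat n"
    unfolding AE_all_countable using AE_N_integer[OF c fin] by blast
  ultimately show ?thesis using AE_space
  proof eventually_elim
    case (elim \<omega>)
    then obtain k0 where k0: "\<And>j. j < T * 2^k0 \<Longrightarrow> emeasure (N \<omega>) (c k0 j) \<in> {0, 1}" by (auto simp: B_def)
    show ?case
    proof (intro allI impI)
      fix t :: real assume t: "0 < t \<and> t \<le> real T"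
      \<comment> \<open>Index of the cell of level \<open>k\<close> that contains \<open>t\<close>.
        Cells are open on the left and closed on the right, hence the ceiling minus 1.\<close>
      define j where "j k = nat (\<lceil>2^k * t\<rceil> - 1)" for k
      have j: "real (j k) < 2^k * t" "2^k * t \<le> real (Suc (j k))" for k
      proof -
        have "0 < 2^k * t" using t by simp
        then have "1 \<le> \<lceil>2^k * t\<rceil>" by linarith
        then have "real (j k) = real_of_int \<lceil>2^k * t\<rceil> - 1" unfolding j_def by simp
        then show "real (j k) < 2^k * t" "2^k * t \<le> real (Suc (j k))" by linarith+
      qed
      have jT: "j k < T * 2^k" for k
      proof -
        have "real (j k) < 2^k * real T" 
        proof -
          have "2^k * t \<le> 2^k * real T" using t by simp
          then show ?thesis using j(1)[of k] by linarith
        qed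
        then have "real (j k) < real (T * 2^k)" by (simp add: mult.commute)
        then show ?thesis by (simp only: of_nat_less_iff)
      qed
      have mem: "t \<in> {real (j k) / 2^k<..real (Suc (j k)) / 2^k}" for k
        using j[of k] by (simp add: field_simps)
      have step: "c (Suc k) (j (Suc k)) \<subseteq> c k (j k)" for k
      proof -
        have "real (2 * j k) < real (Suc (j (Suc k)))" "real (j (Suc k)) < real (2 * Suc (j k))"
          using j[of k] j[of "Suc k"] by simp_all
        then have "2 * j k \<le> j (Suc k)" "Suc (j (Suc k)) \<le> 2 * Suc (j k)" unfolding of_nat_less_iff by linarith+
        then have "2 * real (j k) \<le> real (j (Suc k))" "real (Suc (j (Suc k))) \<le> 2 * real (Suc (j k))"
          by (metis of_nat_le_iff of_nat_mult of_nat_numeral)+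
        then show ?thesis unfolding c_def by (auto simp: field_simps)
      qed
      have dec: "decseq (\<lambda>k. c k (j k))" by (intro decseq_SucI step)
      have INT: "(\<Inter>k. c k (j k)) = E \<times> {t}"
      proof
        show "E \<times> {t} \<subseteq> (\<Inter>k. c k (j k))" using mem by (auto simp: c_def)
        show "(\<Inter>k. c k (j k)) \<subseteq> E \<times> {t}"
        proof
          fix x assume x: "x \<in> (\<Inter>k. c k (j k))"
          have "\<bar>snd x - t\<bar> \<le> (1/2)^k" for k
          proof -
            have "x \<in> c k (j k)" using x by blast
            then have "real (j k) / 2^k < snd x" "snd x \<le> real (Suc (j k)) / 2^k" by (auto simp: c_def)
            moreover have "real (Suc (j k)) / 2^k = real (j k) / 2^k + (1/2)^k"
              by (simp add: add_divide_distrib power_one_over)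
            ultimately show ?thesis using mem[of k] by auto
          qed
          moreover have "(\<lambda>k. (1/2::real)^k) \<longlonglongrightarrow> 0" by (rule LIMSEQ_power_zero) simp
          ultimately have "\<bar>snd x - t\<bar> \<le> 0" by (intro LIMSEQ_le_const) auto
          then have "snd x = t" by simp
          moreover have "fst x \<in> E" using x by (auto simp: c_def)
          ultimately show "x \<in> E \<times> {t}" by (cases x) auto
        qed
      qed
      \<comment> \<open>The cells around \<open>t\<close> shrink to the time slice. Their masses are
        finite because they are integers, and at most 1 from level \<open>k0\<close> on.\<close>
      have lim: "(\<lambda>k. emeasure (N \<omega>) (c k (j k))) \<longlonglongrightarrow> emeasure (N \<omega>) (E \<times> {t})"
        unfolding INT[symmetric]
      proof (rule Lim_emeasure_decseq[OF _ dec])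
        show "range (\<lambda>k. c k (j k)) \<subseteq> sets (N \<omega>)" using c(1) sets_N[OF elim(3)] by auto
        show "emeasure (N \<omega>) (c k (j k)) \<noteq> \<infinity>" for k 
        proof -
          obtain n where "emeasure (N \<omega>) (c k (j k)) = of_nat n" using elim(2) by blast
          then show ?thesis by simp
        qed
      qed
      have "\<forall>\<^sub>F k in sequentially. emeasure (N \<omega>) (c k (j k)) \<in> {0, 1}"
        using eventually_ge_at_top[of k0]
      proof eventually_elim
        case (elim k)
        have "emeasure (N \<omega>) (c k (j k)) \<le> emeasure (N \<omega>) (c k0 (j k0))"
          using decseqD[OF dec elim] c(1) sets_N[OF \<open>\<omega> \<in> space M\<close>] by (intro emeasure_mono) auto
        also have "\<dots> \<le> 1" using k0[OF jT[of k0]] by auto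
        finally have le: "emeasure (N \<omega>) (c k (j k)) \<le> 1" .
        obtain n where n: "emeasure (N \<omega>) (c k (j k)) = of_nat n" using \<open>\<forall>k j. \<exists>n. emeasure (N \<omega>) (c k j) = of_nat n\<close> by blast
        then have "n \<le> 1" using le by (metis of_nat_1 of_nat_le_iff)
        then have "n = 0 \<or> n = 1" by auto
        then show ?case using n by auto
      qed
      then show "emeasure (N \<omega>) (E \<times> {t}) \<in> {0, 1}"
        using lim by (intro Lim_in_closed_set[of "{0, 1}" _ sequentially]) auto
    qed
  qed
qed

end

section \<open>Compensation on predictable sets\<close>

text \<open>The sets with \<open>G = space M\<close> make the marks and negative times predictable as well, so that sections
  of predictable functions are Borel on the whole space.\<close>

definition predictable_rectangles ::
    "'w measure \<Rightarrow> (real \<Rightarrow> 'w measure) \<Rightarrow> ('w \<times> ((real^'m) \<times> real)) set set" where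
  "predictable_rectangles M Fil =
     {G \<times> (E \<times> {s<..u}) | G E s u. E \<in> sets borel \<and> (0 \<le> s \<and> G \<in> sets (Fil s) \<or> G = space M)}"

definition predictable :: "'w measure \<Rightarrow> (real \<Rightarrow> 'w measure) \<Rightarrow> ('w \<times> ((real^'m) \<times> real)) measure" where
  "predictable M Fil = sigma (space M \<times> UNIV) (predictable_rectangles M Fil)"

context poisson_noise
begin

abbreviation "Pred \<equiv> (predictable M Fil :: ('w \<times> ((real^'m) \<times> real)) measure)"

lemma top_Fil: "space M \<in> sets (Fil a)"
  using filt sets.top[of "Fil a"] by (simp add: filtration_def)

lemma predictable_rectangles_Pow: "predictable_rectangles M Fil \<subseteq> Pow (space M \<times> UNIV)"
proof -
  have "G \<subseteq> space M" if "G \<in> sets (Fil s)" for G s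
    using that Fil_sub sets.sets_into_space by blast
  then show ?thesis unfolding predictable_rectangles_def by auto
qed

lemma space_Pred: "space Pred = space M \<times> UNIV"
  unfolding predictable_def by (rule space_measure_of[OF predictable_rectangles_Pow])

lemma sets_Pred: "sets Pred = sigma_sets (space M \<times> UNIV) (predictable_rectangles M Fil)"
  unfolding predictable_def by (rule sets_measure_of[OF predictable_rectangles_Pow])

lemma Pred_rectangle:
  "E \<in> sets borel \<Longrightarrow> 0 \<le> s \<Longrightarrow> G \<in> sets (Fil s) \<Longrightarrow> G \<times> (E \<times> {s<..u}) \<in> sets Pred"
  unfolding sets_Pred predictable_rectangles_def by (rule sigma_sets.Basic) blast

lemma Pred_rectangle_space: "E \<in> sets borel \<Longrightarrow> space M \<times> (E \<times> {s<..u}) \<in> sets Pred"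
  unfolding sets_Pred predictable_rectangles_def by (rule sigma_sets.Basic) blast

lemma sets_Pred_subset: "sets Pred \<subseteq> sets (M \<Otimes>\<^sub>M (borel :: ((real^'m) \<times> real) measure))"
proof -
  have "predictable_rectangles M Fil \<subseteq> sets (M \<Otimes>\<^sub>M (borel :: ((real^'m) \<times> real) measure))"
    unfolding predictable_rectangles_def using Fil_sub cell_sets by blast
  then show ?thesis
    unfolding sets_Pred
    by (metis sets.sigma_sets_subset space_borel space_pair_measure)
qed

lemma Pred_section:
  assumes "D \<in> sets Pred" "\<omega> \<in> space M"
  shows "Pair \<omega> -` D \<in> sets borel"
proof -
  have "D \<in> sets (M \<Otimes>\<^sub>M (borel :: ((real^'m) \<times> real) measure))"
    using sets_Pred_subset assms(1) by (rule subsetD)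
  then show ?thesis by (rule sets_Pair1)
qed

lemma Pred_function_section:
  assumes "f \<in> Pred \<rightarrow>\<^sub>M L" "\<omega> \<in> space M"
  shows "(\<lambda>x. f (\<omega>, x)) \<in> borel \<rightarrow>\<^sub>M L"
proof (rule measurableI)
  show "f (\<omega>, x) \<in> space L" for x using measurable_space[OF assms(1)] assms(2) by (simp add: space_Pred)
  fix U assume "U \<in> sets L"
  then have "f -` U \<inter> space Pred \<in> sets Pred" using assms(1) by (rule measurable_sets[rotated])
  from Pred_section[OF this assms(2)] show "(\<lambda>x. f (\<omega>, x)) -` U \<inter> space borel \<in> sets borel"
    using assms(2) by (simp add: vimage_def space_Pred)
qed

text \<open>Two rectangles that start at different times meet in one that starts at the later time,
  when both events are known.\<close>

lemma Int_stable_predictable: "Int_stable (predictable_rectangles M Fil :: ('w \<times> ((real^'m) \<times> real)) set set)"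
proof (rule Int_stableI)
  fix D D' :: "('w \<times> ((real^'m) \<times> real)) set" assume "D \<in> (predictable_rectangles M Fil :: ('w \<times> ((real^'m) \<times> real)) set set)" "D' \<in> predictable_rectangles M Fil"
  then obtain G E s u G' E' s' u' where D: "D = G \<times> (E \<times> {s<..u})" "E \<in> sets borel" "0 \<le> s \<and> G \<in> sets (Fil s) \<or> G = space M"
    and D': "D' = G' \<times> (E' \<times> {s'<..u'})" "E' \<in> sets borel" "0 \<le> s' \<and> G' \<in> sets (Fil s') \<or> G' = space M"
    unfolding predictable_rectangles_def by blast
  have mono: "sets (Fil a) \<subseteq> sets (Fil b)" if "a \<le> b" for a b using filt that by (auto simp: filtration_def)
  note top = top_Fil
  have "0 \<le> max s s' \<and> G \<inter> G' \<in> sets (Fil (max s s')) \<or> G \<inter> G' = space M"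
  proof (cases "G = space M \<and> G' = space M")
    case False
    then have "0 \<le> max s s'" using D D' by (auto simp: max_def)
    moreover have "G \<in> sets (Fil (max s s'))" using D(3) mono[of s "max s s'"] top by auto
    moreover have "G' \<in> sets (Fil (max s s'))" using D'(3) mono[of s' "max s s'"] top by auto
    ultimately show ?thesis by blast
  qed auto
  moreover have "D \<inter> D' = (G \<inter> G') \<times> ((E \<inter> E') \<times> {max s s'<..min u u'})" unfolding D D' by auto
  ultimately show "D \<inter> D' \<in> predictable_rectangles M Fil"
    unfolding predictable_rectangles_def using D(2) D'(2) sets.Int by blast
qed

text \<open>Dynkin system argument from the predictable rectangles, where the claim is
  \<open>N_mean\<close>. Measurability of the mass of a random section is not given, so a measurable
  version \<open>n\<close> is carried along. Complements require finite masses, hence the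
  restriction to \<open>E0\<close> and to times up to \<open>T\<close>.\<close>

lemma compensation:
  assumes E0: "E0 \<in> sets borel" "emeasure \<nu> E0 < \<infinity>" and T: "0 < T" and D: "D \<in> sets Pred"
  shows "\<exists>n \<in> borel_measurable M. (AE \<omega> in M. n \<omega> = emeasure (N \<omega>) (Pair \<omega> -` D \<inter> E0 \<times> {0<..T}))
    \<and> (\<lambda>\<omega>. emeasure (\<nu> \<Otimes>\<^sub>M lborel) (Pair \<omega> -` D \<inter> E0 \<times> {0<..T})) \<in> borel_measurable M
    \<and> (\<integral>\<^sup>+\<omega>. n \<omega> \<partial>M) = (\<integral>\<^sup>+\<omega>. emeasure (\<nu> \<Otimes>\<^sub>M lborel) (Pair \<omega> -` D \<inter> E0 \<times> {0<..T}) \<partial>M)"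
proof -
  let ?R = "E0 \<times> {0<..T}"
  let ?\<mu> = "\<nu> \<Otimes>\<^sub>M (lborel :: real measure)"
  have R: "?R \<in> sets borel" "?R \<subseteq> UNIV \<times> {0<..}" using cell_sets[OF E0(1)] by auto
  have \<mu>R: "emeasure ?\<mu> ?R < \<infinity>" using emeasure_cell[OF E0(1)] T E0(2) by (simp add: ennreal_mult_less_top)
  have sets\<mu>: "sets ?\<mu> = sets borel" by (simp add: sets_\<nu> borel_prod[symmetric] cong: sets_pair_measure_cong)
  have finN: "AE \<omega> in M. emeasure (N \<omega>) ?R < \<infinity>"
    using AE_N_integer[OF R \<mu>R] by eventually_elim (auto simp: less_top[symmetric])
  define \<Phi> where "\<Phi> D \<omega> = emeasure (N \<omega>) (Pair \<omega> -` D \<inter> ?R)" for D \<omega>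
  define \<Psi> where "\<Psi> D \<omega> = emeasure ?\<mu> (Pair \<omega> -` D \<inter> ?R)" for D and \<omega> :: 'w
  have sec: "Pair \<omega> -` D \<inter> ?R \<in> sets borel" if "D \<in> sets Pred" "\<omega> \<in> space M" for D \<omega>
    using Pred_section[OF that] R(1) by blast
  have goal: "\<exists>n \<in> borel_measurable M. (AE \<omega> in M. n \<omega> = \<Phi> D \<omega>) \<and> \<Psi> D \<in> borel_measurable M \<and>
    (\<integral>\<^sup>+\<omega>. n \<omega> \<partial>M) = (\<integral>\<^sup>+\<omega>. \<Psi> D \<omega> \<partial>M)"
    using D unfolding sets_Pred
  proof (induction rule: sigma_sets_induct_disjoint[OF Int_stable_predictable predictable_rectangles_Pow])
    case 1
    then show ?case using D sets_Pred by simp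
  next
    case (2 D)
    then obtain G E s u where D': "D = G \<times> (E \<times> {s<..u})" "E \<in> sets borel" "0 \<le> s \<and> G \<in> sets (Fil s) \<or> G = space M"
      unfolding predictable_rectangles_def by blast
    \<comment> \<open>Rectangles over \<open>space M\<close> may start at negative times; the
      restriction to positive times moves the start to \<open>s'\<close>, where \<open>G\<close> is
      still known.\<close>
    define s' where "s' = max s 0"
    let ?C = "(E \<inter> E0) \<times> {s'<..min u T}"
    note top = top_Fil
    have G: "G \<in> sets (Fil s')" using D'(3) top by (auto simp: s'_def)
    then have GM: "G \<in> sets M" using Fil_sub by blast
    have C: "?C \<in> sets borel" using D'(2) E0(1) by (intro cell_sets) auto
    have Csub: "?C \<subseteq> UNIV \<times> {s'<..}" "?C \<subseteq> UNIV \<times> {0<..}" "?C \<subseteq> ?R" by (auto simp: s'_def)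
    have \<mu>C: "emeasure ?\<mu> ?C < \<infinity>"
      using emeasure_mono[OF Csub(3), of ?\<mu>] R(1) \<mu>R sets\<mu> by auto
    have secD: "Pair \<omega> -` D \<inter> ?R = (if \<omega> \<in> G then ?C else {})" for \<omega>
      unfolding D' by (auto simp: s'_def)
    have \<Phi>: "\<Phi> D = (\<lambda>\<omega>. indicator G \<omega> * emeasure (N \<omega>) ?C)" unfolding \<Phi>_def secD by (auto simp: fun_eq_iff)
    have \<Psi>: "\<Psi> D = (\<lambda>\<omega>. indicator G \<omega> * emeasure ?\<mu> ?C)" unfolding \<Psi>_def secD by (auto simp: fun_eq_iff)
    have "(\<integral>\<^sup>+\<omega>. \<Phi> D \<omega> \<partial>M) = emeasure M G * emeasure ?\<mu> ?C"
      unfolding \<Phi> by (rule N_mean[OF C Csub(1) \<mu>C _ G]) (simp add: s'_def)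
    also have "\<dots> = (\<integral>\<^sup>+\<omega>. \<Psi> D \<omega> \<partial>M)" unfolding \<Psi> using GM by (subst nn_integral_multc) auto
    moreover have "\<Phi> D \<in> borel_measurable M" unfolding \<Phi> using N_measurable[OF C Csub(2)] GM by measurable
    moreover have "\<Psi> D \<in> borel_measurable M" unfolding \<Psi> using GM by measurable
    ultimately show ?case by (intro bexI[of _ "\<Phi> D"]) auto
  next
    case 3
    show ?case by (intro bexI[of _ "\<lambda>_. 0"]) (auto simp: \<Phi>_def \<Psi>_def)
  next
    case (4 D)
    then have Ds: "D \<in> sets Pred" by (simp add: sets_Pred)
    obtain n where n: "n \<in> borel_measurable M" "AE \<omega> in M. n \<omega> = \<Phi> D \<omega>" "\<Psi> D \<in> borel_measurable M"
      "(\<integral>\<^sup>+\<omega>. n \<omega> \<partial>M) = (\<integral>\<^sup>+\<omega>. \<Psi> D \<omega> \<partial>M)" using 4 by blast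
    let ?D' = "space M \<times> UNIV - D"
    have split: "Pair \<omega> -` ?D' \<inter> ?R = ?R - (Pair \<omega> -` D \<inter> ?R)" if "\<omega> \<in> space M" for \<omega> using that by auto
    have Rm: "(\<lambda>\<omega>. emeasure (N \<omega>) ?R) \<in> borel_measurable M" by (rule N_measurable[OF R])
    have \<Phi>': "AE \<omega> in M. emeasure (N \<omega>) ?R - n \<omega> = \<Phi> ?D' \<omega>"
      using finN n(2) AE_space
    proof eventually_elim
      case (elim \<omega>)
      have "\<Phi> D \<omega> \<noteq> \<infinity>" using elim(1) emeasure_mono[of "Pair \<omega> -` D \<inter> ?R" ?R "N \<omega>"] R(1) sets_N[OF elim(3)]
        unfolding \<Phi>_def by (auto simp: top_unique)
      then show ?case unfolding elim(2) \<Phi>_def split[OF elim(3)]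
        using sec[OF Ds elim(3)] R(1) sets_N[OF elim(3)] by (subst emeasure_Diff) auto
    qed
    have \<Psi>': "\<Psi> ?D' \<omega> = emeasure ?\<mu> ?R - \<Psi> D \<omega>" if "\<omega> \<in> space M" for \<omega>
    proof -
      have "\<Psi> D \<omega> \<noteq> \<infinity>" using \<mu>R emeasure_mono[of "Pair \<omega> -` D \<inter> ?R" ?R ?\<mu>] R(1) sets\<mu>
        unfolding \<Psi>_def by (auto simp: top_unique)
      then show ?thesis unfolding \<Psi>_def split[OF that]
        using sec[OF Ds that] R(1) sets\<mu> by (subst emeasure_Diff) auto
    qed
    have \<Psi>m: "\<Psi> ?D' \<in> borel_measurable M"
      using n(3) by (subst measurable_cong[OF \<Psi>']) measurable
    have "(\<integral>\<^sup>+\<omega>. emeasure (N \<omega>) ?R - n \<omega> \<partial>M) = (\<integral>\<^sup>+\<omega>. emeasure (N \<omega>) ?R \<partial>M) - (\<integral>\<^sup>+\<omega>. n \<omega> \<partial>M)"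
    proof (rule nn_integral_diff[OF Rm n(1)])
      have "(\<integral>\<^sup>+\<omega>. n \<omega> \<partial>M) \<le> (\<integral>\<^sup>+\<omega>. emeasure ?\<mu> ?R \<partial>M)"
        unfolding n(4) \<Psi>_def using R(1) sets\<mu> by (intro nn_integral_mono emeasure_mono) auto
      also have "\<dots> < \<infinity>" using \<mu>R by (simp add: emeasure_space_1)
      finally show "(\<integral>\<^sup>+\<omega>. n \<omega> \<partial>M) \<noteq> \<infinity>" by simp
      show "AE \<omega> in M. n \<omega> \<le> emeasure (N \<omega>) ?R"
        using n(2) AE_space
      proof eventually_elim
        case (elim \<omega>)
        then show ?case unfolding \<Phi>_def using R(1) sets_N[OF elim(2)] by (auto intro!: emeasure_mono)
      qed
    qed
    also have "(\<integral>\<^sup>+\<omega>. emeasure (N \<omega>) ?R \<partial>M) = emeasure ?\<mu> ?R"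
      using N_mean[OF R(1) _ \<mu>R, of 0 "space M"] top_Fil R(2) by (simp add: emeasure_space_1 cong: nn_integral_cong)
    also have "emeasure ?\<mu> ?R - (\<integral>\<^sup>+\<omega>. n \<omega> \<partial>M) = (\<integral>\<^sup>+\<omega>. emeasure ?\<mu> ?R - \<Psi> D \<omega> \<partial>M)"
    proof -
      have "(\<integral>\<^sup>+\<omega>. emeasure ?\<mu> ?R - \<Psi> D \<omega> \<partial>M) = (\<integral>\<^sup>+\<omega>. emeasure ?\<mu> ?R \<partial>M) - (\<integral>\<^sup>+\<omega>. \<Psi> D \<omega> \<partial>M)"
      proof (rule nn_integral_diff[OF _ n(3)])
        have le: "\<Psi> D \<omega> \<le> emeasure ?\<mu> ?R" for \<omega> unfolding \<Psi>_def using R(1) sets\<mu> by (intro emeasure_mono) auto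
        then show "AE \<omega> in M. \<Psi> D \<omega> \<le> emeasure ?\<mu> ?R" by simp
        have "(\<integral>\<^sup>+\<omega>. \<Psi> D \<omega> \<partial>M) \<le> (\<integral>\<^sup>+\<omega>. emeasure ?\<mu> ?R \<partial>M)" using le by (intro nn_integral_mono)
        also have "\<dots> < \<infinity>" using \<mu>R by (simp add: emeasure_space_1)
        finally show "(\<integral>\<^sup>+\<omega>. \<Psi> D \<omega> \<partial>M) \<noteq> \<infinity>" by simp
      qed simp
      then show ?thesis by (simp add: n(4) emeasure_space_1)
    qed
    also have "\<dots> = (\<integral>\<^sup>+\<omega>. \<Psi> ?D' \<omega> \<partial>M)" by (intro nn_integral_cong) (simp add: \<Psi>')
    finally show ?case using \<Phi>' \<Psi>m Rm n(1) by (intro bexI[of _ "\<lambda>\<omega>. emeasure (N \<omega>) ?R - n \<omega>"]) auto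
  next
    case (5 A)
    then have As: "A i \<in> sets Pred" for i by (auto simp: sets_Pred)
    have "\<forall>i. \<exists>n. n \<in> borel_measurable M \<and> (AE \<omega> in M. n \<omega> = \<Phi> (A i) \<omega>) \<and> \<Psi> (A i) \<in> borel_measurable M \<and>
      (\<integral>\<^sup>+\<omega>. n \<omega> \<partial>M) = (\<integral>\<^sup>+\<omega>. \<Psi> (A i) \<omega> \<partial>M)" using 5 by blast
    from choice[OF this] obtain n where n: "\<And>i. n i \<in> borel_measurable M" "\<And>i. AE \<omega> in M. n i \<omega> = \<Phi> (A i) \<omega>"
      "\<And>i. \<Psi> (A i) \<in> borel_measurable M" "\<And>i. (\<integral>\<^sup>+\<omega>. n i \<omega> \<partial>M) = (\<integral>\<^sup>+\<omega>. \<Psi> (A i) \<omega> \<partial>M)"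
      by blast
    have vim: "Pair \<omega> -` (\<Union>i. A i) \<inter> ?R = (\<Union>i. Pair \<omega> -` A i \<inter> ?R)" for \<omega> by auto
    have disj: "disjoint_family (\<lambda>i. Pair \<omega> -` A i \<inter> ?R)" for \<omega>
      using 5 unfolding disjoint_family_on_def by blast
    have \<Phi>': "AE \<omega> in M. (\<Sum>i. n i \<omega>) = \<Phi> (\<Union>i. A i) \<omega>"
    proof -
      have "AE \<omega> in M. \<forall>i. n i \<omega> = \<Phi> (A i) \<omega>" using n(2) by (simp add: AE_all_countable)
      then show ?thesis using AE_space
      proof eventually_elim
        case (elim \<omega>)
        have "(\<Sum>i. \<Phi> (A i) \<omega>) = \<Phi> (\<Union>i. A i) \<omega>"
          unfolding \<Phi>_def vim using sec[OF As elim(2)] sets_N[OF elim(2)] disj by (intro suminf_emeasure) auto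
        then show ?case using elim(1) by simp
      qed
    qed
    have \<Psi>': "\<Psi> (\<Union>i. A i) \<omega> = (\<Sum>i. \<Psi> (A i) \<omega>)" if "\<omega> \<in> space M" for \<omega>
      unfolding \<Psi>_def vim using sec[OF As that] sets\<mu> disj by (intro suminf_emeasure[symmetric]) auto
    have \<Psi>m: "\<Psi> (\<Union>i. A i) \<in> borel_measurable M"
      using n(3) by (subst measurable_cong[OF \<Psi>']) measurable
    have "(\<integral>\<^sup>+\<omega>. (\<Sum>i. n i \<omega>) \<partial>M) = (\<Sum>i. \<integral>\<^sup>+\<omega>. n i \<omega> \<partial>M)" by (rule nn_integral_suminf[OF n(1)])
    also have "\<dots> = (\<Sum>i. \<integral>\<^sup>+\<omega>. \<Psi> (A i) \<omega> \<partial>M)" by (simp add: n(4))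
    also have "\<dots> = (\<integral>\<^sup>+\<omega>. (\<Sum>i. \<Psi> (A i) \<omega>) \<partial>M)" by (rule nn_integral_suminf[symmetric, OF n(3)])
    also have "\<dots> = (\<integral>\<^sup>+\<omega>. \<Psi> (\<Union>i. A i) \<omega> \<partial>M)" by (intro nn_integral_cong) (simp add: \<Psi>')
    finally show ?case using \<Phi>' \<Psi>m n(1) by (intro bexI[of _ "\<lambda>\<omega>. \<Sum>i. n i \<omega>"]) auto
  qed
  then show ?thesis unfolding \<Phi>_def \<Psi>_def .
qed

text \<open>The expected number of points equals the expected mass of the compensator, and a
  nonnegative count of mean 0 vanishes almost surely.\<close>

lemma predictable_null:
  assumes E0: "E0 \<in> sets borel" "emeasure \<nu> E0 < \<infinity>" and T: "0 < T" and D: "D \<in> sets Pred"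
    and null: "AE \<omega> in M. emeasure (\<nu> \<Otimes>\<^sub>M lborel) (Pair \<omega> -` D \<inter> E0 \<times> {0<..T}) = 0"
  shows "AE \<omega> in M. emeasure (N \<omega>) (Pair \<omega> -` D \<inter> E0 \<times> {0<..T}) = 0"
proof -
  obtain n where n: "n \<in> borel_measurable M" "AE \<omega> in M. n \<omega> = emeasure (N \<omega>) (Pair \<omega> -` D \<inter> E0 \<times> {0<..T})"
    "(\<lambda>\<omega>. emeasure (\<nu> \<Otimes>\<^sub>M lborel) (Pair \<omega> -` D \<inter> E0 \<times> {0<..T})) \<in> borel_measurable M"
    "(\<integral>\<^sup>+\<omega>. n \<omega> \<partial>M) = (\<integral>\<^sup>+\<omega>. emeasure (\<nu> \<Otimes>\<^sub>M lborel) (Pair \<omega> -` D \<inter> E0 \<times> {0<..T}) \<partial>M)"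
    using compensation[OF E0 T D] by blast
  have "(\<integral>\<^sup>+\<omega>. n \<omega> \<partial>M) = 0" unfolding n(4) using null by (subst nn_integral_0_iff_AE[OF n(3)])
  then have "AE \<omega> in M. n \<omega> = 0" using nn_integral_0_iff_AE[OF n(1)] by simp
  then show ?thesis using n(2) by eventually_elim simp
qed

end

section \<open>Jumps of the compensated integral\<close>

lemma left_lim_eq: "((\<lambda>s. X s \<omega>) \<longlongrightarrow> l) (at_left t) \<Longrightarrow> left_lim X t \<omega> = l"
  for t :: real
  unfolding left_lim_def by (rule tendsto_Lim) simp

lemma levy_measure_cofinite:
  assumes "levy_measure \<nu>" "0 < e"
  shows "emeasure \<nu> {r. e \<le> norm r} < \<infinity>"
proof -
  have [measurable_cong]: "sets \<nu> = sets borel" using assms by (simp add: levy_measure_def)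
  let ?c = "min 1 (e\<^sup>2)"
  have c: "0 < ?c" using assms by simp
  have "ennreal ?c * emeasure \<nu> {r. e \<le> norm r} = (\<integral>\<^sup>+r. ennreal ?c * indicator {r. e \<le> norm r} r \<partial>\<nu>)"
    by (subst nn_integral_cmult_indicator) (auto, measurable)
  also have "\<dots> \<le> (\<integral>\<^sup>+r. ennreal (min 1 ((norm r)\<^sup>2)) \<partial>\<nu>)"
  proof (rule nn_integral_mono)
    fix r
    have "e \<le> norm r \<Longrightarrow> e\<^sup>2 \<le> (norm r)\<^sup>2" using assms by (intro power_mono) auto
    then show "ennreal ?c * indicator {r. e \<le> norm r} r \<le> ennreal (min 1 ((norm r)\<^sup>2))"
      by (auto simp: indicator_def intro!: ennreal_leI)
  qed
  also have "\<dots> < \<infinity>" using assms by (simp add: levy_measure_def)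
  finally show ?thesis using c by (auto simp: ennreal_mult_less_top)
qed

lemma levy_measure_sigma_finite:
  assumes "levy_measure \<nu>"
  shows "sigma_finite_measure \<nu>"
proof
  have [measurable_cong]: "sets \<nu> = sets borel" and n0: "emeasure \<nu> {0} = 0" using assms by (auto simp: levy_measure_def)
  have sp: "space \<nu> = UNIV" using sets_eq_imp_space_eq[OF \<open>sets \<nu> = sets borel\<close>] by simp
  let ?A = "insert {0} (range (\<lambda>n::nat. {r. 1 / Suc n \<le> norm r}))"
  show "\<exists>A. countable A \<and> A \<subseteq> sets \<nu> \<and> \<Union> A = space \<nu> \<and> (\<forall>a\<in>A. emeasure \<nu> a \<noteq> \<infinity>)"
  proof (intro exI[of _ ?A] conjI)
    show "countable ?A" by simp
    have "{r::real^'a. 1 / Suc n \<le> norm r} \<in> sets \<nu>" for n by measurable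
    then show "?A \<subseteq> sets \<nu>" by auto
    have "r \<in> \<Union> ?A" for r
    proof (cases "r = 0")
      case False
      then obtain n where "1 / real (Suc n) < norm r" using nat_approx_posE[of "norm r"] by auto
      then have "r \<in> {r. 1 / Suc n \<le> norm r}" by simp
      then show ?thesis by blast
    qed simp
    then show "\<Union> ?A = space \<nu>" unfolding sp by blast
    show "\<forall>a\<in>?A. emeasure \<nu> a \<noteq> \<infinity>"
      using n0 levy_measure_cofinite[OF assms] by (auto simp: less_top[symmetric] simp del: of_nat_Suc)
  qed
qed

text \<open>Coming from the left, only the mass of the time slice at \<open>t\<close> is lost, and
  only if \<open>t\<close> lies in the time interval of the cell. Finiteness of the mass is what
  allows the subtraction.\<close>

lemma measure_left_limit:
  fixes m :: "((real^'m) \<times> real) measure"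
  assumes m: "sets m = sets borel" and E: "E \<in> sets borel" and fin: "emeasure m (E \<times> {0<..T}) < \<infinity>"
    and t: "0 < t" "t \<le> T" and su: "0 \<le> s" "s \<le> u"
  shows "((\<lambda>v. measure m (E \<times> {min s v<..min u v})) \<longlongrightarrow>
    measure m (E \<times> {min s t<..min u t}) - indicator {s<..u} t * measure m (E \<times> {t})) (at_left t)"
proof -
  have cs: "E \<times> {a<..b} \<in> sets m" for a b using E m by (simp add: borel_prod[symmetric] pair_measureI)
  consider "t \<le> s" | "s < t" "t \<le> u" | "u < t" by linarith
  then show ?thesis
  proof cases
    case 1
    have ev: "\<forall>\<^sub>F v in at_left t. 0 = measure m (E \<times> {min s v<..min u v})"
      using eventually_at_left_real[of "t - 1" t] by (rule eventually_mono) (use 1 su in auto)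
    have "((\<lambda>v. measure m (E \<times> {min s v<..min u v})) \<longlongrightarrow> 0) (at_left t)"
      by (rule Lim_transform_eventually[OF tendsto_const ev])
    then show ?thesis using 1 su by simp
  next
    case 3
    have ev: "\<forall>\<^sub>F v in at_left t. measure m (E \<times> {s<..u}) = measure m (E \<times> {min s v<..min u v})"
      using eventually_at_left_real[OF 3] by (rule eventually_mono) (use 3 su in auto)
    have "((\<lambda>v. measure m (E \<times> {min s v<..min u v})) \<longlongrightarrow> measure m (E \<times> {s<..u})) (at_left t)"
      by (rule Lim_transform_eventually[OF tendsto_const ev])
    then show ?thesis using 3 su by simp
  next
    case 2
    have sub: "E \<times> {s<..t} \<subseteq> E \<times> {0<..T}" using su t by auto
    have fin': "emeasure m D < \<infinity>" if "D \<subseteq> E \<times> {s<..t}" for D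
      using emeasure_mono[of D "E \<times> {0<..T}" m] that sub fin cs by (auto intro: le_less_trans)
    have pt: "E \<times> {t} \<in> sets m" using E m by (simp add: borel_prod[symmetric] pair_measureI)
    have "E \<times> {s<..<t} \<in> sets m" using E m by (simp add: borel_prod[symmetric] pair_measureI)
    then have "measure m (E \<times> {s<..<t} \<union> E \<times> {t}) = measure m (E \<times> {s<..<t}) + measure m (E \<times> {t})"
    proof (intro measure_Union)
      have "E \<times> {s<..<t} \<subseteq> E \<times> {s<..t}" "E \<times> {t} \<subseteq> E \<times> {s<..t}" using 2 by auto
      then show "emeasure m (E \<times> {s<..<t}) \<noteq> \<infinity>" "emeasure m (E \<times> {t}) \<noteq> \<infinity>"
        using fin' by (metis infinity_ennreal_def less_irrefl)+
    qed (use pt in auto)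
    moreover have "E \<times> {s<..<t} \<union> E \<times> {t} = E \<times> {s<..t}" using 2 by auto
    ultimately have eq: "measure m (E \<times> {s<..t}) - measure m (E \<times> {t}) = measure m (E \<times> {s<..<t})" by simp
    have lim: "((\<lambda>v. measure m (E \<times> {s<..v})) \<longlongrightarrow> measure m (E \<times> {s<..<t})) (at_left t)"
    proof (rule tendsto_at_left_sequentially[OF \<open>s < t\<close>])
      fix S :: "nat \<Rightarrow> real" assume S: "\<And>n. S n < t" "\<And>n. s < S n" "incseq S" "S \<longlonglongrightarrow> t"
      have "(\<Union>n. E \<times> {s<..S n}) = E \<times> {s<..<t}"
      proof
        show "(\<Union>n. E \<times> {s<..S n}) \<subseteq> E \<times> {s<..<t}" by (auto dest: le_less_trans[OF _ S(1)])
        show "E \<times> {s<..<t} \<subseteq> (\<Union>n. E \<times> {s<..S n})"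
        proof
          fix x assume x: "x \<in> E \<times> {s<..<t}"
          then have "\<forall>\<^sub>F n in sequentially. snd x < S n" using S(4) by (intro order_tendstoD(1)) auto
          then obtain n where "snd x < S n" by (auto simp: eventually_sequentially)
          then show "x \<in> (\<Union>n. E \<times> {s<..S n})" using x by (intro UN_I[of n]) auto
        qed
      qed
      moreover have "(\<lambda>n. measure m (E \<times> {s<..S n})) \<longlonglongrightarrow> measure m (\<Union>n. E \<times> {s<..S n})"
      proof (rule Lim_measure_incseq)
        show "range (\<lambda>n. E \<times> {s<..S n}) \<subseteq> sets m" using cs by auto
        show "incseq (\<lambda>n. E \<times> {s<..S n})" using S(3) unfolding incseq_def
          by (intro allI impI Sigma_mono order_refl) (simp add: Ioc_subset_iff)
        have "(\<Union>n. E \<times> {s<..S n}) \<subseteq> E \<times> {s<..t}" by (auto dest: order_trans[OF _ less_imp_le[OF S(1)]])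
        from fin'[OF this] show "emeasure m (\<Union>n. E \<times> {s<..S n}) \<noteq> \<infinity>" by simp
      qed
      ultimately show "(\<lambda>n. measure m (E \<times> {s<..S n})) \<longlonglongrightarrow> measure m (E \<times> {s<..<t})" by simp
    qed
    have ev: "\<forall>\<^sub>F v in at_left t. measure m (E \<times> {s<..v}) = measure m (E \<times> {min s v<..min u v})"
      using eventually_at_left_real[OF 2(1)] by (rule eventually_mono) (use 2 su in auto)
    have "((\<lambda>v. measure m (E \<times> {min s v<..min u v})) \<longlongrightarrow> measure m (E \<times> {s<..<t})) (at_left t)"
      by (rule Lim_transform_eventually[OF lim ev])
    then show ?thesis using 2 eq by simp
  qed
qed

section \<open>Predictability of the integrands\<close>

context poisson_noise
begin

lemma measurable_Pred_mark: "(\<lambda>x. fst (snd x)) \<in> borel_measurable Pred"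
proof (rule measurableI)
  fix E :: "(real^'m) set" assume E: "E \<in> sets borel"
  have "(\<lambda>x. fst (snd x)) -` E \<inter> space Pred = (\<Union>n::nat. space M \<times> (E \<times> {- real n<..real n}))"
  proof -
    have "\<exists>n::nat. - real n < t \<and> t \<le> real n" for t
    proof -
      obtain n :: nat where "\<bar>t\<bar> < real n" using reals_Archimedean2 by blast
      then show ?thesis by (intro exI[of _ n]) auto
    qed
    then show ?thesis by (force simp: space_Pred)
  qed
  then show "(\<lambda>x. fst (snd x)) -` E \<inter> space Pred \<in> sets Pred" using Pred_rectangle_space[OF E] by auto
qed simp

lemma measurable_Pred_time: "(\<lambda>x. snd (snd x)) \<in> borel_measurable Pred"
proof (rule borel_measurableI_le)
  fix y :: real
  have "{x \<in> space Pred. snd (snd x) \<le> y} = (\<Union>n::nat. space M \<times> (UNIV \<times> {- real n<..y}))"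
  proof -
    have "\<exists>n::nat. - real n < t" for t using reals_Archimedean2[of "- t"] by (auto simp: minus_less_iff)
    then show ?thesis by (force simp: space_Pred)
  qed
  then show "{x \<in> space Pred. snd (snd x) \<le> y} \<in> sets Pred" using Pred_rectangle_space[of UNIV] by auto
qed

text \<open>\<open>a n t\<close> is the largest dyadic point of level \<open>n\<close> strictly
  below \<open>t\<close>, that is, the left end of the dyadic cell of \<open>t\<close>. The value of
  \<open>X\<close> there is known when the cell begins, so each approximation is built from
  predictable rectangles.\<close>

lemma measurable_Pred_left_lim:
  fixes X :: "real \<Rightarrow> 'w \<Rightarrow> real^'n"
  assumes X: "adapted_cadlag M Fil X"
  shows "(\<lambda>x. if 0 < snd (snd x) then left_lim X (snd (snd x)) (fst x) else 0) \<in> borel_measurable Pred"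
proof -
  define a where "a n t = (real_of_int \<lceil>2^n * t\<rceil> - 1) / 2^n" for n :: nat and t :: real
  have a: "a n t < t" "t - (1/2)^n \<le> a n t" for n t
  proof -
    have "real_of_int \<lceil>2^n * t\<rceil> - 1 < 2^n * t" "2^n * t - 1 \<le> real_of_int \<lceil>2^n * t\<rceil> - 1" by linarith+
    then show "a n t < t" "t - (1/2)^n \<le> a n t" by (simp_all add: a_def field_simps power_one_over)
  qed
  have lim: "(\<lambda>n. a n t) \<longlonglongrightarrow> t" for t
  proof (rule tendsto_sandwich[of "\<lambda>n. t - (1/2)^n" _ _ "\<lambda>_. t"])
    have "(\<lambda>n. t - (1/2::real)^n) \<longlonglongrightarrow> t - 0" by (intro tendsto_diff tendsto_const LIMSEQ_power_zero) simp
    then show "(\<lambda>n. t - (1/2::real)^n) \<longlonglongrightarrow> t" by simp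
  qed (use a in \<open>auto intro!: always_eventually less_imp_le\<close>)
  have m: "(\<lambda>x. if 0 < snd (snd x) then X (a n (snd (snd x))) (fst x) else 0) \<in> borel_measurable Pred" for n
  proof (rule measurableI)
    fix U :: "(real^'n) set" assume U: "U \<in> sets borel"
    have XF: "X t -` U \<inter> space M \<in> sets (Fil t)" if "0 \<le> t" for t
    proof -
      have "X t \<in> borel_measurable (Fil t)" using X that by (auto simp: adapted_cadlag_def)
      from measurable_sets[OF this U] show ?thesis using filt by (simp add: filtration_def)
    qed
    let ?f = "\<lambda>x. if 0 < snd (snd x) then X (a n (snd (snd x))) (fst x) else 0"
    have ai: "a n t = real i / 2^n" if "t \<in> {real i / 2^n<..real (Suc i) / 2^n}" for i t
    proof -
      have "real i < 2^n * t" "2^n * t \<le> real (Suc i)" using that by (auto simp: field_simps)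
      then have "\<lceil>2^n * t\<rceil> = int (Suc i)" by (intro ceiling_unique) auto
      then show ?thesis by (simp add: a_def)
    qed
    have ex: "\<exists>i::nat. t \<in> {real i / 2^n<..real (Suc i) / 2^n}" if "0 < t" for t
    proof (intro exI[of _ "nat (\<lceil>2^n * t\<rceil> - 1)"])
      have "0 < 2^n * t" using that by simp
      then have "real (nat (\<lceil>2^n * t\<rceil> - 1)) = real_of_int \<lceil>2^n * t\<rceil> - 1" by simp
      then have "real (nat (\<lceil>2^n * t\<rceil> - 1)) < 2^n * t" "2^n * t \<le> real (Suc (nat (\<lceil>2^n * t\<rceil> - 1)))" by linarith+
      then show "t \<in> {real (nat (\<lceil>2^n * t\<rceil> - 1)) / 2^n<..real (Suc (nat (\<lceil>2^n * t\<rceil> - 1))) / 2^n}"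
        by (simp add: field_simps)
    qed
    have "?f -` U \<inter> space Pred = (\<Union>i::nat. (X (real i / 2^n) -` U \<inter> space M) \<times> (UNIV \<times> {real i / 2^n<..real (Suc i) / 2^n}))
       \<union> (if 0 \<in> U then {x\<in>space Pred. snd (snd x) \<le> 0} else {})" (is "?L = ?R")
    proof (rule set_eqI)
      fix x :: "'w \<times> ((real^'m) \<times> real)"
      obtain \<omega> r t where x: "x = (\<omega>, r, t)" by (cases x) auto
      show "x \<in> ?L \<longleftrightarrow> x \<in> ?R"
      proof (cases "0 < t")
        case True
        obtain i where i: "t \<in> {real i / 2^n<..real (Suc i) / 2^n}" using ex[OF True] by blast
        have uniq: "real j / 2^n = real i / 2^n" if "t \<in> {real j / 2^n<..real (Suc j) / 2^n}" for j
          using ai[OF i] ai[OF that] by simp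
        have "x \<in> ?L \<longleftrightarrow> \<omega> \<in> space M \<and> X (real i / 2^n) \<omega> \<in> U" using True ai[OF i] by (auto simp: x space_Pred)
        also have "\<dots> \<longleftrightarrow> x \<in> ?R"
        proof
          assume "\<omega> \<in> space M \<and> X (real i / 2^n) \<omega> \<in> U"
          then have "x \<in> (X (real i / 2^n) -` U \<inter> space M) \<times> (UNIV \<times> {real i / 2^n<..real (Suc i) / 2^n})"
            using i by (simp add: x)
          then show "x \<in> ?R" by blast
        next
          assume "x \<in> ?R"
          then obtain j where "X (real j / 2^n) \<omega> \<in> U" "\<omega> \<in> space M" "t \<in> {real j / 2^n<..real (Suc j) / 2^n}"
            using True by (auto simp: x split: if_splits)
          then show "\<omega> \<in> space M \<and> X (real i / 2^n) \<omega> \<in> U" using uniq by metis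
        qed
        finally show ?thesis .
      next
        case False
        have "t \<notin> {real i / 2^n<..real (Suc i) / 2^n}" for i :: nat
          using False by (auto simp: not_less intro: order_trans)
        then show ?thesis using False by (auto simp: x space_Pred)
      qed
    qed
    moreover have "(X (real i / 2^n) -` U \<inter> space M) \<times> (UNIV \<times> {real i / 2^n<..real (Suc i) / 2^n}) \<in> sets Pred" for i
      by (intro Pred_rectangle XF) auto
    moreover have "{x\<in>space Pred. snd (snd x) \<le> 0} \<in> sets Pred" using measurable_Pred_time by measurable
    ultimately show "?f -` U \<inter> space Pred \<in> sets Pred" by auto
  qed simp
  show ?thesis
  proof (rule borel_measurable_LIMSEQ_metric[OF m])
    fix x assume "x \<in> space Pred"
    then have \<omega>: "fst x \<in> space M" by (auto simp: space_Pred)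
    show "(\<lambda>n. if 0 < snd (snd x) then X (a n (snd (snd x))) (fst x) else 0) \<longlonglongrightarrow>
      (if 0 < snd (snd x) then left_lim X (snd (snd x)) (fst x) else 0)"
    proof (cases "0 < snd (snd x)")
      case True
      have "rcll 0 (\<lambda>s. X s (fst x))" using X \<omega> by (auto simp: adapted_cadlag_def cadlag_on_rcll_0)
      from rcll_left[OF this True] obtain l where l: "((\<lambda>s. X s (fst x)) \<longlongrightarrow> l) (at_left (snd (snd x)))" by blast
      have "filterlim (\<lambda>n. a n (snd (snd x))) (at_left (snd (snd x))) sequentially"
        using lim a(1) by (intro filterlim_at_withinI) (auto simp: less_imp_neq)
      then have "(\<lambda>n. X (a n (snd (snd x))) (fst x)) \<longlonglongrightarrow> l" using l filterlim_compose by fastforce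
      then show ?thesis using True left_lim_eq[where X = X, OF l] by simp
    qed simp
  qed
qed

lemma measurable_Pred_jump_simple_val:
  assumes "jump_simple Fil \<nu> h"
  shows "(\<lambda>x. jump_simple_val h (snd (snd x)) (fst (snd x)) (fst x)) \<in> borel_measurable Pred"
  using assms
proof (induction h)
  case Nil
  then show ?case by (simp add: jump_simple_val_def)
next
  case (Cons e h)
  obtain s u E \<xi> where e: "e = (s, u, E, \<xi>)" by (cases e) auto
  have p: "0 \<le> s" "E \<in> sets borel" "\<xi> \<in> borel_measurable (Fil s)" using Cons.prems by (auto simp: jump_simple_def e)
  let ?f = "\<lambda>x. (indicator {s<..u} (snd (snd x)) * indicator E (fst (snd x))) *\<^sub>R \<xi> (fst x)"
  have "?f \<in> borel_measurable Pred"
  proof (rule measurableI)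
    fix U :: "'b set"
    show "?f -` V \<inter> space Pred \<in> sets Pred" if V: "V \<in> sets borel" for V
    proof -
      have spF: "space (Fil s) = space M" using filt by (simp add: filtration_def)
      have 1: "(\<xi> -` V \<inter> space M) \<times> (E \<times> {s<..u}) \<in> sets Pred"
        using measurable_sets[OF p(3) V] p by (intro Pred_rectangle) (auto simp: spF)
      have 2: "space Pred - space M \<times> (E \<times> {s<..u}) \<in> sets Pred" using Pred_rectangle_space[OF p(2)] by blast
      have "?f -` V \<inter> space Pred = (\<xi> -` V \<inter> space M) \<times> (E \<times> {s<..u}) \<union> (if 0 \<in> V then space Pred - space M \<times> (E \<times> {s<..u}) else {})"
      proof (rule set_eqI)
        fix x :: "'w \<times> ((real^'m) \<times> real)"
        obtain \<omega> r t where x: "x = (\<omega>, r, t)" by (cases x) auto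
        show "x \<in> ?f -` V \<inter> space Pred \<longleftrightarrow>
          x \<in> (\<xi> -` V \<inter> space M) \<times> (E \<times> {s<..u}) \<union> (if 0 \<in> V then space Pred - space M \<times> (E \<times> {s<..u}) else {})"
          by (cases "r \<in> E \<and> t \<in> {s<..u}") (auto simp: x space_Pred)
      qed
      then show ?thesis using 1 2 by auto
    qed
  qed simp
  moreover have "(\<lambda>x. jump_simple_val h (snd (snd x)) (fst (snd x)) (fst x)) \<in> borel_measurable Pred"
    using Cons by (simp add: jump_simple_def)
  ultimately show ?case by (simp add: jump_simple_val_def e)
qed

text \<open>Integrals bounded by a geometric sequence have a finite sum, so the sum of the
  \<open>g n\<close> is finite almost everywhere and its terms tend to 0.\<close>

lemma L2_fast_convergence:
  fixes g :: "nat \<Rightarrow> (real^'m) \<times> real \<Rightarrow> real"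
  assumes g: "\<And>n. g n \<in> borel_measurable borel" "\<And>n x. 0 \<le> g n x"
    and fast: "\<forall>\<^sub>F n in sequentially. (\<integral>\<^sup>+t\<in>{0<..T}. (\<integral>\<^sup>+r. ennreal (g n (r, t)) \<partial>small_marks \<nu>) \<partial>lborel) \<le> ennreal ((1/2)^n)"
  shows "emeasure (\<nu> \<Otimes>\<^sub>M lborel) {x. norm (fst x) < 1 \<and> 0 < snd x \<and> snd x \<le> T \<and> \<not> (\<lambda>n. g n x) \<longlonglongrightarrow> 0} = 0"
proof -
  interpret \<nu>: sigma_finite_measure \<nu> by (rule levy_measure_sigma_finite[OF levy])
  interpret p: pair_sigma_finite \<nu> "lborel :: real measure" ..
  have sets\<mu>: "sets (\<nu> \<Otimes>\<^sub>M (lborel::real measure)) = sets borel"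
    by (simp add: sets_\<nu> borel_prod[symmetric] cong: sets_pair_measure_cong)
  have sp\<nu>: "space \<nu> = UNIV" using sets_eq_imp_space_eq[OF sets_\<nu>] by simp
  let ?S = "{x::(real^'m) \<times> real. norm (fst x) < 1 \<and> 0 < snd x \<and> snd x \<le> T}"
  define G where "G n x = ennreal (g n x) * indicator ?S x" for n x
  have "?S = {r. norm r < 1} \<times> {0<..T}" by auto
  moreover have "{r::real^'m. norm r < 1} \<in> sets borel" by measurable
  ultimately have S: "?S \<in> sets borel" using cell_sets by simp
  have gm: "(\<lambda>x. ennreal (g n x)) \<in> borel_measurable borel" for n using g(1) by measurable
  have Gm: "G n \<in> borel_measurable (\<nu> \<Otimes>\<^sub>M lborel)" for n
    unfolding G_def using gm S by (simp add: measurable_cong_sets[OF sets\<mu> refl] borel_measurable_times_ennreal)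
  have int: "(\<integral>\<^sup>+t\<in>{0<..T}. (\<integral>\<^sup>+r. ennreal (g n (r, t)) \<partial>small_marks \<nu>) \<partial>lborel) = (\<integral>\<^sup>+x. G n x \<partial>(\<nu> \<Otimes>\<^sub>M lborel))" for n
  proof -
    have ball: "{r::real^'m. norm r < 1} \<inter> space \<nu> \<in> sets \<nu>" unfolding sets_\<nu> sp\<nu> by measurable
    have "(\<integral>\<^sup>+r. ennreal (g n (r, t)) \<partial>small_marks \<nu>) * indicator {0<..T} t = (\<integral>\<^sup>+r. G n (r, t) \<partial>\<nu>)" for t
    proof -
      have "(\<integral>\<^sup>+r. ennreal (g n (r, t)) \<partial>small_marks \<nu>) = (\<integral>\<^sup>+r. ennreal (g n (r, t)) * indicator {r. norm r < 1} r \<partial>\<nu>)"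
        unfolding small_marks_def using ball by (subst nn_integral_restrict_space) (auto simp: Int_commute)
      moreover have "G n (r, t) = (if t \<in> {0<..T} then ennreal (g n (r, t)) * indicator {r. norm r < 1} r else 0)" for r
        by (simp add: G_def indicator_def)
      ultimately show ?thesis by (cases "t \<in> {0<..T}") auto
    qed
    then show ?thesis using p.nn_integral_snd[OF Gm, of n] by simp
  qed
  obtain m where m: "\<And>n. n \<ge> m \<Longrightarrow> (\<integral>\<^sup>+x. G n x \<partial>(\<nu> \<Otimes>\<^sub>M lborel)) \<le> ennreal ((1/2)^n)"
    using fast unfolding int by (auto simp: eventually_sequentially)
  have "(\<integral>\<^sup>+x. (\<Sum>n. G (n + m) x) \<partial>(\<nu> \<Otimes>\<^sub>M lborel)) = (\<Sum>n. \<integral>\<^sup>+x. G (n + m) x \<partial>(\<nu> \<Otimes>\<^sub>M lborel))"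
    by (rule nn_integral_suminf[OF Gm])
  also have "\<dots> \<le> (\<Sum>n. ennreal ((1/2)^n))"
  proof (intro suminf_le)
    fix n
    have "(\<integral>\<^sup>+x. G (n + m) x \<partial>(\<nu> \<Otimes>\<^sub>M lborel)) \<le> ennreal ((1/2)^(n + m))" by (rule m) simp
    also have "\<dots> \<le> ennreal ((1/2)^n)" by (intro ennreal_leI power_decreasing) auto
    finally show "(\<integral>\<^sup>+x. G (n + m) x \<partial>(\<nu> \<Otimes>\<^sub>M lborel)) \<le> ennreal ((1/2)^n)" .
  qed auto
  also have "\<dots> = ennreal (\<Sum>n. (1/2)^n)" by (rule suminf_ennreal2) (auto intro: summable_geometric)
  also have "\<dots> < \<infinity>" by simp
  finally have "(\<integral>\<^sup>+x. (\<Sum>n. G (n + m) x) \<partial>(\<nu> \<Otimes>\<^sub>M lborel)) \<noteq> \<infinity>" by simp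
  then have "AE x in \<nu> \<Otimes>\<^sub>M lborel. (\<Sum>n. G (n + m) x) \<noteq> \<infinity>"
    using Gm by (intro nn_integral_PInf_AE) auto
  then have "AE x in \<nu> \<Otimes>\<^sub>M lborel. x \<notin> {x. norm (fst x) < 1 \<and> 0 < snd x \<and> snd x \<le> T \<and> \<not> (\<lambda>n. g n x) \<longlonglongrightarrow> 0}"
  proof eventually_elim
    case (elim x)
    show ?case
    proof
      assume x: "x \<in> {x. norm (fst x) < 1 \<and> 0 < snd x \<and> snd x \<le> T \<and> \<not> (\<lambda>n. g n x) \<longlonglongrightarrow> 0}"
      then have "(\<Sum>n. ennreal (g (n + m) x)) \<noteq> \<infinity>" using elim by (simp add: G_def)
      then have "summable (\<lambda>n. g (n + m) x)" using g(2) by (intro summable_suminf_not_top) auto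
      then have "(\<lambda>n. g (n + m) x) \<longlonglongrightarrow> 0" by (rule summable_LIMSEQ_zero)
      then have "(\<lambda>n. g n x) \<longlonglongrightarrow> 0" by (rule LIMSEQ_offset)
      then show False using x by simp
    qed
  qed
  moreover have "{x. norm (fst x) < 1 \<and> 0 < snd x \<and> snd x \<le> T \<and> \<not> (\<lambda>n. g n x) \<longlonglongrightarrow> 0} \<in> sets (\<nu> \<Otimes>\<^sub>M lborel)"
  proof -
    have "{x \<in> space borel. \<forall>k::nat. \<exists>m. \<forall>n\<ge>m. dist (g n x) 0 < 1 / Suc k} \<in> sets (borel :: ((real^'m) \<times> real) measure)"
      using g(1) by measurable
    then have "{x. (\<lambda>n. g n x) \<longlonglongrightarrow> 0} \<in> sets borel"
      unfolding LIMSEQ_inverse_iff by (simp only: space_borel UNIV_I simp_thms)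
    from sets.Diff[OF S this] have "?S - {x. (\<lambda>n. g n x) \<longlonglongrightarrow> 0} \<in> sets borel" .
    moreover have "?S - {x. (\<lambda>n. g n x) \<longlonglongrightarrow> 0} = {x. norm (fst x) < 1 \<and> 0 < snd x \<and> snd x \<le> T \<and> \<not> (\<lambda>n. g n x) \<longlonglongrightarrow> 0}" by auto
    ultimately show ?thesis by (simp only: sets\<mu>)
  qed
  ultimately show ?thesis by (simp add: AE_iff_null_sets null_setsD1)
qed

text \<open>The compensator is continuous in time, so the jump stems from the mass of
  \<open>N\<close> on the time slice alone.\<close>

lemma jump_simple_integral_left_limit:
  assumes \<omega>: "\<omega> \<in> space M" and h: "jump_simple Fil \<nu> h" and t: "0 < t" "t \<le> T"
    and fin: "\<And>s u E \<xi>. (s, u, E, \<xi>) \<in> set h \<Longrightarrow> emeasure (N \<omega>) (E \<times> {0<..T}) < \<infinity>"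
  shows "((\<lambda>v. jump_simple_integral \<nu> N h v \<omega>) \<longlongrightarrow> jump_simple_integral \<nu> N h t \<omega>
    - (\<Sum>(s, u, E, \<xi>)\<leftarrow>h. (indicator {s<..u} t * measure (N \<omega>) (E \<times> {t})) *\<^sub>R \<xi> \<omega>)) (at_left t)"
  using h fin
proof (induction h)
  case Nil
  then show ?case by (simp add: jump_simple_integral_def)
next
  case (Cons e h)
  obtain s u E \<xi> where e: "e = (s, u, E, \<xi>)" by (cases e) auto
  have p: "0 \<le> s" "s \<le> u" "E \<in> sets borel" using Cons.prems(1) by (auto simp: jump_simple_def e)
  have IH: "((\<lambda>v. jump_simple_integral \<nu> N h v \<omega>) \<longlongrightarrow> jump_simple_integral \<nu> N h t \<omega>
    - (\<Sum>(s, u, E, \<xi>)\<leftarrow>h. (indicator {s<..u} t * measure (N \<omega>) (E \<times> {t})) *\<^sub>R \<xi> \<omega>)) (at_left t)"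
    using Cons by (auto simp: jump_simple_def)
  have "((\<lambda>v. measure (N \<omega>) (E \<times> {min s v<..min u v})) \<longlongrightarrow>
    measure (N \<omega>) (E \<times> {min s t<..min u t}) - indicator {s<..u} t * measure (N \<omega>) (E \<times> {t})) (at_left t)"
    using Cons.prems(2)[of s u E \<xi>] by (intro measure_left_limit[OF sets_N[OF \<omega>] p(3) _ t p(1,2)]) (simp add: e)
  moreover have "((\<lambda>v. measure \<nu> E * (min u v - min s v)) \<longlongrightarrow> measure \<nu> E * (min u t - min s t)) (at_left t)"
    by (intro tendsto_intros)
  ultimately have "((\<lambda>v. (measure (N \<omega>) (E \<times> {min s v<..min u v}) - measure \<nu> E * (min u v - min s v)) *\<^sub>R \<xi> \<omega>) \<longlongrightarrow>
    (measure (N \<omega>) (E \<times> {min s t<..min u t}) - indicator {s<..u} t * measure (N \<omega>) (E \<times> {t})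
      - measure \<nu> E * (min u t - min s t)) *\<^sub>R \<xi> \<omega>) (at_left t)"
    by (intro tendsto_scaleR tendsto_diff tendsto_const)
  from tendsto_add[OF this IH] show ?case
    by (simp add: jump_simple_integral_def e algebra_simps scaleR_diff_left[symmetric])
qed

end

section \<open>From simple integrals to their limits\<close>

lemma sup_le_imp_norm_le:
  assumes "(SUP t\<in>{0..T}. ennreal (norm (f t))) \<le> ennreal e" "0 \<le> e" "0 \<le> t" "t \<le> T"
  shows "norm (f t) \<le> e"
proof -
  have "ennreal (norm (f t)) \<le> (SUP t\<in>{0..T}. ennreal (norm (f t)))"
    using assms by (intro SUP_upper) auto
  then have "ennreal (norm (f t)) \<le> ennreal e" using assms(1) by (rule order_trans)
  then show ?thesis using assms(2) by (simp add: ennreal_le_iff)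
qed

lemma sum_list_map_eq_0: "(\<And>x. x \<in> set xs \<Longrightarrow> f x = 0) \<Longrightarrow> sum_list (map f xs) = (0::'b::comm_monoid_add)"
  by (induction xs) auto

lemma fast_tendsto:
  assumes "\<forall>\<^sub>F n in sequentially. dist (f n) l \<le> (1/2)^n"
  shows "f \<longlonglongrightarrow> l"
proof (rule tendsto_dist_iff[THEN iffD2], rule Lim_null_comparison)
  show "\<forall>\<^sub>F n in sequentially. norm (dist (f n) l) \<le> (1/2)^n" using assms by simp
  show "(\<lambda>n. (1/2::real)^n) \<longlonglongrightarrow> 0" by (rule LIMSEQ_power_zero) simp
qed

text \<open>Uniform convergence allows the left limit in time and the limit in \<open>n\<close> to
  be interchanged.\<close>

lemma uniform_limit_left_limit:
  fixes f :: "nat \<Rightarrow> real \<Rightarrow> 'a::metric_space"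
  assumes unif: "\<forall>\<^sub>F n in sequentially. \<forall>v. 0 \<le> v \<and> v \<le> T \<longrightarrow> dist (f n v) (g v) \<le> (1/2)^n"
    and t: "0 < t" "t \<le> T" and lim: "\<And>n. (f n \<longlongrightarrow> l n) (at_left t)" and l: "(g \<longlongrightarrow> l') (at_left t)"
  shows "l \<longlonglongrightarrow> l'"
proof (rule fast_tendsto)
  show "\<forall>\<^sub>F n in sequentially. dist (l n) l' \<le> (1/2)^n"
    using unif
  proof eventually_elim
    case (elim n)
    have "((\<lambda>v. dist (f n v) (g v)) \<longlongrightarrow> dist (l n) l') (at_left t)" using lim l by (rule tendsto_dist)
    moreover have "\<forall>\<^sub>F v in at_left t. dist (f n v) (g v) \<le> (1/2)^n"
      using eventually_at_left_real[OF t(1)] by (rule eventually_mono) (use elim t in auto)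
    ultimately show ?case by (rule tendsto_upperbound) simp
  qed
qed

context poisson_noise
begin

text \<open>The jump of \<open>Z\<close> at \<open>t\<close> is the limit of the jumps
  \<open>c n\<close> of the simple integrals. One mark \<open>r\<close> has to be found for which
  every \<open>c n\<close> equals the simple integrand at \<open>(r, t)\<close>. As \<open>N\<close>
  is not given as a sum of point masses, \<open>r\<close> is not obtained as an atom but as any mark
  that a null set \<open>V\<close> leaves over in a set of mass 1 on the time slice.\<close>

lemma compensated_integral_jumps_on:
  fixes X :: "real \<Rightarrow> 'w \<Rightarrow> real^'n" and F :: "real^'n \<Rightarrow> real^'m \<Rightarrow> real^'n"
  assumes Z: "has_compensated_integral M Fil \<nu> N (\<lambda>s r \<omega>. F (left_lim X s \<omega>) r) Z"
    and X: "adapted_cadlag M Fil X" and F: "(\<lambda>(x, r). F x r) \<in> borel_measurable borel"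
    and D: "D \<in> sets Pred"
    and null: "AE \<omega> in M. emeasure (\<nu> \<Otimes>\<^sub>M lborel) (Pair \<omega> -` D \<inter> {r. norm r < 1} \<times> {0<..}) = 0"
    and T: "0 < T"
  shows "AE \<omega> in M. Z 0 \<omega> = 0 \<and> (\<forall>t l. 0 < t \<and> t \<le> real T \<and> ((\<lambda>s. Z s \<omega>) \<longlongrightarrow> l) (at_left t) \<and> l \<noteq> Z t \<omega> \<longrightarrow>
     (\<exists>r. norm r < 1 \<and> (\<omega>, r, t) \<notin> D \<and> Z t \<omega> - l = F (left_lim X t \<omega>) r))"
proof -
  let ?T = "real T"
  have T0: "0 < ?T" using T by simp
  obtain h0 where h0: "\<And>n. jump_simple Fil \<nu> (h0 n)"
    and L2: "null_in_prob M (\<lambda>n \<omega>. \<integral>\<^sup>+t\<in>{0<..?T}. (\<integral>\<^sup>+r. ennreal ((norm (jump_simple_val (h0 n) t r \<omega> - F (left_lim X t \<omega>) r))\<^sup>2) \<partial>small_marks \<nu>) \<partial>lborel)"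
    and ucp: "null_in_prob M (\<lambda>n \<omega>. SUP t\<in>{0..?T}. ennreal (norm (jump_simple_integral \<nu> N (h0 n) t \<omega> - Z t \<omega>)))"
    using Z T0 unfolding has_compensated_integral_def ucp_limit_def by blast
  obtain \<sigma> where \<sigma>: "AE \<omega> in M. \<forall>\<^sub>F n in sequentially.
     (\<integral>\<^sup>+t\<in>{0<..?T}. (\<integral>\<^sup>+r. ennreal ((norm (jump_simple_val (h0 (\<sigma> n)) t r \<omega> - F (left_lim X t \<omega>) r))\<^sup>2) \<partial>small_marks \<nu>) \<partial>lborel)
     + (SUP t\<in>{0..?T}. ennreal (norm (jump_simple_integral \<nu> N (h0 (\<sigma> n)) t \<omega> - Z t \<omega>))) \<le> ennreal ((1/2)^n)"
    using null_in_prob_subseq[OF prob_space_axioms null_in_prob_add[OF prob_space_axioms L2 ucp]] by blast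
  define h where "h n = h0 (\<sigma> n)" for n
  have h: "jump_simple Fil \<nu> (h n)" for n using h0 by (simp add: h_def)
  have AEL2: "AE \<omega> in M. \<forall>\<^sub>F n in sequentially. (\<integral>\<^sup>+t\<in>{0<..?T}. (\<integral>\<^sup>+r. ennreal ((norm (jump_simple_val (h n) t r \<omega> - F (left_lim X t \<omega>) r))\<^sup>2) \<partial>small_marks \<nu>) \<partial>lborel) \<le> ennreal ((1/2)^n)"
    using \<sigma> by eventually_elim (erule eventually_mono, auto simp: h_def intro: order_trans[rotated])
  have AEsup: "AE \<omega> in M. \<forall>\<^sub>F n in sequentially. (SUP t\<in>{0..?T}. ennreal (norm (jump_simple_integral \<nu> N (h n) t \<omega> - Z t \<omega>))) \<le> ennreal ((1/2)^n)"
    using \<sigma> by eventually_elim (erule eventually_mono, auto simp: h_def intro: order_trans[rotated])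
  define H where "H x = F (if 0 < snd (snd x) then left_lim X (snd (snd x)) (fst x) else 0) (fst (snd x))" for x
  define J where "J n x = jump_simple_val (h n) (snd (snd x)) (fst (snd x)) (fst x)" for n x
  have Hm [measurable]: "H \<in> borel_measurable Pred"
  proof -
    have "(\<lambda>x. (if 0 < snd (snd x) then left_lim X (snd (snd x)) (fst x) else 0, fst (snd x))) \<in> borel_measurable Pred"
      by (intro borel_measurable_Pair measurable_Pred_left_lim[OF X] measurable_Pred_mark)
    from measurable_compose[OF this F] show ?thesis by (simp add: H_def[abs_def])
  qed
  have Jm [measurable]: "J n \<in> borel_measurable Pred" for n
    unfolding J_def by (rule measurable_Pred_jump_simple_val[OF h])
  \<comment> \<open>The exceptional set of the convergence of integrands is predictable and null for
    the compensator up to time \<open>T\<close>, so it can be treated together with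
    \<open>D\<close>.\<close>
  define D1 where "D1 = {x\<in>space Pred. \<not> (\<lambda>n. J n x) \<longlonglongrightarrow> H x}"
  have D1: "D1 \<in> sets Pred"
  proof -
    have "{x\<in>space Pred. \<not> (\<forall>k::nat. \<exists>m. \<forall>n\<ge>m. dist (J n x) (H x) < 1 / Suc k)} \<in> sets Pred" by measurable
    then show ?thesis unfolding D1_def LIMSEQ_inverse_iff .
  qed
  \<comment> \<open>The countably many mark sets used by the whole sequence. Below, simplicity of
    \<open>N\<close> is required for unions of two of them, because each is to be compared with a
    fixed one.\<close>
  define \<E> where "\<E> = {E. \<exists>n s u \<xi>. (s, u, E, \<xi>) \<in> set (h n)}"
  have \<E>c: "countable \<E>"
  proof -
    have "\<E> = (\<Union>n. (\<lambda>(s, u, E, \<xi>). E) ` set (h n))" unfolding \<E>_def by force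
    then show ?thesis by (auto intro: countable_finite)
  qed
  have \<E>: "E \<in> sets borel" "E \<subseteq> {r. norm r < 1}" "emeasure \<nu> E < \<infinity>" if "E \<in> \<E>" for E
    using that h unfolding \<E>_def jump_simple_def by fastforce+
  have simple: "AE \<omega> in M. \<forall>E\<in>\<E>. \<forall>E'\<in>\<E>. \<forall>t. 0 < t \<and> t \<le> ?T \<longrightarrow> emeasure (N \<omega>) ((E \<union> E') \<times> {t}) \<in> {0, 1}"
  proof -
    have "AE \<omega> in M. \<forall>t. 0 < t \<and> t \<le> ?T \<longrightarrow> emeasure (N \<omega>) ((E \<union> E') \<times> {t}) \<in> {0, 1}" if "E \<in> \<E>" "E' \<in> \<E>" for E E'
    proof (rule AE_N_simple)
      show "E \<union> E' \<in> sets borel" using \<E>(1) that by blast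
      have "emeasure \<nu> (E \<union> E') \<le> emeasure \<nu> E + emeasure \<nu> E'" using \<E>(1) that by (intro emeasure_subadditive) (auto simp: sets_\<nu>)
      also have "\<dots> < \<infinity>" using \<E>(3) that by simp
      finally show "emeasure \<nu> (E \<union> E') < \<infinity>" .
    qed
    then show ?thesis using \<E>c by (simp add: AE_ball_countable)
  qed
  have fin: "AE \<omega> in M. \<forall>E\<in>\<E>. emeasure (N \<omega>) (E \<times> {0<..?T}) < \<infinity>"
  proof -
    have "AE \<omega> in M. emeasure (N \<omega>) (E \<times> {0<..?T}) < \<infinity>" if "E \<in> \<E>" for E
    proof -
      have "AE \<omega> in M. \<exists>k. emeasure (N \<omega>) (E \<times> {0<..?T}) = of_nat k"
        using cell_sets[OF \<E>(1)[OF that]] emeasure_cell[OF \<E>(1)[OF that], of 0 ?T] \<E>(3)[OF that] T0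
        by (intro AE_N_integer) (auto simp: ennreal_mult_less_top)
      then show ?thesis by eventually_elim (auto simp: less_top[symmetric])
    qed
    then show ?thesis using \<E>c by (simp add: AE_ball_countable)
  qed
  have D1null: "AE \<omega> in M. emeasure (\<nu> \<Otimes>\<^sub>M lborel) (Pair \<omega> -` D1 \<inter> {r. norm r < 1} \<times> {0<..?T}) = 0"
    using AEL2 AE_space
  proof eventually_elim
    case (elim \<omega>)
    define g where "g n y = (norm (J n (\<omega>, y) - H (\<omega>, y)))\<^sup>2" for n y
    have "emeasure (\<nu> \<Otimes>\<^sub>M lborel) {x. norm (fst x) < 1 \<and> 0 < snd x \<and> snd x \<le> ?T \<and> \<not> (\<lambda>n. g n x) \<longlonglongrightarrow> 0} = 0"
    proof (rule L2_fast_convergence)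
      show "g n \<in> borel_measurable borel" for n
        unfolding g_def[abs_def] using Pred_function_section[OF Jm elim(2)] Pred_function_section[OF Hm elim(2)] by measurable
      show "0 \<le> g n x" for n x by (simp add: g_def)
      have "(\<integral>\<^sup>+t\<in>{0<..?T}. (\<integral>\<^sup>+r. ennreal (g n (r, t)) \<partial>small_marks \<nu>) \<partial>lborel) =
        (\<integral>\<^sup>+t\<in>{0<..?T}. (\<integral>\<^sup>+r. ennreal ((norm (jump_simple_val (h n) t r \<omega> - F (left_lim X t \<omega>) r))\<^sup>2) \<partial>small_marks \<nu>) \<partial>lborel)" for n
        by (intro nn_integral_cong) (auto simp: g_def J_def H_def indicator_def)
      then show "\<forall>\<^sub>F n in sequentially. (\<integral>\<^sup>+t\<in>{0<..?T}. (\<integral>\<^sup>+r. ennreal (g n (r, t)) \<partial>small_marks \<nu>) \<partial>lborel) \<le> ennreal ((1/2)^n)"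
        using elim(1) by simp
    qed
    moreover have "{x. norm (fst x) < 1 \<and> 0 < snd x \<and> snd x \<le> ?T \<and> \<not> (\<lambda>n. g n x) \<longlonglongrightarrow> 0} =
      Pair \<omega> -` D1 \<inter> {r. norm r < 1} \<times> {0<..?T}"
    proof -
      have "(\<lambda>n. g n x) \<longlonglongrightarrow> 0 \<longleftrightarrow> (\<lambda>n. J n (\<omega>, x)) \<longlonglongrightarrow> H (\<omega>, x)" for x
      proof
        assume "(\<lambda>n. g n x) \<longlonglongrightarrow> 0"
        from tendsto_real_sqrt[OF this] show "(\<lambda>n. J n (\<omega>, x)) \<longlonglongrightarrow> H (\<omega>, x)"
          by (simp add: g_def tendsto_dist_iff[of "\<lambda>n. J n (\<omega>, x)"] dist_norm)
      next
        assume "(\<lambda>n. J n (\<omega>, x)) \<longlonglongrightarrow> H (\<omega>, x)"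
        then have "(\<lambda>n. norm (J n (\<omega>, x) - H (\<omega>, x))) \<longlonglongrightarrow> 0"
          by (simp add: tendsto_dist_iff[of "\<lambda>n. J n (\<omega>, x)"] dist_norm)
        from tendsto_power[OF this, of 2] show "(\<lambda>n. g n x) \<longlonglongrightarrow> 0" by (simp add: g_def)
      qed
      then show ?thesis using elim(2) by (auto simp: D1_def space_Pred)
    qed
    ultimately show ?case by simp
  qed
  have Nnull: "AE \<omega> in M. \<forall>E\<in>\<E>. emeasure (N \<omega>) (Pair \<omega> -` (D \<union> D1) \<inter> E \<times> {0<..?T}) = 0"
  proof -
    have "AE \<omega> in M. emeasure (N \<omega>) (Pair \<omega> -` (D \<union> D1) \<inter> E \<times> {0<..?T}) = 0" if E: "E \<in> \<E>" for E
    proof (rule predictable_null[OF \<E>(1,3)[OF E] T0])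
      show "D \<union> D1 \<in> sets Pred" using D D1 by blast
      show "AE \<omega> in M. emeasure (\<nu> \<Otimes>\<^sub>M lborel) (Pair \<omega> -` (D \<union> D1) \<inter> E \<times> {0<..?T}) = 0"
        using null D1null AE_space
      proof eventually_elim
        case (elim \<omega>)
        have sets\<mu>: "sets (\<nu> \<Otimes>\<^sub>M (lborel::real measure)) = sets borel"
          by (simp add: sets_\<nu> borel_prod[symmetric] cong: sets_pair_measure_cong)
        have B: "{r::real^'m. norm r < 1} \<in> sets borel" by measurable
        have b1: "{r::real^'m. norm r < 1} \<times> {0::real<..} \<in> sets borel"
          using B by (simp add: borel_prod[symmetric] pair_measureI)
        have s1: "Pair \<omega> -` D \<inter> {r. norm r < 1} \<times> {0<..} \<in> sets (\<nu> \<Otimes>\<^sub>M lborel)"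
          unfolding sets\<mu> by (rule sets.Int[OF Pred_section[OF D elim(3)] b1])
        have s2: "Pair \<omega> -` D1 \<inter> {r. norm r < 1} \<times> {0<..?T} \<in> sets (\<nu> \<Otimes>\<^sub>M lborel)"
          unfolding sets\<mu> by (rule sets.Int[OF Pred_section[OF D1 elim(3)] cell_sets[OF B]])
        have "emeasure (\<nu> \<Otimes>\<^sub>M lborel) (Pair \<omega> -` (D \<union> D1) \<inter> E \<times> {0<..?T}) \<le>
          emeasure (\<nu> \<Otimes>\<^sub>M lborel) ((Pair \<omega> -` D \<inter> {r. norm r < 1} \<times> {0<..}) \<union> (Pair \<omega> -` D1 \<inter> {r. norm r < 1} \<times> {0<..?T}))"
          by (intro emeasure_mono sets.Un s1 s2) (auto dest: subsetD[OF \<E>(2)[OF E]])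
        also have "\<dots> \<le> emeasure (\<nu> \<Otimes>\<^sub>M lborel) (Pair \<omega> -` D \<inter> {r. norm r < 1} \<times> {0<..})
          + emeasure (\<nu> \<Otimes>\<^sub>M lborel) (Pair \<omega> -` D1 \<inter> {r. norm r < 1} \<times> {0<..?T})"
          by (intro emeasure_subadditive s1 s2)
        finally show ?case using elim by simp
      qed
    qed
    then show ?thesis using \<E>c by (simp add: AE_ball_countable)
  qed
  from AEsup simple fin Nnull AE_space show ?thesis
  proof eventually_elim
    case (elim \<omega>)
    have unif: "\<forall>\<^sub>F n in sequentially. \<forall>v. 0 \<le> v \<and> v \<le> ?T \<longrightarrow> dist (jump_simple_integral \<nu> N (h n) v \<omega>) (Z v \<omega>) \<le> (1/2)^n"
      using elim(1)
    proof eventually_elim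
      case (elim n)
      show ?case unfolding dist_norm by (intro allI impI sup_le_imp_norm_le[OF elim]) auto
    qed
    have Z0: "Z 0 \<omega> = 0"
    proof -
      have zero: "jump_simple_integral \<nu> N (h n) 0 \<omega> = 0" for n
      proof -
        have "(case e of (s, u, E, \<xi>) \<Rightarrow> (measure (N \<omega>) (E \<times> {min s 0<..min u 0}) - measure \<nu> E * (min u 0 - min s 0)) *\<^sub>R \<xi> \<omega>) = 0"
          if "e \<in> set (h n)" for e
          using h[of n] that unfolding jump_simple_def by (cases e) fastforce
        then show ?thesis unfolding jump_simple_integral_def by (intro sum_list_map_eq_0)
      qed
      have "(\<lambda>n. jump_simple_integral \<nu> N (h n) 0 \<omega>) \<longlonglongrightarrow> Z 0 \<omega>"
        by (rule fast_tendsto, rule eventually_mono[OF unif]) auto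
      then show ?thesis unfolding zero using LIMSEQ_unique tendsto_const by blast
    qed
    have "\<exists>r. norm r < 1 \<and> (\<omega>, r, t) \<notin> D \<and> Z t \<omega> - l = F (left_lim X t \<omega>) r"
      if t: "0 < t" "t \<le> ?T" and l: "((\<lambda>s. Z s \<omega>) \<longlongrightarrow> l) (at_left t)" and jump: "l \<noteq> Z t \<omega>" for t l
    proof -
      let ?m = "\<lambda>E. measure (N \<omega>) (E \<times> {t})"
      have setsN: "sets (N \<omega>) = sets borel" by (rule sets_N[OF elim(5)])
      have pt: "E \<times> {t} \<in> sets (N \<omega>)" if "E \<in> sets borel" for E
        using that setsN by (simp add: borel_prod[symmetric] pair_measureI)
      define c where "c n = (\<Sum>(s, u, E, \<xi>)\<leftarrow>h n. (indicator {s<..u} t * ?m E) *\<^sub>R \<xi> \<omega>)" for n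
      have lim: "((\<lambda>v. jump_simple_integral \<nu> N (h n) v \<omega>) \<longlongrightarrow> jump_simple_integral \<nu> N (h n) t \<omega> - c n) (at_left t)" for n
        unfolding c_def
      proof (rule jump_simple_integral_left_limit[OF elim(5) h t])
        fix s u E \<xi> assume "(s, u, E, \<xi>) \<in> set (h n)"
        then have "E \<in> \<E>" unfolding \<E>_def by blast
        then show "emeasure (N \<omega>) (E \<times> {0<..?T}) < \<infinity>" using elim(3) by blast
      qed
      have "(\<lambda>n. jump_simple_integral \<nu> N (h n) t \<omega> - c n) \<longlonglongrightarrow> l"
        by (rule uniform_limit_left_limit[OF unif t lim l])
      moreover have "(\<lambda>n. jump_simple_integral \<nu> N (h n) t \<omega>) \<longlonglongrightarrow> Z t \<omega>"
        by (rule fast_tendsto, rule eventually_mono[OF unif]) (use t in auto)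
      ultimately have "(\<lambda>n. jump_simple_integral \<nu> N (h n) t \<omega> - (jump_simple_integral \<nu> N (h n) t \<omega> - c n)) \<longlonglongrightarrow> Z t \<omega> - l"
        by (intro tendsto_diff)
      then have clim: "c \<longlonglongrightarrow> Z t \<omega> - l" by simp
      have m01: "?m (E \<union> E') \<in> {0, 1}" "emeasure (N \<omega>) ((E \<union> E') \<times> {t}) < \<infinity>" if "E \<in> \<E>" "E' \<in> \<E>" for E E'
      proof -
        have "emeasure (N \<omega>) ((E \<union> E') \<times> {t}) \<in> {0, 1}" using elim(2) that t by blast
        then show "?m (E \<union> E') \<in> {0, 1}" "emeasure (N \<omega>) ((E \<union> E') \<times> {t}) < \<infinity>"
          by (auto simp: measure_def)
      qed
      \<comment> \<open>If none of the mark sets had mass on the slice, no simple integral would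
        jump at \<open>t\<close>.\<close>
      have "\<exists>E\<in>\<E>. ?m E \<noteq> 0"
      proof (rule ccontr)
        assume "\<not> ?thesis"
        then have m0: "?m E = 0" if "(s, u, E, \<xi>) \<in> set (h n)" for n s u E \<xi>
          using that unfolding \<E>_def by blast
        have "c n = 0" for n unfolding c_def by (intro sum_list_map_eq_0) (auto dest: m0)
        then have "c = (\<lambda>_. 0)" by auto
        then have "Z t \<omega> - l = 0" using clim LIMSEQ_unique tendsto_const by metis
        then show False using jump by simp
      qed
      then obtain E0 where E0: "E0 \<in> \<E>" "?m E0 \<noteq> 0" by blast
      have mE0: "?m E0 = 1" using m01(1)[OF E0(1) E0(1)] E0(2) by auto
      \<comment> \<open>The marks of \<open>E0\<close> whose membership in \<open>E\<close>
        disagrees with the mass of \<open>E\<close> on the slice. Since \<open>E0\<close> already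
        carries the whole mass 1 of its union with \<open>E\<close>, this set turns out to be
        null.\<close>
      define U where "U E = {r\<in>E0. indicator E r \<noteq> ?m E}" for E
      have Um: "U E \<in> sets borel" if "E \<in> \<E>" for E
      proof -
        have "U E = (if ?m E = 1 then E0 - E else if ?m E = 0 then E0 \<inter> E else E0)"
          by (auto simp: U_def indicator_def)
        then show ?thesis using \<E>(1) that E0(1) by auto
      qed
      have fin1: "emeasure (N \<omega>) (E \<times> {t}) < \<infinity>" if "E \<in> \<E>" for E using m01(2)[OF that that] by simp
      have finsub: "emeasure (N \<omega>) B < \<infinity>" if "B \<subseteq> E0 \<times> {t}" for B
        using emeasure_mono[OF that pt[OF \<E>(1)[OF E0(1)]]] fin1[OF E0(1)] by (rule le_less_trans)
      have U0: "emeasure (N \<omega>) (U E \<times> {t}) = 0" if E: "E \<in> \<E>" for E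
      proof -
        have "?m (E0 \<union> E) = ?m (E - E0) + ?m E0"
        proof -
          have "(E0 \<union> E) \<times> {t} = (E - E0) \<times> {t} \<union> E0 \<times> {t}" by auto
          moreover have "emeasure (N \<omega>) ((E - E0) \<times> {t}) \<le> emeasure (N \<omega>) (E \<times> {t})"
            using pt \<E>(1) E by (intro emeasure_mono) auto
          ultimately show ?thesis using pt[OF sets.Diff[OF \<E>(1)[OF E] \<E>(1)[OF E0(1)]]] pt[OF \<E>(1)[OF E0(1)]] fin1[OF E] fin1[OF E0(1)]
            by (simp only:) (intro measure_Union, auto simp: less_top[symmetric] top_unique)
        qed
        moreover have "?m (E0 \<union> E) \<le> 1" using m01(1)[OF E0(1) E] by auto
        ultimately have z: "?m (E - E0) = 0" using mE0 measure_nonneg[of "N \<omega>" "(E - E0) \<times> {t}"] by linarith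
        have EI: "?m E = ?m (E - E0) + ?m (E \<inter> E0)"
        proof -
          have "E \<times> {t} = (E - E0) \<times> {t} \<union> (E \<inter> E0) \<times> {t}" by auto
          moreover have "emeasure (N \<omega>) ((E - E0) \<times> {t}) \<le> emeasure (N \<omega>) (E \<times> {t})"
            using pt \<E>(1) E by (intro emeasure_mono) auto
          ultimately show ?thesis
            using pt[OF sets.Diff[OF \<E>(1)[OF E] \<E>(1)[OF E0(1)]]] pt[OF sets.Int[OF \<E>(1)[OF E] \<E>(1)[OF E0(1)]]] fin1[OF E]
              finsub[of "(E \<inter> E0) \<times> {t}"]
            by (simp only:) (intro measure_Union, auto simp: less_top[symmetric] top_unique)
        qed
        have ED: "?m E0 = ?m (E0 - E) + ?m (E \<inter> E0)"
        proof -
          have "E0 \<times> {t} = (E0 - E) \<times> {t} \<union> (E \<inter> E0) \<times> {t}" by auto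
          then show ?thesis
            using pt[OF sets.Diff[OF \<E>(1)[OF E0(1)] \<E>(1)[OF E]]] pt[OF sets.Int[OF \<E>(1)[OF E] \<E>(1)[OF E0(1)]]]
              finsub[of "(E \<inter> E0) \<times> {t}"] finsub[of "(E0 - E) \<times> {t}"]
            by (simp only:) (intro measure_Union, auto simp: less_top[symmetric] top_unique)
        qed
        have "?m E = 0 \<or> ?m E = 1" using m01(1)[OF E E] by simp
        then have "?m (U E) = 0"
        proof
          assume "?m E = 0"
          then have "U E = E \<inter> E0" by (auto simp: U_def indicator_def)
          then show ?thesis using EI z \<open>?m E = 0\<close> by simp
        next
          assume "?m E = 1"
          then have "U E = E0 - E" by (auto simp: U_def indicator_def)
          then show ?thesis using ED EI z mE0 \<open>?m E = 1\<close> by simp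
        qed
        moreover have "U E \<times> {t} \<subseteq> E0 \<times> {t}" by (auto simp: U_def)
        ultimately show ?thesis using finsub[of "U E \<times> {t}"]
          by (simp add: measure_eq_emeasure_eq_ennreal emeasure_eq_ennreal_measure less_top)
      qed
      define V where "V = (Pair \<omega> -` (D \<union> D1) \<inter> E0 \<times> {0<..?T}) \<union> (\<Union>E\<in>\<E>. U E \<times> {t})"
      have "V \<in> null_sets (N \<omega>)"
        unfolding V_def
      proof (intro null_sets.Un null_sets_UN' \<E>c)
        have "Pair \<omega> -` (D \<union> D1) \<inter> E0 \<times> {0<..?T} \<in> sets (N \<omega>)"
          unfolding setsN using Pred_section[OF sets.Un[OF D D1] elim(5)] cell_sets[OF \<E>(1)[OF E0(1)]] by blast
        then show "Pair \<omega> -` (D \<union> D1) \<inter> E0 \<times> {0<..?T} \<in> null_sets (N \<omega>)" using elim(4) E0(1) by (auto simp: null_sets_def)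
        show "U E \<times> {t} \<in> null_sets (N \<omega>)" if "E \<in> \<E>" for E using U0[OF that] pt[OF Um[OF that]] by (auto simp: null_sets_def)
      qed
      \<comment> \<open>Countably many null sets cannot cover a slice of mass 1, and any mark left
        over serves all \<open>n\<close> at once.\<close>
      have "\<not> E0 \<times> {t} \<subseteq> V"
      proof
        assume "E0 \<times> {t} \<subseteq> V"
        then have "emeasure (N \<omega>) (E0 \<times> {t}) = 0" using \<open>V \<in> null_sets (N \<omega>)\<close> pt[OF \<E>(1)[OF E0(1)]]
          by (meson null_setsD1 null_sets_subset)
        then show False using mE0 by (simp add: measure_def)
      qed
      then obtain r where r: "r \<in> E0" "(r, t) \<notin> V" by blast
      have "(\<omega>, r, t) \<notin> D" "(\<omega>, r, t) \<notin> D1" and ind: "\<And>E. E \<in> \<E> \<Longrightarrow> indicator E r = ?m E"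
        using r t by (auto simp: V_def U_def)
      have "c n = J n (\<omega>, r, t)" for n
        unfolding c_def J_def jump_simple_val_def
      proof (intro arg_cong[of _ _ sum_list] map_cong refl)
        fix e assume e: "e \<in> set (h n)"
        obtain s u E \<xi> where ee: "e = (s, u, E, \<xi>)" by (cases e) auto
        then have "E \<in> \<E>" using e by (auto simp: \<E>_def)
        then show "(case e of (s, u, E, \<xi>) \<Rightarrow> (indicator {s<..u} t * ?m E) *\<^sub>R \<xi> \<omega>) =
          (case e of (s, u, E, \<xi>) \<Rightarrow> (indicator {s<..u} (snd (snd (\<omega>, r, t))) * indicator E (fst (snd (\<omega>, r, t)))) *\<^sub>R \<xi> (fst (\<omega>, r, t)))"
          using ind by (simp add: ee)
      qed
      then have "c = (\<lambda>n. J n (\<omega>, r, t))" by (rule ext)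
      with clim have "(\<lambda>n. J n (\<omega>, r, t)) \<longlonglongrightarrow> Z t \<omega> - l" by simp
      moreover have "(\<lambda>n. J n (\<omega>, r, t)) \<longlonglongrightarrow> H (\<omega>, r, t)"
        using \<open>(\<omega>, r, t) \<notin> D1\<close> elim(5) by (auto simp: D1_def space_Pred)
      ultimately have "Z t \<omega> - l = H (\<omega>, r, t)" using LIMSEQ_unique by blast
      moreover have "norm r < 1" using r(1) \<E>(2)[OF E0(1)] by auto
      ultimately show ?thesis using \<open>(\<omega>, r, t) \<notin> D\<close> t by (intro exI[of _ r]) (simp add: H_def)
    qed
    then show ?case using Z0 by blast
  qed
qed

end

section \<open>Jumps of solutions\<close>

lemma continuous_on_imp_left_limit:
  fixes f :: "real \<Rightarrow> 'a::topological_space"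
  assumes "continuous_on {0..} f" "0 < t"
  shows "(f \<longlongrightarrow> f t) (at_left t)"
proof -
  have "continuous_on {0<..} f" using assms(1) by (rule continuous_on_subset) auto
  then have "isCont f t" using assms(2) by (simp add: continuous_on_eq_continuous_at)
  then have "(f \<longlongrightarrow> f t) (at t)" by (simp add: isCont_def)
  then show ?thesis by (rule tendsto_within_subset) auto
qed

lemma drift_left_limit:
  fixes g :: "real \<Rightarrow> real^'n"
  assumes int: "set_integrable lborel {0<..t} g" and t: "0 < t"
  shows "((\<lambda>v. LINT s:{0<..v}|lborel. g s) \<longlongrightarrow> (LINT s:{0<..t}|lborel. g s)) (at_left t)"
proof (rule tendsto_at_left_sequentially[OF t])
  fix S :: "nat \<Rightarrow> real" assume S: "\<And>n. S n < t" "\<And>n. 0 < S n" "incseq S" "S \<longlonglongrightarrow> t"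
  have U: "(\<Union>n. {0<..S n}) = {0<..<t}"
  proof
    show "(\<Union>n. {0<..S n}) \<subseteq> {0<..<t}" by (auto dest: le_less_trans[OF _ S(1)])
    show "{0<..<t} \<subseteq> (\<Union>n. {0<..S n})"
    proof
      fix x assume x: "x \<in> {0<..<t}"
      then have "\<forall>\<^sub>F n in sequentially. x < S n" using S(4) by (intro order_tendstoD(1)) auto
      then obtain n where "x < S n" by (auto simp: eventually_sequentially)
      then show "x \<in> (\<Union>n. {0<..S n})" using x by (intro UN_I[of n]) auto
    qed
  qed
  have "(\<lambda>n. LINT s:{0<..S n}|lborel. g s) \<longlonglongrightarrow> (LINT s:(\<Union>n. {0<..S n})|lborel. g s)"
  proof (rule set_integral_cont_up)
    show "incseq (\<lambda>n. {0<..S n})" using S(3) by (auto simp: incseq_def Ioc_subset_iff)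
    show "set_integrable lborel (\<Union>n. {0<..S n}) g" unfolding U
      by (rule set_integrable_subset[OF int]) auto
  qed simp
  also have "(LINT s:(\<Union>n. {0<..S n})|lborel. g s) = (LINT s:{0<..t}|lborel. g s)"
    unfolding U set_lebesgue_integral_def
  proof (rule integral_cong_AE)
    show "AE x in lborel. indicator {0<..<t} x *\<^sub>R g x = indicator {0<..t} x *\<^sub>R g x"
      using AE_lborel_singleton[of t] by eventually_elim (auto simp: indicator_def)
    have "set_integrable lborel {0<..<t} g" by (rule set_integrable_subset[OF int]) auto
    then show "(\<lambda>x. indicator {0<..<t} x *\<^sub>R g x) \<in> borel_measurable lborel"
      unfolding set_integrable_def by (rule borel_measurable_integrable)
    show "(\<lambda>x. indicator {0<..t} x *\<^sub>R g x) \<in> borel_measurable lborel"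
      using int unfolding set_integrable_def by (rule borel_measurable_integrable)
  qed
  finally show "(\<lambda>n. LINT s:{0<..S n}|lborel. g s) \<longlonglongrightarrow> (LINT s:{0<..t}|lborel. g s)" .
qed

lemma ito_simple_integral_left_limit:
  fixes W :: "real \<Rightarrow> 'w \<Rightarrow> real^'n"
  assumes h: "ito_simple Fil h" and W: "continuous_on {0..} (\<lambda>t. W t \<omega>)" and t: "0 < t"
  shows "((\<lambda>v. ito_simple_integral W h v \<omega>) \<longlongrightarrow> ito_simple_integral W h t \<omega>) (at_left t)"
  using h
proof (induction h)
  case Nil
  then show ?case by (simp add: ito_simple_integral_def)
next
  case (Cons e h)
  obtain s u \<xi> where e: "e = (s, u, \<xi>)" by (cases e) auto
  have p: "0 \<le> s" "s \<le> u" using Cons.prems by (auto simp: ito_simple_def e)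
  have c: "((\<lambda>v. W (min a v) \<omega>) \<longlongrightarrow> W (min a t) \<omega>) (at_left t)" if "0 \<le> a" for a
  proof (rule continuous_on_imp_left_limit[OF _ t])
    show "continuous_on {0..} (\<lambda>v. W (min a v) \<omega>)"
      by (rule continuous_on_compose2[OF W]) (use that in \<open>auto intro!: continuous_intros\<close>)
  qed
  have "((\<lambda>v. \<xi> \<omega> *v (W (min u v) \<omega> - W (min s v) \<omega>)) \<longlongrightarrow> \<xi> \<omega> *v (W (min u t) \<omega> - W (min s t) \<omega>)) (at_left t)"
    using p by (intro bounded_linear.tendsto[OF matrix_vector_mul_bounded_linear] tendsto_diff c) auto
  moreover have "((\<lambda>v. ito_simple_integral W h v \<omega>) \<longlongrightarrow> ito_simple_integral W h t \<omega>) (at_left t)"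
    using Cons by (simp add: ito_simple_def)
  ultimately show ?case by (simp add: ito_simple_integral_def e tendsto_add)
qed

text \<open>Integrals of simple integrands inherit continuity from \<open>W\<close>, and uniform
  convergence along a subsequence preserves it.\<close>

lemma ito_integral_continuous_on:
  fixes W :: "real \<Rightarrow> 'w \<Rightarrow> real^'n"
  assumes M: "prob_space M" and W: "brownian_motion M Fil W" and Y: "has_ito_integral M Fil W H Y" and T: "0 < T"
  shows "AE \<omega> in M. Y 0 \<omega> = 0 \<and> (\<forall>t. 0 < t \<and> t \<le> real T \<longrightarrow> ((\<lambda>s. Y s \<omega>) \<longlongrightarrow> Y t \<omega>) (at_left t))"
proof -
  have T0: "0 < real T" using T by simp
  obtain h0 where h0: "\<And>n. ito_simple Fil (h0 n)"
    and ucp: "null_in_prob M (\<lambda>n \<omega>. SUP t\<in>{0..real T}. ennreal (norm (ito_simple_integral W (h0 n) t \<omega> - Y t \<omega>)))"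
    using Y T0 unfolding has_ito_integral_def ucp_limit_def by blast
  obtain \<sigma> where "AE \<omega> in M. \<forall>\<^sub>F n in sequentially.
     (SUP t\<in>{0..real T}. ennreal (norm (ito_simple_integral W (h0 (\<sigma> n)) t \<omega> - Y t \<omega>))) \<le> ennreal ((1/2)^n)"
    using null_in_prob_subseq[OF M ucp] by blast
  then show ?thesis using AE_space
  proof eventually_elim
    case (elim \<omega>)
    have Wc: "continuous_on {0..} (\<lambda>t. W t \<omega>)" using W elim(2) by (simp add: brownian_motion_def)
    have rc: "rcll 0 (\<lambda>t. Y t \<omega>)" using Y elim(2) by (auto simp: has_ito_integral_def adapted_cadlag_def cadlag_on_rcll_0)
    have unif: "\<forall>\<^sub>F n in sequentially. \<forall>v. 0 \<le> v \<and> v \<le> real T \<longrightarrow> dist (ito_simple_integral W (h0 (\<sigma> n)) v \<omega>) (Y v \<omega>) \<le> (1/2)^n"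
      using elim(1)
    proof eventually_elim
      case (elim n)
      show ?case unfolding dist_norm by (intro allI impI sup_le_imp_norm_le[OF elim]) auto
    qed
    have pt: "(\<lambda>n. ito_simple_integral W (h0 (\<sigma> n)) t \<omega>) \<longlonglongrightarrow> Y t \<omega>" if "0 \<le> t" "t \<le> real T" for t
      by (rule fast_tendsto, rule eventually_mono[OF unif]) (use that in auto)
    have "ito_simple_integral W (h0 (\<sigma> n)) 0 \<omega> = 0" for n
    proof -
      have "(case e of (s, u, \<xi>) \<Rightarrow> \<xi> \<omega> *v (W (min u 0) \<omega> - W (min s 0) \<omega>)) = 0" if "e \<in> set (h0 (\<sigma> n))" for e
      proof -
        obtain s u \<xi> where e: "e = (s, u, \<xi>)" by (cases e) auto
        then have "0 \<le> s" "0 \<le> u" using h0[of "\<sigma> n"] that by (auto simp: ito_simple_def)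
        then show ?thesis by (simp add: e min_absorb2)
      qed
      then show ?thesis unfolding ito_simple_integral_def by (intro sum_list_map_eq_0)
    qed
    then have "Y 0 \<omega> = 0" using pt[of 0] LIMSEQ_unique[OF _ tendsto_const] by simp
    moreover have "((\<lambda>s. Y s \<omega>) \<longlongrightarrow> Y t \<omega>) (at_left t)" if t: "0 < t" "t \<le> real T" for t
    proof -
      obtain l where l: "((\<lambda>s. Y s \<omega>) \<longlongrightarrow> l) (at_left t)" using rcll_left[OF rc t(1)] by blast
      have "(\<lambda>n. ito_simple_integral W (h0 (\<sigma> n)) t \<omega>) \<longlonglongrightarrow> l"
        by (rule uniform_limit_left_limit[OF unif t ito_simple_integral_left_limit[where W = W, OF h0 Wc t(1)] l])
      then have "l = Y t \<omega>" using pt[of t] t LIMSEQ_unique by fastforce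
      then show ?thesis using l by simp
    qed
    ultimately show ?case by blast
  qed
qed

lemma driving_noise_poisson_noise:
  assumes "driving_noise M Fil W \<nu> N"
  shows "poisson_noise M Fil \<nu> N"
  using assms unfolding driving_noise_def usual_conditions_def poisson_noise_def poisson_noise_axioms_def by blast

context poisson_noise
begin

text \<open>Drift and Ito part do not jump, so a jump of \<open>X\<close> is one of the compensated
  integral. The predictable null set \<open>D\<close> is left free: its choice decides which marks
  and times are excluded.\<close>

lemma sde_solution_jumps:
  fixes X :: "real \<Rightarrow> 'w \<Rightarrow> real^'n"
  assumes sol: "sde_solution M Fil W \<nu> N b \<sigma> F x X" and W: "brownian_motion M Fil W"
    and F: "(\<lambda>(x, r). F x r) \<in> borel_measurable borel" and D: "D \<in> sets Pred"
    and null: "AE \<omega> in M. emeasure (\<nu> \<Otimes>\<^sub>M lborel) (Pair \<omega> -` D \<inter> {r. norm r < 1} \<times> {0<..}) = 0"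
  shows "AE \<omega> in M. X 0 \<omega> = x \<and> (\<forall>t l. 0 < t \<and> ((\<lambda>s. X s \<omega>) \<longlongrightarrow> l) (at_left t) \<and> l \<noteq> X t \<omega> \<longrightarrow>
     (\<exists>r. norm r < 1 \<and> (\<omega>, r, t) \<notin> D \<and> X t \<omega> = l + F l r))"
proof -
  have X: "adapted_cadlag M Fil X"
    and b: "AE \<omega> in M. \<forall>t\<ge>0. set_integrable lborel {0<..t} (\<lambda>s. b (left_lim X s \<omega>))"
    using sol by (auto simp: sde_solution_def)
  obtain Y Z where Y: "has_ito_integral M Fil W (\<lambda>s \<omega>. \<sigma> (left_lim X s \<omega>)) Y"
    and Z: "has_compensated_integral M Fil \<nu> N (\<lambda>s r \<omega>. F (left_lim X s \<omega>) r) Z"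
    and eq: "AE \<omega> in M. \<forall>t\<ge>0. X t \<omega> = x + (LINT s:{0<..t}|lborel. b (left_lim X s \<omega>)) + Y t \<omega> + Z t \<omega>"
    using sol unfolding sde_solution_def by blast
  have "AE \<omega> in M. \<forall>T::nat. Y 0 \<omega> = 0 \<and> (\<forall>t. 0 < t \<and> t \<le> real (Suc T) \<longrightarrow> ((\<lambda>s. Y s \<omega>) \<longlongrightarrow> Y t \<omega>) (at_left t))"
    unfolding AE_all_countable using ito_integral_continuous_on[OF prob_space_axioms W Y] by blast
  moreover have "AE \<omega> in M. \<forall>T::nat. Z 0 \<omega> = 0 \<and> (\<forall>t l. 0 < t \<and> t \<le> real (Suc T) \<and> ((\<lambda>s. Z s \<omega>) \<longlongrightarrow> l) (at_left t) \<and> l \<noteq> Z t \<omega> \<longrightarrow>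
     (\<exists>r. norm r < 1 \<and> (\<omega>, r, t) \<notin> D \<and> Z t \<omega> - l = F (left_lim X t \<omega>) r))"
    unfolding AE_all_countable using compensated_integral_jumps_on[OF Z X F D null] by blast
  ultimately show ?thesis using b eq
  proof eventually_elim
    case (elim \<omega>)
    have "X 0 \<omega> = x" using elim by (simp add: set_lebesgue_integral_def)
    moreover have "\<exists>r. norm r < 1 \<and> (\<omega>, r, t) \<notin> D \<and> X t \<omega> = l + F l r"
      if t: "0 < t" and l: "((\<lambda>s. X s \<omega>) \<longlongrightarrow> l) (at_left t)" and jump: "l \<noteq> X t \<omega>" for t l
    proof -
      obtain T :: nat where "t < real T" using reals_Archimedean2 by blast
      then have T: "t \<le> real (Suc T)" by simp
      let ?d = "\<lambda>v. LINT s:{0<..v}|lborel. b (left_lim X s \<omega>)"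
      \<comment> \<open>The left limit of \<open>Z\<close>, obtained by removing the parts without
        jumps from that of \<open>X\<close>.\<close>
      define lz where "lz = l - (x + ?d t + Y t \<omega>)"
      have "((\<lambda>v. X v \<omega> - (x + ?d v + Y v \<omega>)) \<longlongrightarrow> lz) (at_left t)"
        unfolding lz_def using elim(1,3) t T
        by (intro tendsto_diff tendsto_add tendsto_const l drift_left_limit) auto
      moreover have "\<forall>\<^sub>F v in at_left t. X v \<omega> - (x + ?d v + Y v \<omega>) = Z v \<omega>"
        using eventually_at_left_real[OF t] by (rule eventually_mono) (use elim(4) in auto)
      ultimately have Zl: "((\<lambda>v. Z v \<omega>) \<longlongrightarrow> lz) (at_left t)" by (rule Lim_transform_eventually)
      have Xt: "X t \<omega> = x + ?d t + Y t \<omega> + Z t \<omega>" using elim(4) t by simp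
      then have "lz \<noteq> Z t \<omega>" using jump unfolding lz_def by (metis add.commute diff_add_cancel)
      then obtain r where "norm r < 1" "(\<omega>, r, t) \<notin> D" "Z t \<omega> - lz = F (left_lim X t \<omega>) r"
        using elim(2) t T Zl by blast
      then show ?thesis using left_lim_eq[where X = X, OF l] Xt
        by (intro exI[of _ r]) (auto simp: lz_def algebra_simps)
    qed
    ultimately show ?case by blast
  qed
qed

text \<open>The excluded set consists of all points at the fixed time \<open>t\<close>; it is null
  because Lebesgue measure has no atoms.\<close>

lemma sde_solution_no_fixed_jump:
  fixes X :: "real \<Rightarrow> 'w \<Rightarrow> real^'n"
  assumes sol: "sde_solution M Fil W \<nu> N b \<sigma> F x X" and W: "brownian_motion M Fil W"
    and F: "(\<lambda>(x, r). F x r) \<in> borel_measurable borel" and t: "0 < t"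
  shows "AE \<omega> in M. ((\<lambda>s. X s \<omega>) \<longlongrightarrow> X t \<omega>) (at_left t)"
proof -
  define D where "D = {x \<in> space Pred. snd (snd x) = t}"
  have D: "D \<in> sets Pred" unfolding D_def using measurable_Pred_time by measurable
  have "emeasure (\<nu> \<Otimes>\<^sub>M lborel) (Pair \<omega> -` D \<inter> {r. norm r < 1} \<times> {0<..}) = 0" if \<omega>: "\<omega> \<in> space M" for \<omega>
  proof -
    have sp\<nu>: "UNIV \<in> sets \<nu>" by (simp add: sets_\<nu>)
    have "Pair \<omega> -` D \<inter> {r. norm r < 1} \<times> {0<..} \<subseteq> UNIV \<times> {t}" by (auto simp: D_def)
    moreover have "UNIV \<times> {t} \<in> null_sets (\<nu> \<Otimes>\<^sub>M lborel)"
      using sp\<nu> by (auto simp: null_sets_def lborel.emeasure_pair_measure_Times)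
    ultimately show ?thesis
      by (metis emeasure_mono le_zero_eq null_setsD1 null_setsD2)
  qed
  then have null: "AE \<omega> in M. emeasure (\<nu> \<Otimes>\<^sub>M lborel) (Pair \<omega> -` D \<inter> {r. norm r < 1} \<times> {0<..}) = 0" by simp
  show ?thesis using sde_solution_jumps[OF sol W F D null] AE_space
  proof eventually_elim
    case (elim \<omega>)
    have "rcll 0 (\<lambda>s. X s \<omega>)" using sol elim(2) by (auto simp: sde_solution_def adapted_cadlag_def cadlag_on_rcll_0)
    from rcll_left[OF this t] obtain l where l: "((\<lambda>s. X s \<omega>) \<longlongrightarrow> l) (at_left t)" by blast
    have "l = X t \<omega>"
    proof (rule ccontr)
      assume "l \<noteq> X t \<omega>"
      then obtain r where "(\<omega>, r, t) \<notin> D" using elim(1) t l by blast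
      then show False using elim(2) by (simp add: D_def space_Pred)
    qed
    then show ?case using l by simp
  qed
qed

lemma sde_solution_no_bad_jump:
  fixes X :: "real \<Rightarrow> 'w \<Rightarrow> real^'n"
  assumes sol: "sde_solution M Fil W \<nu> N b \<sigma> F x X" and W: "brownian_motion M Fil W"
    and F: "(\<lambda>(x, r). F x r) \<in> borel_measurable borel" and K: "closed K"
    and good: "AE \<omega> in M. AE t in lborel. 0 < t \<longrightarrow> (AE r in \<nu>. norm r < 1 \<longrightarrow> X t \<omega> \<notin> K \<and> X t \<omega> + F (X t \<omega>) r \<notin> K)"
  shows "AE \<omega> in M. \<forall>b. no_bad_jump K (\<lambda>s. X s \<omega>) 0 b"
proof -
  interpret \<nu>: sigma_finite_measure \<nu> by (rule levy_measure_sigma_finite[OF levy])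
  interpret p: pair_sigma_finite \<nu> "lborel :: real measure" ..
  interpret Ml: pair_sigma_finite M "lborel :: real measure" ..
  have X: "adapted_cadlag M Fil X" using sol by (simp add: sde_solution_def)
  have rc: "rcll 0 (\<lambda>s. X s \<omega>)" if "\<omega> \<in> space M" for \<omega>
    using X that by (auto simp: adapted_cadlag_def cadlag_on_rcll_0)
  have XM: "X t \<in> borel_measurable M" if "0 \<le> t" for t
    using X that Fil_sub filt unfolding adapted_cadlag_def
    by (auto intro!: measurable_from_subalg[of M "Fil t"] simp: subalgebra_def filtration_def)
  define L where "L x = (if 0 < snd (snd x) then left_lim X (snd (snd x)) (fst x) else 0)" for x :: "'w \<times> ((real^'m) \<times> real)"
  have Lm [measurable]: "L \<in> borel_measurable Pred" unfolding L_def by (rule measurable_Pred_left_lim[OF X])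
  define J where "J x = L x + F (L x) (fst (snd x))" for x
  have Jm [measurable]: "J \<in> borel_measurable Pred"
  proof -
    have "(\<lambda>x. (L x, fst (snd x))) \<in> borel_measurable Pred"
      by (intro borel_measurable_Pair Lm measurable_Pred_mark)
    from measurable_compose[OF this F] have "(\<lambda>x. F (L x) (fst (snd x))) \<in> borel_measurable Pred" by simp
    then show ?thesis unfolding J_def by measurable
  qed
  \<comment> \<open>The points whose jump would start in \<open>K\<close>, at the left limit
    \<open>L\<close>, or land in \<open>K\<close>, at \<open>J\<close>.\<close>
  define D where "D = {x \<in> space Pred. 0 < snd (snd x) \<and> (L x \<in> K \<or> J x \<in> K)}"
  have [measurable]: "K \<in> sets borel" using K by simp
  note measurable_Pred_time [measurable]
  have D: "D \<in> sets Pred" unfolding D_def by measurable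
  \<comment> \<open>The hypothesis \<open>good\<close> speaks of values, \<open>D\<close> of left
    limits. The absence of fixed jumps and Fubini make them agree at almost every time.\<close>
  have "AE \<omega> in M. AE t in lborel. 0 < t \<longrightarrow> left_lim X t \<omega> = X t \<omega>"
  proof -
    define e where "e \<omega> t \<longleftrightarrow> 0 < t \<longrightarrow> L (\<omega>, 0, t) = X (max 0 t) \<omega>" for \<omega> t
    have "AE t in lborel. AE \<omega> in M. e \<omega> t"
    proof (rule AE_I2)
      fix t :: real
      show "AE \<omega> in M. e \<omega> t"
      proof (cases "0 < t")
        case True
        show ?thesis using sde_solution_no_fixed_jump[OF sol W F True]
          by eventually_elim (auto simp: e_def L_def left_lim_eq)
      qed (simp add: e_def)
    qed
    moreover have "{x \<in> space (M \<Otimes>\<^sub>M (lborel::real measure)). e (fst x) (snd x)} \<in> sets (M \<Otimes>\<^sub>M lborel)"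
    proof -
      have "(\<lambda>x. (fst x, 0, snd x)) \<in> M \<Otimes>\<^sub>M (borel :: real measure) \<rightarrow>\<^sub>M M \<Otimes>\<^sub>M (borel :: ((real^'m) \<times> real) measure)"
        unfolding borel_prod[symmetric] by measurable
      moreover have "L \<in> borel_measurable (M \<Otimes>\<^sub>M (borel :: ((real^'m) \<times> real) measure))"
        by (rule measurable_mono[THEN subsetD, OF _ _ sets_Pred_subset _ Lm]) (auto simp: space_Pred space_pair_measure)
      ultimately have 1: "(\<lambda>x. L (fst x, 0, snd x)) \<in> borel_measurable (M \<Otimes>\<^sub>M (borel :: real measure))"
        by (rule measurable_compose)
      have "(\<lambda>x. (case x of (t, \<omega>) \<Rightarrow> path_from X (max 0 t) \<omega>) 0) \<in> borel_measurable (borel \<Otimes>\<^sub>M M)"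
        by (rule measurable_compose[OF measurable_pair_path_from[OF rc XM] measurable_coordinate_cadlag[of 0]]) simp_all
      then have "(\<lambda>x. X (max 0 (fst x)) (snd x)) \<in> borel_measurable (borel \<Otimes>\<^sub>M M)"
        by (simp add: path_from_apply case_prod_beta')
      from measurable_compose[OF measurable_pair_swap' this]
      have 2: "(\<lambda>x. X (max 0 (snd x)) (fst x)) \<in> borel_measurable (M \<Otimes>\<^sub>M (borel :: real measure))"
        by (simp add: case_prod_beta')
      have "{x \<in> space (M \<Otimes>\<^sub>M (borel::real measure)). e (fst x) (snd x)} \<in> sets (M \<Otimes>\<^sub>M borel)"
        unfolding e_def using 1 2 by measurable
      then show ?thesis by (simp cong: sets_pair_measure_cong add: space_pair_measure)
    qed
    ultimately have "AE \<omega> in M. AE t in lborel. e \<omega> t" using Ml.AE_commute[of e] by blast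
    then show ?thesis by (rule eventually_mono) (auto elim!: eventually_mono simp: e_def L_def split: if_splits)
  qed
  then have "AE \<omega> in M. emeasure (\<nu> \<Otimes>\<^sub>M lborel) (Pair \<omega> -` D \<inter> {r. norm r < 1} \<times> {0<..}) = 0"
    using good AE_space
  proof eventually_elim
    case (elim \<omega>)
    let ?S = "Pair \<omega> -` D \<inter> {r. norm r < 1} \<times> {0<..}"
    have sets\<mu>: "sets (\<nu> \<Otimes>\<^sub>M (lborel::real measure)) = sets borel"
      by (simp add: sets_\<nu> borel_prod[symmetric] cong: sets_pair_measure_cong)
    have "{r::real^'m. norm r < 1} \<in> sets borel" by measurable
    then have "{r::real^'m. norm r < 1} \<times> {0::real<..} \<in> sets borel"
      by (simp add: borel_prod[symmetric] pair_measureI)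
    then have S: "?S \<in> sets (\<nu> \<Otimes>\<^sub>M lborel)" unfolding sets\<mu> by (rule sets.Int[OF Pred_section[OF D elim(3)]])
    have "AE t in lborel. AE r in \<nu>. (r, t) \<notin> ?S"
      using elim(1,2)
    proof eventually_elim
      case (elim t)
      show ?case
      proof (cases "0 < t")
        case True
        then have "AE r in \<nu>. norm r < 1 \<longrightarrow> X t \<omega> \<notin> K \<and> X t \<omega> + F (X t \<omega>) r \<notin> K" using elim(2) by blast
        then show ?thesis by eventually_elim (use True elim(1) in \<open>auto simp: D_def L_def J_def\<close>)
      qed simp
    qed
    moreover have S': "{x \<in> space (\<nu> \<Otimes>\<^sub>M (lborel::real measure)). (fst x, snd x) \<notin> ?S} \<in> sets (\<nu> \<Otimes>\<^sub>M lborel)"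
    proof -
      have eq: "{x \<in> space (\<nu> \<Otimes>\<^sub>M (lborel::real measure)). (fst x, snd x) \<notin> ?S} = space (\<nu> \<Otimes>\<^sub>M lborel) - ?S" by auto
      show ?thesis unfolding eq by (rule sets.compl_sets[OF S])
    qed
    ultimately have "AE x in \<nu> \<Otimes>\<^sub>M lborel. (fst x, snd x) \<notin> ?S"
      using p.AE_commute[of "\<lambda>r t. (r, t) \<notin> ?S"] p.AE_pair_iff[of "\<lambda>r t. (r, t) \<notin> ?S"] by blast
    then have "AE x in \<nu> \<Otimes>\<^sub>M lborel. x \<notin> ?S" by simp
    then show ?case using S by (simp add: AE_iff_null_sets null_setsD1)
  qed
  from sde_solution_jumps[OF sol W F D this] show ?thesis using AE_space
  proof eventually_elim
    case (elim \<omega>)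
    show ?case unfolding no_bad_jump_def
    proof (intro allI impI)
      fix b v l assume v: "0 < v \<and> v < b \<and> ((\<lambda>s. X s \<omega>) \<longlongrightarrow> l) (at_left v) \<and> l \<noteq> X v \<omega>"
      then obtain r where r: "(\<omega>, r, v) \<notin> D" "X v \<omega> = l + F l r" using elim(1) by blast
      have "left_lim X v \<omega> = l" using v left_lim_eq[of X \<omega> l v] by blast
      then show "l \<notin> K \<and> X v \<omega> \<notin> K" using r v elim(2) by (auto simp: D_def space_Pred L_def J_def)
    qed
  qed
qed

end

section \<open>Null events under the stationary law\<close>

lemma sets_AE_section:
  assumes "sigma_finite_measure M2" and m: "{x\<in>space (M1 \<Otimes>\<^sub>M M2). Q (fst x) (snd x)} \<in> sets (M1 \<Otimes>\<^sub>M M2)"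
  shows "{x\<in>space M1. AE y in M2. Q x y} \<in> sets M1"
proof -
  interpret M2: sigma_finite_measure M2 by fact
  define B where "B = space (M1 \<Otimes>\<^sub>M M2) - {x\<in>space (M1 \<Otimes>\<^sub>M M2). Q (fst x) (snd x)}"
  have B: "B \<in> sets (M1 \<Otimes>\<^sub>M M2)" unfolding B_def by (rule sets.compl_sets[OF m])
  have "(AE y in M2. Q x y) \<longleftrightarrow> emeasure M2 (Pair x -` B) = 0" if "x \<in> space M1" for x
    by (rule AE_iff_measurable[OF sets_Pair1[OF B]]) (use that in \<open>auto simp: B_def space_pair_measure\<close>)
  then have "{x\<in>space M1. AE y in M2. Q x y} = {x\<in>space M1. emeasure M2 (Pair x -` B) = 0}" by auto
  also have "\<dots> \<in> sets M1" using M2.measurable_emeasure_Pair[OF B] by measurable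
  finally show ?thesis .
qed

lemma AE_negligible:
  assumes "N \<in> sets borel" "negligible N"
  shows "AE x in lborel. x \<notin> N"
proof -
  have "N \<in> null_sets lborel" using assms by (simp add: negligible_iff_null_sets null_sets_completion_iff)
  then show ?thesis by (rule AE_not_in)
qed

lemma AE_invariant_coordinate:
  fixes P :: "('n::finite) path_kernel"
  assumes P: "path_kernel P" and inv: "invariant_density P \<rho>" and t: "0 \<le> t"
    and G: "{y. Q y} \<in> sets borel" and ae: "AE y in lborel. Q y"
  shows "AE w in stationary_law P \<rho>. Q (w t)"
proof -
  have N: "{y. \<not> Q y} \<in> sets borel" using sets.compl_sets[OF G] by (simp add: Collect_neg_eq Compl_eq_Diff_UNIV)
  have "AE y in density lborel \<rho>. Q y"
    using ae invariant_density_measurable[OF inv] by (subst AE_density) auto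
  then have "emeasure (density lborel \<rho>) {y. \<not> Q y} = 0"
    by (subst AE_iff_measurable[symmetric, of _ _ Q]) (use N in auto)
  then have z: "emeasure (stationary_law P \<rho>) {w\<in>space cadlag_space. w t \<in> {y. \<not> Q y}} = 0"
    using emeasure_coordinate_stationary_law[OF P inv t N] by simp
  have "(\<lambda>w. w t) -` {y. \<not> Q y} \<inter> space cadlag_space \<in> sets (cadlag_space :: (real \<Rightarrow> real^'n) measure)"
    by (rule measurable_sets[OF measurable_coordinate_cadlag[OF t] N])
  also have "(\<lambda>w. w t) -` {y. \<not> Q y} \<inter> space cadlag_space = {w\<in>space cadlag_space. w t \<in> {y. \<not> Q y}}" by auto
  finally have "{w\<in>space cadlag_space. w t \<in> {y. \<not> Q y}} \<in> null_sets (stationary_law P \<rho>)"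
    using z by (simp add: null_sets_def sets_stationary_law[OF P])
  from AE_not_in[OF this] AE_space show ?thesis
    by eventually_elim (auto simp: space_stationary_law[OF P])
qed

context poisson_noise
begin

text \<open>The Markov property at time 0, with a deterministic start, identifies \<open>P x\<close>
  with the law of the solution.\<close>

lemma markov_law_AE:
  fixes X :: "real \<Rightarrow> 'w \<Rightarrow> real^'n"
  assumes P: "path_kernel P" and markov: "markov_process {0..} M Fil X P" and X: "adapted_cadlag M Fil X"
    and start: "AE \<omega> in M. X 0 \<omega> = x" and Q: "{w\<in>space cadlag_space. Q w} \<in> sets cadlag_space"
  shows "(AE w in P x. Q w) \<longleftrightarrow> (AE \<omega> in M. Q (path_from X 0 \<omega>))"
proof -
  interpret Px: prob_space "P x" by (rule path_kernel_prob_space[OF P])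
  let ?E = "{w\<in>space cadlag_space. Q w}"
  have rc: "rcll 0 (\<lambda>s. X s \<omega>)" if "\<omega> \<in> space M" for \<omega>
    using X that by (auto simp: adapted_cadlag_def cadlag_on_rcll_0)
  have sub: "subalgebra M (Fil t)" for t using filt Fil_sub by (auto simp: subalgebra_def filtration_def)
  have XM: "X t \<in> borel_measurable M" if "0 \<le> t" for t
    using X that sub[of t] unfolding adapted_cadlag_def by (auto intro: measurable_from_subalg)
  have mem: "path_from X 0 \<omega> \<in> space cadlag_space" if "\<omega> \<in> space M" for \<omega>
    by (rule path_from_in_cadlag_space) (rule rc[OF that])
  have pm: "path_from X 0 \<in> M \<rightarrow>\<^sub>M cadlag_space" using rc XM by (intro measurable_path_from) auto
  have E: "{\<omega>\<in>space M. path_from X 0 \<omega> \<in> ?E} \<in> sets M"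
    using measurable_sets[OF pm Q] by (simp add: vimage_def Int_def conj_commute)
  have "prob {\<omega>\<in>space M. path_from X 0 \<omega> \<in> ?E} = (\<integral>\<omega>. indicat_real {\<omega>\<in>space M. path_from X 0 \<omega> \<in> ?E} \<omega> \<partial>M)"
    using E by simp
  also have "\<dots> = (\<integral>\<omega>. 1 * indicator ?E (path_from X 0 \<omega>) \<partial>M)"
    by (intro Bochner_Integration.integral_cong) (auto simp: indicator_def)
  also have "\<dots> = (\<integral>\<omega>. 1 * measure (P (X 0 \<omega>)) ?E \<partial>M)"
    by (rule markov_expectation[OF markov _ prob_space_axioms sub P _ _ Q E]) auto
  also have "\<dots> = (\<integral>\<omega>. measure (P x) ?E \<partial>M)"
  proof (rule integral_cong_AE)
    show "(\<lambda>\<omega>. 1 * measure (P (X 0 \<omega>)) ?E) \<in> borel_measurable M"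
      using measurable_compose[OF XM path_kernel_measure_measurable[OF P Q], of 0] by simp
    show "AE \<omega> in M. 1 * measure (P (X 0 \<omega>)) ?E = measure (P x) ?E"
      using start by eventually_elim simp
  qed simp
  finally have eq: "prob {\<omega>\<in>space M. path_from X 0 \<omega> \<in> ?E} = measure (P x) ?E" by (simp add: prob_space)
  have "(AE w in P x. Q w) \<longleftrightarrow> measure (P x) ?E = 1"
    using Q by (subst Px.prob_eq_1) (auto simp: path_kernel_sets[OF P] path_kernel_space[OF P] AE_conj_iff)
  also have "\<dots> \<longleftrightarrow> (AE \<omega> in M. \<omega> \<in> {\<omega>\<in>space M. path_from X 0 \<omega> \<in> ?E})"
    unfolding eq[symmetric] by (rule prob_eq_1[OF E])
  also have "\<dots> \<longleftrightarrow> (AE \<omega> in M. Q (path_from X 0 \<omega>))"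
    by (rule AE_cong) (use mem in auto)
  finally show ?thesis .
qed

lemma sde_stationary_law_left_continuous:
  fixes P :: "('n::finite) path_kernel"
  assumes W: "brownian_motion M Fil W" and family: "sde_markov_family M Fil W \<nu> N b \<sigma> F P"
    and F: "(\<lambda>(x, r). F x r) \<in> borel_measurable borel" and inv: "invariant_density P \<rho>" and pos: "\<And>x. \<rho> x > 0"
    and h: "0 < h"
  shows "AE w in stationary_law P \<rho>. (w \<longlongrightarrow> w h) (at_left h)"
proof -
  have P: "path_kernel P" using family by (simp add: sde_markov_family_def)
  have m: "{w\<in>space cadlag_space. (w \<longlongrightarrow> w h) (at_left h)} \<in> sets (cadlag_space :: (real \<Rightarrow> real^'n) measure)"
    using sets_left_continuous[where lo = 0 and hi = h and Z = "\<lambda>s w. w s", OF measurable_coordinate_cadlag rcll_cadlag_space] h by auto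
  have "AE w in P x. (w \<longlongrightarrow> w h) (at_left h)" for x
  proof -
    obtain X where sol: "sde_solution M Fil W \<nu> N b \<sigma> F x X" and markov: "markov_process {0..} M Fil X P"
      using family unfolding sde_markov_family_def by blast
    have X: "adapted_cadlag M Fil X" using sol by (simp add: sde_solution_def)
    have "AE \<omega> in M. X 0 \<omega> = x"
      using sde_solution_jumps[OF sol W F, of "{}"] by (auto elim: eventually_mono)
    moreover have "AE \<omega> in M. (path_from X 0 \<omega> \<longlongrightarrow> path_from X 0 \<omega> h) (at_left h)"
      using sde_solution_no_fixed_jump[OF sol W F h]
      by eventually_elim (simp add: left_limit_path_from[OF h] path_from_apply less_imp_le[OF h])
    ultimately show ?thesis using markov_law_AE[OF P markov X _ m] by blast
  qed
  then show ?thesis using AE_stationary_law[OF P inv pos m] by simp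
qed

text \<open>A jump lands on \<open>K\<close> from a null set of starting points, since the inverse jump maps are
  differentiable; under the stationary law the path is almost never in such a null set.\<close>

lemma sde_stationary_law_no_bad_jump:
  fixes P :: "('n::finite) path_kernel"
  assumes W: "brownian_motion M Fil W" and family: "sde_markov_family M Fil W \<nu> N b \<sigma> F P"
    and F: "(\<lambda>(x, r). F x r) \<in> borel_measurable borel" and inv: "invariant_density P \<rho>" and pos: "\<And>x. \<rho> x > 0"
    and maps: "invertible_jump_maps F" and K: "closed K" "negligible K"
  shows "AE w in stationary_law P \<rho>. \<forall>b. no_bad_jump K w 0 b"
proof -
  interpret \<nu>: sigma_finite_measure \<nu> by (rule levy_measure_sigma_finite[OF levy])
  interpret l\<nu>: pair_sigma_finite "lborel :: (real^'n) measure" \<nu> ..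
  have P: "path_kernel P" using family by (simp add: sde_markov_family_def)
  interpret Q: prob_space "stationary_law P \<rho>" by (rule prob_space_stationary_law[OF P inv])
  interpret lQ: pair_sigma_finite "lborel :: real measure" "stationary_law P \<rho>" ..
  have [measurable]: "K \<in> sets borel" using K by simp
  define ok where "ok y r \<longleftrightarrow> (norm r < 1 \<longrightarrow> y \<notin> K \<and> y + F y r \<notin> K)" for y r
  have Fb: "(\<lambda>x. F (fst x) (snd x)) \<in> borel_measurable (borel \<Otimes>\<^sub>M borel)"
    using F by (simp add: borel_prod case_prod_beta')
  have okm: "{x\<in>space ((borel :: (real^'n) measure) \<Otimes>\<^sub>M \<nu>). ok (fst x) (snd x)} \<in> sets (borel \<Otimes>\<^sub>M \<nu>)"
  proof -
    have okb: "{x\<in>space ((borel :: (real^'n) measure) \<Otimes>\<^sub>M (borel :: (real^'m) measure)). ok (fst x) (snd x)} \<in> sets (borel \<Otimes>\<^sub>M borel)"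
      unfolding ok_def using Fb by measurable
    have eq: "sets ((borel :: (real^'n) measure) \<Otimes>\<^sub>M (borel :: (real^'m) measure)) = sets (borel \<Otimes>\<^sub>M \<nu>)"
      by (rule sets_pair_measure_cong) (simp_all add: sets_\<nu>)
    show ?thesis using okb unfolding eq sets_eq_imp_space_eq[OF eq] .
  qed
  define good where "good y \<longleftrightarrow> (AE r in \<nu>. ok y r)" for y
  have goodm: "{y. good y} \<in> sets borel"
    using sets_AE_section[OF \<nu>.sigma_finite_measure_axioms okm] by (simp add: good_def)
  \<comment> \<open>For a fixed mark, the bad states are \<open>K\<close> and the image of
    \<open>K\<close> under the inverse of the full jump map (\<theta> = 1), both null. Fubini then
    exchanges the roles of mark and state.\<close>
  have "AE r in \<nu>. AE y in lborel. ok y r"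
  proof (rule AE_I2)
    fix r
    show "AE y in lborel. ok y r"
    proof (cases "norm r < 1")
      case True
      let ?T = "jump_map F 1 r"
      have b: "bij ?T" "inv ?T differentiable_on UNIV" using maps True by (auto simp: invertible_jump_maps_def)
      have T: "?T y = y + F y r" for y by (simp add: jump_map_def)
      have "{y. y + F y r \<in> K} = inv ?T ` K"
        using b(1) bij_vimage_eq_inv_image[OF b(1), of K] by (auto simp: T vimage_def)
      moreover have "negligible (inv ?T ` K)"
        by (rule negligible_differentiable_image_negligible[OF order_refl K(2)])
          (rule differentiable_on_subset[OF b(2)], simp)
      ultimately have neg: "negligible (K \<union> {y. y + F y r \<in> K})" using K(2) by (simp add: negligible_Un)
      have "(\<lambda>y. F y r) \<in> borel_measurable borel"
        using measurable_compose[OF measurable_Pair2' Fb, of r] by simp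
      then have "{y \<in> space borel. y + F y r \<in> K} \<in> sets borel" by measurable
      then have "K \<union> {y. y + F y r \<in> K} \<in> sets borel" using K by auto
      from AE_negligible[OF this neg] show ?thesis by eventually_elim (simp add: ok_def)
    qed (simp add: ok_def)
  qed
  moreover have "{x\<in>space ((lborel :: (real^'n) measure) \<Otimes>\<^sub>M \<nu>). ok (fst x) (snd x)} \<in> sets (lborel \<Otimes>\<^sub>M \<nu>)"
    using okm by (simp add: space_pair_measure cong: sets_pair_measure_cong)
  ultimately have aegood: "AE y in lborel. good y" using l\<nu>.AE_commute[of ok] unfolding good_def by blast
  \<comment> \<open>By invariance every coordinate has density \<rho>, so a null set of states is
    avoided at each time; Fubini turns this into almost all times along almost every path.\<close>
  have "AE t in lborel. AE w in stationary_law P \<rho>. good (w (max 0 t))"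
    by (rule AE_I2) (rule AE_invariant_coordinate[OF P inv _ goodm aegood], simp)
  have "(\<lambda>x. (case x of (t, w) \<Rightarrow> path_from (\<lambda>s w. w s) (max 0 t) w) 0) \<in> borel_measurable (borel \<Otimes>\<^sub>M (cadlag_space :: (real \<Rightarrow> real^'n) measure))"
    by (rule measurable_compose[OF measurable_pair_path_from[where X = "\<lambda>s w. w s"] measurable_coordinate_cadlag[of 0]])
      (simp_all add: rcll_cadlag_space measurable_coordinate_cadlag)
  then have coord: "(\<lambda>x. snd x (max 0 (fst x))) \<in> borel_measurable (borel \<Otimes>\<^sub>M (cadlag_space :: (real \<Rightarrow> real^'n) measure))"
    by (simp add: path_from_apply case_prod_beta')
  have 1: "{x\<in>space (borel \<Otimes>\<^sub>M (cadlag_space :: (real \<Rightarrow> real^'n) measure)). good (snd x (max 0 (fst x)))} \<in> sets (borel \<Otimes>\<^sub>M cadlag_space)"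
    using measurable_sets[OF coord goodm] by (simp add: vimage_def Int_def conj_commute)
  have "AE w in stationary_law P \<rho>. AE t in lborel. good (w (max 0 t))"
  proof (rule lQ.AE_commute[THEN iffD1])
    show "{x\<in>space (lborel \<Otimes>\<^sub>M stationary_law P \<rho>). good (snd x (max 0 (fst x)))} \<in> sets (lborel \<Otimes>\<^sub>M stationary_law P \<rho>)"
      using 1 by (simp add: space_pair_measure space_stationary_law[OF P] sets_stationary_law[OF P] cong: sets_pair_measure_cong)
  qed fact
  moreover have gm: "{w\<in>space cadlag_space. AE t in lborel. good (w (max 0 t))} \<in> sets (cadlag_space :: (real \<Rightarrow> real^'n) measure)"
  proof (rule sets_AE_section)
    show "sigma_finite_measure (lborel :: real measure)" by (rule lborel.sigma_finite_measure_axioms)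
    have "(\<lambda>x. fst x (max 0 (snd x))) \<in> borel_measurable ((cadlag_space :: (real \<Rightarrow> real^'n) measure) \<Otimes>\<^sub>M borel)"
      using measurable_compose[OF measurable_pair_swap' coord] by (simp add: case_prod_beta')
    from measurable_sets[OF this goodm]
    show "{x\<in>space ((cadlag_space :: (real \<Rightarrow> real^'n) measure) \<Otimes>\<^sub>M lborel). good (fst x (max 0 (snd x)))} \<in> sets (cadlag_space \<Otimes>\<^sub>M lborel)"
      by (simp add: vimage_def Int_def conj_commute space_pair_measure cong: sets_pair_measure_cong)
  qed
  ultimately have "AE x in lborel. AE w in P x. AE t in lborel. good (w (max 0 t))"
    using AE_stationary_law[OF P inv pos gm] by simp
  then have "AE x in lborel. AE w in P x. \<forall>b. no_bad_jump K w 0 b"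
  proof eventually_elim
    \<comment> \<open>Compensation lives on the space of the driving noise, so the statement passes
      from \<open>P x\<close> to a solution started at \<open>x\<close> and back again.\<close>
    case (elim x)
    obtain X where sol: "sde_solution M Fil W \<nu> N b \<sigma> F x X" and markov: "markov_process {0..} M Fil X P"
      using family unfolding sde_markov_family_def by blast
    have X: "adapted_cadlag M Fil X" using sol by (simp add: sde_solution_def)
    have start: "AE \<omega> in M. X 0 \<omega> = x"
      using sde_solution_jumps[OF sol W F, of "{}"] by (auto elim: eventually_mono)
    have "AE \<omega> in M. AE t in lborel. good (path_from X 0 \<omega> (max 0 t))"
      using elim markov_law_AE[OF P markov X start gm] by simp
    then have "AE \<omega> in M. AE t in lborel. 0 < t \<longrightarrow> (AE r in \<nu>. norm r < 1 \<longrightarrow> X t \<omega> \<notin> K \<and> X t \<omega> + F (X t \<omega>) r \<notin> K)"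
    proof eventually_elim
      case (elim \<omega>)
      then show ?case by eventually_elim (auto simp: good_def ok_def path_from_apply)
    qed
    from sde_solution_no_bad_jump[OF sol W F K(1) this]
    have "AE \<omega> in M. \<forall>b. no_bad_jump K (path_from X 0 \<omega>) 0 b"
      by eventually_elim (simp add: no_bad_jump_path_from)
    then show ?case using markov_law_AE[OF P markov X start sets_no_bad_jump_all[OF K(1)]] by simp
  qed
  then show ?thesis using AE_stationary_law[OF P inv pos sets_no_bad_jump_all[OF K(1)]] by simp
qed

end

section \<open>Smooth boundaries are null sets\<close>

text \<open>A set of finite measure has no room for infinitely many disjoint copies of a set of
  positive measure.\<close>

lemma negligible_disjoint_translates:
  fixes S :: "(real^'n) set" and v :: "nat \<Rightarrow> real^'n"
  assumes S: "S \<in> lmeasurable" and B: "B \<in> lmeasurable" "\<And>k. (+) (v k) ` S \<subseteq> B"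
    and disj: "disjoint_family (\<lambda>k. (+) (v k) ` S)"
  shows "negligible S"
proof -
  have le: "real n * measure lebesgue S \<le> measure lebesgue B" for n
  proof -
    have "real n * measure lebesgue S = (\<Sum>k<n. measure lebesgue ((+) (v k) ` S))" by (simp add: measure_translation)
    also have "\<dots> = measure lebesgue (\<Union>k<n. (+) (v k) ` S)"
      using measurable_translation[OF S] disj
      by (intro measure_UNION'[symmetric]) (auto simp: pairwise_def disjoint_family_on_def disjnt_def)
    also have "\<dots> \<le> measure lebesgue B"
      using measurable_translation[OF S] B by (intro measure_mono_fmeasurable fmeasurableD sets.finite_UN) auto
    finally show ?thesis .
  qed
  have "measure lebesgue S = 0"
  proof (rule ccontr)
    assume "measure lebesgue S \<noteq> 0"
    then have "0 < measure lebesgue S" using measure_nonneg[of lebesgue S] by linarith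
    then obtain n :: nat where "measure lebesgue B < real n * measure lebesgue S" using reals_Archimedean3 by blast
    then show False using le[of n] by simp
  qed
  then show ?thesis using S by (simp add: negligible_iff_measure)
qed

text \<open>Near a regular point some partial derivative does not vanish, so the level set meets each line in that
  direction at most once and its translates in that direction are disjoint.\<close>

lemma regular_level_set_negligible:
  fixes g :: "real^'n \<Rightarrow> real"
  assumes U: "open U" "p \<in> U" and g: "smooth_on U g" "grad g p \<noteq> 0"
  shows "\<exists>V. open V \<and> p \<in> V \<and> V \<subseteq> U \<and> negligible {x\<in>V. g x = 0}"
proof -
  have Ck: "Ck_on (Suc 0) U g" using g(1) by (simp add: smooth_on_def)
  have diff: "g differentiable_on U" and pc: "continuous_on U (partial i g)" for i using Ck by auto
  obtain i where i: "partial i g p \<noteq> 0" using g(2) by (auto simp: grad_def vec_eq_iff)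
  have "continuous (at p) (partial i g)" using pc U by (simp add: continuous_on_eq_continuous_at)
  then have "\<forall>\<^sub>F x in at p. partial i g x \<in> - {0}"
    using topological_tendstoD[OF _ open_Compl[OF closed_singleton], of "partial i g" "partial i g p" "at p" 0] i
    by (simp add: isCont_def)
  then obtain d where d: "d > 0" "\<And>x. x \<noteq> p \<Longrightarrow> dist x p < d \<Longrightarrow> partial i g x \<noteq> 0"
    by (auto simp: eventually_at)
  obtain d' where d': "d' > 0" "ball p d' \<subseteq> U" using U open_contains_ball by blast
  define e where "e = min d d'"
  have e: "e > 0" using d d' by (simp add: e_def)
  have nz: "partial i g x \<noteq> 0" if "x \<in> ball p e" for x
    using that d(2)[of x] i by (cases "x = p") (auto simp: e_def dist_commute)
  have eU: "ball p e \<subseteq> U" using d'(2) by (auto simp: e_def)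
  let ?a = "axis i (1::real)"
  \<comment> \<open>Two zeros on a line in direction \<open>i\<close> would force, by Rolle, a zero
    of the partial derivative between them; the segment stays in the ball by convexity.\<close>
  have line: "c = 0" if x: "x \<in> ball p e" "g x = 0" and y: "x + c *\<^sub>R ?a \<in> ball p e" "g (x + c *\<^sub>R ?a) = 0" for x c
  proof (rule ccontr)
    assume c: "c \<noteq> 0"
    define f where "f t = g (x + (t * c) *\<^sub>R ?a)" for t
    have seg: "x + (t * c) *\<^sub>R ?a \<in> ball p e" if "0 \<le> t" "t \<le> 1" for t
    proof -
      have "(1 - t) *\<^sub>R x + t *\<^sub>R (x + c *\<^sub>R ?a) \<in> ball p e"
        using convexD[OF convex_ball x(1) y(1), of "1 - t" t] that by simp
      then show ?thesis by (simp add: algebra_simps)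
    qed
    have der: "(f has_real_derivative c * partial i g (x + (t * c) *\<^sub>R ?a)) (at t)" if t: "0 \<le> t" "t \<le> 1" for t
    proof -
      let ?z = "x + (t * c) *\<^sub>R ?a"
      have "g differentiable at ?z"
        using diff seg[OF t] eU U(1) by (auto simp: differentiable_on_eq_differentiable_at)
      then have G: "(g has_derivative frechet_derivative g (at ?z)) (at ?z)" by (simp add: frechet_derivative_works)
      have "((\<lambda>t. x + (t * c) *\<^sub>R ?a) has_derivative (\<lambda>s. (s * c) *\<^sub>R ?a)) (at t)"
        by (auto intro!: derivative_eq_intros)
      from has_derivative_compose[OF this G]
      have D: "(f has_derivative (\<lambda>s. frechet_derivative g (at ?z) ((s * c) *\<^sub>R ?a))) (at t)" by (simp add: f_def[abs_def])
      have "frechet_derivative g (at ?z) ((s * c) *\<^sub>R ?a) = (c * partial i g ?z) * s" for s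
        using linear_scale[OF has_derivative_linear[OF G], of "s * c" ?a] by (simp add: partial_def)
      then show ?thesis using D by (simp add: has_field_derivative_def)
    qed
    have "\<exists>z>0. z < 1 \<and> (f has_real_derivative 0) (at z)"
    proof (rule Rolle)
      show "f 0 = f 1" using x y by (simp add: f_def)
      show "continuous_on {0..1} f"
      proof (rule DERIV_continuous_on)
        show "(f has_real_derivative c * partial i g (x + (t * c) *\<^sub>R ?a)) (at t within {0..1})" if "t \<in> {0..1}" for t
          using that by (intro has_field_derivative_at_within[OF der]) simp_all
      qed
      show "f differentiable (at t)" if "0 < t" "t < 1" for t
        using der[OF less_imp_le[OF that(1)] less_imp_le[OF that(2)]] unfolding real_differentiable_def by blast
    qed simp
    then obtain z where z: "0 < z" "z < 1" "(f has_real_derivative 0) (at z)" by blast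
    then have "c * partial i g (x + (z * c) *\<^sub>R ?a) = 0" using DERIV_unique[OF der[of z] z(3)] by simp
    then show False using c nz seg[of z] z by auto
  qed
  let ?S = "{x\<in>ball p e. g x = 0}"
  have "continuous_on (ball p e) g"
    using differentiable_imp_continuous_on[OF diff] eU by (rule continuous_on_subset)
  then have "?S \<in> sets borel"
  proof -
    assume "continuous_on (ball p e) g"
    then have "closedin (top_of_set (ball p e)) (ball p e \<inter> g -` {0})" by (rule continuous_closedin_preimage) simp
    then obtain T where "closed T" "ball p e \<inter> g -` {0} = ball p e \<inter> T" by (auto simp: closedin_closed)
    moreover have "?S = ball p e \<inter> g -` {0}" by auto
    ultimately show ?thesis by auto
  qed
  then have S: "?S \<in> lmeasurable"
    by (intro bounded_set_imp_lmeasurable bounded_subset[OF bounded_ball, of _ p e] sets_completionI_sets) auto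
  have "negligible ?S"
  \<comment> \<open>The lengths \<open>1 / Suc k\<close> are pairwise different and at most 1, so
    the translates are disjoint and stay in the ball of radius \<open>e + 1\<close>.\<close>
  proof (rule negligible_disjoint_translates[OF S, of "ball p (e + 1)" "\<lambda>k. (1 / Suc k) *\<^sub>R ?a"])
    show "(+) ((1 / Suc k) *\<^sub>R ?a) ` ?S \<subseteq> ball p (e + 1)" for k
    proof
      fix y assume "y \<in> (+) ((1 / Suc k) *\<^sub>R ?a) ` ?S"
      then obtain x where x: "dist p x < e" "y = (1 / Suc k) *\<^sub>R ?a + x" by auto
      have "norm ((1 / Suc k) *\<^sub>R ?a) \<le> 1" by simp
      then have "dist x y \<le> 1" using x(2) by (simp add: dist_norm del: of_nat_Suc)
      then show "y \<in> ball p (e + 1)" using x(1) dist_triangle[of p y x] by simp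
    qed
    show "disjoint_family (\<lambda>k. (+) ((1 / Suc k) *\<^sub>R ?a) ` ?S)"
      unfolding disjoint_family_on_def
    proof (intro ballI impI)
      fix k j :: nat assume kj: "k \<noteq> j"
      show "(+) ((1 / Suc k) *\<^sub>R ?a) ` ?S \<inter> (+) ((1 / Suc j) *\<^sub>R ?a) ` ?S = {}"
      proof (rule ccontr)
        assume "\<not> ?thesis"
        then obtain x y where xy: "x \<in> ?S" "y \<in> ?S" "(1 / Suc k) *\<^sub>R ?a + x = (1 / Suc j) *\<^sub>R ?a + y" by blast
        then have "y = x + (1 / Suc k - 1 / Suc j) *\<^sub>R ?a" by (simp add: algebra_simps del: of_nat_Suc)
        then have "1 / real (Suc k) - 1 / real (Suc j) = 0" using line[of x "1 / Suc k - 1 / Suc j"] xy by auto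
        then have "1 / real (Suc k) = 1 / real (Suc j)" by linarith
        then show False using kj by (simp del: of_nat_Suc)
      qed
    qed
  qed auto
  then show ?thesis using e eU by (intro exI[of _ "ball p e"]) auto
qed

lemma smooth_boundary_negligible:
  assumes "smooth_boundary A"
  shows "negligible (frontier A)"
proof (subst locally_negligible_alt, rule ballI)
  fix p assume p: "p \<in> frontier A"
  from bspec[OF assms[unfolded smooth_boundary_def] p]
  obtain U g where U: "open U" "p \<in> U" and g: "smooth_on U g" "\<forall>x\<in>U. grad g x \<noteq> 0"
    and fr: "frontier A \<inter> U = {x\<in>U. g x = 0}"
    by (elim exE conjE) (rule that)
  obtain V where V: "open V" "p \<in> V" "V \<subseteq> U" "negligible {x\<in>V. g x = 0}"
    using regular_level_set_negligible[OF U g(1)] g(2) U(2) by blast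
  have "frontier A \<inter> V = {x\<in>V. g x = 0}" using fr V(3) by auto
  then have "negligible (frontier A \<inter> V)" using V(4) by simp
  then show "\<exists>V. openin (top_of_set (frontier A)) V \<and> p \<in> V \<and> negligible V"
    using openin_open_Int[OF V(1), of "frontier A"] V(2) p by blast
qed

lemma closures_disjoint:
  fixes A B :: "'a::metric_space set"
  assumes "\<forall>x\<in>A. \<forall>y\<in>B. dist x y > 1"
  shows "closure A \<inter> closure B = {}"
proof (rule ccontr)
  assume "closure A \<inter> closure B \<noteq> {}"
  then obtain z where "z \<in> closure A" "z \<in> closure B" by blast
  then obtain x y where "x \<in> A" "dist x z < 1/2" "y \<in> B" "dist y z < 1/2"
    by (meson closure_approachable half_gt_zero zero_less_one)
  then show False using assms dist_triangle2[of x y z] by fastforce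
qed

theorem theorem3:
  fixes M :: "'w measure" and Fil :: "real \<Rightarrow> 'w measure"
    and W :: "real \<Rightarrow> 'w \<Rightarrow> real^'n" and \<nu> :: "(real^'m) measure"
    and N :: "'w \<Rightarrow> ((real^'m) \<times> real) measure"
    and b :: "real^'n \<Rightarrow> real^'n" and \<sigma> :: "real^'n \<Rightarrow> real^'n^'n"
    and F :: "real^'n \<Rightarrow> real^'m \<Rightarrow> real^'n"
    and x0 :: "real^'n" and X :: "real \<Rightarrow> 'w \<Rightarrow> real^'n"
    and P :: "real^'n \<Rightarrow> (real \<Rightarrow> real^'n) measure" and \<rho> :: "real^'n \<Rightarrow> real"
    and S :: "'s measure" and Y :: "real \<Rightarrow> 's \<Rightarrow> real^'n"
    and A B :: "(real^'n) set" and q qb :: "real^'n \<Rightarrow> real"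
    and \<tau>Am \<tau>Bp \<tau>Bm \<tau>Ap :: "'w \<Rightarrow> nat \<Rightarrow> real"
  assumes noise: "driving_noise M Fil W \<nu> N"
    and coefficients: "b \<in> borel_measurable borel" "\<sigma> \<in> borel_measurable borel"
      "(\<lambda>(x, r). F x r) \<in> borel_measurable borel"
    and family: "sde_markov_family M Fil W \<nu> N b \<sigma> F P"
    and sets_AB: "open A" "open B" "A \<inter> B = {}" "smooth_boundary A" "smooth_boundary B"
      "\<forall>x\<in>A. \<forall>y\<in>B. dist x y > 1"
    and X: "x0 \<in> A" "sde_solution M Fil W \<nu> N b \<sigma> F x0 X"
    and ergodic: "ergodic_process M X \<rho>"
    and \<rho>: "unique_invariant_density P \<rho>" "\<forall>x. \<rho> x > 0"
    and jump_maps: "invertible_jump_maps F"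
    and fokker_planck: "stationary_fokker_planck b \<sigma> F \<nu> \<rho>"
    and Y: "stationary_version S Y P \<rho>"
    and q: "forward_committor P A B q"
    and qb: "backward_committor b \<sigma> F \<nu> \<rho> S Y A B qb"
    and times: "AE \<omega> in M. transition_times (\<lambda>t. X t \<omega>) A B (\<tau>Am \<omega>) (\<tau>Bp \<omega>) (\<tau>Bm \<omega>) (\<tau>Ap \<omega>)"
  shows "occupation_density M X (\<lambda>\<omega>. reactive_times (\<tau>Am \<omega>) (\<tau>Bp \<omega>)) (\<lambda>x. \<rho> x * q x * qb x)"
proof -
  have usual: "usual_conditions M Fil" and W: "brownian_motion M Fil W"
    using noise by (auto simp: driving_noise_def)
  have M: "prob_space M" and fil: "filtration (space M) Fil" "\<And>t. sets (Fil t) \<subseteq> sets M"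
    using usual by (auto simp: usual_conditions_def)
  interpret poisson_noise M Fil \<nu> N by (rule driving_noise_poisson_noise[OF noise])
  have P: "path_kernel P" using family by (simp add: sde_markov_family_def)
  have inv: "invariant_density P \<rho>" using \<rho>(1) by (simp add: unique_invariant_density_def)
  have pos: "\<rho> x > 0" for x using \<rho>(2) by blast
  have Xc: "adapted_cadlag M Fil X" using X(2) by (simp add: sde_solution_def)
  have markov: "markov_process {0..} M Fil X P" using family X(2) unfolding sde_markov_family_def by blast
  have AB: "open A" "open B" "closure A \<inter> closure B = {}" "A \<noteq> {}"
    using sets_AB(1,2) closures_disjoint[OF sets_AB(6)] X(1) by auto
  let ?K = "frontier A \<union> frontier B"
  have K: "closed ?K" "negligible ?K"
    using sets_AB smooth_boundary_negligible by (auto simp: closed_Un intro: negligible_Un)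
  have bad: "AE w in stationary_law P \<rho>. \<forall>b. no_bad_jump ?K w 0 b"
    by (rule sde_stationary_law_no_bad_jump[OF W family coefficients(3) inv pos jump_maps K])
  have cont: "AE w in stationary_law P \<rho>. (w \<longlongrightarrow> w h) (at_left h)" if "0 < h" for h
    by (rule sde_stationary_law_left_continuous[OF W family coefficients(3) inv pos that])
  show ?thesis
    unfolding occupation_density_def
  proof (intro conjI ballI)
    show "integrable lebesgue (\<lambda>x. \<rho> x * q x * qb x)"
      using committor_formula(1)[OF Y P inv pos AB(1-3) bad q qb, of UNIV] by (simp add: set_integrable_def)
    show "AE \<omega> in M. ((\<lambda>T. (LINT t:{0..T}|lborel. indicator C (X t \<omega>) * indicator (reactive_times (\<tau>Am \<omega>) (\<tau>Bp \<omega>)) t) / T)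
        \<longlongrightarrow> (LINT x:C|lebesgue. \<rho> x * q x * qb x)) at_top" if "C \<in> sets borel" for C
      by (rule reactive_occupation_limit[where X = X and \<tau>Am = \<tau>Am and \<tau>Bp = \<tau>Bp and \<tau>Bm = \<tau>Bm and \<tau>Ap = \<tau>Ap,
          OF M fil Xc P markov ergodic inv pos Y AB bad cont q qb times that])
  qed
qed

end
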